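(* Let $\tau$ be a linear anti-symplectic involution on $(\mathbb{R}^{2n},\omega_0)$ and let $D\subset\mathbb{R}^{2n}$ be a $\tau$-invariant convex bounded domain. Then there is a generalized $\tau$-brake closed characteristic $x^\ast$ on $\partial D$ such that $$A(x^\ast)=\min\{A(x)>0\,|\,x \text{ is a generalized $\tau$-brake closed characteristic on } \partial D\}=c_{\rm HZ,\tau}(D,\omega_0).$$ If moreover $\partial D$ is of class $C^{1,1}$, then there is a $\tau$-brake closed characteristic $x^\ast$ on $\partial D$ such that $$c_{\rm HZ,\tau}(D,\omega_0)=A(x^\ast)=\min\{A(x)>0\,|\,x\text{ is a $\tau$-brake closed characteristic on }\partial D\}.$$
   Context: $\mathbb{R}^{2n}$ has coordinates $(x,y)=(x_1,\dots,x_n,y_1,\dots,y_n)$, symplectic form $\omega_0=\sum_i dx_i\wedge dy_i$, standard inner product $\langle\cdot,\cdot\rangle$ and complex structure $J_0(x,y)=(-y,x)$. A linear anti-symplectic involution is a linear map $\tau$ with $\tau^*\omega_0=-\omega_0$ and $\tau^2=\mathrm{id}$; $L={\rm Fix}(\tau)$. The action of an absolutely continuous curve $x:[0,T]\to\mathbb{R}^{2n}$ is $A(x)=\frac12\int_0^T\langle -J_0\dot x(t),x(t)\rangle dt$. Symmetric Hofer–Zehnder capacity: for a symplectic manifold $(M,\omega)$ with anti-symplectic involution $\tau$ ($\tau^*\omega=-\omega$, $\tau^2=\mathrm{id}$) and $L={\rm Fix}(\tau)\neq\emptyset$, let $\mathcal H(M,\omega,\tau)$ be the set of $\tau$-invariant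 smooth $H:M\to\mathbb{R}$ for which there are a nonempty open $U$ with $U\cap L\ne\emptyset$ and $H|_U=0$, and a compact $K\subset M\setminus\partial M$ with $H|_{M\setminus K}=m(H):=\max H$, and $0\le H\le m(H)$. The Hamiltonian vector field is given by $\omega(X_H,v)=-dH(v)$. A $T$-periodic trajectory $x$ of $X_H$ is a $\tau$-brake orbit if $x(T-t)=x(-t)=\tau(x(t))$ for all $t$. $H$ is admissible if $X_H$ has no nonconstant $\tau$-brake orbit of period $T\in(0,1]$. Then $c_{\rm HZ,\tau}(M,\omega)=\sup\{m(H)\,|\,H \text{ admissible}\}$. For a $\tau$-invariant open $D\subset\mathbb{R}^{2n}$ meeting $L$, $c_{\rm HZ,\tau}(D,\omega_0)$ is this quantity for $(D,\omega_0|_D,\tau|_D)$. For a $\tau$-invariant convex domain $D$ with boundary $\mathcal S$, the normal cone at $x\in\mathcal S$ is $N_{\mathcal S}(x)=\{y\,|\,\langle u-x,y\rangle\le0\ \forall u\in D\}$. A generalized $\tau$-brake closed characteristic on $\mathcal S$ is a nonconstant absolutely continuous $x:\mathbb{R}/T\mathbb{Z}\to\mathcal S$ ($T>0$) with $\dot x(t)\in J_0N_{\mathcal S}(x(t))$ a.e. and $x(T-t)=\tau(x(t))$ for all $t$. A $\tau$-brake closed characteristic on a $\tau$-invariant smooth hypersurface $\mathcal S$ is a $C^1$ embedding $x:\mathbb{R}/T\mathbb{Z}\to\mathcal S$ with $\dot x(t)$ in the characteristic line $(\mathcal L_{\mathcal S})_{x(t)}=\ker(\omega_0|_{T_{x(t)}\mathcal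 S})$ and $x(T-t)=\tau(x(t))$ for all $t$. *)

theory Defs
  imports "HOL-Analysis.Analysis"
begin

type_synonym 'n pt = "(real^'n) \<times> (real^'n)"

definition J0 :: "'n::finite pt \<Rightarrow> 'n pt" where
  "J0 p = (- snd p, fst p)"

text \<open>omega0(u,v) = sum_i (dx_i /\ dy_i)(u,v) = <J0 u, v>\<close>
definition omega0 :: "'n::finite pt \<Rightarrow> 'n pt \<Rightarrow> real" where
  "omega0 u v = fst u \<bullet> snd v - snd u \<bullet> fst v"

definition lin_antisymp_involution :: "('n::finite pt \<Rightarrow> 'n pt) \<Rightarrow> bool" where
  "lin_antisymp_involution \<tau> \<longleftrightarrow> linear \<tau> \<and>
     (\<forall>u v. omega0 (\<tau> u) (\<tau> v) = - omega0 u v) \<and> (\<forall>p. \<tau> (\<tau> p) = p)"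

definition action :: "(real \<Rightarrow> 'n::finite pt) \<Rightarrow> real \<Rightarrow> real" where
  "action x T = (1/2) * integral {0..T} (\<lambda>t. (- J0 (vector_derivative x (at t))) \<bullet> x t)"

definition absolutely_continuous_on :: "real set \<Rightarrow> (real \<Rightarrow> 'a::real_normed_vector) \<Rightarrow> bool" where
  "absolutely_continuous_on S f \<longleftrightarrow>
     (\<forall>\<epsilon>>0. \<exists>\<delta>>0. \<forall>(n::nat) (a::nat \<Rightarrow> real) b.
        (\<forall>i<n. a i \<le> b i \<and> {a i..b i} \<subseteq> S) \<and>
        (\<forall>i<n. \<forall>j<n. i \<noteq> j \<longrightarrow> b i \<le> a j \<or> b j \<le> a i) \<and>
        (\<Sum>i<n. b i - a i) < \<delta> \<longrightarrow> (\<Sum>i<n. norm (f (b i) - f (a i))) < \<epsilon>)"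

definition normal_cone :: "'n::finite pt set \<Rightarrow> 'n pt \<Rightarrow> 'n pt set" where
  "normal_cone D p = {y. \<forall>u\<in>D. (u - p) \<bullet> y \<le> 0}"

definition gen_brake_char ::
  "('n::finite pt \<Rightarrow> 'n pt) \<Rightarrow> 'n pt set \<Rightarrow> (real \<Rightarrow> 'n pt) \<Rightarrow> real \<Rightarrow> bool" where
  "gen_brake_char \<tau> D x T \<longleftrightarrow> T > 0 \<and> (\<forall>t. x (t + T) = x t) \<and>
     (\<forall>t. x t \<in> frontier D) \<and> \<not> (\<exists>c. \<forall>t. x t = c) \<and>
     absolutely_continuous_on {0..T} x \<and>
     (AE t in lebesgue. x differentiable (at t) \<and>
        vector_derivative x (at t) \<in> J0 ` normal_cone D (x t)) \<and>
     (\<forall>t. x (T - t) = \<tau> (x t))"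

definition tangent_space :: "'n::finite pt set \<Rightarrow> 'n pt \<Rightarrow> 'n pt set" where
  "tangent_space S p = {v. \<exists>\<gamma>. \<gamma> 0 = p \<and> (\<forall>\<^sub>F t in nhds 0. \<gamma> t \<in> S) \<and>
                             (\<gamma> has_vector_derivative v) (at 0)}"

definition char_line :: "'n::finite pt set \<Rightarrow> 'n pt \<Rightarrow> 'n pt set" where
  "char_line S p = {v \<in> tangent_space S p. \<forall>w \<in> tangent_space S p. omega0 v w = 0}"

text \<open>tau-brake closed characteristic: C^1 embedding of R/TZ tangent to the characteristic line.\<close>
definition brake_char ::
  "('n::finite pt \<Rightarrow> 'n pt) \<Rightarrow> 'n pt set \<Rightarrow> (real \<Rightarrow> 'n pt) \<Rightarrow> real \<Rightarrow> bool" where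
  "brake_char \<tau> S x T \<longleftrightarrow> T > 0 \<and> (\<forall>t. x (t + T) = x t) \<and>
     x C1_differentiable_on UNIV \<and> (\<forall>t. vector_derivative x (at t) \<noteq> 0) \<and>
     inj_on x {0..<T} \<and> (\<forall>t. x t \<in> S) \<and>
     (\<forall>t. vector_derivative x (at t) \<in> char_line S (x t)) \<and>
     (\<forall>t. x (T - t) = \<tau> (x t))"

definition C11_hypersurface :: "'n::finite pt set \<Rightarrow> bool" where
  "C11_hypersurface S \<longleftrightarrow> (\<forall>p\<in>S. \<exists>V g L. open V \<and> p \<in> V \<and>
     (\<forall>q\<in>V. g differentiable (at q) \<and> frechet_derivative g (at q) \<noteq> (\<lambda>_. 0)) \<and>
     (\<forall>q\<in>V. \<forall>r\<in>V. \<forall>v. \<bar>frechet_derivative g (at q) v - frechet_derivative g (at r) v\<bar>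
                        \<le> L * norm (q - r) * norm v) \<and>
     S \<inter> V = {q\<in>V. g q = (0::real)})"

fun iter_dderiv :: "'a::real_normed_vector list \<Rightarrow> ('a \<Rightarrow> real) \<Rightarrow> 'a \<Rightarrow> real" where
  "iter_dderiv [] f = f"
| "iter_dderiv (v # vs) f = (\<lambda>p. frechet_derivative (iter_dderiv vs f) (at p) v)"

definition smooth_on :: "'a::real_normed_vector set \<Rightarrow> ('a \<Rightarrow> real) \<Rightarrow> bool" where
  "smooth_on S f \<longleftrightarrow> (\<forall>vs. continuous_on S (iter_dderiv vs f) \<and>
                          (\<forall>p\<in>S. iter_dderiv vs f differentiable (at p)))"

definition mH :: "'n::finite pt set \<Rightarrow> ('n pt \<Rightarrow> real) \<Rightarrow> real" where
  "mH D H = Sup (H ` D)"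

definition hz_class :: "('n::finite pt \<Rightarrow> 'n pt) \<Rightarrow> 'n pt set \<Rightarrow> ('n pt \<Rightarrow> real) \<Rightarrow> bool" where
  "hz_class \<tau> D H \<longleftrightarrow> smooth_on D H \<and> (\<forall>p\<in>D. H (\<tau> p) = H p) \<and>
     (\<exists>U. open U \<and> U \<noteq> {} \<and> U \<subseteq> D \<and> U \<inter> {p. \<tau> p = p} \<noteq> {} \<and> (\<forall>p\<in>U. H p = 0)) \<and>
     (\<exists>K. compact K \<and> K \<subseteq> D \<and> (\<forall>p\<in>D - K. H p = mH D H)) \<and>
     (\<forall>p\<in>D. 0 \<le> H p \<and> H p \<le> mH D H)"

definition ham_brake_orbit ::
  "('n::finite pt \<Rightarrow> 'n pt) \<Rightarrow> 'n pt set \<Rightarrow> ('n pt \<Rightarrow> real) \<Rightarrow> (real \<Rightarrow> 'n pt) \<Rightarrow> real \<Rightarrow> bool" where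
  "ham_brake_orbit \<tau> D H x T \<longleftrightarrow> (\<forall>t. x t \<in> D) \<and> (\<forall>t. x (t + T) = x t) \<and>
     (\<forall>t. \<exists>v. (x has_vector_derivative v) (at t) \<and>
            (\<forall>w. omega0 v w = - frechet_derivative H (at (x t)) w)) \<and>
     (\<forall>t. x (T - t) = x (- t) \<and> x (- t) = \<tau> (x t))"

definition hz_admissible :: "('n::finite pt \<Rightarrow> 'n pt) \<Rightarrow> 'n pt set \<Rightarrow> ('n pt \<Rightarrow> real) \<Rightarrow> bool" where
  "hz_admissible \<tau> D H \<longleftrightarrow> hz_class \<tau> D H \<and>
     \<not> (\<exists>x T. 0 < T \<and> T \<le> 1 \<and> ham_brake_orbit \<tau> D H x T \<and> \<not> (\<exists>c. \<forall>t. x t = c))"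

definition c_HZ_tau :: "('n::finite pt \<Rightarrow> 'n pt) \<Rightarrow> 'n pt set \<Rightarrow> ereal" where
  "c_HZ_tau \<tau> D = Sup {ereal (mH D H) | H. hz_admissible \<tau> D H}"

end

theory Submission
  imports Defs "HOL-Homology.Homology" "HOL-Complex_Analysis.Complex_Analysis" "HOL-Real_Asymp.Real_Asymp"
    "HOL-Computational_Algebra.Polynomial"
begin

text \<open>Fix a symmetric point \<open>p0\<close> of \<open>D\<close> and let \<open>g\<close> be the gauge of \<open>D - p0\<close>.

  Upper bound. A characteristic of action \<open>a\<close>, parametrised by its action, is a loop \<open>z\<close> with \<open>- J z'\<close> in \<open>2a\<close> times the
  polar of \<open>D - p0\<close>; mollified, it becomes a trigonometric polynomial of almost the same action. A Hamiltonian \<open>H\<close> with maximum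
  above \<open>a\<close> is extended outside \<open>D\<close> by a function of a smooth approximation of \<open>g\<close> growing like \<open>c g\<^sup>2\<close> with \<open>c > a\<close>. The action
  functional, restricted to symmetric trigonometric polynomials, links the small sphere of positive modes with the half space
  spanned by the nonpositive modes and the loop, on whose boundary it is nonpositive. Topological degree yields almost critical
  points of positive critical value, and a compactness argument a brake orbit of period 1 of positive action; the shape of the
  extension forces that orbit into \<open>D\<close>.

  Existence. Apply the definition of the capacity \<open>c\<close> to Hamiltonians \<open>m \<Theta>(l\<^sup>2)\<close>, where \<open>m\<close> is slightly above \<open>c\<close>, \<open>l\<close> is a
  log-sum-exp approximation of \<open>g\<close> and \<open>\<Theta>\<close> is a smooth step of slope almost 1. They are not admissible, and their brake orbits
  lie on level sets of \<open>l\<close>; rescaled, they converge to a characteristic of action at most \<open>c\<close>. By the upper bound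
  every characteristic has action at least \<open>c\<close>.

  If the boundary is of class \<open>C\<^sup>1\<^sup>,\<^sup>1\<close>, the normal direction is unique and locally Lipschitz. Hence the minimal characteristic is
  \<open>C\<^sup>1\<close>, and it is embedded, because a self-intersection would give a characteristic of smaller action.\<close>


section \<open>Absolutely continuous and Lipschitz curves\<close>

text \<open>A linear symplectic change of coordinates turns \<open>\<tau>\<close> into
  \<open>mirror\<close>, complex conjugation. Loops with \<open>z (- t) = mirror (z t)\<close> are
  those with real Fourier coefficients, so the brake symmetry is built into the coefficient space.
  The boundary has no regularity, hence no vector field to follow. A characteristic enters only
  through two inequalities for increments (\<open>char_loop\<close>), which survive averaging and
  uniform limits. Each Hamiltonian brings its own symmetric point near which it vanishes, so the
  upper bound needs a loop for the gauge centred at every symmetric point of \<open>D\<close>.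
  Translation does not change the action, so one characteristic serves all of them. Mollification
  loses some action; the gap between \<open>a\<close> and the maximum of \<open>H\<close> pays for
  it. The sphere estimate and the a priori bounds are uniform in the number of modes, so that
  compactness of curves replaces fractional Sobolev spaces. Finiteness of the capacity must precede
  the existence part, which picks \<open>m\<close> slightly above it; a large circle supplies a
  finite bound.\<close>

lemma absolutely_continuous_on_finite:
 assumes ac: "absolutely_continuous_on S F" and "e > 0"
 obtains c where "c > 0" "!!p l r. [|finite p; \<And>i. i \<in> p ==> l i <= r i \<and> {l i..r i} \<subseteq> S;
   \<And>i j. [|i \<in> p; j \<in> p; i ~= j|] ==> r i <= l j \<or> r j <= l i; (\<Sum>i\<in>p. r i - l i) < c|]
   ==> (\<Sum>i\<in>p. norm (F (r i) - F (l i))) < e"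
proof -
 from ac[unfolded absolutely_continuous_on_def, THEN spec, THEN mp, OF \<open>e > 0\<close>]
 obtain c where d: "c > 0" and D: "\<forall>(n::nat) (a::nat => real) b.
    (\<forall>i<n. a i <= b i \<and> {a i..b i} \<subseteq> S) \<and>
    (\<forall>i<n. \<forall>j<n. i ~= j --> b i <= a j \<or> b j <= a i) \<and>
    (\<Sum>i<n. b i - a i) < c --> (\<Sum>i<n. norm (F (b i) - F (a i))) < e"
  by (elim exE conjE)
 show ?thesis
 proof (rule that[OF d])
  fix p :: "'c set" and l r :: "'c => real"
  assume fp: "finite p" and lr: "!!i. i \<in> p ==> l i <= r i \<and> {l i..r i} \<subseteq> S"
   and no: "!!i j. [|i \<in> p; j \<in> p; i ~= j|] ==> r i <= l j \<or> r j <= l i"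
   and s: "(\<Sum>i\<in>p. r i - l i) < c"
  obtain h where h: "bij_betw h {0..<card p} p" using ex_bij_betw_nat_finite[OF fp] by blast
  hence h: "bij_betw h {..<card p} p" by (simp add: atLeast0LessThan)
  have hin: "h i \<in> p" if "i < card p" for i using h that bij_betwE by fastforce
  have hne: "h i ~= h j" if "i < card p" "j < card p" "i ~= j" for i j
   using h that by (auto simp: bij_betw_def inj_on_def)
  have "(\<Sum>i<card p. norm (F ((r\<circ>h) i) - F ((l\<circ>h) i))) < e"
  proof (rule D[THEN spec, THEN spec, THEN spec, THEN mp], intro conjI allI impI)
   show "(\<Sum>i<card p. (r \<circ> h) i - (l \<circ> h) i) < c"
    using sum.reindex_bij_betw[OF h, of "\<lambda>i. r i - l i"] s by simp
  qed (use hin hne lr no in auto)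
  thus "(\<Sum>i\<in>p. norm (F (r i) - F (l i))) < e"
   using sum.reindex_bij_betw[OF h, of "\<lambda>i. norm (F (r i) - F (l i))"] by simp
 qed
qed

lemma lmeasurable_outer_open:
 fixes S :: "'a::euclidean_space set"
 assumes S: "S \<in> lmeasurable" and "e > 0"
 obtains T where "open T" "S \<subseteq> T" "T \<in> lmeasurable" "measure lebesgue T < measure lebesgue S + e"
proof -
 obtain T where T: "open T" "S \<subseteq> T" "T - S \<in> lmeasurable" "emeasure lebesgue (T - S) < ennreal e"
  using sets_lebesgue_outer_open[OF fmeasurableD[OF S] \<open>e > 0\<close>] by blast
 have "T = S \<union> (T - S)" using T by auto
 moreover have "measure lebesgue (T - S) < e"
  using T(4) \<open>e > 0\<close> by (simp add: emeasure_eq_measure2[OF T(3)] ennreal_less_iff)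
 moreover have "measure lebesgue (S \<union> (T - S)) <= measure lebesgue S + measure lebesgue (T - S)"
  by (rule measure_Un_le) (use S T in auto)
 ultimately show ?thesis using that[OF T(1,2)] S T(3) fmeasurable.Un by (smt (verit))
qed

text \<open>Henstock-Kurzweil integration makes this direct. Pieces tagged outside N are controlled
  by differentiability at the tag; pieces tagged in N lie in an open set of small measure, where
  absolute continuity bounds the sum of the increments.\<close>

lemma AC_has_integral:
 fixes F :: "real => 'a::euclidean_space"
 assumes ac: "absolutely_continuous_on {a..b} F" and ab: "a <= b" and N: "negligible N"
  and der: "!!t. t \<in> {a..b} - N ==> (F has_vector_derivative f t) (at t within {a..b})"
 shows "(f has_integral (F b - F a)) {a..b}"
proof -
 define f' where "f' t = (if t \<in> N then 0 else f t)" for t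
 have "(f' has_integral (F b - F a)) (cbox a b)"
 proof (subst has_integral, intro allI impI)
  fix e :: real assume e: "e > 0"
  obtain g where d: "g > 0" and D: "!!p l r. [|finite p; \<And>i::real\<times>real set. i \<in> p ==> l i <= r i \<and> {l i..r i} \<subseteq> {a..b};
    \<And>i j. [|i \<in> p; j \<in> p; i ~= j|] ==> r i <= l j \<or> r j <= l i; (\<Sum>i\<in>p. r i - l i) < g|]
    ==> (\<Sum>i\<in>p. norm (F (r i) - F (l i))) < e/2"
   by (rule absolutely_continuous_on_finite[OF ac, of "e/2"]) (use e in \<open>simp, blast\<close>)
  have "N \<in> lmeasurable" "measure lebesgue N = 0" using N by (auto simp: negligible_iff_measure)
  then obtain U where U: "open U" "N \<subseteq> U" "U \<in> lmeasurable" "measure lebesgue U < g"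
   using lmeasurable_outer_open[of N g] d by auto
  \<comment> \<open>The good pieces contribute at most \<epsilon> (b - a), which is at most e/2; the
    summand 2 covers the case a = b.\<close>
  define \<epsilon> where "\<epsilon> = e / (2 * (b - a) + 2)"
  have ep: "\<epsilon> > 0" using e ab by (simp add: \<epsilon>_def)
  have "\<exists>c>0. \<forall>y\<in>{a..b}. \<bar>y - t\<bar> < c --> norm (F y - F t - (y - t) *\<^sub>R f t) <= \<epsilon> * \<bar>y - t\<bar>"
   if "t \<in> {a..b} - N" for t
   using der[OF that] ep unfolding has_vector_derivative_def has_derivative_within_alt by (auto simp: real_norm_def)
  then obtain c where c: "!!t. t \<in> {a..b} - N ==> c t > 0" 
   "!!t y. t \<in> {a..b} - N ==> y \<in> {a..b} ==> \<bar>y - t\<bar> < c t ==> norm (F y - F t - (y - t) *\<^sub>R f t) <= \<epsilon> * \<bar>y - t\<bar>"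
   by metis
  define G where "G t = (if t \<in> N then U else if t \<in> {a..b} then ball t (c t) else ball t 1)" for t
  have "gauge G" unfolding gauge_def G_def using U c by auto
  moreover have "norm ((\<Sum>(x,k)\<in>\<D>. Henstock_Kurzweil_Integration.content k *\<^sub>R f' x) - (F b - F a)) < e"
   if td: "\<D> tagged_division_of cbox a b" and fine: "G fine \<D>" for \<D>
  proof -
   note t4 = tagged_division_ofD[OF td]
   have td': "\<D> tagged_division_of {a..b}" using td by simp
   have kk: "\<exists>u v. u <= v \<and> k = {u..v} \<and> u <= x \<and> x <= v \<and> a <= u \<and> v <= b" if "(x,k) \<in> \<D>" for x k
    using t4(2,3,4)[OF that] by (auto; metis atLeastAtMost_iff order_trans order_refl subset_iff)
   have tele: "(\<Sum>(x,k)\<in>\<D>. F (Sup k) - F (Inf k)) = F b - F a"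
    using additive_tagged_division_1[OF ab td'] .
   \<comment> \<open>Degenerate intervals are dropped: for nondegenerate ones, disjoint interiors
     give the ordering of endpoints that absolute continuity asks for.\<close>
   define p where "p = {(x,k) \<in> \<D>. x \<in> N \<and> Inf k < Sup k}"
   have fp: "finite p" using t4(1) unfolding p_def by (rule rev_finite_subset) auto
   have pD: "p \<subseteq> \<D>" by (auto simp: p_def)
   have sumU: "(\<Sum>i\<in>p. Sup (snd i) - Inf (snd i)) < g"
   proof -
    have "(\<Sum>i\<in>p. Sup (snd i) - Inf (snd i)) = (\<Sum>i\<in>p. measure lebesgue (snd i))"
    proof (rule sum.cong)
     fix i assume "i \<in> p" then obtain x k where i: "i = (x,k)" "(x,k) \<in> \<D>" by (auto simp: p_def)
     from kk[OF i(2)] show "Sup (snd i) - Inf (snd i) = measure lebesgue (snd i)" using i by auto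
    qed simp
    also have "... = measure lebesgue (\<Union>i\<in>p. snd i)"
    proof (rule measure_negligible_finite_Union_image[symmetric, OF fp])
     show "snd i \<in> lmeasurable" if "i \<in> p" for i
      using that pD kk by (metis lmeasurable_cbox cbox_interval prod.collapse subsetD)
     show "pairwise (\<lambda>i j. negligible (snd i \<inter> snd j)) p"
     proof (rule pairwiseI)
      fix i j assume ij: "i \<in> p" "j \<in> p" "i ~= j"
      obtain x k y l where xy: "i = (x,k)" "j = (y,l)" by fastforce
      hence D: "(x,k) \<in> \<D>" "(y,l) \<in> \<D>" and h: "(x,k) ~= (y,l)" using pD ij by auto
      have i: "interior k \<inter> interior l = {}" using t4(5)[OF D h] .
      obtain u v u' v' where "k = {u..v}" "l = {u'..v'}" using kk[OF D(1)] kk[OF D(2)] by auto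
      hence "k \<inter> l = {max u u'..min v v'}" "interior k \<inter> interior l = {max u u'<..<min v v'}"
       by (auto simp: interior_atLeastAtMost_real)
      with i have "min v v' <= max u u'" using greaterThanLessThan_empty_iff by metis
      hence "negligible (k \<inter> l)" using \<open>k \<inter> l = _\<close>
       by (metis atLeastatMost_empty_iff atLeastAtMost_singleton negligible_empty negligible_sing order_antisym_conv)
      thus "negligible (snd i \<inter> snd j)" by (simp add: xy)
     qed
    qed
    also have "... <= measure lebesgue U"
    proof (rule measure_mono_fmeasurable)
     show "(\<Union>i\<in>p. snd i) \<subseteq> U"
      using fine unfolding fine_def p_def G_def by force
     show "(\<Union>i\<in>p. snd i) \<in> sets lebesgue"
      by (intro sets.finite_UN fp) (metis kk pD prod.collapse subsetD lmeasurable_cbox cbox_interval fmeasurableD)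
    qed (use U in auto)
    finally show ?thesis using U by simp
   qed
   have A: "(\<Sum>i\<in>p. norm (F (Sup (snd i)) - F (Inf (snd i)))) < e/2"
   proof (rule D[of p "\<lambda>i. Inf (snd i)" "\<lambda>i. Sup (snd i)", OF fp _ _ sumU])
    fix i assume "i \<in> p" then obtain x k where i: "i = (x,k)" "(x,k) \<in> \<D>" by (auto simp: p_def)
    from kk[OF i(2)] show "Inf (snd i) <= Sup (snd i) \<and> {Inf (snd i)..Sup (snd i)} \<subseteq> {a..b}" using i by auto
   next
    fix i j assume ij: "i \<in> p" "j \<in> p" "i ~= j"
    obtain x k y l where i: "i = (x,k)" "(x,k) \<in> \<D>" and j: "j = (y,l)" "(y,l) \<in> \<D>" using ij by (auto simp: p_def)
    have ii: "interior k \<inter> interior l = {}" using t4(5)[OF i(2) j(2)] ij i j by auto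
    obtain u v u' v' where uv: "k = {u..v}" "l = {u'..v'}" "u <= v" "u' <= v'" using kk[OF i(2)] kk[OF j(2)] by auto
    hence "u < v" "u' < v'" using ij i j by (auto simp: p_def)
    have "interior k \<inter> interior l = {max u u'<..<min v v'}"
     using uv by (auto simp: interior_atLeastAtMost_real)
    with ii have "min v v' <= max u u'" using greaterThanLessThan_empty_iff by metis
    hence "v <= u' \<or> v' <= u" using \<open>u < v\<close> \<open>u' < v'\<close> by linarith
    thus "Sup (snd i) <= Inf (snd j) \<or> Sup (snd j) <= Inf (snd i)" using uv i j by simp
   qed
   have B: "norm (Henstock_Kurzweil_Integration.content k *\<^sub>R f' x - (F (Sup k) - F (Inf k))) <= 
      (if (x,k) \<in> p then norm (F (Sup k) - F (Inf k)) else \<epsilon> * Henstock_Kurzweil_Integration.content k)" if xk: "(x,k) \<in> \<D>" for x k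
   proof -
    obtain u v where uv: "u <= v" "k = {u..v}" "u <= x" "x <= v" "a <= u" "v <= b" using kk[OF xk] by blast
    show ?thesis
    proof (cases "x \<in> N")
     case True
     thus ?thesis using uv xk by (cases "u = v") (auto simp: p_def f'_def norm_minus_commute)
    next
     case False
     have x: "x \<in> {a..b} - N" using False uv by auto
     have "k \<subseteq> ball x (c x)" using fine xk x unfolding fine_def G_def by fastforce
     moreover have "u \<in> k" "v \<in> k" using uv by auto
     ultimately have "u \<in> ball x (c x)" "v \<in> ball x (c x)" by blast+
     hence "\<bar>u - x\<bar> < c x" "\<bar>v - x\<bar> < c x" by (simp_all add: dist_real_def)
     hence 1: "norm (F u - F x - (u - x) *\<^sub>R f x) <= \<epsilon> * \<bar>u - x\<bar>" "norm (F v - F x - (v - x) *\<^sub>R f x) <= \<epsilon> * \<bar>v - x\<bar>"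
      using c(2)[OF x, of u] c(2)[OF x, of v] uv by auto
     have "(v-u) *\<^sub>R f x - (F v - F u) = (F u - F x - (u - x) *\<^sub>R f x) - (F v - F x - (v - x) *\<^sub>R f x)"
      by (simp add: algebra_simps)
     hence "norm ((v-u) *\<^sub>R f x - (F v - F u)) <= \<epsilon> * \<bar>u - x\<bar> + \<epsilon> * \<bar>v - x\<bar>"
      by (simp only:) (rule order_trans[OF norm_triangle_ineq4 add_mono[OF 1]])
     also have "... = \<epsilon> * (v - u)" using uv by (simp add: algebra_simps)
     finally show ?thesis using False uv by (auto simp: p_def f'_def)
    qed
   qed
   have "norm ((\<Sum>(x,k)\<in>\<D>. Henstock_Kurzweil_Integration.content k *\<^sub>R f' x) - (F b - F a)) 
     = norm (\<Sum>(x,k)\<in>\<D>. Henstock_Kurzweil_Integration.content k *\<^sub>R f' x - (F (Sup k) - F (Inf k)))"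
    unfolding tele[symmetric] by (simp add: sum_subtractf case_prod_unfold)
   also have "... <= (\<Sum>(x,k)\<in>\<D>. (if (x,k) \<in> p then norm (F (Sup k) - F (Inf k)) else \<epsilon> * Henstock_Kurzweil_Integration.content k))"
    by (rule sum_norm_le) (use B in auto)
   also have "... <= (\<Sum>(x,k)\<in>\<D>. (if (x,k) \<in> p then norm (F (Sup k) - F (Inf k)) else 0) + \<epsilon> * Henstock_Kurzweil_Integration.content k)"
    by (rule sum_mono) (use ep in auto)
   also have "... = (\<Sum>i\<in>p. norm (F (Sup (snd i)) - F (Inf (snd i)))) + \<epsilon> * (\<Sum>(x,k)\<in>\<D>. Henstock_Kurzweil_Integration.content k)"
   proof -
    have "(\<Sum>i\<in>\<D>. if i \<in> p then norm (F (Sup (snd i)) - F (Inf (snd i))) else 0) = (\<Sum>i\<in>p. norm (F (Sup (snd i)) - F (Inf (snd i))))"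
     using sum.inter_restrict[OF t4(1), of "\<lambda>i. norm (F (Sup (snd i)) - F (Inf (snd i)))" p] pD
     by (simp add: Int_absorb1)
    thus ?thesis by (simp add: sum.distrib sum_distrib_left case_prod_unfold)
   qed
   also have "(\<Sum>(x,k)\<in>\<D>. Henstock_Kurzweil_Integration.content k) = b - a" using additive_content_tagged_division[OF td] ab by simp
   also have "(\<Sum>i\<in>p. norm (F (Sup (snd i)) - F (Inf (snd i)))) + \<epsilon> * (b - a) < e/2 + e/2"
   proof (rule add_less_le_mono[OF A])
    show "\<epsilon> * (b - a) <= e / 2" using e ab unfolding \<epsilon>_def by (simp add: field_simps)
   qed
   finally show ?thesis by simp
  qed
  ultimately show "\<exists>G. gauge G \<and> (\<forall>\<D>. \<D> tagged_division_of cbox a b \<and> G fine \<D> -->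
     norm ((\<Sum>(x,k)\<in>\<D>. Henstock_Kurzweil_Integration.content k *\<^sub>R f' x) - (F b - F a)) < e)" by (intro exI[of _ G]) simp
 qed
 hence "(f' has_integral (F b - F a)) {a..b}" by simp
 thus ?thesis by (rule has_integral_spike[OF N, rotated]) (auto simp: f'_def)
qed

section \<open>Almost everywhere differentiability of Lipschitz curves\<close>

lemma tendsto_real_if_no_gap:
 fixes Q :: "real => real"
 assumes F: "F ~= bot" and bd: "!!y. 0 <= Q y \<and> Q y <= L"
  and gap: "!!p q. [|p \<in> \<rat>; q \<in> \<rat>; 0 < p; p < q; \<exists>\<^sub>F y in F. Q y < p|] ==> \<not> (\<exists>\<^sub>F y in F. q < Q y)"
 shows "\<exists>l. (Q \<longlongrightarrow> l) F"
proof -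
 let ?Q = "\<lambda>y. ereal (Q y)"
 have le: "Liminf F ?Q <= Limsup F ?Q" by (rule Liminf_le_Limsup[OF F])
 have lo: "0 <= Liminf F ?Q" using bd by (intro Liminf_bounded) (auto intro!: always_eventually)
 have hi: "Limsup F ?Q <= ereal L" using bd by (intro Limsup_bounded) (auto intro!: always_eventually)
 have eq: "Liminf F ?Q = Limsup F ?Q"
 proof (rule ccontr)
  assume "Liminf F ?Q ~= Limsup F ?Q"
  with le have lt: "Liminf F ?Q < Limsup F ?Q" by simp
  obtain a where a: "Liminf F ?Q < ereal a" "ereal a < Limsup F ?Q" using ereal_dense2[OF lt] by blast
  obtain b where b: "ereal a < ereal b" "ereal b < Limsup F ?Q" using ereal_dense2[OF a(2)] by blast
  obtain a' where a': "Liminf F ?Q < ereal a'" "ereal a' < ereal a" using ereal_dense2[OF a(1)] by blast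
  obtain p where p: "p \<in> \<rat>" "a' < p" "p < a" using Rats_dense_in_real[of a' a] a' by auto
  obtain q where q: "q \<in> \<rat>" "a < q" "q < b" using Rats_dense_in_real[of a b] b by auto
  have "0 < p" using lo a'(1) p(2) by (metis ereal_less(2) ereal_less_eq(3) less_eq_real_def less_ereal.simps(1) order_le_less_trans order_less_trans zero_ereal_def)
  have fr1: "\<exists>\<^sub>F y in F. Q y < p"
  proof (rule ccontr)
   assume "\<not> ?thesis"
   hence "\<forall>\<^sub>F y in F. p <= Q y" by (simp add: not_frequently not_less)
   hence "ereal p <= Liminf F ?Q" by (intro Liminf_bounded) (auto elim: eventually_mono)
   with a'(1) p(2) show False by (metis ereal_less_eq(3) less_eq_real_def not_le order_less_le_trans order_trans)
  qed
  have fr2: "\<exists>\<^sub>F y in F. q < Q y"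
  proof (rule ccontr)
   assume "\<not> ?thesis"
   hence "\<forall>\<^sub>F y in F. Q y <= q" by (simp add: not_frequently not_less)
   hence "Limsup F ?Q <= ereal q" by (intro Limsup_bounded) (auto elim: eventually_mono)
   with b(2) q(3) show False by (meson ereal_less_eq(3) less_eq_real_def not_le order_trans)
  qed
  show False using gap[OF p(1) q(1) \<open>0 < p\<close> _ fr1] fr2 p q by simp
 qed
 obtain l where l: "Limsup F ?Q = ereal l" using lo[unfolded eq] hi 
  by (cases "Limsup F (\<lambda>y. ereal (Q y))") auto
 have "(?Q \<longlongrightarrow> ereal l) F" using eq l F by (subst tendsto_iff_Liminf_eq_Limsup) auto
 thus ?thesis by auto
qed

lemma interval_as_cball: "cball ((u + v) / 2) ((v - u) / 2) = {u..v::real}"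
 by (auto simp: cball_def dist_real_def abs_le_iff field_simps)

text \<open>The Vitali covering theorem is used twice. Intervals of slope below p cover E inside an
  open set of almost minimal measure; intervals of slope above q cover E again inside the first
  family. Comparing both with the Stieltjes measure of f gives q e <= p (e + \<epsilon>), which is
  false if the outer measure e is positive.\<close>

lemma dini_gap_negligible:
 fixes f :: "real => real"
 assumes mono: "!!x y. x <= y ==> f x <= f y" and cont: "continuous_on UNIV f"
  and E: "bounded E" and pq: "0 < p" "p < q"
  and lo: "!!x. x \<in> E ==> \<exists>\<^sub>F y in at x. (f y - f x) / (y - x) < p"
  and hi: "!!x. x \<in> E ==> \<exists>\<^sub>F y in at x. q < (f y - f x) / (y - x)"
 shows "negligible E"
proof (rule ccontr)
 assume nn: "\<not> negligible E"
 define \<mu> where "\<mu> = interval_measure f"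
 have setsmu[simp]: "sets \<mu> = sets borel" by (simp add: \<mu>_def)
 have mu: "emeasure \<mu> {u..v} = ennreal (f v - f u)" if "u <= v" for u v
  unfolding \<mu>_def using emeasure_interval_measure_Icc[OF that mono cont] .
 \<comment> \<open>E is not known to be measurable, so its outer measure is taken as an infimum over
   open supersets.\<close>
 define M where "M = {measure lebesgue T |T. open T \<and> T \<in> lmeasurable \<and> E \<subseteq> T}"
 define e where "e = Inf M"
 obtain R where R: "E \<subseteq> ball 0 R" using E bounded_subset_ballD by blast
 have Mne: "M ~= {}" and Mbd: "bdd_below M" unfolding M_def using R by (auto intro!: bdd_belowI[of _ 0] exI[of _ "ball 0 R"])
 have e_le: "e <= measure lebesgue T" if T: "E \<subseteq> T" "T \<in> lmeasurable" for T
 proof (rule field_le_epsilon)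
  fix d :: real assume "0 < d"
  obtain U where "open U" "T \<subseteq> U" "U \<in> lmeasurable" "measure lebesgue U < measure lebesgue T + d"
   using lmeasurable_outer_open[OF T(2) \<open>0 < d\<close>] by blast
  moreover have "e <= measure lebesgue U"
   unfolding e_def by (rule cInf_lower[OF _ Mbd], unfold M_def) (use calculation T in blast)
  ultimately show "e <= measure lebesgue T + d" by simp
 qed
 have "0 <= e" unfolding e_def by (rule cInf_greatest[OF Mne]) (auto simp: M_def)
 have "e ~= 0"
 proof
  assume e0: "e = 0"
  have "\<exists>T. E \<subseteq> T \<and> T \<in> lmeasurable \<and> measure lebesgue T < d" if "d > 0" for d
   using cInf_lessD[OF Mne, of d] e0 that unfolding e_def M_def by auto
  with nn show False using negligible_outer by blast
 qed
 with \<open>0 <= e\<close> have epos: "e > 0" by simp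
 \<comment> \<open>Then p (e + \<epsilon>) is the midpoint of p e and q e, hence below q e.\<close>
 define \<epsilon> where "\<epsilon> = e * (q - p) / (2 * p)"
 have eps: "\<epsilon> > 0" "p * (e + \<epsilon>) < q * e" using epos pq by (auto simp: \<epsilon>_def field_simps)
 obtain U where U: "open U" "U \<in> lmeasurable" "E \<subseteq> U" "measure lebesgue U < e + \<epsilon>"
  using cInf_lessD[OF Mne, of "e + \<epsilon>"] eps unfolding e_def M_def by auto
 have near: "\<exists>u v. u < v \<and> {u..v} \<subseteq> V \<and> x \<in> {u..v} \<and> (v - u) / 2 < d \<and> P ((f v - f u) / (v - u))"
  if fr: "\<exists>\<^sub>F y in at x. P ((f y - f x) / (y - x))" and V: "open V" "x \<in> V" "d > 0" for x P V d
 proof -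
  obtain r where r: "r > 0" "ball x r \<subseteq> V" using V openE by blast
  have "\<forall>\<^sub>F y in at x. y \<in> ball x (min r d) \<and> y ~= x"
   using r V by (auto simp: eventually_at intro!: exI[of _ "min r d"] simp: dist_commute)
  from frequently_eventually_frequently[OF fr this]
  obtain y where y: "P ((f y - f x) / (y - x))" "y \<in> ball x (min r d)" "y ~= x"
   by (auto dest!: frequently_ex)
  define u v where "u = min x y" and "v = max x y"
  have sl: "(f v - f u) / (v - u) = (f y - f x) / (y - x)"
   unfolding u_def v_def min_def max_def by (cases "x <= y") (simp_all, metis minus_diff_eq minus_divide_divide)
  have "{u..v} \<subseteq> ball x r" using y unfolding u_def v_def by (auto simp: dist_real_def)
  moreover have "(v - u) / 2 < d" using y \<open>d > 0\<close> unfolding u_def v_def by (auto simp: dist_real_def)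
  ultimately show ?thesis using y sl r unfolding u_def v_def by (intro exI[of _ "min x y"] exI[of _ "max x y"]) auto
 qed
 define K1 where "K1 = {(u,v). u < v \<and> {u..v} \<subseteq> U \<and> (f v - f u) / (v - u) < p}"
 let ?c = "\<lambda>i::real\<times>real. (fst i + snd i) / 2" and ?r = "\<lambda>i::real\<times>real. (snd i - fst i) / 2"
 have V1: "\<exists>C. countable C \<and> C \<subseteq> K1 \<and> pairwise (\<lambda>i j. disjnt (cball (?c i) (?r i)) (cball (?c j) (?r j))) C \<and>
   negligible (E - (\<Union>i\<in>C. cball (?c i) (?r i)))"
 proof (rule Vitali_covering_theorem_cballs[of K1 ?r E ?c])
  show "\<exists>i. i \<in> K1 \<and> x \<in> cball (?c i) (?r i) \<and> ?r i < d" if x: "x \<in> E" "0 < d" for x d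
  proof -
   have "x \<in> U" using x U(3) by blast
   from near[where P = "\<lambda>s. s < p", OF lo[OF x(1)] U(1) this x(2)] 
   obtain u v where "u < v" "{u..v} \<subseteq> U" "x \<in> {u..v}" "(v - u) / 2 < d" "(f v - f u) / (v - u) < p" by blast
   thus ?thesis by (intro exI[of _ "(u,v)"]) (simp add: K1_def interval_as_cball)
  qed
 qed (auto simp: K1_def)
 then obtain C1 where C1: "countable C1" "C1 \<subseteq> K1" 
   "pairwise (\<lambda>i j. disjnt {fst i..snd i} {fst j..snd j}) C1" "negligible (E - (\<Union>i\<in>C1. {fst i..snd i}))"
  unfolding interval_as_cball by blast
 \<comment> \<open>Open intervals make G open, as the second covering requires; the endpoints lost
   are countable.\<close>
 define G where "G = (\<Union>i\<in>C1. {fst i<..<snd i})"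
 define K2 where "K2 = {(u,v). u < v \<and> {u..v} \<subseteq> G \<and> q < (f v - f u) / (v - u)}"
 have V2: "\<exists>C. countable C \<and> C \<subseteq> K2 \<and> pairwise (\<lambda>i j. disjnt (cball (?c i) (?r i)) (cball (?c j) (?r j))) C \<and>
   negligible (E \<inter> G - (\<Union>i\<in>C. cball (?c i) (?r i)))"
 proof (rule Vitali_covering_theorem_cballs[of K2 ?r "E \<inter> G" ?c])
  have "open G" by (auto simp: G_def)
  show "\<exists>i. i \<in> K2 \<and> x \<in> cball (?c i) (?r i) \<and> ?r i < d" if x: "x \<in> E \<inter> G" "0 < d" for x d
  proof -
   have "x \<in> E" "x \<in> G" using x by auto
   from near[where P = "\<lambda>s. q < s", OF hi[OF this(1)] \<open>open G\<close> this(2) x(2)] 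
   obtain u v where "u < v" "{u..v} \<subseteq> G" "x \<in> {u..v}" "(v - u) / 2 < d" "q < (f v - f u) / (v - u)" by blast
   thus ?thesis by (intro exI[of _ "(u,v)"]) (simp add: K2_def interval_as_cball)
  qed
 qed (auto simp: K2_def)
 then obtain C2 where C2: "countable C2" "C2 \<subseteq> K2" 
   "pairwise (\<lambda>i j. disjnt {fst i..snd i} {fst j..snd j}) C2" "negligible (E \<inter> G - (\<Union>i\<in>C2. {fst i..snd i}))"
  unfolding interval_as_cball by blast
 let ?I = "\<lambda>i::real\<times>real. {fst i..snd i}"
 have dj: "disjoint_family_on ?I C1" "disjoint_family_on ?I C2"
  using C1(3) C2(3) by (auto simp: disjoint_family_on_def pairwise_def disjnt_def)
 have sub: "\<Union>(?I ` C1) \<subseteq> U" "\<Union>(?I ` C2) \<subseteq> \<Union>(?I ` C1)"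
 proof -
  show "\<Union>(?I ` C1) \<subseteq> U" 
  proof (rule UN_least)
   fix i assume "i \<in> C1"
   hence "i \<in> K1" using C1(2) by blast
   thus "?I i \<subseteq> U" by (cases i) (simp add: K1_def)
  qed
  have "\<Union>(?I ` C2) \<subseteq> G" 
  proof (rule UN_least)
   fix i assume "i \<in> C2"
   hence "i \<in> K2" using C2(2) by blast
   thus "?I i \<subseteq> G" by (cases i) (simp add: K2_def)
  qed
  moreover have "G \<subseteq> \<Union>(?I ` C1)" unfolding G_def by (intro UN_mono) auto
  ultimately show "\<Union>(?I ` C2) \<subseteq> \<Union>(?I ` C1)" by (rule subset_trans)
 qed
 have um: "emeasure m (\<Union>(?I ` C)) = (\<integral>\<^sup>+i. emeasure m (?I i) \<partial>count_space C)" 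
  if "disjoint_family_on ?I C" "countable C" "sets m = sets borel" for C and m :: "real measure"
  by (rule emeasure_UN_countable) (use that in auto)
 have "ennreal q * emeasure lborel (\<Union>(?I ` C2)) = (\<integral>\<^sup>+i. ennreal q * emeasure lborel (?I i) \<partial>count_space C2)"
  by (subst um) (use dj C2 in \<open>auto simp: nn_integral_cmult\<close>)
 also have "... <= (\<integral>\<^sup>+i. emeasure \<mu> (?I i) \<partial>count_space C2)"
 proof (rule nn_integral_mono, simp)
  fix i assume "i \<in> C2" hence "fst i < snd i" "q < (f (snd i) - f (fst i)) / (snd i - fst i)" using C2 by (auto simp: K2_def)
  hence "q * (snd i - fst i) <= f (snd i) - f (fst i)" by (simp add: field_simps)
  thus "ennreal q * emeasure lborel (?I i) <= emeasure \<mu> (?I i)" using \<open>fst i < snd i\<close> pq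
   by (simp add: mu ennreal_mult[symmetric] ennreal_leI)
 qed
 also have "... = emeasure \<mu> (\<Union>(?I ` C2))" by (subst um) (use dj C2 in auto)
 also have "... <= emeasure \<mu> (\<Union>(?I ` C1))"
 proof (rule emeasure_mono)
  show "\<Union>(?I ` C2) \<subseteq> \<Union>(?I ` C1)" by (rule sub(2))
  show "\<Union>(?I ` C1) \<in> sets \<mu>" using C1(1) by (auto intro!: sets.countable_UN')
 qed
 also have "... = (\<integral>\<^sup>+i. emeasure \<mu> (?I i) \<partial>count_space C1)" by (subst um) (use dj C1 in auto)
 also have "... <= (\<integral>\<^sup>+i. ennreal p * emeasure lborel (?I i) \<partial>count_space C1)"
 proof (rule nn_integral_mono, simp)
  fix i assume "i \<in> C1" hence "fst i < snd i" "(f (snd i) - f (fst i)) / (snd i - fst i) < p" using C1 by (auto simp: K1_def)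
  hence "f (snd i) - f (fst i) <= p * (snd i - fst i)" by (simp add: field_simps)
  thus "emeasure \<mu> (?I i) <= ennreal p * emeasure lborel (?I i)" using \<open>fst i < snd i\<close> pq
   by (simp add: mu ennreal_mult[symmetric] ennreal_leI)
 qed
 also have "... = ennreal p * emeasure lborel (\<Union>(?I ` C1))"
  by (subst um) (use dj C1 in \<open>auto simp: nn_integral_cmult\<close>)
 finally have key: "ennreal q * emeasure lborel (\<Union>(?I ` C2)) <= ennreal p * emeasure lborel (\<Union>(?I ` C1))" .
 have b: "\<Union>(?I ` C1) \<in> sets borel" "\<Union>(?I ` C2) \<in> sets borel" 
  using C1(1) C2(1) by (auto intro!: sets.countable_UN')
 have lm: "\<Union>(?I ` C1) \<in> lmeasurable" "\<Union>(?I ` C2) \<in> lmeasurable"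
  by (rule fmeasurableI2[OF U(2)], use sub b in auto)+
 have em: "emeasure lborel (\<Union>(?I ` C1)) = ennreal (measure lebesgue (\<Union>(?I ` C1)))" 
   "emeasure lborel (\<Union>(?I ` C2)) = ennreal (measure lebesgue (\<Union>(?I ` C2)))"
  using emeasure_eq_measure2[OF lm(1)] emeasure_eq_measure2[OF lm(2)] b by simp_all
 have k2: "q * measure lebesgue (\<Union>(?I ` C2)) <= p * measure lebesgue (\<Union>(?I ` C1))"
  using key pq unfolding em by (simp add: ennreal_mult[symmetric])
 have "measure lebesgue (\<Union>(?I ` C1)) <= measure lebesgue U"
  using sub U(2) lm by (intro measure_mono_fmeasurable) auto
 hence k3: "q * measure lebesgue (\<Union>(?I ` C2)) <= p * (e + \<epsilon>)" using k2 U(4) pq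
  by (smt (verit, best) mult_left_mono)
 define Z where "Z = (E - \<Union>(?I ` C1)) \<union> (E \<inter> G - \<Union>(?I ` C2)) \<union> (fst ` C1 \<union> snd ` C1)"
 have cn: "negligible A" if "countable A" for A :: "real set"
  using negligible_countable_Union[of "(\<lambda>x. {x}) ` A"] that by auto
 have Z: "negligible Z" unfolding Z_def using C1 C2 
  by (intro negligible_Un) (auto intro!: cn)
 have "E \<subseteq> \<Union>(?I ` C2) \<union> Z"
 proof
  fix x assume x: "x \<in> E"
  show "x \<in> \<Union>(?I ` C2) \<union> Z"
  proof (cases "x \<in> \<Union>(?I ` C1) \<and> x \<notin> G")
   case True
   then obtain i where "i \<in> C1" "fst i <= x" "x <= snd i" by auto
   with True have "x = fst i \<or> x = snd i" unfolding G_def by force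
   thus ?thesis using \<open>i \<in> C1\<close> by (auto simp: Z_def)
  qed (use x in \<open>auto simp: Z_def\<close>)
 qed
 hence "e <= measure lebesgue (\<Union>(?I ` C2) \<union> Z)"
  using e_le lm(2) Z negligible_imp_measurable by (metis fmeasurable.Un)
 also have "... = measure lebesgue (\<Union>(?I ` C2))"
  using measure_Un_null_set[of "\<Union>(?I ` C2)" lebesgue Z] lm Z by (auto simp: negligible_iff_null_sets)
 finally have "q * e <= q * measure lebesgue (\<Union>(?I ` C2))" using pq by simp
 with k3 eps show False by simp
qed

lemma lipschitz_real_differentiable_ae:
 fixes f :: "real => real"
 assumes lip: "!!x y. \<bar>f x - f y\<bar> <= L * \<bar>x - y\<bar>"
 shows "negligible {x. \<not> f differentiable (at x)}"
proof -
 \<comment> \<open>Adding L x makes the function monotone with difference quotients in [0, 2 L].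
   Where they fail to converge, rational levels p < q separate lower and upper values, so countably
   many gap sets suffice.\<close>
 define g where "g x = f x + L * x" for x
 have L0: "L >= 0" using lip[of 1 0] by simp
 have sl: "0 <= (g y - g x) / (y - x) \<and> (g y - g x) / (y - x) <= 2 * L" for x y
 proof (cases "y = x")
  case False
  have "\<bar>(f y - f x) / (y - x)\<bar> <= L" using lip[of y x] False by (simp add: abs_divide field_simps)
  moreover have "(g y - g x) / (y - x) = (f y - f x) / (y - x) + L" using False by (simp add: g_def field_simps)
  ultimately show ?thesis by linarith
 qed (use L0 in auto)
 have mono: "g x <= g y" if "x <= y" for x y using lip[of x y] that by (auto simp: g_def abs_if algebra_simps split: if_splits)
 have cont: "continuous_on UNIV g"
 proof -
  have "continuous_on UNIV f" 
   by (rule lipschitz_on_continuous_on[of L]) (use lip L0 in \<open>auto simp: lipschitz_on_def dist_real_def\<close>)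
  thus ?thesis unfolding g_def by (intro continuous_intros)
 qed
 define E where "E p q n = {x \<in> ball 0 (real n). (\<exists>\<^sub>F y in at x. (g y - g x) / (y - x) < p) \<and>
   (\<exists>\<^sub>F y in at x. q < (g y - g x) / (y - x))}" for p q n
 have neg: "negligible (E p q n)" if "0 < p" "p < q" for p q n
  by (rule dini_gap_negligible[OF mono cont _ that]) (auto simp: E_def intro!: bounded_subset[OF bounded_ball[of 0 "real n"]])
 have "negligible (\<Union>(p,q,n)\<in>{(p,q,n). p \<in> \<rat> \<and> q \<in> \<rat> \<and> 0 < p \<and> p < q}. E p q n)"
 proof (rule negligible_countable_Union)
  have "countable (\<rat> \<times> \<rat> \<times> (UNIV::nat set))" by (intro countable_SIGMA countable_rat) auto
  hence "countable {(p::real,q::real,n::nat). p \<in> \<rat> \<and> q \<in> \<rat> \<and> 0 < p \<and> p < q}"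
   by (rule countable_subset[rotated]) auto
  thus "countable ((\<lambda>(p,q,n). E p q n) ` {(p::real,q::real,n::nat). p \<in> \<rat> \<and> q \<in> \<rat> \<and> 0 < p \<and> p < q})" by simp
 qed (use neg in auto)
 moreover have "{x. \<not> f differentiable (at x)} \<subseteq> (\<Union>(p,q,n)\<in>{(p,q,n). p \<in> \<rat> \<and> q \<in> \<rat> \<and> 0 < p \<and> p < q}. E p q n)"
 proof (rule subsetI, rule ccontr)
  fix x assume x: "x \<in> {x. \<not> f differentiable (at x)}"
   and n: "x \<notin> (\<Union>(p,q,n)\<in>{(p,q,n). p \<in> \<rat> \<and> q \<in> \<rat> \<and> 0 < p \<and> p < q}. E p q n)"
  obtain n where "norm x < real n" using reals_Archimedean2 by blast
  have "\<exists>l. ((\<lambda>y. (g y - g x) / (y - x)) \<longlongrightarrow> l) (at x)"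
  proof (rule tendsto_real_if_no_gap[OF _ sl])
   fix p q assume pq: "p \<in> \<rat>" "q \<in> \<rat>" "0 < p" "p < q" "\<exists>\<^sub>F y in at x. (g y - g x) / (y - x) < p"
   have "x \<notin> E p q n" using n pq by auto
   thus "\<not> (\<exists>\<^sub>F y in at x. q < (g y - g x) / (y - x))" using pq \<open>norm x < real n\<close> by (auto simp: E_def)
  qed simp
  then obtain l where "(g has_field_derivative l) (at x)" by (auto simp: has_field_derivative_iff)
  hence "((\<lambda>x. g x - L * x) has_field_derivative (l - L)) (at x)" by (auto intro!: derivative_eq_intros)
  hence "f differentiable (at x)" unfolding g_def
   by (auto simp: differentiable_def has_field_derivative_def)
  with x show False by simp
 qed
 ultimately show ?thesis using negligible_subset by blast
qed

lemma lipschitz_differentiable_ae: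
 fixes f :: "real => 'a::euclidean_space"
 assumes lip: "!!x y. norm (f x - f y) <= L * \<bar>x - y\<bar>"
 shows "negligible {x. \<not> f differentiable (at x)}"
proof -
 have "negligible (\<Union>b\<in>Basis. {x. \<not> (\<lambda>x. f x \<bullet> b) differentiable (at x)})"
 proof (rule negligible_Union)
  fix T assume "T \<in> (\<lambda>b. {x. \<not> (\<lambda>x. f x \<bullet> b) differentiable (at x)}) ` Basis"
  then obtain b where b: "b \<in> Basis" "T = {x. \<not> (\<lambda>x. f x \<bullet> b) differentiable (at x)}" by auto
  have "\<bar>f x \<bullet> b - f y \<bullet> b\<bar> <= L * \<bar>x - y\<bar>" for x y
   using Basis_le_norm[OF b(1), of "f x - f y"] lip[of x y] by (simp add: inner_diff_left)
  thus "negligible T" unfolding b(2) by (rule lipschitz_real_differentiable_ae)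
 qed auto
 thus ?thesis by (rule negligible_subset) (use differentiable_componentwise_within[of f _ UNIV] in auto)
qed

section \<open>Topological degree\<close>

lemma nsphere_top_of_set:
 "nsphere n = top_of_set {x::nat\<Rightarrow>real. (\<forall>i>n. x i = 0) \<and> (\<Sum>i\<le>n. (x i)^2) = 1}"
proof -
 have "{x::nat\<Rightarrow>real. \<forall>i\<ge>Suc n. x i = 0} \<inter> {x. (\<Sum>i\<le>n. (x i)^2) = 1}
   = {x. (\<forall>i>n. x i = 0) \<and> (\<Sum>i\<le>n. (x i)^2) = 1}" by (auto simp: Suc_le_eq)
 thus ?thesis
  by (simp add: nsphere_def Euclidean_space_def subtopology_subtopology euclidean_product_topology)
qed

lemma continuous_on_fun_normalize:
 fixes G :: "'a::topological_space => nat => real"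
 assumes c: "!!i. i <= n ==> continuous_on S (\<lambda>x. G x i)" and nz: "!!x. x \<in> S ==> (\<Sum>i\<le>n. (G x i)^2) ~= 0"
 shows "continuous_on S (\<lambda>x i. if i <= n then G x i / sqrt (\<Sum>i\<le>n. (G x i)^2) else 0)"
proof (rule continuous_on_coordinatewise_then_product)
 fix i
 show "continuous_on S (\<lambda>x. if i <= n then G x i / sqrt (\<Sum>i\<le>n. (G x i)^2) else 0)"
 proof (cases "i <= n")
  case True
  have "continuous_on S (\<lambda>x. G x i / sqrt (\<Sum>i\<le>n. (G x i)^2))"
   by (intro continuous_intros c True) (use nz in \<open>auto intro: c\<close>)
  thus ?thesis using True by simp
 qed simp
qed

lemma sum_squares_normalize:
 fixes g :: "nat => real"
 assumes "(\<Sum>i\<le>n. (g i)^2) ~= 0"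
 shows "(\<Sum>i\<le>n. (g i / sqrt (\<Sum>i\<le>n. (g i)^2))^2) = 1"
proof -
 have "(\<Sum>i\<le>n. (g i / sqrt (\<Sum>i\<le>n. (g i)^2))^2) = (\<Sum>i\<le>n. (g i)^2 / (\<Sum>i\<le>n. (g i)^2))"
  by (rule sum.cong) (auto simp: power_divide sum_nonneg)
 also have "... = 1" using assms by (simp flip: sum_divide_distrib)
 finally show ?thesis .
qed

text \<open>If q were missed, then F - q could be normalised to the sphere. Shrinking the radius
  from R' to 0 contracts the normalised map to a constant, and moving q to 0 deforms its boundary
  value into the identity; the sphere would be contractible.\<close>

lemma surjective_if_identity_at_infinity_nat:
 fixes F :: "(nat => real) => nat => real" and q :: "nat => real"
 assumes cont: "continuous_on UNIV F"
  and far: "!!x i. [|\<forall>i>n. x i = 0; (\<Sum>i\<le>n. (x i)^2) >= R^2; i <= n|] ==> F x i = x i"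
 shows "\<exists>x. (\<forall>i>n. x i = 0) \<and> (\<forall>i\<le>n. F x i = q i)"
proof (rule ccontr)
 assume neg: "\<not> ?thesis"
 define S where "S = {x::nat\<Rightarrow>real. (\<forall>i>n. x i = 0) \<and> (\<Sum>i\<le>n. (x i)^2) = 1}"
 define Q where "Q = sqrt (\<Sum>i\<le>n. (q i)^2)"
 \<comment> \<open>At least R, so that F is the identity on the sphere of radius R', and larger than
   the norm Q of q, so that \<open>R' * x - (1 - t) * q\<close> never vanishes there.\<close>
 define R' where "R' = \<bar>R\<bar> + Q + 1"
 have Q0: "Q >= 0" by (simp add: Q_def sum_nonneg)
 have R': "R' > Q" "R'^2 >= R^2" "R' > 0" using Q0 by (auto simp: R'_def abs_le_square_iff[symmetric])
 have cF: "continuous_on UNIV (\<lambda>x. F x i)" for i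
  using continuous_on_product_then_coordinatewise[OF cont] .
 have cx: "continuous_on A (\<lambda>x::nat\<Rightarrow>real. x i)" for i A
  by (rule continuous_on_subset[OF continuous_on_product_coordinates]) simp
 have csnd: "continuous_on A (\<lambda>z::real\<times>(nat\<Rightarrow>real). snd z i)" for i A
  using continuous_on_compose2[OF cx[of UNIV i] continuous_on_snd[OF continuous_on_id]] by auto
 define u where "u = (\<lambda>(t,x) i. if i <= n then (F (\<lambda>j. t * R' * x j) i - q i) /
   sqrt (\<Sum>i\<le>n. (F (\<lambda>j. t * R' * x j) i - q i)^2) else 0)"
 define v where "v = (\<lambda>(t,x) i. if i <= n then (R' * x i - (1 - t) * q i) /
   sqrt (\<Sum>i\<le>n. (R' * x i - (1 - t) * q i)^2) else 0)"
 have nz_u: "(\<Sum>i\<le>n. (F (\<lambda>j. t * R' * x j) i - q i)^2) ~= 0" if "x \<in> S" for t x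
 proof
  assume "(\<Sum>i\<le>n. (F (\<lambda>j. t * R' * x j) i - q i)^2) = 0"
  hence "\<forall>i\<le>n. F (\<lambda>j. t * R' * x j) i = q i" by (subst (asm) sum_nonneg_eq_0_iff) auto
  moreover have "\<forall>i>n. t * R' * x i = 0" using that by (auto simp: S_def)
  ultimately show False using neg by (auto dest!: spec[of _ "\<lambda>j. t * R' * x j"])
 qed
 have nz_v: "(\<Sum>i\<le>n. (R' * x i - (1 - t) * q i)^2) ~= 0" if "x \<in> S" "t \<in> {0..1}" for t x
 proof
  assume "(\<Sum>i\<le>n. (R' * x i - (1 - t) * q i)^2) = 0"
  hence "\<forall>i\<le>n. R' * x i = (1 - t) * q i" by (subst (asm) sum_nonneg_eq_0_iff) auto
  hence "(\<Sum>i\<le>n. (R' * x i)^2) = (\<Sum>i\<le>n. ((1 - t) * q i)^2)" by (intro sum.cong) auto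
  hence "R'^2 * (\<Sum>i\<le>n. (x i)^2) = (1 - t)^2 * (\<Sum>i\<le>n. (q i)^2)" by (simp add: power_mult_distrib sum_distrib_left)
  hence "R'^2 = ((1 - t) * Q)^2" using that by (simp add: S_def Q_def sum_nonneg power_mult_distrib)
  hence "R' = (1 - t) * Q" using R' Q0 that by (subst (asm) power2_eq_iff_nonneg) auto
  also have "... <= Q" using that Q0 by (simp add: mult_left_le_one_le)
  finally show False using R' by simp
 qed
 have 1: "homotopic_with (\<lambda>x. True) (top_of_set S) (top_of_set S) (\<lambda>x. u (0,x)) (\<lambda>x. u (1,x))"
  unfolding homotopic_with_def
 proof (intro exI[of _ u] conjI)
  have "continuous_on ({0..1} \<times> S) u"
   unfolding u_def case_prod_unfold
  proof (rule continuous_on_fun_normalize)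
   show "continuous_on ({0..1} \<times> S) (\<lambda>z. F (\<lambda>j. fst z * R' * snd z j) i - q i)" for i
    by (intro continuous_intros continuous_on_compose2[OF cF] continuous_on_coordinatewise_then_product csnd) auto
  qed (use nz_u in auto)
  moreover have "u ` ({0..1} \<times> S) \<subseteq> S"
   unfolding u_def S_def using sum_squares_normalize[OF nz_u] by (auto simp: S_def)
  ultimately show "continuous_map (prod_topology (top_of_set {0..1}) (top_of_set S)) (top_of_set S) u"
   by (auto simp: prod_topology_subtopology_eu)
 qed auto
 have 2: "homotopic_with (\<lambda>x. True) (top_of_set S) (top_of_set S) (\<lambda>x. v (0,x)) (\<lambda>x. v (1,x))"
  unfolding homotopic_with_def
 proof (intro exI[of _ v] conjI)
  have "continuous_on ({0..1} \<times> S) v"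
   unfolding v_def case_prod_unfold
  proof (rule continuous_on_fun_normalize)
   show "continuous_on ({0..1} \<times> S) (\<lambda>z. R' * snd z i - (1 - fst z) * q i)" for i
    by (intro continuous_intros csnd)
  qed (use nz_v in auto)
  moreover have "v ` ({0..1} \<times> S) \<subseteq> S"
   unfolding v_def S_def using sum_squares_normalize[OF nz_v] by (auto simp: S_def)
  ultimately show "continuous_map (prod_topology (top_of_set {0..1}) (top_of_set S)) (top_of_set S) v"
   by (auto simp: prod_topology_subtopology_eu)
 qed auto
 have uv: "u (1,x) = v (0,x)" if "x \<in> S" for x
 proof -
  have "F (\<lambda>j. R' * x j) i = R' * x i" if "i <= n" for i
  proof (rule far[OF _ _ that])
   show "(\<Sum>i\<le>n. (R' * x i)^2) >= R^2" using \<open>x \<in> S\<close> R' by (simp add: S_def power_mult_distrib flip: sum_distrib_left)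
  qed (use \<open>x \<in> S\<close> in \<open>auto simp: S_def\<close>)
  thus ?thesis by (auto simp: u_def v_def fun_eq_iff)
 qed
 define w where "w = u (0, \<lambda>_. 0)"
 have u0: "u (0,x) = w" for x by (simp only: w_def u_def mult_zero_left prod.case)
 have v1: "v (1,x) = x" if "x \<in> S" for x
 proof
  fix i
  have "(\<Sum>i\<le>n. (R' * x i)^2) = R'^2" using that by (simp add: S_def power_mult_distrib flip: sum_distrib_left)
  thus "v (1,x) i = x i" using that R' by (auto simp: v_def S_def)
 qed
 have "homotopic_with (\<lambda>x. True) (top_of_set S) (top_of_set S) (\<lambda>x. w) (\<lambda>x. v (0,x))"
  by (rule homotopic_with_eq[OF 1]) (use uv u0 in auto)
 moreover have "homotopic_with (\<lambda>x. True) (top_of_set S) (top_of_set S) (\<lambda>x. v (0,x)) id"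
  by (rule homotopic_with_eq[OF 2]) (use v1 in auto)
 ultimately have "homotopic_with (\<lambda>x. True) (top_of_set S) (top_of_set S) (\<lambda>x. w) id"
  by (rule homotopic_with_trans)
 hence "contractible_space (nsphere n)"
  unfolding contractible_space_def nsphere_top_of_set S_def[symmetric]
  by (intro exI[of _ w]) (rule homotopic_with_symD)
 thus False using non_contractible_space_nsphere by blast
qed

lemma surjective_if_identity_at_infinity:
 fixes F :: "('i => real) => 'i => real" and q :: "'i => real"
 assumes I: "finite I" and cont: "continuous_on UNIV F"
  and far: "!!x i. [|\<forall>i. i \<notin> I --> x i = 0; (\<Sum>i\<in>I. (x i)^2) >= R^2; i \<in> I|] ==> F x i = x i"
 shows "\<exists>x. (\<forall>i. i \<notin> I --> x i = 0) \<and> (\<forall>i\<in>I. F x i = q i)"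
proof (cases "I = {}")
 case False
 then obtain n where n: "card I = Suc n" using I by (metis card_eq_0_iff not0_implies_Suc)
 obtain h where "bij_betw h {0..<card I} I" using ex_bij_betw_nat_finite[OF I] by blast
 hence h: "bij_betw h {..n} I" by (simp add: n atLeast0LessThan lessThan_Suc_atMost)
 define g where "g = inv_into {..n} h"
 have g: "bij_betw g I {..n}" unfolding g_def by (rule bij_betw_inv_into[OF h])
 have hg: "h (g i) = i" if "i \<in> I" for i using h that by (auto simp: g_def bij_betw_def f_inv_into_f)
 have gh: "g (h j) = j" if "j <= n" for j using h that by (auto simp: g_def bij_betw_def)
 have gn: "g i <= n" if "i \<in> I" for i using g that by (auto simp: bij_betw_def)
 have hI: "h j \<in> I" if "j <= n" for j using h that by (auto simp: bij_betw_def)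
 define E where "E y = (\<lambda>i. if i \<in> I then y (g i) else (0::real))" for y
 have "\<exists>y. (\<forall>j>n. y j = 0) \<and> (\<forall>j\<le>n. (\<lambda>y j. F (E y) (h j)) y j = q (h j))"
 proof (rule surjective_if_identity_at_infinity_nat[where R = R])
  have cE: "continuous_on UNIV E"
  proof (rule continuous_on_coordinatewise_then_product)
   show "continuous_on UNIV (\<lambda>y. E y i)" for i
    unfolding E_def by (cases "i \<in> I") (auto intro: continuous_on_product_coordinates)
  qed
  show "continuous_on UNIV (\<lambda>y j. F (E y) (h j))"
   by (intro continuous_on_coordinatewise_then_product continuous_on_compose2[OF continuous_on_product_then_coordinatewise[OF cont] cE]) auto
 next
  fix y :: "nat => real" and j assume y: "\<forall>i>n. y i = 0" "R^2 <= (\<Sum>i\<le>n. (y i)^2)" "j <= n"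
  have "(\<Sum>i\<in>I. (E y i)^2) = (\<Sum>i\<in>I. (y (g i))^2)" by (rule sum.cong) (auto simp: E_def)
  also have "... = (\<Sum>i\<le>n. (y i)^2)" by (rule sum.reindex_bij_betw[OF g, of "\<lambda>i. (y i)^2"])
  finally show "F (E y) (h j) = y j"
   using far[of "E y" "h j"] y hI[OF y(3)] gh[OF y(3)] by (auto simp: E_def)
 qed
 then obtain y where y: "\<forall>j\<le>n. F (E y) (h j) = q (h j)" by auto
 show ?thesis by (rule exI[of _ "E y"]) (use y hg gn in \<open>auto simp: E_def, metis\<close>)
qed auto

section \<open>Trigonometric polynomials\<close>

lemma continuous_antiderivative_UNIV:
 fixes f :: "real => 'a::euclidean_space"
 assumes f: "continuous_on UNIV f"
 obtains P where "!!x. (P has_vector_derivative f x) (at x)"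
proof -
 define P where "P x = (if x >= 0 then integral {0..x} f else - integral {x..0} f)" for x
 have i: "f integrable_on {a..b}" for a b
  by (rule integrable_continuous_interval) (rule continuous_on_subset[OF f], simp)
 have eq: "P x = integral {-c..x} f - integral {-c..0} f" if "-c <= x" "c >= 0" for x c
 proof (cases "x >= 0")
  case True
  thus ?thesis using Henstock_Kurzweil_Integration.integral_combine[of "-c" 0 x f] i that by (simp add: P_def algebra_simps)
 next
  case False
  thus ?thesis using Henstock_Kurzweil_Integration.integral_combine[of "-c" x 0 f] i that by (simp add: P_def algebra_simps)
 qed
 show ?thesis
 proof (rule that[of P])
  fix x :: real
  define c where "c = \<bar>x\<bar> + 1"
  have c: "-c < x" "x < c" "c >= 0" by (auto simp: c_def)
  have "((\<lambda>u. integral {-c..u} f) has_vector_derivative f x) (at x within {-c..c})"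
   by (rule integral_has_vector_derivative) (use c f continuous_on_subset in auto)
  hence "((\<lambda>u. integral {-c..u} f) has_vector_derivative f x) (at x)"
   using c at_within_interior[of x "{-c..c}"] by simp
  hence "((\<lambda>u. integral {-c..u} f - integral {-c..0} f) has_vector_derivative f x) (at x)"
   by (auto intro!: derivative_eq_intros)
  thus "(P has_vector_derivative f x) (at x)"
  proof (rule has_vector_derivative_transform_within_open[where S = "{-c<..<c}"])
   show "integral {- c..y} f - integral {- c..0} f = P y" if "y \<in> {-c<..<c}" for y
    using eq[of c y] c that by simp
  qed (use c in auto)
 qed
qed

lemma integral_eq_antiderivative:
 fixes f :: "real => 'a::euclidean_space"
 assumes "!!x. (P has_vector_derivative f x) (at x)" "a <= b"
 shows "integral {a..b} f = P b - P a"
 by (rule integral_unique, rule fundamental_theorem_of_calculus) 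
   (use assms has_vector_derivative_at_within in blast)+

lemma integral_periodic_shift:
 fixes f :: "real => 'a::euclidean_space"
 assumes f: "continuous_on UNIV f" and per: "!!t. f (t + 1) = f t"
 shows "integral {a..a+1} f = integral {0..1} f"
proof -
 obtain P where P: "!!x. (P has_vector_derivative f x) (at x)" using continuous_antiderivative_UNIV[OF f] by blast
 have "((\<lambda>x. P (x + 1) - P x) has_vector_derivative 0) (at x)" for x
 proof -
  have "((P \<circ> (\<lambda>x. x + 1)) has_vector_derivative 1 *\<^sub>R f (x + 1)) (at x)"
   by (rule vector_diff_chain_at) (auto intro!: derivative_eq_intros P)
  hence "((\<lambda>x. P (x + 1) - P x) has_vector_derivative (f (x + 1) - f x)) (at x)"
   by (auto intro!: has_vector_derivative_diff P simp: o_def)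
  thus ?thesis by (simp add: per)
 qed
 then obtain c where c: "!!x. x \<in> UNIV ==> P (x + 1) - P x = c"
  by (rule has_vector_derivative_zero_constant[of UNIV, OF convex_UNIV]) auto
 from c[of a] c[of 0] show ?thesis by (simp add: integral_eq_antiderivative[OF P])
qed

lemma integral_cos_int:
 "integral {0..1} (\<lambda>t. cos (2 * pi * real_of_int m * t)) = (if m = 0 then 1 else 0)"
proof (cases "m = 0")
 case False
 have "((\<lambda>t. cos (2 * pi * real_of_int m * t)) has_integral
   (sin (2 * pi * real_of_int m * 1) / (2 * pi * real_of_int m) - sin (2 * pi * real_of_int m * 0) / (2 * pi * real_of_int m))) {0..1}"
  by (rule fundamental_theorem_of_calculus)
    (use False in \<open>auto intro!: derivative_eq_intros simp: has_real_derivative_iff_has_vector_derivative[symmetric] divide_simps\<close>)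
 moreover have "sin (2 * pi * real_of_int m) = 0" using sin_integer_2pi[of "real_of_int m"] by (simp add: mult_ac)
 ultimately show ?thesis using False by (simp add: integral_unique)
qed simp

definition modes :: "nat => int set" where "modes N = {- int N..int N}"

text \<open>The loop exp (2 pi i k t) c in C^n with the point (x, y) read as x + i y. Taking c in
  R^n is what makes it symmetric under \<open>mirror\<close>.\<close>

definition fmode :: "int => real^'n => real => 'n::finite pt" where
 "fmode k c t = (cos (2 * pi * real_of_int k * t) *\<^sub>R c, sin (2 * pi * real_of_int k * t) *\<^sub>R c)"

definition trig :: "nat => (int => real^'n) => real => 'n::finite pt" where
 "trig N a t = (\<Sum>k\<in>modes N. fmode k (a k) t)"

text \<open>The real part of the k-th complex Fourier coefficient. For symmetric loops the imaginary
  part vanishes; for other loops this is the coefficient of the orthogonal projection to the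
  symmetric ones.\<close>

definition fcoef :: "(real => 'n::finite pt) => int => real^'n" where
 "fcoef y k = integral {0..1} (\<lambda>t. cos (2 * pi * real_of_int k * t) *\<^sub>R fst (y t) + sin (2 * pi * real_of_int k * t) *\<^sub>R snd (y t))"

definition mirror :: "'n::finite pt => 'n pt" where "mirror p = (fst p, - snd p)"

lemma finite_modes [simp]: "finite (modes N)" by (simp add: modes_def)

lemma continuous_on_fmode [continuous_intros]: "continuous_on S (fmode k c)"
 unfolding fmode_def by (intro continuous_intros)

lemma continuous_on_trig [continuous_intros]: "continuous_on S (trig N a)"
 unfolding trig_def by (intro continuous_intros)

lemma continuous_on_trig_comp [continuous_intros]:
 "continuous_on S f ==> continuous_on S (\<lambda>x. trig N a (f x))"
 by (rule continuous_on_compose2[OF continuous_on_trig[of UNIV]]) auto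

lemma norm_fmode: "norm (fmode k c t) = norm c"
proof -
 have "norm (fmode k c t) = sqrt ((cos (2 * pi * real_of_int k * t))^2 * (norm c)^2 + (sin (2 * pi * real_of_int k * t))^2 * (norm c)^2)"
  by (simp add: fmode_def norm_Pair power_mult_distrib)
 also have "... = sqrt ((norm c)^2)" by (simp flip: distrib_right)
 finally show ?thesis by simp
qed

lemma inner_fmode: "fmode k c t \<bullet> y = c \<bullet> (cos (2 * pi * real_of_int k * t) *\<^sub>R fst y + sin (2 * pi * real_of_int k * t) *\<^sub>R snd y)"
 by (cases y) (simp add: fmode_def inner_add_right)

lemma fcoef_integrable:
 fixes y :: "real => 'n::finite pt"
 assumes "continuous_on {0..1} y"
 shows "(\<lambda>t. cos (2 * pi * real_of_int k * t) *\<^sub>R fst (y t) + sin (2 * pi * real_of_int k * t) *\<^sub>R snd (y t)) integrable_on {0..1}"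
 by (intro integrable_continuous_interval continuous_intros assms)

lemma integral_fmode_inner:
 assumes y: "continuous_on {0..1} y"
 shows "integral {0..1} (\<lambda>t. fmode k c t \<bullet> y t) = c \<bullet> fcoef y k"
 unfolding inner_fmode fcoef_def
 using integral_component_eq integral_linear[OF fcoef_integrable[OF y, of k] bounded_linear_inner_right[of c]]
 by (simp add: o_def)

lemma integral_trig_inner:
 assumes y: "continuous_on {0..1} y"
 shows "integral {0..1} (\<lambda>t. trig N a t \<bullet> y t) = (\<Sum>k\<in>modes N. a k \<bullet> fcoef y k)"
proof -
 have "integral {0..1} (\<lambda>t. trig N a t \<bullet> y t) = integral {0..1} (\<lambda>t. \<Sum>k\<in>modes N. fmode k (a k) t \<bullet> y t)"
  by (simp add: trig_def inner_sum_left)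
 also have "... = (\<Sum>k\<in>modes N. integral {0..1} (\<lambda>t. fmode k (a k) t \<bullet> y t))"
  by (rule integral_sum) (auto intro!: integrable_continuous_interval continuous_intros y)
 finally show ?thesis by (simp add: integral_fmode_inner[OF y])
qed

lemma fcoef_fmode: "fcoef (fmode l d) k = (if k = l then d else 0)"
proof -
 have "fcoef (fmode l d) k = integral {0..1} (\<lambda>t. cos (2 * pi * real_of_int (k - l) * t) *\<^sub>R d)"
  unfolding fcoef_def fmode_def
  by (rule integral_cong) (simp add: cos_diff left_diff_distrib right_diff_distrib scaleR_add_left)
 also have "... = integral {0..1} (\<lambda>t. cos (2 * pi * real_of_int (k - l) * t)) *\<^sub>R d"
  using integral_linear[OF _ bounded_linear_scaleR_left[of d], of "\<lambda>t. cos (2 * pi * real_of_int (k - l) * t)" "{0..1}"]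
  by (simp add: o_def integrable_continuous_interval continuous_intros)
 finally show ?thesis by (simp only: integral_cos_int) simp
qed

lemma fcoef_add:
 assumes "continuous_on {0..1} y" "continuous_on {0..1} z"
 shows "fcoef (\<lambda>t. y t + z t) k = fcoef y k + fcoef z k"
 unfolding fcoef_def
 by (subst integral_add[OF fcoef_integrable[OF assms(1)] fcoef_integrable[OF assms(2)], symmetric])
   (rule integral_cong, simp add: algebra_simps)

lemma fcoef_diff:
 assumes "continuous_on {0..1} y" "continuous_on {0..1} z"
 shows "fcoef (\<lambda>t. y t - z t) k = fcoef y k - fcoef z k"
 unfolding fcoef_def
 by (subst integral_diff[OF fcoef_integrable[OF assms(1)] fcoef_integrable[OF assms(2)], symmetric])
   (rule integral_cong, simp add: algebra_simps)

lemma fcoef_sum: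
 assumes "finite I" "!!i. i \<in> I ==> continuous_on {0..1} (y i)"
 shows "fcoef (\<lambda>t. \<Sum>i\<in>I. y i t) k = (\<Sum>i\<in>I. fcoef (y i) k)"
 using assms
proof (induction I rule: finite_induct)
 case empty show ?case by (simp add: fcoef_def)
next
 case (insert i I)
 thus ?case by (simp add: fcoef_add continuous_on_sum)
qed

lemma fcoef_trig: "fcoef (trig N a) k = (if k \<in> modes N then a k else 0)"
proof -
 have "fcoef (trig N a) k = (\<Sum>l\<in>modes N. fcoef (fmode l (a l)) k)"
  unfolding trig_def[abs_def] by (rule fcoef_sum) (auto intro: continuous_intros)
 also have "... = (\<Sum>l\<in>modes N. if l = k then a l else 0)" by (rule sum.cong) (auto simp: fcoef_fmode)
 also have "... = (if k \<in> modes N then a k else 0)" by (simp add: sum.delta')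
 finally show ?thesis .
qed

lemma integral_trig_trig: "integral {0..1} (\<lambda>t. trig N a t \<bullet> trig N b t) = (\<Sum>k\<in>modes N. a k \<bullet> b k)"
 by (subst integral_trig_inner) (auto intro!: continuous_intros sum.cong simp: fcoef_trig)

lemma integral_trig_norm: "integral {0..1} (\<lambda>t. (norm (trig N a t))^2) = (\<Sum>k\<in>modes N. (norm (a k))^2)"
 using integral_trig_trig[of N a a] by (simp add: power2_norm_eq_inner)

lemma fcoef_bessel:
 assumes y: "continuous_on {0..1} y"
 shows "(\<Sum>k\<in>modes N. (norm (fcoef y k))^2) <= integral {0..1} (\<lambda>t. (norm (y t))^2)"
proof -
 let ?T = "trig N (fcoef y)"
 have "0 <= integral {0..1} (\<lambda>t. (norm (y t - ?T t))^2)"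
  by (rule integral_nonneg) (auto intro!: integrable_continuous_interval continuous_intros y)
 also have "... = integral {0..1} (\<lambda>t. (norm (y t))^2 + (norm (?T t))^2 - 2 * (?T t \<bullet> y t))"
  by (rule integral_cong) (simp add: power2_norm_eq_inner inner_diff_left inner_diff_right inner_commute)
 also have "... = integral {0..1} (\<lambda>t. (norm (y t))^2) + integral {0..1} (\<lambda>t. (norm (?T t))^2) - 2 * integral {0..1} (\<lambda>t. ?T t \<bullet> y t)"
  by (subst integral_diff integral_add integral_mult_right; (intro integrable_continuous_interval continuous_intros y)?)+ simp
 also have "integral {0..1} (\<lambda>t. ?T t \<bullet> y t) = (\<Sum>k\<in>modes N. (norm (fcoef y k))^2)"
  by (simp add: integral_trig_inner[OF y] power2_norm_eq_inner)
 finally show ?thesis by (simp add: integral_trig_norm)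
qed

lemma norm_fcoef_le:
 assumes y: "continuous_on {0..1} y"
 shows "norm (fcoef y k) <= integral {0..1} (\<lambda>t. norm (y t))"
proof (cases "fcoef y k = 0")
 case True
 thus ?thesis by (auto intro!: integral_nonneg integrable_continuous_interval continuous_intros y)
next
 case False
 let ?c = "fcoef y k"
 have "(norm ?c)^2 = integral {0..1} (\<lambda>t. fmode k ?c t \<bullet> y t)"
  by (simp add: integral_fmode_inner[OF y] power2_norm_eq_inner)
 also have "... <= integral {0..1} (\<lambda>t. norm ?c * norm (y t))"
  by (rule integral_le) (auto intro!: integrable_continuous_interval continuous_intros y 
    order_trans[OF norm_cauchy_schwarz] simp: norm_fmode)
 also have "... = norm ?c * integral {0..1} (\<lambda>t. norm (y t))" by simp
 finally show ?thesis using False by (simp add: power2_eq_square)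
qed

lemma fmode_has_vector_derivative:
 "(fmode k c has_vector_derivative J0 (fmode k ((2 * pi * real_of_int k) *\<^sub>R c) t)) (at t within S)"
proof -
 have "((\<lambda>t. (cos (2 * pi * real_of_int k * t) *\<^sub>R c, sin (2 * pi * real_of_int k * t) *\<^sub>R c)) has_vector_derivative
   ((- sin (2 * pi * real_of_int k * t) * (2 * pi * real_of_int k)) *\<^sub>R c, (cos (2 * pi * real_of_int k * t) * (2 * pi * real_of_int k)) *\<^sub>R c)) (at t within S)"
  by (intro has_vector_derivative_Pair)
    (auto intro!: derivative_eq_intros simp: has_real_derivative_iff_has_vector_derivative[symmetric])
 thus ?thesis by (simp add: fmode_def[abs_def] J0_def mult_ac)
qed

lemma J0_add: "J0 (x + y) = J0 x + J0 y" and J0_scaleR: "J0 (c *\<^sub>R x) = c *\<^sub>R J0 x"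
 and J0_minus: "J0 (- x) = - J0 x" and J0_diff: "J0 (x - y) = J0 x - J0 y" and J0_zero [simp]: "J0 0 = 0"
 by (simp_all add: J0_def prod_eq_iff)

lemma J0_J0 [simp]: "J0 (J0 x) = - x" by (simp add: J0_def prod_eq_iff)
lemma norm_J0 [simp]: "norm (J0 x) = norm x" by (cases x) (simp add: J0_def norm_Pair)
lemma inner_J0_J0 [simp]: "J0 x \<bullet> J0 y = x \<bullet> y" by (cases x; cases y) (simp add: J0_def)
lemma inner_J0_self [simp]: "J0 x \<bullet> x = 0" "x \<bullet> J0 x = 0" by (cases x; simp add: J0_def inner_commute)+
lemma omega0_eq: "omega0 u v = J0 u \<bullet> v" by (cases u; cases v) (simp add: J0_def omega0_def inner_commute)
lemma J0_sum: "J0 (sum f A) = (\<Sum>a\<in>A. J0 (f a))"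
 by (induction A rule: infinite_finite_induct) (auto simp: J0_add)
lemma linear_J0: "linear J0" by (rule linearI) (auto simp: J0_add J0_scaleR)
lemma bounded_linear_J0: "bounded_linear J0" using linear_J0 linear_conv_bounded_linear by blast

lemma trig_has_vector_derivative:
 "(trig N a has_vector_derivative J0 (trig N (\<lambda>k. (2 * pi * real_of_int k) *\<^sub>R a k) t)) (at t within S)"
 unfolding trig_def[abs_def] J0_sum by (rule has_vector_derivative_sum) (rule fmode_has_vector_derivative)

lemma cos_shift_int: "cos (2 * pi * real_of_int k * (t + 1)) = cos (2 * pi * real_of_int k * t)"
 and sin_shift_int: "sin (2 * pi * real_of_int k * (t + 1)) = sin (2 * pi * real_of_int k * t)"
 using sin_integer_2pi[of "real_of_int k"] cos_integer_2pi[of "real_of_int k"]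
 by (simp_all add: distrib_left cos_add sin_add mult_ac)

lemma trig_periodic: "trig N a (t + 1) = trig N a t"
 unfolding trig_def fmode_def by (simp add: cos_shift_int sin_shift_int)

lemma mirror_sum: "mirror (sum f A) = (\<Sum>a\<in>A. mirror (f a))"
 by (induction A rule: infinite_finite_induct) (auto simp: mirror_def prod_eq_iff)

lemma trig_mirror: "trig N a (- t) = mirror (trig N a t)"
 unfolding trig_def mirror_sum by (rule sum.cong) (auto simp: fmode_def mirror_def)

lemma trig_diff: "trig N (\<lambda>k. a k - b k) t = trig N a t - trig N b t"
 and trig_scaleR: "trig N (\<lambda>k. c *\<^sub>R a k) t = c *\<^sub>R trig N a t"
 by (simp_all add: trig_def fmode_def sum.distrib sum_subtractf scaleR_sum_right prod_eq_iff algebra_simps fst_sum snd_sum)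

lemma periodic_int:
 fixes z :: "real => 'a" assumes per: "!!t. z (t + 1) = z t"
 shows "z (t + of_int n) = z t"
proof (induction n rule: int_induct[where k = 0])
 case (step1 i)
 thus ?case using per[of "t + of_int i"] by (simp add: add.assoc)
next
 case (step2 i)
 thus ?case using per[of "t + of_int (i - 1)"] by (simp add: add.assoc)
qed simp

lemma integral_periodic_reflect:
 fixes f :: "real => 'a::euclidean_space"
 assumes f: "continuous_on UNIV f" and per: "!!t. f (t + 1) = f t"
 shows "integral {0..1} (\<lambda>r. f (s - r)) = integral {0..1} f"
proof -
 obtain P where P: "!!x. (P has_vector_derivative f x) (at x)" using continuous_antiderivative_UNIV[OF f] by blast
 have "((\<lambda>r. - P (s - r)) has_vector_derivative f (s - r)) (at r)" for r
 proof -
  have "((P \<circ> (\<lambda>r. s - r)) has_vector_derivative (-1) *\<^sub>R f (s - r)) (at r)"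
   by (rule vector_diff_chain_at) (auto intro!: derivative_eq_intros P)
  thus ?thesis by (auto intro!: derivative_eq_intros simp: o_def)
 qed
 hence "integral {0..1} (\<lambda>r. f (s - r)) = P s - P (s - 1)"
  by (subst integral_eq_antiderivative) auto
 also have "... = integral {s-1..s-1+1} f" by (subst integral_eq_antiderivative[OF P]) auto
 finally show ?thesis using integral_periodic_shift[OF f per, of "s - 1"] by simp
qed

lemma integral_periodic_odd:
 fixes f :: "real => 'a::euclidean_space"
 assumes f: "continuous_on UNIV f" and per: "!!t. f (t + 1) = f t" and odd: "!!t. f (-t) = - f t"
 shows "integral {0..1} f = 0"
proof -
 have "integral {0..1} f = - integral {0..1} f"
  using integral_periodic_reflect[OF f per, of 0] by (simp add: odd)
 thus ?thesis by (metis add.inverse_unique add_eq_0_iff scaleR_2 scaleR_eq_0_iff right_minus zero_neq_numeral)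
qed

lemma periodic_uniformly_continuous:
 fixes z :: "real => 'a::real_normed_vector"
 assumes z: "continuous_on UNIV z" and per: "!!t. z (t + 1) = z t" and "n > 0"
 obtains \<delta> where "0 < \<delta>" "\<delta> <= 1/2" "!!s r. \<bar>r\<bar> < \<delta> ==> norm (z (s - r) - z s) < n"
proof -
 have "uniformly_continuous_on {-1..2} z"
  by (rule compact_uniformly_continuous) (auto intro: continuous_on_subset[OF z])
 then obtain d where d: "d > 0" "!!x y. x \<in> {-1..2} ==> y \<in> {-1..2} ==> dist y x < d ==> dist (z y) (z x) < n"
  using \<open>n > 0\<close> unfolding uniformly_continuous_on_def by metis
 show ?thesis
 proof (rule that[of "min d (1/2)"])
  fix s r :: real assume r: "\<bar>r\<bar> < min d (1/2)"
  obtain x where x: "x = frac s" and "0 <= x" "x < 1" using frac_lt_1 frac_ge_0 by blast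
  have "dist (z (x - r)) (z x) < n" using r by (intro d(2)) (use \<open>0 <= x\<close> \<open>x < 1\<close> in \<open>auto simp: dist_real_def\<close>)
  hence "dist (z (frac s - r)) (z (frac s)) < n" by (simp add: x)
  moreover have "z (frac s - r) = z (s - r)" "z (frac s) = z s"
   using periodic_int[of z, OF per, of "frac s - r" "\<lfloor>s\<rfloor>"] periodic_int[of z, OF per, of "frac s" "\<lfloor>s\<rfloor>"]
   by (simp_all add: frac_def algebra_simps)
  ultimately show "norm (z (s - r) - z s) < n" by (simp add: dist_norm)
 qed (use d in auto)
qed

lemma periodic_bounded:
 fixes z :: "real => 'a::real_normed_vector"
 assumes z: "continuous_on UNIV z" and per: "!!t. z (t + 1) = z t"
 obtains B where "B >= 0" "!!t. norm (z t) <= B"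
proof -
 have "compact (z ` {0..1})" by (rule compact_continuous_image) (auto intro: continuous_on_subset[OF z])
 then obtain B where B: "!!t. t \<in> {0..1} ==> norm (z t) <= B" by (meson bounded_iff compact_imp_bounded imageI)
 have "norm (z t) <= B" for t
  using B[of "frac t"] periodic_int[of z, OF per, of "frac t" "\<lfloor>t\<rfloor>"] by (simp add: frac_def less_imp_le) 
    (metis frac_def frac_ge_0 frac_lt_1 less_imp_le diff_ge_0_iff_ge)
 thus ?thesis using that[of B] norm_ge_zero order_trans by blast
qed

section \<open>Approximate identities and convolution\<close>

text \<open>The kernel is the 2N-th power of cos (pi t): nonnegative, peaked at the integers, with N
  modes. The induction multiplies by (2 + exp (2 pi i t) + exp (- 2 pi i t)) / 4, whence the weights
  1/2, 1/4, 1/4 in \<open>K'\<close>.\<close>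

lemma cos_power_trig:
 "\<exists>K::int\<Rightarrow>real. (\<forall>k. K (-k) = K k) \<and> (\<forall>k. k \<notin> modes N --> K k = 0) \<and>
   (\<forall>t. ((1 + cos (2 * pi * t)) / 2) ^ N = (\<Sum>k\<in>modes N. K k * cos (2 * pi * real_of_int k * t)))"
proof (induction N)
 case 0
 show ?case by (rule exI[of _ "\<lambda>k. if k = 0 then 1 else 0"]) (auto simp: modes_def)
next
 case (Suc N)
 then obtain K :: "int => real" where k: "!!k. K (-k) = K k" "!!k. k \<notin> modes N ==> K k = 0"
   "!!t. ((1 + cos (2 * pi * t)) / 2) ^ N = (\<Sum>k\<in>modes N. K k * cos (2 * pi * real_of_int k * t))" by blast
 define K' where "K' k = K k / 2 + (K (k - 1) + K (k + 1)) / 4" for k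
 have sh: "(\<Sum>k\<in>modes (Suc N). K (k - d) * f k) = (\<Sum>k\<in>modes N. K k * f (k + d))" if "d \<in> {-1,0,1}" for d and f :: "int => real"
 proof -
  have "(\<Sum>k\<in>modes N. K k * f (k + d)) = (\<Sum>k\<in>(\<lambda>k. k + d) ` modes N. K (k - d) * f k)"
   by (subst sum.reindex) (auto simp: inj_on_def)
  also have "... = (\<Sum>k\<in>modes (Suc N). K (k - d) * f k)"
  proof (rule sum.mono_neutral_left)
   show "\<forall>i\<in>modes (Suc N) - (\<lambda>k. k + d) ` modes N. K (i - d) * f i = 0"
   proof
    fix i assume i: "i \<in> modes (Suc N) - (\<lambda>k. k + d) ` modes N"
    have "i - d \<notin> modes N" using i by (metis DiffD2 diff_add_cancel imageI)
    thus "K (i - d) * f i = 0" by (simp add: k)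
   qed
  qed (use that in \<open>auto simp: modes_def\<close>)
  finally show ?thesis by simp
 qed
 show ?case
 proof (intro exI[of _ K'] conjI allI impI)
  fix j :: int
  have a: "- j - 1 = - (j + 1)" "- j + 1 = - (j - 1)" by simp_all
  show "K' (- j) = K' j" unfolding K'_def a k(1) by (simp add: add.commute)
 next
  fix j assume "j \<notin> modes (Suc N)"
  hence "j \<notin> modes N" "j - 1 \<notin> modes N" "j + 1 \<notin> modes N" by (auto simp: modes_def)
  thus "K' j = 0" by (simp add: K'_def k)
 next
  fix t
  let ?c = "\<lambda>k. cos (2 * pi * real_of_int k * t)"
  have cc: "?c k * cos (2 * pi * t) = (?c (k + 1) + ?c (k - 1)) / 2" for k
   by (simp add: algebra_simps cos_add cos_diff)
  have "(\<Sum>k\<in>modes (Suc N). K' k * ?c k) = (\<Sum>k\<in>modes (Suc N). K (k - 0) * (?c k / 2)) + 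
    (\<Sum>k\<in>modes (Suc N). K (k - 1) * (?c k / 4)) + (\<Sum>k\<in>modes (Suc N). K (k - (-1)) * (?c k / 4))"
   unfolding sum.distrib[symmetric] by (rule sum.cong) (auto simp: K'_def field_simps)
  also have "... = (\<Sum>k\<in>modes N. K k * (?c k / 2) + K k * (?c (k + 1) / 4) + K k * (?c (k - 1) / 4))"
   by (simp only: sh insert_iff simp_thms sum.distrib[symmetric] add_0_right) simp
  also have "... = (\<Sum>k\<in>modes N. K k * ?c k * ((1 + cos (2 * pi * t)) / 2))"
  proof (rule sum.cong)
   fix k
   have "K k * ?c k * ((1 + cos (2 * pi * t)) / 2) = K k * ((?c k + ?c k * cos (2 * pi * t)) / 2)"
    by (simp add: algebra_simps)
   also have "... = K k * ((?c k + (?c (k + 1) + ?c (k - 1)) / 2) / 2)" by (simp only: cc)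
   finally show "K k * (?c k / 2) + K k * (?c (k + 1) / 4) + K k * (?c (k - 1) / 4) = K k * ?c k * ((1 + cos (2 * pi * t)) / 2)"
    by (simp only:) (simp add: field_simps)
  qed simp
  also have "... = (\<Sum>k\<in>modes N. K k * ?c k) * ((1 + cos (2 * pi * t)) / 2)"
   by (rule sum_distrib_right[symmetric])
  also have "... = ((1 + cos (2 * pi * t)) / 2) ^ Suc N" by (simp only: k(3)[symmetric] power_Suc2)
  finally show "((1 + cos (2 * pi * t)) / 2) ^ Suc N = (\<Sum>k\<in>modes (Suc N). K' k * ?c k)" by simp
 qed
qed

definition ckernel :: "nat => (int => real) => real => real" where
 "ckernel N \<kappa> t = (\<Sum>k\<in>modes N. \<kappa> k * cos (2 * pi * real_of_int k * t))"

lemma continuous_on_ckernel [continuous_intros]: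
 fixes f :: "'a::t2_space => real"
 shows
 "continuous_on S f ==> continuous_on S (\<lambda>x. ckernel N k (f x))"
 unfolding ckernel_def by (intro continuous_intros)

lemma ckernel_periodic: "ckernel N k (t + 1) = ckernel N k t"
 unfolding ckernel_def by (simp add: cos_shift_int)

lemma integral_ckernel: "integral {0..1} (ckernel N K) = K 0"
proof -
 have "integral {0..1} (ckernel N K) = (\<Sum>k\<in>modes N. integral {0..1} (\<lambda>t. K k * cos (2 * pi * real_of_int k * t)))"
  unfolding ckernel_def by (rule integral_sum) (auto intro!: integrable_continuous_interval continuous_intros)
 also have "... = (\<Sum>k\<in>modes N. if k = 0 then K k else 0)"
  by (rule sum.cong) (auto simp: integral_cos_int)
 also have "... = K 0" by (simp add: modes_def)
 finally show ?thesis .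
qed

text \<open>Outside (-b, b) the power is at most \<open>q ^ N\<close>, while the part with |t| <=
  b/2 already gives mass \<open>q' ^ N * b\<close> with q' > q. After division by the mass
  \<open>K 0\<close> the tail is at most \<open>(q / q') ^ N / b\<close>, which becomes
  small.\<close>

lemma approximate_identity:
 assumes d: "0 < b" "b <= 1/2" and e: "E > 0"
 obtains N K where "!!k. K (-k) = K k" "integral {-(1/2)..1/2} (ckernel N K) = 1" "!!t. ckernel N K t >= 0"
  "!!t. [|b <= \<bar>t\<bar>; \<bar>t\<bar> <= 1/2|] ==> ckernel N K t <= E"
proof -
 let ?g = "\<lambda>t. (1 + cos (2 * pi * t)) / 2"
 define q q' where "q = ?g b" and "q' = ?g (b/2)"
 have g0: "0 <= ?g t" for t
 proof -
  have "0 <= cos (2 * pi * t) - (-1)" by (simp only: diff_ge_0_iff_ge cos_ge_minus_one)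
  thus ?thesis by (simp add: add.commute)
 qed
 have "cos (2 * pi * b) < cos (2 * pi * (b/2))"
  using d by (intro cos_monotone_0_pi) auto
 hence qq: "0 <= q" "q < q'" "q' > 0" using g0[of b] by (auto simp: q_def q'_def)
 obtain N where N: "(q / q') ^ N < E * b"
  using real_arch_pow_inv[of "E * b" "q / q'"] qq d e by auto
 obtain K where k: "!!k. K (-k) = K k" "!!t. ?g t ^ N = ckernel N K t"
  using cos_power_trig[of N] unfolding ckernel_def by blast
 have I: "integral {-(1/2)..1/2} (ckernel N K') = K' 0" for K'
  using integral_periodic_shift[of "ckernel N K'" "-(1/2)"] ckernel_periodic[of N K'] integral_ckernel[of N K'] 
   continuous_on_ckernel[OF continuous_on_id, of UNIV N K'] by simp
 have low: "q' ^ N <= ckernel N K t" if "t \<in> {-(b/2)..b/2}" for t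
 proof -
  have "cos (2 * pi * (b/2)) <= cos (2 * pi * \<bar>t\<bar>)" using that d by (intro cos_monotone_0_pi_le) auto
  also have "... = cos (2 * pi * t)" by (cases "t >= 0") (auto simp: abs_if)
  finally have "q' <= ?g t" by (simp add: q'_def)
  thus ?thesis using qq by (simp flip: k(2) add: power_mono)
 qed
 have nn: "0 <= ckernel N K t" for t using g0[of t] by (simp flip: k(2))
 have "q' ^ N * b = integral {-(b/2)..b/2} (\<lambda>t. q' ^ N)" using d by simp
 also have "... <= integral {-(b/2)..b/2} (ckernel N K)"
  by (rule integral_le) (use low in \<open>auto intro!: integrable_continuous_interval continuous_intros continuous_on_ckernel[OF continuous_on_id]\<close>)
 also have "... <= integral {-(1/2)..1/2} (ckernel N K)"
  by (rule integral_subset_le) (use nn d in \<open>auto intro!: integrable_continuous_interval continuous_on_ckernel[OF continuous_on_id]\<close>)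
 finally have k0: "q' ^ N * b <= K 0" by (simp add: I)
 hence k0p: "K 0 > 0" using qq d by (meson order_less_le_trans zero_less_mult_iff zero_less_power)
 have sc: "ckernel N (\<lambda>k. K k / K 0) t = ckernel N K t / K 0" for t
  by (simp add: ckernel_def sum_divide_distrib)
 show ?thesis
 proof (rule that[of "\<lambda>k. K k / K 0" N])
  show "integral {-(1/2)..1/2} (ckernel N (\<lambda>k. K k / K 0)) = 1" using I k0p by simp
  fix t assume t: "b <= \<bar>t\<bar>" "\<bar>t\<bar> <= 1/2"
  have "cos (2 * pi * t) = cos (2 * pi * \<bar>t\<bar>)" by (cases "t >= 0") (auto simp: abs_if)
  also have "... <= cos (2 * pi * b)" using t d by (intro cos_monotone_0_pi_le) auto
  finally have "?g t <= q" by (simp add: q_def)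
  hence "ckernel N K t <= q ^ N" using g0[of t] by (simp flip: k(2) add: power_mono)
  also have "... = (q / q') ^ N * q' ^ N" using qq by (simp add: power_divide)
  also have "... <= E * b * q' ^ N" using N qq by (intro mult_right_mono) auto
  also have "... <= E * K 0" using k0 e by (simp add: mult_ac)
  finally show "ckernel N (\<lambda>k. K k / K 0) t <= E" using k0p by (simp add: sc field_simps)
 qed (use k nn k0p sc in auto)
qed

lemma ckernel_integral_bound:
 fixes f :: "real => 'a::euclidean_space"
 assumes K: "integral {-(1/2)..1/2} (ckernel N k) = 1" "!!t. ckernel N k t >= 0"
  "!!t. [|y <= \<bar>t\<bar>; \<bar>t\<bar> <= 1/2|] ==> ckernel N k t <= e"
  and c: "continuous_on UNIV f" and b: "!!r. \<bar>r\<bar> < y ==> norm (f r) <= n" "!!r. norm (f r) <= B"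
  and pos: "n >= 0" "B >= 0" "e >= 0"
 shows "norm (integral {-(1/2)..1/2} (\<lambda>r. ckernel N k r *\<^sub>R f r)) <= n + e * B"
proof -
 have "norm (integral {-(1/2)..1/2} (\<lambda>r. ckernel N k r *\<^sub>R f r)) <= integral {-(1/2)..1/2} (\<lambda>r. ckernel N k r * n + e * B)"
 proof (rule integral_norm_bound_integral)
  fix r :: real assume r: "r \<in> {-(1/2)..1/2}"
  show "norm (ckernel N k r *\<^sub>R f r) <= ckernel N k r * n + e * B"
  proof (cases "\<bar>r\<bar> < y")
   case True
   thus ?thesis using b(1) K(2) pos by (simp add: mult_left_mono add_increasing2)
  next
   case False
   hence "ckernel N k r * norm (f r) <= e * B" using K r b pos by (intro mult_mono) auto
   thus ?thesis using K(2)[of r] pos by (simp add: add_increasing)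
  qed
 qed (auto intro!: integrable_continuous_interval continuous_intros continuous_on_subset[OF c])
 also have "... = n + e * B"
  using K(1) by (subst integral_add) (auto intro!: integrable_continuous_interval continuous_intros)
 finally show ?thesis .
qed

text \<open>Here the kernel carries the variable s, which exhibits the convolution as a
  trigonometric polynomial. The form of \<open>convol_alt\<close> is an average of translates of z,
  which inherits the inequalities for increments.\<close>

definition convol :: "nat => (int => real) => (real => 'n::finite pt) => real => 'n pt" where
 "convol N \<kappa> z s = integral {0..1} (\<lambda>r. ckernel N \<kappa> (s - r) *\<^sub>R z r)"

lemma convol_alt:
 assumes z: "continuous_on UNIV z" and per: "!!t. z (t + 1) = z t"
 shows "convol N k z s = integral {-(1/2)..1/2} (\<lambda>r. ckernel N k r *\<^sub>R z (s - r))"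
proof -
 let ?f = "\<lambda>r. ckernel N k r *\<^sub>R z (s - r)"
 have zz: "continuous_on UNIV (\<lambda>r. z (s - r))"
  by (rule continuous_on_compose2[OF z]) (auto intro!: continuous_intros)
 have c: "continuous_on UNIV ?f" by (intro continuous_intros zz)
 have p: "?f (t + 1) = ?f t" for t
 proof -
  have "z (s - (t + 1)) = z (s - t)" using per[of "s - t - 1"] by (simp add: algebra_simps)
  thus ?thesis by (simp only: ckernel_periodic)
 qed
 have "convol N k z s = integral {0..1} (\<lambda>r. ?f (s - r))" by (simp add: convol_def)
 also have "... = integral {-(1/2)..-(1/2)+1} ?f"
  using integral_periodic_reflect[OF c p, of s] integral_periodic_shift[OF c p, of "-(1/2)"] by simp
 finally show ?thesis by simp
qed

lemma convol_approx:
 assumes K: "integral {-(1/2)..1/2} (ckernel N k) = 1" "!!t. ckernel N k t >= 0"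
  "!!t. [|c <= \<bar>t\<bar>; \<bar>t\<bar> <= 1/2|] ==> ckernel N k t <= E" and e: "E >= 0" "\<eta> >= 0"
  and z: "continuous_on UNIV z" and per: "!!t. z (t + 1) = z t"
  and b: "!!r. \<bar>r\<bar> < c ==> norm (z (s - r) - z s) <= \<eta>" "!!r. norm (z r) <= B"
 shows "norm (convol N k z s - z s) <= \<eta> + E * (2 * B)"
proof -
 have zz: "continuous_on UNIV (\<lambda>r. z (s - r))"
  by (rule continuous_on_compose2[OF z]) (auto intro!: continuous_intros)
 have B: "B >= 0" using b(2)[of 0] norm_ge_zero order_trans by blast
 have "integral {-(1/2)..1/2} (\<lambda>r. ckernel N k r *\<^sub>R (z (s - r) - z s)) = 
   convol N k z s - integral {-(1/2)..1/2} (\<lambda>r. ckernel N k r *\<^sub>R z s)"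
  unfolding convol_alt[OF z per] scaleR_diff_right
  by (rule integral_diff) (auto intro!: integrable_continuous_interval continuous_intros continuous_on_subset[OF zz])
 also have "integral {-(1/2)..1/2} (\<lambda>r. ckernel N k r *\<^sub>R z s) = z s"
  using integral_linear[OF _ bounded_linear_scaleR_left[of "z s"], of "ckernel N k" "{-(1/2)..1/2}"] K(1)
  by (simp add: o_def integrable_continuous_interval continuous_on_ckernel[OF continuous_on_id])
 finally have eq: "convol N k z s - z s = integral {-(1/2)..1/2} (\<lambda>r. ckernel N k r *\<^sub>R (z (s - r) - z s))" by simp
 have 2: "norm (z (s - r) - z s) <= 2 * B" for r
  using norm_triangle_ineq4[of "z (s - r)" "z s"] b(2)[of "s - r"] b(2)[of s] by linarith
 show ?thesis unfolding eq
  by (rule ckernel_integral_bound[OF K _ b(1) 2]) (use e B in \<open>auto intro!: continuous_intros zz\<close>)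
qed

text \<open>By symmetry fst z is even and snd z is odd, so the mixed integrals vanish. The weights
  are even in k, and the terms for k and -k combine into modes with real coefficients.\<close>

lemma convol_trig:
 assumes z: "continuous_on UNIV z" and per: "!!t. z (t + 1) = z t" and mir: "!!t. z (- t) = mirror (z t)"
  and K: "!!k. K (-k) = K k"
 shows "convol N K z s = trig N (\<lambda>k. K k *\<^sub>R fcoef z k) s"
proof -
 have fz: "continuous_on S (\<lambda>t. fst (z t))" and sz: "continuous_on S (\<lambda>t. snd (z t))" for S
  using continuous_on_subset[OF z] by (auto intro!: continuous_intros)
 have zS: "continuous_on S z" for S using continuous_on_subset[OF z] by auto
 let ?C = "\<lambda>k. integral {0..1} (\<lambda>t. cos (2 * pi * real_of_int k * t) *\<^sub>R fst (z t))"
 let ?S = "\<lambda>k. integral {0..1} (\<lambda>t. sin (2 * pi * real_of_int k * t) *\<^sub>R snd (z t))"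
 have mf: "fst (z (-t)) = fst (z t)" "snd (z (-t)) = - snd (z t)" for t by (simp_all add: mir mirror_def)
 have o1: "integral {0..1} (\<lambda>t. sin (2 * pi * real_of_int k * t) *\<^sub>R fst (z t)) = 0" for k
  by (rule integral_periodic_odd) (auto intro!: continuous_intros fz simp: sin_shift_int per mf)
 have o2: "integral {0..1} (\<lambda>t. cos (2 * pi * real_of_int k * t) *\<^sub>R snd (z t)) = 0" for k
  by (rule integral_periodic_odd) (auto intro!: continuous_intros sz simp: cos_shift_int per mf)
 have fc: "fcoef z k = ?C k + ?S k" for k
  unfolding fcoef_def by (rule integral_add) (auto intro!: integrable_continuous_interval continuous_intros fz sz)
 have Cm: "?C (-k) = ?C k" "?S (-k) = - ?S k" for k by simp_all
 define I where "I k = integral {0..1} (\<lambda>r. cos (2 * pi * real_of_int k * (s - r)) *\<^sub>R z r)" for k :: int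
 have lin: "integral {0..1} (\<lambda>r. c *\<^sub>R g r + d *\<^sub>R h r) = c *\<^sub>R integral {0..1} g + d *\<^sub>R integral {0..1} h"
  if "continuous_on {0..1} g" "continuous_on {0..1} h" for c d :: real and g h :: "real => real^'a"
  by (subst integral_add) (use that in \<open>auto intro!: integrable_continuous_interval continuous_intros\<close>)
 have I: "I k = (1/2) *\<^sub>R (fmode k (fcoef z k) s + fmode (-k) (fcoef z (-k)) s)" for k
 proof (rule prod_eqI)
  have int: "(\<lambda>r. cos (2 * pi * real_of_int k * (s - r)) *\<^sub>R z r) integrable_on {0..1}"
   by (intro integrable_continuous_interval continuous_intros zS)
  have "fst (I k) = integral {0..1} (\<lambda>r. cos (2 * pi * real_of_int k * (s - r)) *\<^sub>R fst (z r))"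
   unfolding I_def using integral_linear[OF int bounded_linear_fst] by (simp add: o_def)
  also have "... = integral {0..1} (\<lambda>r. cos (2 * pi * real_of_int k * s) *\<^sub>R (cos (2 * pi * real_of_int k * r) *\<^sub>R fst (z r))
    + sin (2 * pi * real_of_int k * s) *\<^sub>R (sin (2 * pi * real_of_int k * r) *\<^sub>R fst (z r)))"
   by (rule integral_cong) (simp add: right_diff_distrib cos_diff scaleR_add_left)
  also have "... = cos (2 * pi * real_of_int k * s) *\<^sub>R ?C k"
   by (subst lin) (auto intro!: continuous_intros fz simp: o1)
  finally show "fst (I k) = fst ((1/2) *\<^sub>R (fmode k (fcoef z k) s + fmode (-k) (fcoef z (-k)) s))"
   by (simp add: fc fmode_def vec_eq_iff field_simps)
  have "snd (I k) = integral {0..1} (\<lambda>r. cos (2 * pi * real_of_int k * (s - r)) *\<^sub>R snd (z r))"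
   unfolding I_def using integral_linear[OF int bounded_linear_snd] by (simp add: o_def)
  also have "... = integral {0..1} (\<lambda>r. cos (2 * pi * real_of_int k * s) *\<^sub>R (cos (2 * pi * real_of_int k * r) *\<^sub>R snd (z r))
    + sin (2 * pi * real_of_int k * s) *\<^sub>R (sin (2 * pi * real_of_int k * r) *\<^sub>R snd (z r)))"
   by (rule integral_cong) (simp add: right_diff_distrib cos_diff scaleR_add_left)
  also have "... = sin (2 * pi * real_of_int k * s) *\<^sub>R ?S k"
   by (subst lin) (auto intro!: continuous_intros sz simp: o2)
  finally show "snd (I k) = snd ((1/2) *\<^sub>R (fmode k (fcoef z k) s + fmode (-k) (fcoef z (-k)) s))"
   by (simp add: fc fmode_def vec_eq_iff field_simps)
 qed
 have "convol N K z s = integral {0..1} (\<lambda>r. \<Sum>k\<in>modes N. K k *\<^sub>R (cos (2 * pi * real_of_int k * (s - r)) *\<^sub>R z r))"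
  unfolding convol_def ckernel_def by (simp add: scaleR_sum_left)
 also have "... = (\<Sum>k\<in>modes N. integral {0..1} (\<lambda>r. K k *\<^sub>R (cos (2 * pi * real_of_int k * (s - r)) *\<^sub>R z r)))"
  by (rule integral_sum) (auto intro!: integrable_continuous_interval continuous_intros zS)
 also have "... = (\<Sum>k\<in>modes N. K k *\<^sub>R I k)"
  unfolding I_def by (simp only: integral_cmul)
 also have "... = (\<Sum>k\<in>modes N. (1/2) *\<^sub>R (K k *\<^sub>R fmode k (fcoef z k) s)) + (\<Sum>k\<in>modes N. (1/2) *\<^sub>R (K k *\<^sub>R fmode (-k) (fcoef z (-k)) s))"
  by (simp add: I scaleR_add_right sum.distrib mult.commute)
 also have "(\<Sum>k\<in>modes N. (1/2) *\<^sub>R (K k *\<^sub>R fmode (-k) (fcoef z (-k)) s)) = (\<Sum>k\<in>modes N. (1/2) *\<^sub>R (K k *\<^sub>R fmode k (fcoef z k) s))"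
  by (rule sum.reindex_bij_witness[of _ uminus uminus]) (auto simp: modes_def K)
 also have "(\<Sum>k\<in>modes N. (1/2) *\<^sub>R (K k *\<^sub>R fmode k (fcoef z k) s)) + (\<Sum>k\<in>modes N. (1/2) *\<^sub>R (K k *\<^sub>R fmode k (fcoef z k) s))
   = (\<Sum>k\<in>modes N. K k *\<^sub>R fmode k (fcoef z k) s)"
  unfolding sum.distrib[symmetric] by (rule sum.cong) (auto simp flip: scaleR_add_left)
 finally show ?thesis by (simp add: trig_def fmode_def mult_ac)
qed

text \<open>Convolution with an approximate identity approximates w, and it is constant because only
  the mode 0 survives, with weight \<open>K 0 = 1\<close>.\<close>

lemma fourier_uniqueness:
 assumes w: "continuous_on UNIV w" and per: "!!t. w (t + 1) = w t" and mir: "!!t. w (- t) = mirror (w t)"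
  and zero: "!!k. k ~= 0 ==> fcoef w k = 0"
 shows "w s = (fcoef w 0, 0)"
proof -
 obtain B where B: "B >= 0" "!!t. norm (w t) <= B" using periodic_bounded[OF w per] by blast
 have * : "norm ((fcoef w 0, 0) - w s) <= e" if epos: "e > 0" for e
 proof -
  obtain \<delta> where d: "0 < \<delta>" "\<delta> <= 1/2" "!!s r. \<bar>r\<bar> < \<delta> ==> norm (w (s - r) - w s) < e/2"
   by (rule periodic_uniformly_continuous[OF w per, of "e/2"]) (use epos in auto)
  define \<epsilon> where "\<epsilon> = e / (4 * (B + 1))"
  have e: "\<epsilon> > 0" "\<epsilon> * (2 * B) <= e/2" using B \<open>e > 0\<close> by (auto simp: \<epsilon>_def field_simps)
  obtain N K where k: "!!k. K (-k) = K k" "integral {-(1/2)..1/2} (ckernel N K) = 1" "!!t. ckernel N K t >= 0"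
   "!!t. [|\<delta> <= \<bar>t\<bar>; \<bar>t\<bar> <= 1/2|] ==> ckernel N K t <= \<epsilon>" using approximate_identity[OF d(1,2) e(1)] by metis
  have "norm (convol N K w s - w s) <= e/2 + \<epsilon> * (2 * B)"
   by (rule convol_approx[OF k(2,3,4) _ _ w per _ B(2)]) (use e d epos in \<open>auto intro: less_imp_le\<close>)
  also have "convol N K w s = (fcoef w 0, 0)"
  proof -
   have ct: "convol N K w s = trig N (\<lambda>k. K k *\<^sub>R fcoef w k) s"
    by (rule convol_trig) (use w per mir k in auto)
   have k0: "K 0 = 1"
    using integral_periodic_shift[of "ckernel N K" "-(1/2)"] ckernel_periodic[of N K] integral_ckernel[of N K] 
     continuous_on_ckernel[OF continuous_on_id, of UNIV N K] k(2) by simp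
   have "convol N K w s = (\<Sum>k\<in>modes N. if k = 0 then (fcoef w 0, 0) else 0)"
    unfolding ct trig_def
    by (rule sum.cong) (auto simp: zero fmode_def k0 zero_prod_def)
   thus ?thesis by (simp add: modes_def)
  qed
  finally show ?thesis using e by linarith
 qed
 have "norm ((fcoef w 0, 0) - w s) <= 0"
 proof (rule field_le_epsilon)
  fix e :: real assume "e > 0"
  show "norm ((fcoef w 0, 0) - w s) <= 0 + e" unfolding add_0 by (rule *[OF \<open>e > 0\<close>])
 qed
 thus ?thesis by simp
qed

section \<open>Linking and brake orbits\<close>

text \<open>The functional contains minus the integral of h, so a lower quadratic bound on h is the
  side that bounds the functional from above after a descent step.\<close>

locale semiconvex_hamiltonian =
 fixes h :: "'n::finite pt => real" and dh :: "'n pt => 'n pt" and L :: real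
 assumes h_cont: "continuous_on UNIV h" and dh_cont: "continuous_on UNIV dh" and L_nonneg: "L >= 0"
  and semiconvex: "!!p q. h (p + q) >= h p + dh p \<bullet> q - L * (norm q)^2"
begin

lemma h_comp [continuous_intros]: "continuous_on S f ==> continuous_on S (\<lambda>x. h (f x))"
 and dh_comp [continuous_intros]: "continuous_on S f ==> continuous_on S (\<lambda>x. dh (f x))"
 using continuous_on_compose2[OF h_cont] continuous_on_compose2[OF dh_cont] by auto

text \<open>Half the integral of <- J x', x> in Fourier coordinates: applying - J d/dt to a
  trigonometric polynomial multiplies its k-th coefficient by 2 pi k.\<close>

definition Act :: "nat => (int => real^'n) => real" where
 "Act N a = pi * (\<Sum>k\<in>modes N. real_of_int k * (norm (a k))^2)"

definition Phi :: "nat => (int => real^'n) => real" where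
 "Phi N a = Act N a - integral {0..1} (\<lambda>t. h (trig N a t))"

text \<open>The L2 gradient of \<open>Phi\<close> in the coefficient space.\<close>

definition Grad :: "nat => (int => real^'n) => int => real^'n" where
 "Grad N a k = (2 * pi * real_of_int k) *\<^sub>R a k - fcoef (\<lambda>t. dh (trig N a t)) k"

definition Gsq :: "nat => (int => real^'n) => real" where
 "Gsq N a = (\<Sum>k\<in>modes N. (norm (Grad N a k))^2)"

lemma Gsq_nonneg: "Gsq N a >= 0" by (simp add: Gsq_def sum_nonneg)

text \<open>The action is expanded exactly, its second-order term being at most pi N times the
  squared gradient; semiconvexity bounds the integral of h with second-order term L. The first-order
  terms add up to \<open>- s * Gsq N a\<close>.\<close>

lemma descent:
 assumes s: "s >= 0"
 shows "Phi N (\<lambda>k. a k - s *\<^sub>R Grad N a k) <= Phi N a - s * Gsq N a + s^2 * (pi * N + L) * Gsq N a"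
proof -
 let ?G = "Grad N a" and ?c = "fcoef (\<lambda>t. dh (trig N a t))"
 let ?x = "trig N a" and ?g = "trig N ?G"
 have cdh: "continuous_on {0..1} (\<lambda>t. dh (?x t))" by (intro continuous_intros)
 have x: "trig N (\<lambda>k. a k - s *\<^sub>R ?G k) t = ?x t - s *\<^sub>R ?g t" for t by (simp add: trig_diff trig_scaleR)
 have "integral {0..1} (\<lambda>t. h (?x t)) - s * (\<Sum>k\<in>modes N. ?G k \<bullet> ?c k) - L * s^2 * Gsq N a
   = integral {0..1} (\<lambda>t. h (?x t)) - integral {0..1} (\<lambda>t. s * (?g t \<bullet> dh (?x t))) - integral {0..1} (\<lambda>t. (L * s^2) * (norm (?g t))^2)"
  by (simp only: integral_mult_right integral_trig_inner[OF cdh] integral_trig_norm Gsq_def)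
 also have "... = integral {0..1} (\<lambda>t. h (?x t) - s * (?g t \<bullet> dh (?x t)) - (L * s^2) * (norm (?g t))^2)"
  by (simp only: integral_diff[symmetric] integrable_continuous_interval continuous_intros integrable_diff)
 also have "... <= integral {0..1} (\<lambda>t. h (trig N (\<lambda>k. a k - s *\<^sub>R ?G k) t))"
 proof (rule integral_le)
  fix t :: real
  have "h (?x t + (- s) *\<^sub>R ?g t) >= h (?x t) + dh (?x t) \<bullet> ((- s) *\<^sub>R ?g t) - L * (norm ((- s) *\<^sub>R ?g t))^2"
   by (rule semiconvex)
  thus "h (?x t) - s * (?g t \<bullet> dh (?x t)) - (L * s^2) * (norm (?g t))^2 <= h (trig N (\<lambda>k. a k - s *\<^sub>R ?G k) t)"
   by (simp add: x power_mult_distrib inner_commute mult_ac)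
 qed (intro integrable_continuous_interval continuous_intros)+
 finally have H: "integral {0..1} (\<lambda>t. h (?x t)) - s * (\<Sum>k\<in>modes N. ?G k \<bullet> ?c k) - L * s^2 * Gsq N a
   <= integral {0..1} (\<lambda>t. h (trig N (\<lambda>k. a k - s *\<^sub>R ?G k) t))" .
 have nn: "(norm (a k - s *\<^sub>R ?G k))^2 = (norm (a k))^2 - 2 * s * (a k \<bullet> ?G k) + s^2 * (norm (?G k))^2" for k
  by (simp add: power2_norm_eq_inner inner_diff_left inner_diff_right inner_commute power2_eq_square[of s] algebra_simps)
 have "Act N (\<lambda>k. a k - s *\<^sub>R ?G k) = (\<Sum>k\<in>modes N. pi * (real_of_int k * (norm (a k))^2) - s * (((2 * pi * real_of_int k) *\<^sub>R a k) \<bullet> ?G k) + s^2 * (pi * real_of_int k * (norm (?G k))^2))"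
  unfolding Act_def sum_distrib_left
  by (rule sum.cong) (simp_all add: nn algebra_simps)
 also have "... <= (\<Sum>k\<in>modes N. pi * (real_of_int k * (norm (a k))^2) - s * (((2 * pi * real_of_int k) *\<^sub>R a k) \<bullet> ?G k) + s^2 * (pi * real N * (norm (?G k))^2))"
  by (rule sum_mono) (auto simp: modes_def intro!: mult_left_mono mult_right_mono)
 also have "... = Act N a - s * (\<Sum>k\<in>modes N. ((2 * pi * real_of_int k) *\<^sub>R a k) \<bullet> ?G k) + s^2 * (pi * N) * Gsq N a"
  unfolding Act_def Gsq_def sum_distrib_left sum.distrib[symmetric] sum_subtractf[symmetric]
  by (rule sum.cong) (simp_all add: algebra_simps)
 finally have A: "Act N (\<lambda>k. a k - s *\<^sub>R ?G k) <= Act N a - s * (\<Sum>k\<in>modes N. ((2 * pi * real_of_int k) *\<^sub>R a k) \<bullet> ?G k) + s^2 * (pi * N) * Gsq N a" .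
 have "(\<Sum>k\<in>modes N. ((2 * pi * real_of_int k) *\<^sub>R a k) \<bullet> ?G k) - (\<Sum>k\<in>modes N. ?G k \<bullet> ?c k) = Gsq N a"
  unfolding Gsq_def sum_subtractf[symmetric]
  by (rule sum.cong) (simp_all add: Grad_def power2_norm_eq_inner inner_diff_left inner_diff_right inner_commute)
 hence "s * (\<Sum>k\<in>modes N. ((2 * pi * real_of_int k) *\<^sub>R a k) \<bullet> ?G k) - s * (\<Sum>k\<in>modes N. ?G k \<bullet> ?c k) = s * Gsq N a"
  by (simp flip: right_diff_distrib)
 thus ?thesis using A H unfolding Phi_def by (simp add: algebra_simps)
qed

lemma continuous_on_coordinate: "continuous_on S (\<lambda>a::int => real^'n. a k)"
 by (rule continuous_on_subset[OF continuous_on_product_coordinates]) simp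

lemma continuous_on_trig_joint: "continuous_on (UNIV \<times> {0..1}) (\<lambda>(a :: int => real^'n, t). trig N a t)"
proof -
 have c: "continuous_on S (\<lambda>z::(int => real^'n) \<times> real. fst z k)" for S k
  by (rule continuous_on_compose2[OF continuous_on_coordinate[of UNIV]]) (auto intro: continuous_intros)
 show ?thesis unfolding trig_def fmode_def case_prod_unfold by (intro continuous_intros c)
qed

lemma continuous_on_Phi: "continuous_on UNIV (Phi N)"
proof -
 have "continuous_on (UNIV \<times> cbox 0 1) (\<lambda>(a, t). h (trig N a t))"
  using h_comp[OF continuous_on_trig_joint[of N]] by (simp add: case_prod_unfold)
 hence "continuous_on UNIV (\<lambda>a. integral (cbox 0 1) (\<lambda>t. h (trig N a t)))"
  by (rule integral_continuous_on_param)
 thus ?thesis unfolding Phi_def[abs_def] Act_def by (intro continuous_intros continuous_on_coordinate) simp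
qed

lemma continuous_on_Grad: "continuous_on UNIV (\<lambda>a. Grad N a k)"
proof -
 have c: "continuous_on (UNIV \<times> cbox 0 1) (\<lambda>z. dh (trig N (fst z) (snd z)))"
  using dh_comp[OF continuous_on_trig_joint[of N]] by (simp add: case_prod_unfold)
 have "continuous_on (UNIV \<times> cbox 0 1) (\<lambda>(a, t). cos (2 * pi * real_of_int k * t) *\<^sub>R fst (dh (trig N a t)) + sin (2 * pi * real_of_int k * t) *\<^sub>R snd (dh (trig N a t)))"
  unfolding case_prod_unfold by (intro continuous_intros c)
 hence "continuous_on UNIV (\<lambda>a. integral (cbox 0 1) (\<lambda>t. cos (2 * pi * real_of_int k * t) *\<^sub>R fst (dh (trig N a t)) + sin (2 * pi * real_of_int k * t) *\<^sub>R snd (dh (trig N a t))))"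
  by (rule integral_continuous_on_param)
 thus ?thesis unfolding Grad_def fcoef_def by (intro continuous_intros continuous_on_coordinate) simp
qed

lemma modes_split: "modes N = {- int N..0} \<union> {1..int N}" "{- int N..0} \<inter> {1..int N} = {}"
 by (auto simp: modes_def)

lemma Phi_le_Act: assumes "!!p. h p >= 0" shows "Phi N a <= Act N a"
proof -
 have "integral {0..1} (\<lambda>t. h (trig N a t)) >= 0"
  by (rule integral_nonneg) (auto intro!: integrable_continuous_interval continuous_intros assms)
 thus ?thesis by (simp add: Phi_def)
qed

lemma Act_le: "Act N a <= pi * (\<Sum>k\<in>{1..int N}. real_of_int k * (norm (a k))^2)"
proof -
 have "(\<Sum>k\<in>modes N. real_of_int k * (norm (a k))^2) = (\<Sum>k\<in>{-int N..0}. real_of_int k * (norm (a k))^2) + (\<Sum>k\<in>{1..int N}. real_of_int k * (norm (a k))^2)"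
  unfolding modes_split(1) by (rule sum.union_disjoint) auto
 moreover have "(\<Sum>k\<in>{-int N..0}. real_of_int k * (norm (a k))^2) <= 0"
  by (rule sum_nonpos) (auto intro: mult_nonpos_nonneg)
 ultimately show ?thesis unfolding Act_def by (intro mult_left_mono) auto
qed

text \<open>Discrete gradient descent, frozen where the functional is nonpositive, cannot unlink the half space
  spanned by the nonpositive modes and \<open>e\<close> from the sphere in the positive modes.\<close>

lemma linking_almost_critical:
 fixes e :: "int => real^'n"
 assumes h0: "!!p. h p >= 0"
  and e: "(\<Sum>k\<in>{1..int N}. real_of_int k * (norm (e k))^2) = 1"
  and \<beta>: "\<beta> > 0" and \<rho>: "\<rho> > 0" and y: "y > 0"
  and sphere: "!!a. [|\<And>k. k \<in> {-int N..0} ==> a k = 0; (\<Sum>k\<in>{1..int N}. real_of_int k * (norm (a k))^2) = \<rho>^2|] ==> Phi N a >= \<beta>"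
  and far: "!!a s. [|s >= 0; \<And>k. k \<in> {1..int N} ==> a k = s *\<^sub>R e k; s\<^sup>2 + (\<Sum>k\<in>{-int N..0}. (norm (a k))^2) >= R^2|] ==> Phi N a <= 0"
 shows "\<exists>a. Phi N a >= \<beta> \<and> Gsq N a <= y"
proof (rule ccontr)
 assume "\<not> ?thesis"
 hence neg: "Gsq N a > y" if "Phi N a >= \<beta>" for a using that by force
 \<comment> \<open>With \<sigma> (pi N + L) <= 1/2 the quadratic error consumes at most half of the
   first-order decrease.\<close>
 define \<sigma> where "\<sigma> = 1 / (2 * (pi * N + L + 1))"
 have gen: "0 < 1 / (2 * (x + 1)) \<and> 1 / (2 * (x + 1)) * x <= 1/2" if "x >= 0" for x :: real
  using that by (auto simp: divide_simps)
 have "pi * N + L >= 0" using L_nonneg by simp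
 from gen[OF this] have \<sigma>: "\<sigma> > 0" "\<sigma> * (pi * N + L) <= 1/2" unfolding \<sigma>_def by simp_all
 \<comment> \<open>The cutoff freezes the points with \<open>Phi <= 0\<close> and lets points with
   \<open>Phi >= \<beta>\<close> move with full step size.\<close>
 define t where "t u = max 0 (min 1 (u / \<beta>))" for u :: real
 define step where "step a k = a k - (\<sigma> * t (Phi N a)) *\<^sub>R Grad N a k" for a k
 have step1: "Phi N (step a) <= Phi N a - \<sigma> * t (Phi N a) / 2 * Gsq N a" for a
 proof -
  define \<tau> where "\<tau> = \<sigma> * t (Phi N a)"
  have \<tau>: "\<tau> >= 0" "\<tau> <= \<sigma>" using \<sigma> by (auto simp: \<tau>_def t_def mult_left_le)
  have "\<tau> * (pi * N + L) <= \<sigma> * (pi * N + L)" using \<tau> L_nonneg by (intro mult_right_mono) auto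
  hence "\<tau> * (\<tau> * (pi * N + L)) <= \<tau> * (1/2)" using \<sigma> \<tau> by (intro mult_left_mono) auto
  hence "\<tau>^2 * (pi * N + L) * Gsq N a <= \<tau> * (1/2) * Gsq N a"
   using Gsq_nonneg by (intro mult_right_mono) (auto simp: power2_eq_square mult_ac)
  moreover have "Phi N (step a) <= Phi N a - \<tau> * Gsq N a + \<tau>^2 * (pi * N + L) * Gsq N a"
   unfolding step_def[abs_def] \<tau>_def[symmetric] by (rule descent[OF \<tau>(1)])
  ultimately show ?thesis unfolding \<tau>_def[symmetric] by (simp add: algebra_simps)
 qed
 have chi0: "t u >= 0" for u by (simp add: t_def)
 have step_le: "Phi N (step a) <= Phi N a" for a
  using step1[of a] mult_nonneg_nonneg[OF mult_nonneg_nonneg[OF less_imp_le[OF \<sigma>(1)] chi0[of "Phi N a"]] Gsq_nonneg[of N a]] by simp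
 define c where "c = \<sigma> * y / 2"
 have c: "c > 0" using \<sigma> y by (simp add: c_def)
 have step_dec: "Phi N (step a) <= Phi N a - c" if "Phi N a >= \<beta>" for a
 proof -
  have "t (Phi N a) = 1" using that \<beta> by (simp add: t_def)
  moreover have "\<sigma> * 1 / 2 * y <= \<sigma> * 1 / 2 * Gsq N a"
   using neg[OF that] \<sigma> by (intro mult_left_mono) auto
  ultimately show ?thesis using step1[of a] unfolding c_def by simp
 qed
 have step_fix: "step a = a" if "Phi N a <= 0" for a
 proof -
  have "t (Phi N a) = 0" using that \<beta> by (simp add: t_def divide_nonpos_pos)
  thus ?thesis by (simp add: step_def[abs_def])
 qed
 have iter_fix: "(step ^^ m) a = a" if "Phi N a <= 0" for a m
  by (induction m) (simp_all add: step_fix that)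
 have iter: "Phi N ((step ^^ m) a) < \<beta> \<or> Phi N ((step ^^ m) a) <= Phi N a - real m * c" for m a
 proof (induction m)
  case (Suc m)
  show ?case
  proof (cases "Phi N ((step ^^ m) a) < \<beta>")
   case True
   thus ?thesis using step_le[of "(step ^^ m) a"] by simp
  next
   case False
   with Suc step_dec[of "(step ^^ m) a"] show ?thesis by (simp add: algebra_simps)
  qed
 qed simp
 \<comment> \<open>All starting values will be at most pi R^2 and each step above \<beta> costs c,
   so m steps bring every point below \<beta>.\<close>
 obtain m where m: "real m * c > pi * R^2" using reals_Archimedean3[OF c] by blast
 have cstep: "continuous_on UNIV step"
 proof (rule continuous_on_coordinatewise_then_product)
  show "continuous_on UNIV (\<lambda>a. step a k)" for k
   unfolding step_def t_def
   by (intro continuous_intros continuous_on_coordinate continuous_on_Phi continuous_on_Grad) (use \<beta> in auto)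
 qed
 have citer: "continuous_on UNIV (step ^^ m)"
 proof (induction m)
  case (Suc m)
  thus ?case using continuous_on_compose2[OF cstep Suc] by (simp add: o_def)
 qed (simp add: continuous_on_id)
 \<comment> \<open>Coordinates on the half space, extended to a full vector space:
   \<open>None\<close> is the coordinate along e and is cut off at 0. A negative value lands in the
   nonpositive modes, where \<open>Phi <= 0\<close> and nothing moves.\<close>
 define emb where "emb w k = (if k > 0 then max 0 (w None) *\<^sub>R e k else (\<chi> i. w (Some (k, i))))" 
  for w :: "(int \<times> 'n) option => real" and k
 have cw: "continuous_on UNIV (\<lambda>w::(int \<times> 'n) option => real. w j)" for j
  by (rule continuous_on_product_coordinates)
 have cemb: "continuous_on UNIV emb"
 proof (rule continuous_on_coordinatewise_then_product)
  show "continuous_on UNIV (\<lambda>w. emb w k)" for k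
   unfolding emb_def by (cases "k > 0") (auto intro!: continuous_intros cw)
 qed
 define I where "I = insert None (Some ` ({-int N..0} \<times> (UNIV::'n set)))"
 \<comment> \<open>The norm of the positive modes and the nonpositive modes of the deformed point.
   Adding \<open>min 0 (w None)\<close> restores the coordinate that \<open>emb\<close> cuts off, so
   F is the identity wherever the descent is frozen, in particular far out.\<close>
 define F where "F w j = (case j of None => sqrt (\<Sum>k\<in>{1..int N}. real_of_int k * (norm ((step ^^ m) (emb w) k))^2) + min 0 (w None)
   | Some (k, i) => (step ^^ m) (emb w) k $ i)" for w j
 have cb: "continuous_on UNIV (\<lambda>w. (step ^^ m) (emb w) k)" for k
  by (rule continuous_on_compose2[OF continuous_on_product_then_coordinatewise[OF citer] cemb]) auto
 have cF: "continuous_on UNIV F"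
 proof (rule continuous_on_coordinatewise_then_product)
  fix j show "continuous_on UNIV (\<lambda>w. F w j)"
  proof (cases j)
   case None
   thus ?thesis unfolding F_def by (auto intro!: continuous_intros cb cw)
  next
   case (Some p)
   thus ?thesis unfolding F_def by (cases p) (auto intro!: continuous_intros cb)
  qed
 qed
 have sumI: "(\<Sum>j\<in>I. (w j)^2) = (w None)^2 + (\<Sum>k\<in>{-int N..0}. (norm (emb w k))^2)" for w
 proof -
  have "(\<Sum>j\<in>I. (w j)^2) = (w None)^2 + (\<Sum>j\<in>Some ` ({-int N..0} \<times> UNIV). (w j)^2)"
   unfolding I_def by (rule sum.insert) auto
  also have "(\<Sum>j\<in>Some ` ({-int N..0} \<times> (UNIV::'n set)). (w j)^2) = (\<Sum>p\<in>{-int N..0} \<times> UNIV. (w (Some p))^2)"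
   by (subst sum.reindex) auto
  also have "... = (\<Sum>k\<in>{-int N..0}. \<Sum>i\<in>UNIV. (w (Some (k, i)))^2)" by (simp add: sum.cartesian_product)
  also have "... = (\<Sum>k\<in>{-int N..0}. (norm (emb w k))^2)"
   by (rule sum.cong) (auto simp: emb_def norm_vec_def L2_set_def sum_nonneg)
  finally show ?thesis .
 qed
 have emb_pos: "emb w k = max 0 (w None) *\<^sub>R e k" if "k \<in> {1..int N}" for w k using that by (simp add: emb_def)
 have ssum: "(\<Sum>k\<in>{1..int N}. real_of_int k * (norm (emb w k))^2) = (max 0 (w None))^2" for w
 proof -
  have "(\<Sum>k\<in>{1..int N}. real_of_int k * (norm (emb w k))^2) = (\<Sum>k\<in>{1..int N}. (max 0 (w None))^2 * (real_of_int k * (norm (e k))^2))"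
   by (rule sum.cong) (simp_all add: emb_pos power_mult_distrib)
  thus ?thesis using e by (simp flip: sum_distrib_left)
 qed
 have Fid: "F w j = w j" if "Phi N (emb w) <= 0" "j \<in> I" for w j
 proof (cases j)
  case None
  thus ?thesis using that by (simp add: F_def iter_fix ssum)
 next
  case (Some p)
  thus ?thesis using that by (cases p) (auto simp: F_def I_def iter_fix emb_def)
 qed
 have low: "Phi N (emb w) <= 0" if "w None <= 0" for w
 proof -
  have "Act N (emb w) <= pi * (max 0 (w None))^2" using Act_le[of N "emb w"] by (simp add: ssum)
  thus ?thesis using Phi_le_Act[OF h0, of N "emb w"] that by (simp add: max_absorb1)
 qed
 have outside: "Phi N (emb w) <= 0" if "(\<Sum>j\<in>I. (w j)^2) >= R^2" for w
 proof (cases "w None <= 0")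
  case False
  show ?thesis by (rule far[of "max 0 (w None)"]) (use False that in \<open>auto simp: emb_pos sumI\<close>)
 qed (rule low)
 have bound: "Phi N (emb w) <= pi * R^2" for w
 proof (cases "(\<Sum>j\<in>I. (w j)^2) >= R^2")
  case True
  thus ?thesis using outside[OF True] by (meson order_trans mult_nonneg_nonneg pi_ge_zero zero_le_power2)
 next
  case False
  hence "(w None)^2 <= R^2" unfolding sumI using sum_nonneg[of "{-int N..0}" "\<lambda>k. (norm (emb w k))^2"] by force
  moreover have "(max 0 (w None))^2 <= (w None)^2" by (simp add: max_def)
  ultimately have "pi * (max 0 (w None))^2 <= pi * R^2" by (intro mult_left_mono) auto
  thus ?thesis using Act_le[of N "emb w", unfolded ssum] Phi_le_Act[OF h0, of N "emb w"] by linarith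
 qed
 have "finite I" by (simp add: I_def)
 \<comment> \<open>Surjectivity puts a deformed point on the sphere: positive modes of norm \<rho>,
   nonpositive modes zero. There \<open>Phi >= \<beta>\<close>, against the choice of m.\<close>
 then obtain w where w: "\<forall>j\<in>I. F w j = (if j = None then \<rho> else 0)"
  using surjective_if_identity_at_infinity[of I F R "\<lambda>j. if j = None then \<rho> else 0", OF _ cF] Fid outside by blast
 have "w None > 0"
 proof (rule ccontr)
  assume "\<not> ?thesis"
  hence "F w None = w None" using low Fid by (auto simp: I_def)
  thus False using w \<rho> \<open>\<not> w None > 0\<close> by (auto simp: I_def)
 qed
 define b where "b = (step ^^ m) (emb w)"
 have "sqrt (\<Sum>k\<in>{1..int N}. real_of_int k * (norm (b k))^2) = \<rho>"
  using w \<open>w None > 0\<close> by (auto simp: I_def F_def b_def)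
 hence b1: "(\<Sum>k\<in>{1..int N}. real_of_int k * (norm (b k))^2) = \<rho>^2"
  using real_sqrt_pow2[OF sum_nonneg[of "{1..int N}" "\<lambda>k. real_of_int k * (norm (b k))^2"]] by simp
 have b2: "b k = 0" if "k \<in> {-int N..0}" for k
  using w that by (auto simp: I_def F_def b_def vec_eq_iff)
 have "Phi N b >= \<beta>" by (rule sphere[OF b2 b1])
 moreover have "Phi N b < \<beta>"
  using iter[of m "emb w"] bound[of w] m \<beta> unfolding b_def by linarith
 ultimately show False by simp
qed

end

section \<open>Compactness of periodic curves\<close>

lemma periodic_Arzela_Ascoli:
 fixes X :: "nat => real => 'a::euclidean_space"
 assumes per: "!!n t. X n (t + 1) = X n t" and bd: "!!n t. norm (X n t) <= B"
  and mod: "!!n t s. \<bar>t - s\<bar> <= 1 ==> norm (X n t - X n s) <= C * sqrt \<bar>t - s\<bar>"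
 obtains r x where "strict_mono (r :: nat => nat)" "uniform_limit UNIV (\<lambda>n. X (r n)) x sequentially"
proof -
 have eq: "\<exists>d. 0 < d \<and> (\<forall>n y. y \<in> {0..1} \<and> norm (x - y) < d --> norm (X n x - X n y) < e)" if e: "0 < e" for x e
 proof (intro exI[of _ "min 1 ((e / (\<bar>C\<bar> + 1))^2)"] conjI allI impI)
  show "0 < min 1 ((e / (\<bar>C\<bar> + 1))^2)" using e by simp
  fix n y assume y: "y \<in> {0..1} \<and> norm (x - y) < min 1 ((e / (\<bar>C\<bar> + 1))^2)"
  have "sqrt \<bar>x - y\<bar> < e / (\<bar>C\<bar> + 1)"
   by (rule real_less_lsqrt) (use y e in auto)
  have "norm (X n x - X n y) <= C * sqrt \<bar>x - y\<bar>" using y by (intro mod) auto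
  also have "... <= \<bar>C\<bar> * sqrt \<bar>x - y\<bar>" by (intro mult_right_mono) auto
  also have "... <= \<bar>C\<bar> * (e / (\<bar>C\<bar> + 1))" using \<open>sqrt _ < _\<close> by (intro mult_left_mono) auto
  also have "... < e" using e by (simp add: field_simps)
  finally show "norm (X n x - X n y) < e" .
 qed
 obtain g r where g: "continuous_on {0..1} g" "strict_mono (r :: nat => nat)"
  "!!e. 0 < e ==> \<exists>N. \<forall>n x. n >= N \<and> x \<in> {0..1} --> norm (X (r n) x - g x) < e"
  by (rule Arzela_Ascoli[of "{0..1::real}" X B]) (use bd eq in auto)
 have "uniform_limit UNIV (\<lambda>n. X (r n)) (\<lambda>t. g (frac t)) sequentially"
 proof (rule uniform_limitI)
  fix e :: real assume "e > 0"
  then obtain N where N: "!!n x. n >= N ==> x \<in> {0..1} ==> norm (X (r n) x - g x) < e" using g(3) by blast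
  have "X n t = X n (frac t)" for n t
   using periodic_int[of "X n", OF per, of "frac t" "\<lfloor>t\<rfloor>"] by (simp add: frac_def)
  moreover have "frac t \<in> {0..1}" for t :: real using frac_lt_1[of t] by (simp add: less_imp_le)
  ultimately have "\<forall>n\<ge>N. \<forall>t. dist (X (r n) t) (g (frac t)) < e" using N by (metis dist_norm)
  thus "\<forall>\<^sub>F n in sequentially. \<forall>t\<in>UNIV. dist (X (r n) t) (g (frac t)) < e"
   by (auto simp: eventually_sequentially)
 qed
 thus ?thesis using that[OF g(2)] by blast
qed

lemma uniform_limit_continuous_comp:
 fixes X :: "nat => 'c => 'a::euclidean_space" and f :: "'a => 'b::metric_space"
 assumes u: "uniform_limit A X x sequentially" and bd: "!!n t. norm (X n t) <= B" and f: "continuous_on UNIV f"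
 shows "uniform_limit A (\<lambda>n t. f (X n t)) (\<lambda>t. f (x t)) sequentially"
proof (rule uniform_limit_compose_uniformly_continuous_on[OF u])
 show "uniformly_continuous_on (cball 0 B) f"
  by (rule compact_uniformly_continuous) (auto intro: continuous_on_subset[OF f])
qed (use bd in auto)

lemma uniform_limit_integral_tendsto:
 fixes f :: "nat => real => 'a::banach"
 assumes u: "uniform_limit {a..b} f g sequentially" and c: "!!n. continuous_on {a..b} (f n)"
 shows "(\<lambda>n. integral {a..b} (f n)) \<longlonglongrightarrow> integral {a..b} g"
proof -
 obtain I J where "!!n. (f n has_integral I n) {a..b}" "(g has_integral J) {a..b}" "(I \<longlongrightarrow> J) sequentially"
  by (rule uniform_limit_integral[OF u c]) auto
 moreover from this have "(\<lambda>n. integral {a..b} (f n)) = I" "integral {a..b} g = J" by (auto simp: integral_unique fun_eq_iff)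
 ultimately show ?thesis by simp
qed

lemma fcoef_tendsto:
 fixes Y :: "nat => real => 'n::finite pt"
 assumes u: "uniform_limit UNIV Y y sequentially" and c: "!!n. continuous_on UNIV (Y n)" and y: "continuous_on UNIV y"
 shows "(\<lambda>n. fcoef (Y n) k) \<longlonglongrightarrow> fcoef y k"
proof -
 have cY: "continuous_on {0..1} (Y n)" "continuous_on {0..1} y" for n using c y continuous_on_subset by blast+
 have "uniform_limit {0..1} (\<lambda>n t. norm (Y n t - y t)) (\<lambda>t. 0) sequentially"
  using u unfolding uniform_limit_iff by (auto simp: dist_norm elim!: eventually_mono)
 hence "(\<lambda>n. integral {0..1} (\<lambda>t. norm (Y n t - y t))) \<longlonglongrightarrow> integral {0..1} (\<lambda>t::real. 0::real)"
  by (rule uniform_limit_integral_tendsto) (intro continuous_intros cY)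
 hence L: "(\<lambda>n. integral {0..1} (\<lambda>t. norm (Y n t - y t))) \<longlonglongrightarrow> 0" by simp
 have "norm (fcoef (Y n) k - fcoef y k) <= integral {0..1} (\<lambda>t. norm (Y n t - y t))" for n
  using norm_fcoef_le[of "\<lambda>t. Y n t - y t" k] fcoef_diff[OF cY, of n k] by (simp add: continuous_on_diff cY)
 hence "(\<lambda>n. fcoef (Y n) k - fcoef y k) \<longlonglongrightarrow> 0"
  by (intro Lim_null_comparison[OF _ L]) auto
 thus ?thesis by (simp add: LIM_zero_iff)
qed

lemma tendsto_add_zero_right:
 fixes f g :: "nat => real"
 assumes "f \<longlonglongrightarrow> l" "g \<longlonglongrightarrow> 0"
 shows "(\<lambda>n. f n + g n) \<longlonglongrightarrow> l"
 using tendsto_add[OF assms] by simp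

text \<open>With d = sqrt (v - u) the velocity g satisfies |g| <= 1/(2 d) + d |g|^2 / 2 pointwise.
  Integrating over [u, v], which lies in one period, gives (1 + M) d / 2, the Cauchy-Schwarz
  estimate with a weaker constant.\<close>

lemma trig_holder:
 assumes D: "(\<Sum>k\<in>modes N. (2 * pi * real_of_int k)^2 * (norm (a k))^2) <= M" and ts: "\<bar>t - s\<bar> <= 1"
 shows "norm (trig N a t - trig N a s) <= (1 + M) / 2 * sqrt \<bar>t - s\<bar>"
proof -
 have main: "norm (trig N a v - trig N a u) <= (1 + M) / 2 * sqrt (v - u)" if uv: "u <= v" "v <= u + 1" for u v
 proof (cases "u = v")
  case False
  define d where "d = sqrt (v - u)"
  have d: "d > 0" "d^2 = v - u" using uv False by (auto simp: d_def)
  let ?b = "\<lambda>k. (2 * pi * real_of_int k) *\<^sub>R a k"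
  let ?g = "trig N ?b"
  have "integral {u..v} (\<lambda>t. (norm (?g t))^2) <= integral {u..u+1} (\<lambda>t. (norm (?g t))^2)"
   by (rule integral_subset_le) (use uv in \<open>auto intro!: integrable_continuous_interval continuous_intros\<close>)
  also have "... = integral {0..1} (\<lambda>t. (norm (?g t))^2)"
   by (rule integral_periodic_shift) (auto intro!: continuous_intros simp: trig_periodic)
  also have "... = (\<Sum>k\<in>modes N. (2 * pi * real_of_int k)^2 * (norm (a k))^2)"
   by (simp add: integral_trig_norm power_mult_distrib)
  also note D
  finally have I: "integral {u..v} (\<lambda>t. (norm (?g t))^2) <= M" .
  have "((\<lambda>t. J0 (?g t)) has_integral (trig N a v - trig N a u)) {u..v}"
   by (rule fundamental_theorem_of_calculus) (use uv trig_has_vector_derivative in auto)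
  hence "norm (trig N a v - trig N a u) = norm (integral {u..v} (\<lambda>t. J0 (?g t)))" by (simp add: integral_unique)
  also have "... <= integral {u..v} (\<lambda>t. inverse d / 2 + d / 2 * (norm (?g t))^2)"
  proof (rule integral_norm_bound_integral)
   fix t
   have "0 <= (d * norm (?g t) - 1)^2" by simp
   hence "2 * d * norm (?g t) <= d^2 * (norm (?g t))^2 + 1" by (simp add: power2_eq_square algebra_simps)
   hence "2 * d * norm (?g t) / (2 * d) <= (d^2 * (norm (?g t))^2 + 1) / (2 * d)" using d by (intro divide_right_mono) auto
   moreover have "2 * d * norm (?g t) / (2 * d) = norm (?g t)" using d by simp
   moreover have "(d^2 * (norm (?g t))^2 + 1) / (2 * d) = inverse d / 2 + d / 2 * (norm (?g t))^2"
    using d(1) by (simp add: add_divide_distrib power2_eq_square[of d] inverse_eq_divide)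
   ultimately show "norm (J0 (?g t)) <= inverse d / 2 + d / 2 * (norm (?g t))^2" by simp
  next
   show "(\<lambda>t. J0 (?g t)) integrable_on {u..v}"
    by (intro integrable_continuous_interval bounded_linear.continuous_on[OF bounded_linear_J0] continuous_intros)
  qed (intro integrable_continuous_interval continuous_intros)
  also have "... = inverse d / 2 * (v - u) + d / 2 * integral {u..v} (\<lambda>t. (norm (?g t))^2)"
   by (subst integral_add) (use uv in \<open>auto intro!: integrable_continuous_interval continuous_intros\<close>)
  also have "... <= d / 2 + d / 2 * M"
   using I d by (intro add_mono mult_left_mono) (auto simp: power2_eq_square field_simps simp flip: d(2))
  also have "... = (1 + M) / 2 * sqrt (v - u)" by (simp add: d_def field_simps)
  finally show ?thesis .
 qed simp
 show ?thesis
  using main[of s t] main[of t s] ts by (cases "s <= t") (auto simp: abs_if norm_minus_commute)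
qed

text \<open>Vanishing near 0 and the quadratic bound give positivity on a small sphere of positive
  modes. The \<open>growth\<close> condition bounds the L1 norm of almost critical points of
  nonnegative value, and with \<open>dh_lin\<close> this yields compactness.\<close>

locale hamiltonian_growth = semiconvex_hamiltonian h dh L
 for h :: "'n::finite pt => real" and dh L +
 fixes r0 C1 C2 C3 d :: real
 assumes h_nonneg: "h p >= 0" and r0: "r0 > 0" and h_zero: "norm p < r0 ==> h p = 0"
  and h_quad: "h p <= C2 * (norm p)^2" and dh_lin: "norm (dh p) <= C1 * (1 + norm p)"
  and d: "d > 0" and growth: "h p - (1/2) * (dh p \<bullet> p) >= d * norm p - C3"
  and dh_mirror: "dh (mirror p) = mirror (dh p)"
begin

text \<open>Modes are split at K >= 4 |C2|. At most K low modes, each of norm at most \<rho>, stay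
  below r0/2 in sup norm. Hence where h does not vanish the high part u is at least half of the loop
  and h <= 4 |C2| |u|^2 <= K |u|^2. For modes above K this is dominated by the sum of k |a k|^2, so
  the integral of h is at most \<rho>^2 whereas the action is pi \<rho>^2. The radius does not
  depend on N.\<close>

lemma sphere_estimate:
 obtains \<rho> where "\<rho> > 0"
  "!!N a. [|\<And>k. k \<in> {-int N..0} ==> a k = 0; (\<Sum>k\<in>{1..int N}. real_of_int k * (norm (a k))^2) = \<rho>^2|] ==> Phi N a >= \<rho>^2"
proof -
 obtain K :: nat where K: "4 * \<bar>C2\<bar> <= real K" using real_arch_simple by blast
 define \<rho> where "\<rho> = r0 / (2 * (real K + 1))"
 have \<rho>: "\<rho> > 0" "K * \<rho> < r0 / 2" using r0 by (auto simp: \<rho>_def field_simps)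
 show ?thesis
 proof (rule that[OF \<rho>(1)])
  fix N and a :: "int => real^'n"
  assume neg: "!!k. k \<in> {-int N..0} ==> a k = 0" and sum: "(\<Sum>k\<in>{1..int N}. real_of_int k * (norm (a k))^2) = \<rho>^2"
  define l where "l k = (if k <= int K then a k else 0)" for k
  define u where "u k = (if k <= int K then 0 else a k)" for k
  have lu: "trig N a t = trig N l t + trig N u t" for t
   unfolding trig_def sum.distrib[symmetric] by (rule sum.cong) (auto simp: l_def u_def fmode_def zero_prod_def)
  have ak: "norm (a k) <= \<rho>" if "k \<in> {1..int N}" for k
  proof (rule power2_le_imp_le)
   have "(norm (a k))^2 <= real_of_int k * (norm (a k))^2" using that by (simp add: mult_le_cancel_right1)
   also have "... <= (\<Sum>k\<in>{1..int N}. real_of_int k * (norm (a k))^2)"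
    by (rule member_le_sum[OF that]) auto
   finally show "(norm (a k))^2 <= \<rho>^2" using sum by simp
  qed (use \<rho> in simp)
  have nl: "norm (trig N l t) < r0 / 2" for t
  proof -
   have "norm (trig N l t) <= (\<Sum>k\<in>modes N. norm (l k))"
    unfolding trig_def by (rule order_trans[OF norm_sum]) (simp add: norm_fmode)
   also have "... <= (\<Sum>k\<in>modes N. if k \<in> {1..int K} then \<rho> else 0)"
    by (rule sum_mono) (use ak neg \<rho> in \<open>auto simp: l_def modes_def\<close>)
   also have "... = (\<Sum>k\<in>modes N \<inter> {1..int K}. \<rho>)" by (rule sum.inter_restrict[symmetric]) simp
   also have "... <= (\<Sum>k\<in>{1..int K}. \<rho>)" by (rule sum_mono2) (use \<rho> in auto)
   also have "... = K * \<rho>" by simp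
   finally show ?thesis using \<rho> by simp
  qed
  have pw: "h (trig N a t) <= 4 * \<bar>C2\<bar> * (norm (trig N u t))^2" for t
  proof (cases "norm (trig N a t) < r0")
   case False
   have "norm (trig N a t) <= norm (trig N l t) + norm (trig N u t)" unfolding lu by (rule norm_triangle_ineq)
   hence "norm (trig N a t) <= 2 * norm (trig N u t)" using nl[of t] False by linarith
   hence "(norm (trig N a t))^2 <= (2 * norm (trig N u t))^2" by (intro power_mono) auto
   hence "\<bar>C2\<bar> * (norm (trig N a t))^2 <= \<bar>C2\<bar> * (4 * (norm (trig N u t))^2)" by (intro mult_left_mono) (auto simp: power_mult_distrib)
   moreover have "h (trig N a t) <= \<bar>C2\<bar> * (norm (trig N a t))^2"
    by (rule order_trans[OF h_quad], rule mult_right_mono) auto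
   ultimately show ?thesis by linarith
  qed (simp add: h_zero)
  have "integral {0..1} (\<lambda>t. h (trig N a t)) <= integral {0..1} (\<lambda>t. 4 * \<bar>C2\<bar> * (norm (trig N u t))^2)"
   by (rule integral_le) (use pw in \<open>auto intro!: integrable_continuous_interval continuous_intros\<close>)
  also have "... = 4 * \<bar>C2\<bar> * (\<Sum>k\<in>modes N. (norm (u k))^2)" by (simp add: integral_trig_norm)
  also have "... <= real K * (\<Sum>k\<in>modes N. (norm (u k))^2)" by (rule mult_right_mono[OF K]) (simp add: sum_nonneg)
  also have "... = (\<Sum>k\<in>{1..int N}. real K * (norm (u k))^2)"
   unfolding sum_distrib_left modes_split(1)
   by (subst sum.union_disjoint) (auto simp: u_def neg intro!: sum.neutral)
  also have "... <= (\<Sum>k\<in>{1..int N}. real_of_int k * (norm (a k))^2)"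
   by (rule sum_mono) (auto simp: u_def intro!: mult_right_mono)
  finally have int: "integral {0..1} (\<lambda>t. h (trig N a t)) <= \<rho>^2" using sum by simp
  have "(\<Sum>k\<in>modes N. real_of_int k * (norm (a k))^2) = \<rho>^2"
   unfolding modes_split(1) sum[symmetric] by (subst sum.union_disjoint) (auto simp: neg intro!: sum.neutral)
  hence "Phi N a = pi * \<rho>^2 - integral {0..1} (\<lambda>t. h (trig N a t))" by (simp add: Phi_def Act_def)
  moreover have "2 * \<rho>^2 <= pi * \<rho>^2" using pi_ge_two by (intro mult_right_mono) auto
  ultimately show "Phi N a >= \<rho>^2" using int by linarith
 qed
qed

text \<open>Euler's identity: the action is quadratic, so half the pairing of the gradient with a
  returns the action minus half the integral of <dh x, x>. Almost critical values are thereby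
  expressed through \<open>growth\<close>.\<close>

lemma Phi_eq: "Phi N a = (1/2) * (\<Sum>k\<in>modes N. Grad N a k \<bullet> a k) + integral {0..1} (\<lambda>t. (1/2) * (dh (trig N a t) \<bullet> trig N a t) - h (trig N a t))"
proof -
 have cdh: "continuous_on {0..1} (\<lambda>t. dh (trig N a t))" by (intro continuous_intros)
 have "integral {0..1} (\<lambda>t. (1/2) * (dh (trig N a t) \<bullet> trig N a t) - h (trig N a t))
   = integral {0..1} (\<lambda>t. (1/2) * (dh (trig N a t) \<bullet> trig N a t)) - integral {0..1} (\<lambda>t. h (trig N a t))"
  by (intro integral_diff integrable_continuous_interval continuous_intros)
 also have "integral {0..1} (\<lambda>t. (1/2) * (dh (trig N a t) \<bullet> trig N a t)) = (1/2) * integral {0..1} (\<lambda>t. trig N a t \<bullet> dh (trig N a t))"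
  by (simp add: inner_commute)
 also have "... = (1/2) * (\<Sum>k\<in>modes N. a k \<bullet> fcoef (\<lambda>t. dh (trig N a t)) k)" by (simp add: integral_trig_inner[OF cdh])
 finally have I: "integral {0..1} (\<lambda>t. (1/2) * (dh (trig N a t) \<bullet> trig N a t) - h (trig N a t)) = 
   (1/2) * (\<Sum>k\<in>modes N. a k \<bullet> fcoef (\<lambda>t. dh (trig N a t)) k) - integral {0..1} (\<lambda>t. h (trig N a t))" .
 have "Act N a = (1/2) * (\<Sum>k\<in>modes N. Grad N a k \<bullet> a k) + (1/2) * (\<Sum>k\<in>modes N. a k \<bullet> fcoef (\<lambda>t. dh (trig N a t)) k)"
  unfolding Act_def sum_distrib_left sum.distrib[symmetric]
  by (rule sum.cong) (auto simp: Grad_def inner_diff_left inner_commute power2_norm_eq_inner algebra_simps)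
 thus ?thesis unfolding Phi_def I by simp
qed

lemma Grad_inner_le: 
 assumes "Gsq N a <= e^2" "e >= 0"
 shows "(\<Sum>k\<in>modes N. Grad N a k \<bullet> a k) <= e * sqrt (\<Sum>k\<in>modes N. (norm (a k))^2)"
proof -
 have "(\<Sum>k\<in>modes N. Grad N a k \<bullet> a k) <= (\<Sum>k\<in>modes N. \<bar>norm (Grad N a k)\<bar> * \<bar>norm (a k)\<bar>)"
  by (rule sum_mono) (simp add: norm_cauchy_schwarz)
 also have "... <= L2_set (\<lambda>k. norm (Grad N a k)) (modes N) * L2_set (\<lambda>k. norm (a k)) (modes N)" by (rule L2_set_mult_ineq)
 also have "... <= e * L2_set (\<lambda>k. norm (a k)) (modes N)"
 proof (rule mult_right_mono)
  have "L2_set (\<lambda>k. norm (Grad N a k)) (modes N) = sqrt (Gsq N a)" by (simp add: L2_set_def Gsq_def)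
  also have "... <= e" using assms by (simp add: real_le_lsqrt Gsq_nonneg)
  finally show "L2_set (\<lambda>k. norm (Grad N a k)) (modes N) <= e" .
 qed simp
 finally show ?thesis by (simp add: L2_set_def)
qed

text \<open>Let S be the L2 norm squared, I the L1 norm and E the energy of the derivative. Growth
  bounds I by a constant plus a small multiple of sqrt S; the gradient equation and Bessel bound E
  by C4 (1 + S). Each coefficient is at most I, which controls the low modes, and the high modes are
  controlled by E / K^2; a bound for S closes up.\<close>

lemma apriori_bound:
 obtains q0 M where "q0 > 0" 
  "!!N a q. [|Phi N a >= 0; Gsq N a <= q^2; 0 <= q; q <= q0|] ==> (\<Sum>k\<in>modes N. (norm (a k))^2) <= M \<and>
   (\<Sum>k\<in>modes N. (2 * pi * real_of_int k)^2 * (norm (a k))^2) <= M \<and> integral {0..1} (\<lambda>t. norm (trig N a t)) <= M"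
proof -
 define C4 where "C4 = 2 + 4 * C1^2"
 have C4: "C4 > 0" by (simp add: C4_def add_pos_nonneg)
 \<comment> \<open>Large enough that \<open>E / K^2\<close> is at most (1 + S) / 4.\<close>
 obtain K :: nat where K: "4 * C4 <= real K" using real_arch_simple by blast
 hence "1 <= real K" using C4 by (auto simp: C4_def)
 hence K2: "4 * C4 <= (real K)^2" using K by (smt (verit) power2_eq_square mult_le_cancel_left1)
 define P where "P = 2 * real K + 1"
 have P: "P > 0" by (simp add: P_def)
 \<comment> \<open>For gradients below q0 the term in sqrt S contributes at most S / 4 to
   \<open>P * I^2\<close>. Together with (1 + S) / 4 from the high modes half of S remains, whence
   the value of \<open>M0\<close>.\<close>
 define q0 where "q0 = min 1 (d / sqrt (2 * P))"
 have e0: "q0 > 0" "q0 <= 1" using d P by (auto simp: q0_def)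
 define M0 where "M0 = 4 * P * C3^2 / d^2 + 1/2"
 have M0: "M0 >= 0" using P by (simp add: M0_def)
 define M where "M = max (C4 * (1 + M0)) (max (1 + M0) M0)"
 show ?thesis
 proof (rule that[OF e0(1)])
  fix N q and a :: "int => real^'n"
  assume Phi: "Phi N a >= 0" and G: "Gsq N a <= q^2" and e: "0 <= q" "q <= q0"
  define S where "S = (\<Sum>k\<in>modes N. (norm (a k))^2)"
  define I where "I = integral {0..1} (\<lambda>t. norm (trig N a t))"
  define E where "E = (\<Sum>k\<in>modes N. (2 * pi * real_of_int k)^2 * (norm (a k))^2)"
  have S0: "S >= 0" and I0: "I >= 0" unfolding S_def I_def
   by (auto intro!: sum_nonneg integral_nonneg integrable_continuous_interval continuous_intros)
  have e2: "q^2 <= 1" "q^2 * (2 * P) <= d^2"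
  proof -
   show "q^2 <= 1" using e e0 power_mono[of q 1 2] by simp
   have "q <= d / sqrt (2 * P)" using e by (simp add: q0_def)
   hence "q^2 <= (d / sqrt (2 * P))^2" using e by (intro power_mono) auto
   thus "q^2 * (2 * P) <= d^2" using P by (simp add: power_divide field_simps)
  qed
  have "integral {0..1} (\<lambda>t. (1/2) * (dh (trig N a t) \<bullet> trig N a t) - h (trig N a t)) <= integral {0..1} (\<lambda>t. C3 - d * norm (trig N a t))"
  proof (rule integral_le)
   fix t show "(1/2) * (dh (trig N a t) \<bullet> trig N a t) - h (trig N a t) <= C3 - d * norm (trig N a t)"
    using growth[of "trig N a t"] by linarith
  qed (intro integrable_continuous_interval continuous_intros)+
  also have "... = C3 - d * I" unfolding I_def
   by (subst integral_diff) (auto intro!: integrable_continuous_interval continuous_intros)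
  finally have dI: "d * I <= C3 + q / 2 * sqrt S"
   using Phi Grad_inner_le[OF G e(1)] unfolding Phi_eq S_def by linarith
  have I2: "I^2 * P <= 2 * C3^2 * P / d^2 + S / 4"
  proof -
   have "(d * I)^2 <= (C3 + q / 2 * sqrt S)^2" using dI d I0 by (intro power_mono) auto
   also have "... <= 2 * C3^2 + 2 * (q / 2 * sqrt S)^2"
    using sum_squares_ge_zero[of 0 "C3 - q / 2 * sqrt S"] by (simp add: power2_eq_square algebra_simps)
   also have "2 * (q / 2 * sqrt S)^2 = q^2 * S / 2" using S0 by (simp add: power_mult_distrib power_divide)
   finally have "(d * I)^2 * P <= (2 * C3^2 + q^2 * S / 2) * P" using P by (intro mult_right_mono) auto
   also have "... = 2 * C3^2 * P + (q^2 * (2 * P)) * S / 4" by (simp add: algebra_simps)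
   also have "... <= 2 * C3^2 * P + d^2 * S / 4" using e2(2) S0 by (intro add_left_mono divide_right_mono mult_right_mono) auto
   finally have "(d * I)^2 * P / d^2 <= (2 * C3^2 * P + d^2 * S / 4) / d^2" by (rule divide_right_mono) simp
   thus ?thesis using d by (simp add: power_mult_distrib add_divide_distrib)
  qed
  have ak: "norm (a k) <= I" if "k \<in> modes N" for k
   using norm_fcoef_le[of "trig N a" k] that by (simp add: fcoef_trig I_def continuous_on_trig)
  have E: "E <= C4 * (1 + S)"
  proof -
   let ?c = "fcoef (\<lambda>t. dh (trig N a t))"
   have cdh: "continuous_on {0..1} (\<lambda>t. dh (trig N a t))" by (intro continuous_intros)
   have sq: "(norm (x + y))^2 <= 2 * (norm x)^2 + 2 * (norm y)^2" for x y :: "real^'n"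
   proof -
    have "(norm (x + y))^2 <= (norm x + norm y)^2" by (intro power_mono norm_triangle_ineq) auto
    thus ?thesis using sum_squares_bound[of "norm x" "norm y"] by (simp add: power2_sum)
   qed
   have "E = (\<Sum>k\<in>modes N. (norm (Grad N a k + ?c k))^2)"
    unfolding E_def by (rule sum.cong) (auto simp: Grad_def power_mult_distrib)
   also have "... <= (\<Sum>k\<in>modes N. 2 * (norm (Grad N a k))^2 + 2 * (norm (?c k))^2)" by (rule sum_mono) (rule sq)
   also have "... = 2 * Gsq N a + 2 * (\<Sum>k\<in>modes N. (norm (?c k))^2)" by (simp add: Gsq_def sum.distrib sum_distrib_left)
   also have "(\<Sum>k\<in>modes N. (norm (?c k))^2) <= integral {0..1} (\<lambda>t. (norm (dh (trig N a t)))^2)" by (rule fcoef_bessel[OF cdh])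
   also have "... <= integral {0..1} (\<lambda>t. 2 * C1^2 + 2 * C1^2 * (norm (trig N a t))^2)"
   proof (rule integral_le)
    fix t :: real
    let ?x = "norm (trig N a t)"
    have "(norm (dh (trig N a t)))^2 <= (C1 * (1 + ?x))^2" by (intro power_mono dh_lin) auto
    also have "... = C1^2 * (1 + ?x)^2" by (simp add: power_mult_distrib)
    also have "... <= C1^2 * (2 + 2 * ?x^2)"
     using sum_squares_bound[of 1 ?x] by (intro mult_left_mono) (auto simp: power2_sum)
    finally show "(norm (dh (trig N a t)))^2 <= 2 * C1^2 + 2 * C1^2 * ?x^2" by (simp add: algebra_simps)
   qed (intro integrable_continuous_interval continuous_intros)+
   also have "... = 2 * C1^2 + 2 * C1^2 * S" unfolding S_def integral_trig_norm[symmetric]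
    by (subst integral_add) (auto intro!: integrable_continuous_interval continuous_intros)
   finally have "E <= 2 * 1 + 2 * (2 * C1^2 + 2 * C1^2 * S)" using G e2 by linarith
   also have "... <= C4 * (1 + S)" using S0 by (simp add: C4_def algebra_simps)
   finally show ?thesis .
  qed
  have "S <= P * I^2 + E / (real K)^2"
  proof -
   have "S <= (\<Sum>k\<in>modes N. (if k \<in> modes K then I\<^sup>2 else 0) + (2 * pi * real_of_int k)^2 * (norm (a k))^2 / (real K)^2)"
    unfolding S_def
   proof (rule sum_mono)
    fix k assume k: "k \<in> modes N"
    show "(norm (a k))^2 <= (if k \<in> modes K then I\<^sup>2 else 0) + (2 * pi * real_of_int k)^2 * (norm (a k))^2 / (real K)^2"
    proof (cases "k \<in> modes K")
     case True
     have "(norm (a k))^2 <= I^2" using ak[OF k] by (intro power_mono) auto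
     thus ?thesis using True by (simp add: add_increasing2)
    next
     case False
     hence "real K <= \<bar>real_of_int k\<bar>" by (auto simp: modes_def)
     also have "... <= 2 * pi * \<bar>real_of_int k\<bar>" using pi_ge_two by (simp add: mult_le_cancel_right1)
     finally have "(real K)^2 <= (2 * pi * \<bar>real_of_int k\<bar>)^2" by (intro power_mono) auto
     hence "(real K)^2 * (norm (a k))^2 <= (2 * pi * real_of_int k)^2 * (norm (a k))^2"
      by (intro mult_right_mono) (auto simp: power_mult_distrib)
     thus ?thesis using False \<open>1 <= real K\<close> by (simp add: field_simps)
    qed
   qed
   also have "... = (\<Sum>k\<in>modes N. if k \<in> modes K then I\<^sup>2 else 0) + E / (real K)^2"
    unfolding E_def sum.distrib sum_divide_distrib ..
   also have "(\<Sum>k\<in>modes N. if k \<in> modes K then I\<^sup>2 else 0) = (\<Sum>k\<in>modes N \<inter> modes K. I^2)" by (rule sum.inter_restrict[symmetric]) simp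
   also have "... <= (\<Sum>k\<in>modes K. I^2)" by (rule sum_mono2) auto
   also have "... = P * I^2" by (simp add: P_def modes_def)
   finally show ?thesis by simp
  qed
  also have "E / (real K)^2 <= (1 + S) / 4"
  proof -
   have "4 * E <= (4 * C4) * (1 + S)" using E by simp
   also have "... <= (real K)^2 * (1 + S)" using K2 S0 by (intro mult_right_mono) auto
   finally show ?thesis using \<open>1 <= real K\<close> by (simp add: field_simps)
  qed
  finally have "S <= P * I^2 + (1 + S) / 4" by simp
  moreover have "P * I^2 = I^2 * P" "M0 = 2 * (2 * C3^2 * P / d^2) + 1/2" by (simp_all add: M0_def)
  moreover have "S <= m" if "S <= z + (1 + S) / 4" "z <= y + S / 4" "m = 2 * y + 1/2" for z y m
   using that by (simp add: field_simps)
  ultimately have SM: "S <= M0" using I2 by metis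
  have "I^2 <= 1 + M0"
  proof -
   define y where "y = 2 * C3^2 * P / d^2"
   have y: "y >= 0" "M0 = 2 * y + 1/2" using P by (simp_all add: M0_def y_def)
   have "I^2 * 1 <= I^2 * P" by (intro mult_left_mono) (auto simp: P_def)
   also have "... <= 2 * C3^2 * P / d^2 + S / 4" by (rule I2)
   also have "... <= 1 + M0" using SM y(1) unfolding y_def[symmetric] y(2) by argo
   finally show ?thesis by simp
  qed
  also have "... <= (1 + M0)^2" using M0 by (intro self_le_power) auto
  finally have "I <= 1 + M0" using M0 by (intro power2_le_imp_le[of I]) auto
  moreover have "E <= C4 * (1 + M0)" 
   by (rule order_trans[OF E mult_left_mono]) (use SM C4 in auto)
  ultimately show "(\<Sum>k\<in>modes N. (norm (a k))^2) <= M \<and>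
   (\<Sum>k\<in>modes N. (2 * pi * real_of_int k)^2 * (norm (a k))^2) <= M \<and> integral {0..1} (\<lambda>t. norm (trig N a t)) <= M"
   using SM unfolding S_def E_def I_def M_def by auto
 qed
qed

text \<open>Almost critical trigonometric polynomials of growing degree converge uniformly. The
  limit x solves the Hamiltonian equation for each Fourier coefficient, so it differs from a
  primitive of \<open>J0 (dh (x t))\<close> by a constant and is therefore C^1. The lower bound
  \<rho>^2 for the values passes to the limit.\<close>

theorem brake_orbit_exists:
 assumes b0: "!!k. k > int N0 ==> b k = 0" and b1: "(\<Sum>k\<in>{1..int N0}. real_of_int k * (norm (b k))^2) = 1"
  and link: "!!N. N >= N0 ==> \<exists>R. \<forall>a s. s >= 0 --> (\<forall>k\<in>{1..int N}. a k = s *\<^sub>R b k) -->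
    s\<^sup>2 + (\<Sum>k\<in>{-int N..0}. (norm (a k))^2) >= R^2 --> Phi N a <= 0"
 obtains x where "!!t. (x has_vector_derivative J0 (dh (x t))) (at t)" "!!t. x (t + 1) = x t" "!!t. x (- t) = mirror (x t)"
  "integral {0..1} (\<lambda>t. (1/2) * (dh (x t) \<bullet> x t) - h (x t)) > 0"
proof -
 obtain \<rho> where \<rho>: "\<rho> > 0" and sph: 
  "!!N a. [|\<And>k. k \<in> {-int N..0} ==> a k = 0; (\<Sum>k\<in>{1..int N}. real_of_int k * (norm (a k))^2) = \<rho>^2|] ==> Phi N a >= \<rho>^2"
  using sphere_estimate by blast
 obtain E0 M where e0: "E0 > 0" and bnd:
  "!!N a E. [|Phi N a >= 0; Gsq N a <= E^2; 0 <= E; E <= E0|] ==> (\<Sum>k\<in>modes N. (norm (a k))^2) <= M \<and>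
   (\<Sum>k\<in>modes N. (2 * pi * real_of_int k)^2 * (norm (a k))^2) <= M \<and> integral {0..1} (\<lambda>t. norm (trig N a t)) <= M"
  by (rule apriori_bound) (rule that; assumption)
 define e where "e n = min E0 (1 / real (Suc n))" for n
 have e: "e n > 0" "e n <= E0" "e n <= 1 / real (Suc n)" for n using e0 by (auto simp: e_def)
 have e_lim: "e \<longlonglongrightarrow> 0"
  by (rule tendsto_sandwich[OF _ _ tendsto_const lim_inverse_n'[THEN LIMSEQ_Suc]])
    (use e in \<open>auto intro!: always_eventually less_imp_le\<close>)
 have "\<exists>a. Phi (N0 + n) a >= \<rho>^2 \<and> Gsq (N0 + n) a <= (e n)^2" for n
 proof -
  obtain R where R: "!!a s. s >= 0 ==> (\<forall>k\<in>{1..int (N0 + n)}. a k = s *\<^sub>R b k) ==>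
    s\<^sup>2 + (\<Sum>k\<in>{-int (N0 + n)..0}. (norm (a k))^2) >= R^2 ==> Phi (N0 + n) a <= 0" using link[of "N0 + n"] by auto
  have "(\<Sum>k\<in>{1..int (N0 + n)}. real_of_int k * (norm (b k))^2) = (\<Sum>k\<in>{1..int N0}. real_of_int k * (norm (b k))^2)"
   by (rule sum.mono_neutral_right) (auto simp: b0)
  hence b1': "(\<Sum>k\<in>{1..int (N0 + n)}. real_of_int k * (norm (b k))^2) = 1" using b1 by simp
  show ?thesis
   by (rule linking_almost_critical[OF h_nonneg b1', where \<rho> = \<rho> and R = R]) (use \<rho> e[of n] sph R in auto)
 qed
 then obtain A where A: "!!n. Phi (N0 + n) (A n) >= \<rho>^2" "!!n. Gsq (N0 + n) (A n) <= (e n)^2" by metis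
 define X where "X n = trig (N0 + n) (A n)" for n
 have Phi0: "Phi (N0 + n) (A n) >= 0" for n using A(1)[of n] by (meson order_trans zero_le_power2)
 note bnd' = bnd[OF Phi0 A(2) less_imp_le[OF e(1)] e(2)]
 have M0: "M >= 0" using bnd'[of 0] by (meson order_trans sum_nonneg zero_le_power2)
 have cX: "continuous_on S (X n)" for n S unfolding X_def by (intro continuous_intros)
 have hol: "norm (X n t - X n s) <= (1 + M) / 2 * sqrt \<bar>t - s\<bar>" if "\<bar>t - s\<bar> <= 1" for n t s
  unfolding X_def by (rule trig_holder) (use bnd' that in auto)
 have per: "X n (t + 1) = X n t" and mir: "X n (- t) = mirror (X n t)" for n t
  by (simp_all add: X_def trig_periodic trig_mirror)
 \<comment> \<open>A sup bound: the mean of the norm is at most M and the oscillation within one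
   period at most (1 + M) / 2.\<close>
 define B where "B = M + (1 + M) / 2"
 have bd: "norm (X n t) <= B" for n t
 proof -
  have "norm (X n t) = norm (X n (frac t))"
   using periodic_int[of "X n", OF per, of "frac t" "\<lfloor>t\<rfloor>"] by (simp add: frac_def)
  also have "... = integral {0..1} (\<lambda>s::real. norm (X n (frac t)))" by simp
  also have "... <= integral {0..1} (\<lambda>s. norm (X n s) + (1 + M) / 2)"
  proof (rule integral_le)
   fix s :: real assume s: "s \<in> {0..1}"
   have "\<bar>frac t - s\<bar> <= 1" using s frac_lt_1[of t] frac_ge_0[of t] unfolding abs_le_iff atLeastAtMost_iff by linarith
   hence "norm (X n (frac t) - X n s) <= (1 + M) / 2 * sqrt \<bar>frac t - s\<bar>" by (rule hol)
   also have "... <= (1 + M) / 2 * 1" using M0 \<open>\<bar>frac t - s\<bar> <= 1\<close> by (intro mult_left_mono) auto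
   finally show "norm (X n (frac t)) <= norm (X n s) + (1 + M) / 2"
    using norm_triangle_ineq2[of "X n (frac t)" "X n s"] by linarith
  qed (intro integrable_continuous_interval continuous_intros cX)+
  also have "... = integral {0..1} (\<lambda>s. norm (X n s)) + (1 + M) / 2"
   by (subst integral_add) (auto intro!: integrable_continuous_interval continuous_intros cX)
  finally show ?thesis using bnd'[of n] unfolding B_def X_def by linarith
 qed
 obtain r x where r: "strict_mono (r :: nat => nat)" and u: "uniform_limit UNIV (\<lambda>n. X (r n)) x sequentially"
  by (rule periodic_Arzela_Ascoli[of X B "(1 + M) / 2"]) (use per bd hol in auto)
 have cx: "continuous_on UNIV x"
  by (rule uniform_limit_theorem[OF _ u]) (auto simp: cX intro: always_eventually)
 have pt: "(\<lambda>n. X (r n) t) \<longlonglongrightarrow> x t" for t by (rule tendsto_uniform_limitI[OF u]) simp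
 have perx: "x (t + 1) = x t" for t
  using LIMSEQ_unique[OF pt[of "t + 1"]] pt[of t] by (simp add: per)
 have mirx: "x (- t) = mirror (x t)" for t
 proof -
  have "(\<lambda>n. mirror (X (r n) t)) \<longlonglongrightarrow> mirror (x t)" unfolding mirror_def by (intro tendsto_intros pt)
  thus ?thesis using LIMSEQ_unique[OF pt[of "- t"]] by (simp add: mir)
 qed
 have e_lim': "(\<lambda>n. e (r n)) \<longlonglongrightarrow> 0" using LIMSEQ_subseq_LIMSEQ[OF e_lim r] by (simp add: o_def)
 have udh: "uniform_limit UNIV (\<lambda>n t. dh (X (r n) t)) (\<lambda>t. dh (x t)) sequentially"
  by (rule uniform_limit_continuous_comp[OF u bd dh_cont])
 have cdh: "continuous_on S (\<lambda>t. dh (X n t))" for n S by (intro continuous_intros cX)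
 have cdx: "continuous_on S (\<lambda>t. dh (x t))" for S by (intro continuous_intros continuous_on_subset[OF cx]) auto
 have weak: "(2 * pi * real_of_int k) *\<^sub>R fcoef x k = fcoef (\<lambda>t. dh (x t)) k" for k
 proof -
  have l1: "(\<lambda>n. (2 * pi * real_of_int k) *\<^sub>R fcoef (X (r n)) k - fcoef (\<lambda>t. dh (X (r n) t)) k) \<longlonglongrightarrow>
    (2 * pi * real_of_int k) *\<^sub>R fcoef x k - fcoef (\<lambda>t. dh (x t)) k"
   by (intro tendsto_intros fcoef_tendsto[OF u cX cx] fcoef_tendsto[OF udh cdh cdx])
  have "\<forall>\<^sub>F n in sequentially. norm ((2 * pi * real_of_int k) *\<^sub>R fcoef (X (r n)) k - fcoef (\<lambda>t. dh (X (r n) t)) k) <= e (r n)"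
   using eventually_ge_at_top[of "nat \<bar>k\<bar>"]
  proof eventually_elim
   case (elim n)
   have "n <= r n" using r by (rule seq_suble)
   hence k: "k \<in> modes (N0 + r n)" using elim by (auto simp: modes_def)
   have "(norm (Grad (N0 + r n) (A (r n)) k))^2 <= Gsq (N0 + r n) (A (r n))"
    unfolding Gsq_def by (rule member_le_sum[OF k]) auto
   also have "... <= (e (r n))^2" by (rule A(2))
   finally have "norm (Grad (N0 + r n) (A (r n)) k) <= e (r n)" by (rule power2_le_imp_le[OF _ less_imp_le[OF e(1)]])
   moreover have "Grad (N0 + r n) (A (r n)) k = (2 * pi * real_of_int k) *\<^sub>R fcoef (X (r n)) k - fcoef (\<lambda>t. dh (X (r n) t)) k"
    unfolding Grad_def X_def fcoef_trig if_P[OF k] ..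
   ultimately show ?case by simp
  qed
  from Lim_null_comparison[OF this e_lim']
  have "(\<lambda>n. (2 * pi * real_of_int k) *\<^sub>R fcoef (X (r n)) k - fcoef (\<lambda>t. dh (X (r n) t)) k) \<longlonglongrightarrow> 0" .
  from LIMSEQ_unique[OF l1 this] show ?thesis by simp
 qed
 let ?f = "\<lambda>t. dh (x t)"
 have mirf: "?f (- t) = mirror (?f t)" for t by (simp add: mirx dh_mirror)
 obtain P where P: "!!t. (P has_vector_derivative J0 (?f t)) (at t)"
  using continuous_antiderivative_UNIV[OF bounded_linear.continuous_on[OF bounded_linear_J0 cdx]] by blast
 \<comment> \<open>The primitive that agrees with x at 0; once x - y is known to be constant, it is
   0.\<close>
 define y where "y t = P t - P 0 + x 0" for t
 have y': "(y has_vector_derivative J0 (?f t)) (at t)" for t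
  unfolding y_def by (auto intro!: derivative_eq_intros P)
 have cy: "continuous_on S y" for S
  using y' has_vector_derivative_continuous continuous_at_imp_continuous_on by blast
 \<comment> \<open>Needed for the primitive to be periodic. The first component is the equation for
   the mode 0, which carries the factor k = 0; the second integrates an odd function.\<close>
 have int0: "integral {0..1} ?f = 0"
 proof (rule prod_eqI)
  have i: "?f integrable_on {0..1}" by (intro integrable_continuous_interval cdx)
  have "fcoef ?f 0 = 0" using weak[of 0] by simp
  hence "integral {0..1} (\<lambda>t. fst (?f t)) = 0" by (simp add: fcoef_def)
  thus "fst (integral {0..1} ?f) = fst 0" using integral_linear[OF i bounded_linear_fst] by (simp add: o_def)
  have "integral {0..1} (\<lambda>t. snd (?f t)) = 0"
   by (rule integral_periodic_odd) (use mirf in \<open>auto intro!: continuous_intros cdx simp: perx mirror_def\<close>)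
  thus "snd (integral {0..1} ?f) = snd 0" using integral_linear[OF i bounded_linear_snd] by (simp add: o_def)
 qed
 have J0f: "continuous_on S (\<lambda>t. J0 (?f t))" for S by (rule bounded_linear.continuous_on[OF bounded_linear_J0 cdx])
 have pery: "y (t + 1) = y t" for t
 proof -
  have "y (t + 1) - y t = integral {t..t+1} (\<lambda>t. J0 (?f t))"
   by (rule integral_eq_antiderivative[symmetric]) (auto intro: y')
  also have "... = integral {0..1} (\<lambda>t. J0 (?f t))" by (rule integral_periodic_shift[OF J0f]) (simp add: perx)
  also have "... = J0 (integral {0..1} ?f)"
   using integral_linear[OF integrable_continuous_interval[OF cdx] bounded_linear_J0] by (simp add: o_def)
  finally show ?thesis by (simp add: int0)
 qed
 have miry: "y (- t) = mirror (y t)" for t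
 proof -
  have bm: "bounded_linear (mirror :: 'n pt => 'n pt)"
   unfolding mirror_def by (intro bounded_linear_Pair bounded_linear_fst bounded_linear_minus bounded_linear_snd)
  have "((\<lambda>t. y (- t) - mirror (y t)) has_vector_derivative 0) (at t within UNIV)" for t
  proof -
   have "((y \<circ> uminus) has_vector_derivative (-1) *\<^sub>R J0 (?f (- t))) (at t)"
    by (rule vector_diff_chain_at) (auto intro!: derivative_eq_intros y')
   moreover have "((\<lambda>t. mirror (y t)) has_vector_derivative mirror (J0 (?f t))) (at t)"
    by (rule bounded_linear.has_vector_derivative[OF bm y'])
   ultimately have "((\<lambda>t. y (- t) - mirror (y t)) has_vector_derivative (-1) *\<^sub>R J0 (?f (- t)) - mirror (J0 (?f t))) (at t)"
    by (auto intro!: has_vector_derivative_diff simp: o_def)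
   moreover have "(-1) *\<^sub>R J0 (?f (- t)) - mirror (J0 (?f t)) = 0" by (simp add: mirf J0_def mirror_def)
   ultimately show ?thesis by simp
  qed
  then obtain c where c: "!!t. t \<in> UNIV ==> y (- t) - mirror (y t) = c"
   by (rule has_vector_derivative_zero_constant[OF convex_UNIV]) auto
  have "y 0 = x 0" "mirror (x 0) = x 0" using mirx[of 0] by (simp_all add: y_def)
  hence "c = 0" using c[of 0] by simp
  thus ?thesis using c[of t] by simp
 qed
 \<comment> \<open>Integration by parts over one period.\<close>
 have coef_y: "(2 * pi * real_of_int k) *\<^sub>R fcoef y k = fcoef ?f k" if "k ~= 0" for k
 proof -
  let ?c = "\<lambda>t. cos (2 * pi * real_of_int k * t)" and ?s = "\<lambda>t. sin (2 * pi * real_of_int k * t)"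
  let ?K = "2 * pi * real_of_int k"
  have f1: "((\<lambda>t. fst (y t)) has_vector_derivative - snd (?f t)) (at t)" for t
   using bounded_linear.has_vector_derivative[OF bounded_linear_fst y'[of t]] by (simp add: J0_def)
  have f2: "((\<lambda>t. snd (y t)) has_vector_derivative fst (?f t)) (at t)" for t
   using bounded_linear.has_vector_derivative[OF bounded_linear_snd y'[of t]] by (simp add: J0_def)
  have dc: "(?c has_vector_derivative - ?s t * ?K) (at t)" "(?s has_vector_derivative ?c t * ?K) (at t)" for t
   by (auto intro!: derivative_eq_intros simp: has_real_derivative_iff_has_vector_derivative[symmetric])
  have "((\<lambda>t. ?c t *\<^sub>R snd (y t) - ?s t *\<^sub>R fst (y t)) has_vector_derivative
    (?c t *\<^sub>R fst (?f t) + (- ?s t * ?K) *\<^sub>R snd (y t)) - (?s t *\<^sub>R (- snd (?f t)) + (?c t * ?K) *\<^sub>R fst (y t))) (at t)" for t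
   by (intro has_vector_derivative_diff has_vector_derivative_scaleR f1 f2)
     (use dc in \<open>auto simp: has_real_derivative_iff_has_vector_derivative\<close>)
  hence "integral {0..1} (\<lambda>t. (?c t *\<^sub>R fst (?f t) + (- ?s t * ?K) *\<^sub>R snd (y t)) - (?s t *\<^sub>R (- snd (?f t)) + (?c t * ?K) *\<^sub>R fst (y t)))
   = (?c 1 *\<^sub>R snd (y 1) - ?s 1 *\<^sub>R fst (y 1)) - (?c 0 *\<^sub>R snd (y 0) - ?s 0 *\<^sub>R fst (y 0))"
   by (rule integral_eq_antiderivative) simp
  also have "... = 0" using pery[of 0] cos_shift_int[of k 0] sin_shift_int[of k 0] by simp
  also have "(\<lambda>t. (?c t *\<^sub>R fst (?f t) + (- ?s t * ?K) *\<^sub>R snd (y t)) - (?s t *\<^sub>R (- snd (?f t)) + (?c t * ?K) *\<^sub>R fst (y t)))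
   = (\<lambda>t. (?c t *\<^sub>R fst (?f t) + ?s t *\<^sub>R snd (?f t)) - ?K *\<^sub>R (?c t *\<^sub>R fst (y t) + ?s t *\<^sub>R snd (y t)))"
   by (auto simp: algebra_simps)
  also have "integral {0..1} ... = fcoef ?f k - ?K *\<^sub>R fcoef y k"
   unfolding fcoef_def integral_cmul[symmetric]
   by (intro integral_diff integrable_continuous_interval continuous_intros cdx cy)
  finally show ?thesis by simp
 qed
 define w where "w t = x t - y t" for t
 have "w t = (fcoef w 0, 0)" for t
 proof (rule fourier_uniqueness)
  show "continuous_on UNIV w" unfolding w_def by (intro continuous_intros cx cy)
  fix k :: int assume "k ~= 0"
  have "fcoef w k = fcoef x k - fcoef y k" unfolding w_def[abs_def]
   by (rule fcoef_diff[OF continuous_on_subset[OF cx] cy]) simp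
  moreover have "(2 * pi * real_of_int k) *\<^sub>R (fcoef x k - fcoef y k) = 0"
   using weak[of k] coef_y[OF \<open>k ~= 0\<close>] by (simp add: scaleR_diff_right)
  ultimately show "fcoef w k = 0" using \<open>k ~= 0\<close> by simp
 qed (auto simp: w_def perx pery mirx miry mirror_def)
 moreover have "w 0 = 0" by (simp add: w_def y_def)
 ultimately have "w t = 0" for t by metis
 hence xy: "x = y" by (auto simp: w_def)
 have "integral {0..1} (\<lambda>t. (1/2) * (dh (x t) \<bullet> x t) - h (x t)) >= \<rho>^2"
 proof (rule LIMSEQ_le_const)
  have "uniform_limit UNIV (\<lambda>n t. (\<lambda>p. (1/2) * (dh p \<bullet> p) - h p) (X (r n) t)) (\<lambda>t. (\<lambda>p. (1/2) * (dh p \<bullet> p) - h p) (x t)) sequentially"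
   by (rule uniform_limit_continuous_comp[OF u bd]) (intro continuous_intros dh_cont h_cont)
  hence U: "uniform_limit {0..1} (\<lambda>n t. (1/2) * (dh (X (r n) t) \<bullet> X (r n) t) - h (X (r n) t)) (\<lambda>t. (1/2) * (dh (x t) \<bullet> x t) - h (x t)) sequentially"
   by (rule uniform_limit_on_subset) simp
  have L1: "(\<lambda>n. integral {0..1} (\<lambda>t. (1/2) * (dh (X (r n) t) \<bullet> X (r n) t) - h (X (r n) t))) \<longlonglongrightarrow>
    integral {0..1} (\<lambda>t. (1/2) * (dh (x t) \<bullet> x t) - h (x t))"
   by (rule uniform_limit_integral_tendsto[OF U]) (intro continuous_intros cX)
  have "(\<lambda>n. e (r n) / 2 * sqrt M) \<longlonglongrightarrow> 0 / 2 * sqrt M" by (intro tendsto_intros e_lim') simp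
  hence L2: "(\<lambda>n. e (r n) / 2 * sqrt M) \<longlonglongrightarrow> 0" by simp
  show "(\<lambda>n. integral {0..1} (\<lambda>t. (1/2) * (dh (X (r n) t) \<bullet> X (r n) t) - h (X (r n) t)) + e (r n) / 2 * sqrt M) \<longlonglongrightarrow>
    integral {0..1} (\<lambda>t. (1/2) * (dh (x t) \<bullet> x t) - h (x t))"
   by (rule tendsto_add_zero_right[OF L1 L2])
  show "\<exists>N. \<forall>n\<ge>N. \<rho>^2 <= integral {0..1} (\<lambda>t. (1/2) * (dh (X (r n) t) \<bullet> X (r n) t) - h (X (r n) t)) + e (r n) / 2 * sqrt M"
  proof (intro exI[of _ 0] allI impI)
   fix n
   have "(\<Sum>k\<in>modes (N0 + r n). Grad (N0 + r n) (A (r n)) k \<bullet> A (r n) k) <= e (r n) * sqrt (\<Sum>k\<in>modes (N0 + r n). (norm (A (r n) k))^2)"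
    by (rule Grad_inner_le[OF A(2)]) (use e in \<open>auto intro: less_imp_le\<close>)
   also have "... <= e (r n) * sqrt M" using bnd'[of "r n"] e(1)[of "r n"] by (intro mult_left_mono) auto
   finally show "\<rho>^2 <= integral {0..1} (\<lambda>t. (1/2) * (dh (X (r n) t) \<bullet> X (r n) t) - h (X (r n) t)) + e (r n) / 2 * sqrt M"
    using A(1)[of "r n"] unfolding Phi_eq X_def by linarith
  qed
 qed
 moreover have "\<rho>^2 > 0" using \<rho> by simp
 ultimately have "integral {0..1} (\<lambda>t. (1/2) * (dh (x t) \<bullet> x t) - h (x t)) > 0" by linarith
 moreover have "(x has_vector_derivative J0 (dh (x t))) (at t)" for t using y'[of t] unfolding xy .
 ultimately show ?thesis using that perx mirx by blast
qed

end

context hamiltonian_growth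
begin

text \<open>If \<open>-J z'\<close> lies in \<open>2a\<close> times the subdifferential ball of \<open>\<gamma>\<close> for the loop \<open>z = trig N0 b\<close>, then
  \<open>2\<sigma>\<gamma> \<le> \<gamma>\<^sup>2 + \<sigma>\<^sup>2\<close> bounds the action of every loop in the half space spanned by the nonpositive modes and \<open>z\<close>
  by \<open>a \<integral> \<gamma>\<^sup>2\<close>, up to the defect \<open>a - Act N0 b\<close>.\<close>

lemma Act_le_gauge:
 assumes b0: "!!k. k \<notin> modes N0 ==> b k = 0" and N: "N >= N0" and \<sigma>: "\<sigma> >= 0" and a: "a >= 0"
  and \<gamma>: "continuous_on UNIV \<gamma>"
  and sup: "!!t u. trig N0 (\<lambda>k. (2 * pi * real_of_int k) *\<^sub>R b k) t \<bullet> u <= 2 * a * \<gamma> u"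
  and c: "!!k. k \<in> {1..int N} ==> c k = \<sigma> *\<^sub>R b k"
 shows "Act N c <= a * integral {0..1} (\<lambda>t. (\<gamma> (trig N c t))^2) + \<sigma>^2 * (a - Act N0 b)"
proof -
 let ?x = "trig N c"
 have \<gamma>x: "continuous_on {0..1} (\<lambda>t. \<gamma> (?x t))" by (rule continuous_on_compose2[OF \<gamma>]) (auto intro: continuous_intros)
 have sub: "modes N0 \<subseteq> modes N" using N by (auto simp: modes_def)
 have "Act N c <= pi * (\<Sum>k\<in>modes N. 2 * \<sigma> * (real_of_int k * (b k \<bullet> c k)) - \<sigma>^2 * (real_of_int k * (norm (b k))^2))"
  unfolding Act_def
 proof (intro mult_left_mono sum_mono)
  fix k assume k: "k \<in> modes N"
  have e: "(norm (c k - \<sigma> *\<^sub>R b k))^2 = (norm (c k))^2 - 2 * \<sigma> * (b k \<bullet> c k) + \<sigma>^2 * (norm (b k))^2"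
   by (simp add: power2_norm_eq_inner inner_diff_left inner_diff_right inner_commute power2_eq_square[of \<sigma>] algebra_simps)
  \<comment> \<open>On positive modes c equals \<sigma> b and the term vanishes; on the others the
    factor k is nonpositive. This is where membership in the half space enters.\<close>
  have "real_of_int k * (norm (c k - \<sigma> *\<^sub>R b k))^2 <= 0"
  proof (cases "k >= 1")
   case True
   thus ?thesis using c[of k] k by (simp add: modes_def)
  qed (auto intro: mult_nonpos_nonneg)
  thus "real_of_int k * (norm (c k))^2 <= 2 * \<sigma> * (real_of_int k * (b k \<bullet> c k)) - \<sigma>^2 * (real_of_int k * (norm (b k))^2)"
   unfolding e by (simp add: algebra_simps)
 qed auto
 also have "(\<Sum>k\<in>modes N. 2 * \<sigma> * (real_of_int k * (b k \<bullet> c k)) - \<sigma>^2 * (real_of_int k * (norm (b k))^2))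
   = (\<Sum>k\<in>modes N0. 2 * \<sigma> * (real_of_int k * (b k \<bullet> c k)) - \<sigma>^2 * (real_of_int k * (norm (b k))^2))"
  by (rule sum.mono_neutral_right) (use sub b0 in auto)
 also have "pi * ... = \<sigma> * (\<Sum>k\<in>modes N0. ((2 * pi * real_of_int k) *\<^sub>R b k) \<bullet> c k) - \<sigma>^2 * Act N0 b"
  unfolding Act_def sum_distrib_left sum_subtractf[symmetric] by (rule sum.cong) (auto simp: algebra_simps)
 also have "(\<Sum>k\<in>modes N0. ((2 * pi * real_of_int k) *\<^sub>R b k) \<bullet> c k) = (\<Sum>k\<in>modes N0. ((2 * pi * real_of_int k) *\<^sub>R b k) \<bullet> fcoef ?x k)"
  by (rule sum.cong) (use sub in \<open>auto simp: fcoef_trig\<close>)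
 also have "... = integral {0..1} (\<lambda>t. trig N0 (\<lambda>k. (2 * pi * real_of_int k) *\<^sub>R b k) t \<bullet> ?x t)"
  by (rule integral_trig_inner[symmetric]) (intro continuous_intros)
 also have "\<sigma> * integral {0..1} (\<lambda>t. trig N0 (\<lambda>k. (2 * pi * real_of_int k) *\<^sub>R b k) t \<bullet> ?x t)
   <= integral {0..1} (\<lambda>t. a * (\<gamma> (?x t))^2 + a * \<sigma>^2)"
  unfolding integral_mult_right[symmetric]
 proof (rule integral_le)
  fix t :: real
  have "\<sigma> * (trig N0 (\<lambda>k. (2 * pi * real_of_int k) *\<^sub>R b k) t \<bullet> ?x t) <= \<sigma> * (2 * a * \<gamma> (?x t))" using sup \<sigma> by (rule mult_left_mono)
  also have "... = a * (2 * \<gamma> (?x t) * \<sigma>)" by simp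
  also have "... <= a * ((\<gamma> (?x t))^2 + \<sigma>^2)" by (rule mult_left_mono[OF sum_squares_bound a])
  finally show "\<sigma> * (trig N0 (\<lambda>k. (2 * pi * real_of_int k) *\<^sub>R b k) t \<bullet> ?x t) <= a * (\<gamma> (?x t))^2 + a * \<sigma>^2" by (simp add: distrib_left)
 qed (intro integrable_continuous_interval continuous_intros \<gamma>x)+
 also have "... = a * integral {0..1} (\<lambda>t. (\<gamma> (?x t))^2) + a * \<sigma>^2"
  by (subst integral_add) (auto intro!: integrable_continuous_interval continuous_intros \<gamma>x)
 finally show ?thesis by (simp add: algebra_simps)
qed

text \<open>On the half space \<open>Act_le_gauge\<close> and \<open>hlow\<close> leave -2 e times
  the integral G of the squared gauge, plus the defect. As G is at least the L2 norm squared over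
  R^2, part of it absorbs the defect and the rest makes \<open>Phi\<close> nonpositive far out,
  which is the linking condition.\<close>

theorem brake_orbit_exists_of_loop:
 assumes b0: "!!k. k \<notin> modes N0 ==> b k = 0" and a: "a >= 0" and R: "R > 0" and e: "e > 0"
  and g: "continuous_on UNIV g" and gR: "!!u. norm u <= R * g u"
  and sup: "!!t u. trig N0 (\<lambda>k. (2 * pi * real_of_int k) *\<^sub>R b k) t \<bullet> u <= 2 * a * g u"
  and pos: "Act N0 b > 0"
  and defect: "a - Act N0 b <= e * (\<Sum>k\<in>{1..int N0}. (norm (b k))^2) / R^2"
  and hlow: "!!p. h p >= (a + 2 * e) * (g p)^2 - C"
 obtains x where "!!t. (x has_vector_derivative J0 (dh (x t))) (at t)" "!!t. x (t + 1) = x t" "!!t. x (- t) = mirror (x t)"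
  "integral {0..1} (\<lambda>t. (1/2) * (dh (x t) \<bullet> x t) - h (x t)) > 0"
proof -
 define V where "V = (\<Sum>k\<in>{1..int N0}. real_of_int k * (norm (b k))^2)"
 define Q where "Q = (\<Sum>k\<in>{1..int N0}. (norm (b k))^2)"
 have "pi * V > 0" using pos Act_le[of N0 b] by (simp add: V_def)
 hence V: "V > 0" by (simp add: zero_less_mult_iff)
 have Q: "Q > 0"
 proof (rule ccontr)
  assume "\<not> Q > 0"
  hence "Q = 0" unfolding Q_def by (smt (verit) sum_nonneg zero_le_power2)
  hence "\<forall>k\<in>{1..int N0}. b k = 0" unfolding Q_def by (subst (asm) sum_nonneg_eq_0_iff) auto
  thus False using V by (simp add: V_def)
 qed
 \<comment> \<open>The linking statement wants the weighted norm of the positive part to be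
   1.\<close>
 define b' where "b' k = (1 / sqrt V) *\<^sub>R b k" for k
 show ?thesis
 proof (rule brake_orbit_exists[of N0 b'])
  show "b' k = 0" if "k > int N0" for k using b0[of k] that by (auto simp: b'_def modes_def)
  have "(\<Sum>k\<in>{1..int N0}. real_of_int k * (norm (b' k))^2) = (\<Sum>k\<in>{1..int N0}. real_of_int k * (norm (b k))^2 / V)"
   by (rule sum.cong) (use V in \<open>auto simp: b'_def power_divide\<close>)
  thus "(\<Sum>k\<in>{1..int N0}. real_of_int k * (norm (b' k))^2) = 1" using V by (simp add: V_def flip: sum_divide_distrib)
 next
  fix N assume N: "N >= N0"
  \<comment> \<open>The factor by which the coordinates \<open>s^2 + T\<close> of the half space
    overestimate the actual L2 norm squared \<open>T + \<sigma>^2 * Q\<close>.\<close>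
  define m where "m = min 1 (Q / V)"
  have m: "m > 0" using Q V by (simp add: m_def)
  \<comment> \<open>Solves \<open>e * m * R'^2 / R^2 = |C|\<close>, so that beyond this radius the
    surplus beats the constant C.\<close>
  define R' where "R' = sqrt (\<bar>C\<bar> * R^2 / (e * m))"
  have R': "R'^2 = \<bar>C\<bar> * R^2 / (e * m)" using e m by (simp add: R'_def)
  have "Phi N c <= 0" if s: "s >= 0" and c: "\<forall>k\<in>{1..int N}. c k = s *\<^sub>R b' k" and far: "s^2 + (\<Sum>k\<in>{-int N..0}. (norm (c k))^2) >= R'^2" for c s
  proof -
   define \<sigma> where "\<sigma> = s / sqrt V"
   have \<sigma>: "\<sigma> >= 0" "\<sigma>^2 = s^2 / V" using s V by (auto simp: \<sigma>_def power_divide)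
   have c\<sigma>: "c k = \<sigma> *\<^sub>R b k" if "k \<in> {1..int N}" for k using c that by (simp add: \<sigma>_def b'_def)
   define T where "T = (\<Sum>k\<in>{-int N..0}. (norm (c k))^2)"
   have T: "T >= 0" by (simp add: T_def sum_nonneg)
   let ?x = "trig N c"
   have gx: "continuous_on {0..1} (\<lambda>t. g (?x t))" by (rule continuous_on_compose2[OF g]) (auto intro: continuous_intros)
   define G where "G = integral {0..1} (\<lambda>t. (g (?x t))^2)"
   have "(\<Sum>k\<in>{1..int N}. (norm (c k))^2) = (\<Sum>k\<in>{1..int N0}. \<sigma>^2 * (norm (b k))^2)"
    by (rule sum.mono_neutral_cong_right) (use N b0 c\<sigma> in \<open>auto simp: modes_def power_mult_distrib\<close>)
   hence sq: "(\<Sum>k\<in>modes N. (norm (c k))^2) = T + \<sigma>^2 * Q"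
    unfolding modes_split(1) T_def Q_def by (subst sum.union_disjoint) (auto simp flip: sum_distrib_left)
   have "T + \<sigma>^2 * Q = integral {0..1} (\<lambda>t. (norm (?x t))^2)" by (simp add: integral_trig_norm sq)
   also have "... <= integral {0..1} (\<lambda>t. R^2 * (g (?x t))^2)"
   proof (rule integral_le)
    fix t :: real
    show "(norm (?x t))^2 <= R^2 * (g (?x t))^2" 
     using power_mono[OF gR[of "?x t"], of 2] by (simp add: power_mult_distrib)
   qed (intro integrable_continuous_interval continuous_intros gx)+
   finally have G: "(T + \<sigma>^2 * Q) / R^2 <= G" using R by (simp add: G_def field_simps)
   have "(a + 2 * e) * G - C = integral {0..1} (\<lambda>t. (a + 2 * e) * (g (?x t))^2 - C)"
    unfolding G_def by (subst integral_diff) (auto intro!: integrable_continuous_interval continuous_intros gx)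
   also have "... <= integral {0..1} (\<lambda>t. h (?x t))"
    by (rule integral_le) (use hlow in \<open>auto intro!: integrable_continuous_interval continuous_intros gx\<close>)
   finally have hi: "(a + 2 * e) * G - C <= integral {0..1} (\<lambda>t. h (?x t))" .
   have "Act N c <= a * G + \<sigma>^2 * (a - Act N0 b)" unfolding G_def
    by (rule Act_le_gauge[OF b0 N \<sigma>(1) a g sup c\<sigma>])
   also have "... <= a * G + \<sigma>^2 * (e * Q / R^2)" using defect by (intro add_left_mono mult_left_mono) (auto simp: Q_def)
   finally have "Phi N c <= - (2 * e * G) + e * (\<sigma>^2 * Q / R^2) + C" using hi unfolding Phi_def by (simp add: algebra_simps)
   moreover have "2 * e * ((T + \<sigma>^2 * Q) / R^2) <= 2 * e * G" using G e by (intro mult_left_mono) auto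
   moreover have "2 * e * ((T + \<sigma>^2 * Q) / R^2) = 2 * (e * (T / R^2)) + 2 * (e * (\<sigma>^2 * Q / R^2))" by (simp add: add_divide_distrib algebra_simps)
   moreover have "e * (T / R^2) >= 0" using T e by simp
   moreover have "e * (T / R^2) + e * (\<sigma>^2 * Q / R^2) >= C"
   proof -
    have "m * (s^2 + T) <= T + \<sigma>^2 * Q"
    proof -
     have "m * s^2 <= Q / V * s^2" by (intro mult_right_mono) (auto simp: m_def)
     moreover have "m * T <= 1 * T" using T by (intro mult_right_mono) (auto simp: m_def)
     ultimately show ?thesis by (simp add: \<sigma> distrib_left mult.commute)
    qed
    moreover have "m * R'^2 <= m * (s^2 + T)" using far m by (intro mult_left_mono) (auto simp: T_def)
    ultimately have "m * R'^2 <= T + \<sigma>^2 * Q" by linarith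
    hence "e * (m * R'^2) / R^2 <= e * (T + \<sigma>^2 * Q) / R^2" using e by (intro divide_right_mono mult_left_mono) auto
    moreover have "e * (m * R'^2) / R^2 = \<bar>C\<bar>" using e m R by (simp add: R')
    ultimately have "\<bar>C\<bar> <= e * (T + \<sigma>^2 * Q) / R^2" by simp
    thus ?thesis by (simp add: add_divide_distrib distrib_left)
   qed
   ultimately show ?thesis by linarith
  qed
  thus "\<exists>R. \<forall>a s. s >= 0 --> (\<forall>k\<in>{1..int N}. a k = s *\<^sub>R b' k) -->
    s\<^sup>2 + (\<Sum>k\<in>{-int N..0}. (norm (a k))^2) >= R^2 --> Phi N a <= 0" by blast
 qed (use that in blast)
qed

end

section \<open>Characteristics as loops\<close>

lemma omega0_linear: "linear (omega0 u)" "linear (\<lambda>u. omega0 u v)"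
 unfolding omega0_def by (intro linearI; simp add: inner_add_left inner_add_right algebra_simps)+

lemma omega0_antisym: "omega0 u v = - omega0 v u"
 by (simp add: omega0_def inner_commute)

lemma omega0_nondegenerate: "(!!v. omega0 u v = 0) ==> u = 0"
 unfolding omega0_eq by (metis inner_eq_zero_iff norm_J0 norm_eq_zero)

lemma dim_isotropic_le:
 fixes V :: "'n::finite pt set"
 assumes V: "subspace V" and iso: "!!u v. u \<in> V ==> v \<in> V ==> omega0 u v = 0"
 shows "dim V <= CARD('n)"
proof -
 have "dim (V \<union> J0 ` V) = dim V + dim (J0 ` V)"
  by (rule dim_orthogonal_sum) (use iso in \<open>auto simp: orthogonal_def omega0_eq inner_commute\<close>)
 also have "dim (J0 ` V) = dim V"
  by (rule dim_image_eq[OF linear_J0]) (metis J0_J0 inj_onI neg_equal_iff_equal)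
 finally have "dim V + dim V <= DIM('n pt)" using dim_subset_UNIV[of "V \<union> J0 ` V"] by simp
 thus ?thesis by simp
qed

text \<open>Both eigenspaces of \<open>\<tau>\<close> are isotropic and together span, so both have
  dimension n. The form pairs them without degeneracy; correcting a parametrisation of the second by
  the inverse of this pairing makes the pairing standard.\<close>

lemma symplectic_normal_form:
 fixes \<tau> :: "'n::finite pt => 'n pt"
 assumes \<tau>: "lin_antisymp_involution \<tau>"
 obtains a f :: "'n pt => 'n pt" where "linear a" "linear f" "!!u. a (f u) = u" "!!u. f (a u) = u"
  "!!u v. omega0 (a u) (a v) = omega0 u v" "!!u. a (mirror u) = \<tau> (a u)"
proof -
 have lin: "linear \<tau>" and anti: "!!u v. omega0 (\<tau> u) (\<tau> v) = - omega0 u v" and inv: "!!p. \<tau> (\<tau> p) = p"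
  using \<tau> by (auto simp: lin_antisymp_involution_def)
 define P where "P = {p. \<tau> p = p}"
 define M where "M = {p. \<tau> p = - p}"
 note tl = linear_add[OF lin] linear_cmul[OF lin] linear_0[OF lin] linear_neg[OF lin] linear_diff[OF lin]
 have sP: "subspace P" and sM: "subspace M" by (auto simp: P_def M_def subspace_def tl)
 have iP: "omega0 u v = 0" if "u \<in> P" "v \<in> P" for u v using anti[of u v] that by (simp add: P_def)
 have om: "omega0 (- u) (- v) = omega0 u v" for u v :: "'n pt" by (simp add: omega0_def)
 have iM: "omega0 u v = 0" if "u \<in> M" "v \<in> M" for u v using anti[of u v] that by (simp add: M_def om)
 have split: "\<exists>q\<in>P. \<exists>r\<in>M. p = q + r" for p
  by (intro bexI[of _ "(1/2) *\<^sub>R (p + \<tau> p)"] bexI[of _ "(1/2) *\<^sub>R (p - \<tau> p)"])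
    (auto simp: P_def M_def tl inv algebra_simps simp flip: scaleR_add_left)
 have self_neg: "p = 0" if "p = - p" for p :: "'n pt"
 proof -
  have "p + p = 0" using that by (metis add.left_inverse)
  hence "2 *\<^sub>R p = 0" by (simp add: scaleR_2)
  thus ?thesis by simp
 qed
 have "P \<inter> M = {0}"
 proof
  show "P \<inter> M \<subseteq> {0}" unfolding P_def M_def by (auto intro: self_neg)
  show "{0} \<subseteq> P \<inter> M" by (simp add: P_def M_def tl)
 qed
 hence "dim {x + y |x y. x \<in> P \<and> y \<in> M} = dim P + dim M" using dim_sums_Int[OF sP sM] by simp
 moreover have "{x + y |x y. x \<in> P \<and> y \<in> M} = UNIV" using split by blast
 ultimately have "dim P + dim M = 2 * CARD('n)" by simp
 hence dims: "dim P = CARD('n)" "dim M = CARD('n)" using dim_isotropic_le[OF sP iP] dim_isotropic_le[OF sM iM] by linarith+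
 obtain \<alpha> :: "real^'n => 'n pt" where \<alpha>: "linear \<alpha>" "range \<alpha> = P"
  by (rule isometries_subspaces[of "UNIV :: (real^'n) set" P]) (use sP dims in auto)
 obtain \<alpha>' :: "real^'n => 'n pt" and g where \<alpha>': "linear \<alpha>'" "range \<alpha>' = M" "!!x. g (\<alpha>' x) = x"
  by (rule isometries_subspaces[of "UNIV :: (real^'n) set" M]) (use sM dims in auto)
 \<comment> \<open>The pairing of the eigenspaces as a linear map:
   \<open>omega0 (\<alpha> x) (\<alpha>' y)\<close> equals \<open>x \<bullet> T y\<close>.\<close>
 define T where "T y = (\<chi> i. omega0 (\<alpha> (axis i 1)) (\<alpha>' y))" for y
 have linT: "linear T" unfolding T_def
  by (rule linearI) (simp_all add: vec_eq_iff linear_add[OF \<alpha>'(1)] linear_cmul[OF \<alpha>'(1)] linear_add[OF omega0_linear(1)] linear_cmul[OF omega0_linear(1)])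
 have \<alpha>sum: "\<alpha> x = (\<Sum>i\<in>UNIV. x $ i *\<^sub>R \<alpha> (axis i 1))" for x
 proof -
  have "\<alpha> x = \<alpha> (\<Sum>i\<in>UNIV. x $ i *\<^sub>R axis i 1)" using basis_expansion[of x] by (simp add: scalar_mult_eq_scaleR)
  thus ?thesis by (simp add: linear_sum[OF \<alpha>(1)] linear_cmul[OF \<alpha>(1)])
 qed
 have om_T: "omega0 (\<alpha> x) (\<alpha>' y) = x \<bullet> T y" for x y
 proof -
  have "omega0 (\<alpha> x) (\<alpha>' y) = (\<Sum>i\<in>UNIV. x $ i * omega0 (\<alpha> (axis i 1)) (\<alpha>' y))"
   unfolding \<alpha>sum[of x] by (simp add: linear_sum[OF omega0_linear(2)] linear_cmul[OF omega0_linear(2)])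
  thus ?thesis by (simp add: T_def inner_vec_def)
 qed
 have "inj T"
 proof (rule linear_injective_0[OF linT, THEN iffD2], intro allI impI)
  fix y assume "T y = 0"
  have "omega0 (\<alpha>' y) v = 0" for v
  proof -
   obtain q r where qr: "q \<in> P" "r \<in> M" "v = q + r" using split by blast
   obtain x where "q = \<alpha> x" using qr \<alpha>(2) by blast
   hence "omega0 (\<alpha>' y) q = 0" using om_T[of x y] \<open>T y = 0\<close> omega0_antisym[of "\<alpha>' y" q] by simp
   moreover have "omega0 (\<alpha>' y) r = 0" using iM qr \<alpha>'(2) by blast
   ultimately show ?thesis by (simp add: qr linear_add[OF omega0_linear(1)])
  qed
  hence "\<alpha>' y = 0" by (rule omega0_nondegenerate)
  thus "y = 0" using \<alpha>'(3)[of y] \<alpha>'(3)[of 0] linear_0[OF \<alpha>'(1)] by simp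
 qed
 then obtain S where S: "linear S" "!!x. T (S x) = x" using linear_injective_isomorphism[OF linT] by blast
 define a where "a p = \<alpha> (fst p) + \<alpha>' (S (snd p))" for p
 have lina: "linear a" unfolding a_def
  by (rule linearI) (simp_all add: linear_add[OF \<alpha>(1)] linear_cmul[OF \<alpha>(1)] linear_add[OF \<alpha>'(1)] linear_cmul[OF \<alpha>'(1)] linear_add[OF S(1)] linear_cmul[OF S(1)] algebra_simps)
 have symp: "omega0 (a u) (a v) = omega0 u v" for u v
 proof -
  have 1: "omega0 (\<alpha> x) (\<alpha> y) = 0" "omega0 (\<alpha>' x) (\<alpha>' y) = 0" for x y using iP iM \<alpha>(2) \<alpha>'(2) by blast+
  have 2: "omega0 (\<alpha>' (S y)) (\<alpha> x) = - (y \<bullet> x)" for x y using om_T[of x "S y"] omega0_antisym[of "\<alpha>' (S y)" "\<alpha> x"] by (simp add: S inner_commute)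
  show ?thesis unfolding a_def 
   by (simp add: linear_add[OF omega0_linear(1)] linear_add[OF omega0_linear(2)] 1 2 om_T S) (simp add: omega0_def)
 qed
 have "inj a"
 proof (rule linear_injective_0[OF lina, THEN iffD2], intro allI impI)
  fix u assume "a u = 0"
  hence "omega0 u v = 0" for v using symp[of u v] linear_0[OF omega0_linear(2), of "a v"] by simp
  thus "u = 0" by (rule omega0_nondegenerate)
 qed
 then obtain f where f: "linear f" "!!x. f (a x) = x" "!!x. a (f x) = x" using linear_injective_isomorphism[OF lina] by blast
 have "a (mirror u) = \<tau> (a u)" for u
 proof -
  have "\<tau> (\<alpha> x) = \<alpha> x" for x using \<alpha>(2) by (auto simp: P_def)
  moreover have "\<tau> (\<alpha>' x) = - \<alpha>' x" for x using \<alpha>'(2) by (auto simp: M_def)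
  ultimately show ?thesis by (simp add: a_def mirror_def tl linear_neg[OF \<alpha>'(1)] linear_neg[OF S(1)])
 qed
 thus ?thesis using that[OF lina f(1,3,2) symp] by blast
qed

text \<open>The way back from inequalities for increments to derivatives: an error of order h^2
  disappears.\<close>

lemma derivative_le_of_increment:
 fixes F :: "real => real"
 assumes F: "(F has_real_derivative D) (at s)" and inc: "!!h. 0 < h ==> h < 1 ==> F (s + h) - F s <= c * h + C * h^2"
 shows "D <= c"
proof (rule tendsto_le[of "at_right (0::real)"])
 have "((\<lambda>h. (F (s + h) - F s) / h) \<longlongrightarrow> D) (at 0)" using F by (simp add: DERIV_def)
 thus "((\<lambda>h. (F (s + h) - F s) / h) \<longlongrightarrow> D) (at_right 0)" by (rule filterlim_mono) (auto simp: at_le)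
 have "((\<lambda>h::real. c + C * h) \<longlongrightarrow> c + C * 0) (at_right 0)" by (intro tendsto_intros)
 thus "((\<lambda>h::real. c + C * h) \<longlongrightarrow> c) (at_right 0)" by simp
 have "\<forall>\<^sub>F h in at_right (0::real). h \<in> {0<..<1}" by (rule eventually_at_right_real) simp
 thus "\<forall>\<^sub>F h in at_right 0. (F (s + h) - F s) / h <= c + C * h"
 proof eventually_elim
  case (elim h)
  thus ?case using inc[of h] by (simp add: field_simps power2_eq_square)
 qed
qed simp

lemma norm_le_of_omega_bound:
 assumes up: "!!u. - omega0 v u <= c * \<gamma> u" and \<gamma>: "!!u. \<gamma> u <= K * norm u" and c: "c >= 0" and K: "K >= 0"
 shows "norm v <= c * K"
proof (cases "v = 0")
 case True
 thus ?thesis using c K by simp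
next
 case False
 have "norm v * norm v = - omega0 v (- J0 v)" by (simp add: omega0_eq flip: power2_eq_square power2_norm_eq_inner)
 also have "... <= c * \<gamma> (- J0 v)" by (rule up)
 also have "... <= c * (K * norm (- J0 v))" by (rule mult_left_mono[OF \<gamma> c])
 finally have "norm v * norm v <= (c * K) * norm v" by simp
 thus ?thesis using False by simp
qed

lemma omega0_diff_left: "omega0 (u - v) w = omega0 u w - omega0 v w"
 and omega0_diff_right: "omega0 w (u - v) = omega0 w u - omega0 w v"
 by (simp_all add: omega0_def inner_add_left inner_add_right inner_diff_left inner_diff_right)

lemma bounded_linear_omega0_left: "bounded_linear (\<lambda>u. omega0 u v)"
 unfolding omega0_eq using bounded_linear_compose[OF bounded_linear_inner_left[of v] bounded_linear_J0] by (simp add: o_def)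

lemma abs_omega0_le: "\<bar>omega0 u v\<bar> <= norm u * norm v"
 unfolding omega0_eq using Cauchy_Schwarz_ineq2[of "J0 u" v] by simp

section \<open>Mollification of characteristic loops\<close>

text \<open>The inequality \<open>up\<close> is linear in z, so averages of translates satisfy it
  exactly. The inequality \<open>low\<close> is quadratic: its averaged form costs the Lipschitz
  constant times the mean distance between z and its translates, which is made small.\<close>

lemma mollified_loop:
 fixes z :: "real => 'n::finite pt"
 assumes per: "!!t. z (t + 1) = z t" and mir: "!!t. z (- t) = mirror (z t)"
  and a: "a > 0" and \<gamma>: "!!u. \<gamma> u <= K * norm u" and K: "K >= 0" and \<eta>: "\<eta> > 0"
  and up: "!!s h u. [|0 <= h; h <= 1|] ==> - omega0 (z (s + h) - z s) u <= 2 * a * h * \<gamma> u"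
  and low: "!!s h. [|0 <= h; h <= 1|] ==> - omega0 (z (s + h) - z s) (z s) >= 2 * a * h - C * h^2"
 obtains N b where "!!k. k \<notin> modes N ==> b k = 0"
  "!!t u. trig N (\<lambda>k. (2 * pi * real_of_int k) *\<^sub>R b k) t \<bullet> u <= 2 * a * \<gamma> u"
  "pi * (\<Sum>k\<in>modes N. real_of_int k * (norm (b k))^2) >= a - \<eta>"
  "(\<Sum>k\<in>modes N. (2 * pi * real_of_int k)^2 * (norm (b k))^2) <= (2 * a * K)^2"
proof -
 define \<Lambda> where "\<Lambda> = 2 * a * K"
 have lip: "norm (z (s + h) - z s) <= \<Lambda> * h" if "0 <= h" "h <= 1" for s h
  using norm_le_of_omega_bound[of "z (s + h) - z s" "2 * a * h" \<gamma> K] up[OF that] \<gamma> a that K by (simp add: \<Lambda>_def mult_ac)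
 have \<Lambda>0: "\<Lambda> >= 0" using lip[of 1 0] norm_ge_zero[of "z (0 + 1) - z 0"] by linarith
 have lip': "norm (z t - z s) <= \<Lambda> * \<bar>t - s\<bar>" if "\<bar>t - s\<bar> <= 1" for s t
  using lip[of "t - s" s] lip[of "s - t" t] that by (cases "s <= t") (auto simp: abs_if norm_minus_commute)
 have z: "continuous_on UNIV z"
 proof (unfold continuous_on_iff, intro ballI allI impI)
  fix s e :: real assume e: "0 < e"
  show "\<exists>d>0. \<forall>x'\<in>UNIV. dist x' s < d --> dist (z x') (z s) < e"
  proof (intro exI[of _ "min 1 (e / (\<Lambda> + 1))"] conjI ballI impI)
   show "0 < min 1 (e / (\<Lambda> + 1))" using e \<Lambda>0 by simp
   fix t assume t: "dist t s < min 1 (e / (\<Lambda> + 1))"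
   have "norm (z t - z s) <= \<Lambda> * \<bar>t - s\<bar>" using t by (intro lip') (auto simp: dist_real_def)
   also have "... <= \<Lambda> * (e / (\<Lambda> + 1))" using t \<Lambda>0 by (intro mult_left_mono) (auto simp: dist_real_def)
   also have "... < e" using e \<Lambda>0 by (simp add: field_simps)
   finally show "dist (z t) (z s) < e" by (simp add: dist_norm)
  qed
 qed
 have zc: "continuous_on S (\<lambda>x. z (f x))" if "continuous_on S f" for f :: "real => real" and S
  using continuous_on_compose2[OF z that] by auto
 obtain B where B: "B >= 0" "!!t. norm (z t) <= B" using periodic_bounded[OF z per] by blast
 \<comment> \<open>Two errors of size 2 \<Lambda> e1 occur, one in the lower inequality and one in
   replacing z by y. Each is at most \<eta>, and the action is half of the integral.\<close>
 define e1 where "e1 = \<eta> / (2 * (\<Lambda> + 1))"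
 have e1: "e1 > 0" using \<eta> \<Lambda>0 by (simp add: e1_def)
 obtain \<delta> where d: "0 < \<delta>" "\<delta> <= 1/2" "!!s r. \<bar>r\<bar> < \<delta> ==> norm (z (s - r) - z s) < e1"
  using periodic_uniformly_continuous[OF z per e1] by blast
 define e2 where "e2 = e1 / (2 * B + 1)"
 have e2: "e2 > 0" "e2 * (2 * B) <= e1" using e1 B by (auto simp: e2_def field_simps)
 obtain N q where k: "!!k. q (-k) = q k" "integral {-(1/2)..1/2} (ckernel N q) = 1" "!!t. ckernel N q t >= 0"
   "!!t. [|\<delta> <= \<bar>t\<bar>; \<bar>t\<bar> <= 1/2|] ==> ckernel N q t <= e2" using approximate_identity[OF d(1,2) e2(1)] by metis
 define b where "b k = (if k \<in> modes N then q k *\<^sub>R fcoef z k else 0)" for k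
 define y where "y = trig N b"
 have yc: "y s = convol N q z s" for s
 proof -
  have "convol N q z s = trig N (\<lambda>k. q k *\<^sub>R fcoef z k) s"
   by (rule convol_trig) (use z per mir k in auto)
  thus ?thesis unfolding y_def trig_def by (simp add: b_def)
 qed
 let ?g = "trig N (\<lambda>k. (2 * pi * real_of_int k) *\<^sub>R b k)"
 have y': "(y has_vector_derivative J0 (?g s)) (at s)" for s unfolding y_def by (rule trig_has_vector_derivative)
 have cK: "continuous_on S (ckernel N q)" for S by (rule continuous_on_ckernel[OF continuous_on_id])
 have inc: "omega0 (y (s + h) - y s) u = integral {-(1/2)..1/2} (\<lambda>r. ckernel N q r * omega0 (z (s - r + h) - z (s - r)) u)" for s h u
 proof -
  have int: "(\<lambda>r. ckernel N q r *\<^sub>R z (t - r)) integrable_on {-(1/2)..1/2}" for t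
   by (intro integrable_continuous_interval continuous_intros cK zc)
  have "y (s + h) - y s = integral {-(1/2)..1/2} (\<lambda>r. ckernel N q r *\<^sub>R z (s + h - r) - ckernel N q r *\<^sub>R z (s - r))"
   unfolding yc convol_alt[OF z per] by (rule integral_diff[OF int int, symmetric])
  also have "(\<lambda>r. ckernel N q r *\<^sub>R z (s + h - r) - ckernel N q r *\<^sub>R z (s - r)) = (\<lambda>r. ckernel N q r *\<^sub>R (z (s - r + h) - z (s - r)))"
   by (auto simp: algebra_simps)
  finally have e: "y (s + h) - y s = integral {-(1/2)..1/2} (\<lambda>r. ckernel N q r *\<^sub>R (z (s - r + h) - z (s - r)))" .
  have int2: "(\<lambda>r. ckernel N q r *\<^sub>R (z (s - r + h) - z (s - r))) integrable_on {-(1/2)..1/2}"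
   by (intro integrable_continuous_interval continuous_intros cK zc)
  have "omega0 (y (s + h) - y s) u = integral {-(1/2)..1/2} (\<lambda>r. omega0 (ckernel N q r *\<^sub>R (z (s - r + h) - z (s - r))) u)"
   unfolding e using integral_linear[OF int2 bounded_linear_omega0_left[of u]] by (simp add: o_def)
  thus ?thesis by (simp add: omega0_def algebra_simps)
 qed
 have icK: "(\<lambda>r. ckernel N q r * omega0 (z (s - r + h) - z (s - r)) u) integrable_on {-(1/2)..1/2}" for s h u
  unfolding omega0_def by (intro integrable_continuous_interval continuous_intros cK zc)
 have der: "((\<lambda>t. - omega0 (y t) u) has_real_derivative ?g s \<bullet> u) (at s)" for s u
 proof -
  have "((\<lambda>t. - omega0 (y t) u) has_vector_derivative - omega0 (J0 (?g s)) u) (at s)"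
   by (intro has_vector_derivative_minus bounded_linear.has_vector_derivative[OF bounded_linear_omega0_left y'])
  thus ?thesis by (simp add: omega0_eq has_real_derivative_iff_has_vector_derivative)
 qed
 have sup: "?g s \<bullet> u <= 2 * a * \<gamma> u" for s u
 proof (rule derivative_le_of_increment[OF der, where C = 0])
  fix h :: real assume h: "0 < h" "h < 1"
  have "- omega0 (y (s + h)) u - - omega0 (y s) u = - omega0 (y (s + h) - y s) u" by (simp add: omega0_diff_left)
  also have "... = integral {-(1/2)..1/2} (\<lambda>r. - (ckernel N q r * omega0 (z (s - r + h) - z (s - r)) u))"
   unfolding inc by (rule integral_neg[symmetric])
  also have "... <= integral {-(1/2)..1/2} (\<lambda>r. ckernel N q r * (2 * a * h * \<gamma> u))"
  proof (rule integral_le)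
   fix r show "- (ckernel N q r * omega0 (z (s - r + h) - z (s - r)) u) <= ckernel N q r * (2 * a * h * \<gamma> u)"
    using mult_left_mono[OF up[of h "s - r" u] k(3)[of r]] h by simp
  next
   show "(\<lambda>r. - (ckernel N q r * omega0 (z (s - r + h) - z (s - r)) u)) integrable_on {-(1/2)..1/2}" by (rule integrable_neg[OF icK])
  qed (intro integrable_continuous_interval continuous_intros cK)
  also have "... = 2 * a * h * \<gamma> u" using k(2) by simp
  finally show "- omega0 (y (s + h)) u - - omega0 (y s) u <= 2 * a * \<gamma> u * h + 0 * h^2" by (simp add: mult_ac)
 qed
 have ng: "norm (?g s) <= \<Lambda>" for s
 proof -
  have "norm (J0 (?g s)) <= 2 * a * K"
   by (rule norm_le_of_omega_bound[where \<gamma> = \<gamma>]) (use sup \<gamma> a K in \<open>auto simp: omega0_eq\<close>)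
  thus ?thesis by (simp add: \<Lambda>_def)
 qed
 have ap: "norm (y s - z s) <= 2 * e1" for s
  using convol_approx[OF k(2,3,4) _ _ z per _ B(2), where \<eta> = e1 and s = s] d(3) e1 e2 unfolding yc by (smt (verit))
 have lower: "?g s \<bullet> z s >= 2 * a - \<Lambda> * (2 * e1)" for s
 proof -
  have "- (?g s \<bullet> z s) <= - (2 * a - \<Lambda> * (2 * e1))"
  proof (rule derivative_le_of_increment[where F = "\<lambda>t. omega0 (y t) (z s)" and s = s and C = "\<bar>C\<bar>"])
   show "((\<lambda>t. omega0 (y t) (z s)) has_real_derivative - (?g s \<bullet> z s)) (at s)"
    using DERIV_minus[OF der[of "z s" s]] by simp
   fix h :: real assume h: "0 < h" "h < 1"
   define p where "p r = norm (z s - z (s - r))" for r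
   have cp: "continuous_on S p" for S unfolding p_def by (intro continuous_intros zc)
   have "norm (integral {-(1/2)..1/2} (\<lambda>r. ckernel N q r *\<^sub>R p r)) <= e1 + e2 * (2 * B)"
   proof (rule ckernel_integral_bound[OF k(2,3,4) cp])
    show "norm (p r) <= e1" if "\<bar>r\<bar> < \<delta>" for r using d(3)[OF that, of s] by (simp add: p_def norm_minus_commute)
    show "norm (p r) <= 2 * B" for r 
     using norm_triangle_ineq4[of "z s" "z (s - r)"] B(2)[of s] B(2)[of "s - r"] by (simp add: p_def)
   qed (use e1 e2 B in auto)
   hence pI: "integral {-(1/2)..1/2} (\<lambda>r. ckernel N q r * p r) <= 2 * e1" using e2 by (simp add: abs_le_iff)
   have "omega0 (y (s + h)) (z s) - omega0 (y s) (z s) = integral {-(1/2)..1/2} (\<lambda>r. ckernel N q r * omega0 (z (s - r + h) - z (s - r)) (z s))"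
    unfolding inc[symmetric] by (simp add: omega0_diff_left)
   also have "... <= integral {-(1/2)..1/2} (\<lambda>r. ckernel N q r * (- (2 * a * h) + \<bar>C\<bar> * h^2) + \<Lambda> * h * (ckernel N q r * p r))"
   proof (rule integral_le)
    fix r
    have "omega0 (z (s - r + h) - z (s - r)) (z s) = omega0 (z (s - r + h) - z (s - r)) (z (s - r)) + omega0 (z (s - r + h) - z (s - r)) (z s - z (s - r))"
     by (simp add: omega0_diff_right)
    also have "... <= - (2 * a * h - C * h^2) + \<Lambda> * h * p r"
    proof (rule add_mono)
     show "omega0 (z (s - r + h) - z (s - r)) (z (s - r)) <= - (2 * a * h - C * h^2)" using low[of h "s - r"] h by linarith
     have "omega0 (z (s - r + h) - z (s - r)) (z s - z (s - r)) <= norm (z (s - r + h) - z (s - r)) * p r"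
      unfolding p_def using abs_omega0_le[of "z (s - r + h) - z (s - r)" "z s - z (s - r)"] by linarith
     also have "... <= \<Lambda> * h * p r" using lip[of h "s - r"] h by (intro mult_right_mono) (auto simp: p_def)
     finally show "omega0 (z (s - r + h) - z (s - r)) (z s - z (s - r)) <= \<Lambda> * h * p r" .
    qed
    also have "... <= - (2 * a * h) + \<bar>C\<bar> * h^2 + \<Lambda> * h * p r" 
     using mult_right_mono[OF abs_ge_self[of C], of "h^2"] by simp
    finally have "omega0 (z (s - r + h) - z (s - r)) (z s) <= - (2 * a * h) + \<bar>C\<bar> * h^2 + \<Lambda> * h * p r" .
    from mult_left_mono[OF this k(3)[of r]]
    show "ckernel N q r * omega0 (z (s - r + h) - z (s - r)) (z s) <= ckernel N q r * (- (2 * a * h) + \<bar>C\<bar> * h^2) + \<Lambda> * h * (ckernel N q r * p r)"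
     by (simp add: algebra_simps)
   qed (rule icK, intro integrable_continuous_interval continuous_intros cK cp)
   also have "... = (- (2 * a * h) + \<bar>C\<bar> * h^2) + \<Lambda> * h * integral {-(1/2)..1/2} (\<lambda>r. ckernel N q r * p r)"
    using k(2) by (subst integral_add) (auto intro!: integrable_continuous_interval continuous_intros cK cp)
   also have "... <= (- (2 * a * h) + \<bar>C\<bar> * h^2) + \<Lambda> * h * (2 * e1)"
    using pI \<Lambda>0 h by (intro add_left_mono mult_left_mono) auto
   finally show "omega0 (y (s + h)) (z s) - omega0 (y s) (z s) <= - (2 * a - \<Lambda> * (2 * e1)) * h + \<bar>C\<bar> * h^2"
    by (simp add: algebra_simps)
  qed
  thus ?thesis by simp
 qed
 have "2 * a - 2 * \<eta> <= integral {0..1} (\<lambda>s. ?g s \<bullet> y s)"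
 proof -
  have "integral {0..1} (\<lambda>s::real. 2 * a - 2 * \<eta>) <= integral {0..1} (\<lambda>s. ?g s \<bullet> y s)"
  proof (rule integral_le)
   fix s :: real
   have "?g s \<bullet> (z s - y s) <= norm (?g s) * norm (z s - y s)" by (rule norm_cauchy_schwarz)
   also have "... <= \<Lambda> * (2 * e1)" using ng[of s] ap[of s] \<Lambda>0 by (intro mult_mono) (auto simp: norm_minus_commute)
   finally have "?g s \<bullet> y s >= 2 * a - \<Lambda> * (2 * e1) - \<Lambda> * (2 * e1)" using lower[of s] by (simp add: inner_diff_right)
   moreover have "\<Lambda> * (2 * e1) <= \<eta>" using \<Lambda>0 \<eta> by (simp add: e1_def field_simps)
   ultimately show "2 * a - 2 * \<eta> <= ?g s \<bullet> y s" by linarith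
  qed (auto simp: y_def intro!: integrable_continuous_interval continuous_intros)
  thus ?thesis by simp
 qed
 also have "... = (\<Sum>k\<in>modes N. ((2 * pi * real_of_int k) *\<^sub>R b k) \<bullet> b k)" unfolding y_def by (rule integral_trig_trig)
 also have "... = 2 * (pi * (\<Sum>k\<in>modes N. real_of_int k * (norm (b k))^2))"
  unfolding sum_distrib_left by (rule sum.cong) (auto simp: power2_norm_eq_inner)
 finally have act: "pi * (\<Sum>k\<in>modes N. real_of_int k * (norm (b k))^2) >= a - \<eta>" by simp
 have "(\<Sum>k\<in>modes N. (2 * pi * real_of_int k)^2 * (norm (b k))^2) = integral {0..1} (\<lambda>t. (norm (?g t))^2)"
  by (simp add: integral_trig_norm power_mult_distrib)
 also have "... <= integral {0..1} (\<lambda>t::real. \<Lambda>^2)"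
  by (rule integral_le) (use ng \<Lambda>0 in \<open>auto intro!: integrable_continuous_interval continuous_intros power_mono\<close>)
 finally have "(\<Sum>k\<in>modes N. (2 * pi * real_of_int k)^2 * (norm (b k))^2) <= (2 * a * K)^2" by (simp add: \<Lambda>_def)
 with act sup show ?thesis using that[of N b] by (auto simp: b_def)
qed

text \<open>The loss of action has to be small relative to the L2 mass Q of the positive modes, so Q
  needs a lower bound that does not depend on the mollification. Interpolation k <= \<mu> + k^2 / (4
  \<mu>) provides it: the weighted sum V is at least a / (2 pi), and the energy bound M limits the
  contribution of k^2.\<close>

lemma mollified_loop_defect:
 fixes z :: "real => 'n::finite pt"
 assumes per: "!!t. z (t + 1) = z t" and mir: "!!t. z (- t) = mirror (z t)"
  and a: "a > 0" and g: "!!u. g u <= K * norm u" and K: "K >= 0" and e: "e > 0"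
  and up: "!!s h u. [|0 <= h; h <= 1|] ==> - omega0 (z (s + h) - z s) u <= 2 * a * h * g u"
  and low: "!!s h. [|0 <= h; h <= 1|] ==> - omega0 (z (s + h) - z s) (z s) >= 2 * a * h - C * h^2"
 obtains N b where "!!k. k \<notin> modes N ==> b k = 0"
  "!!t u. trig N (\<lambda>k. (2 * pi * real_of_int k) *\<^sub>R b k) t \<bullet> u <= 2 * a * g u"
  "pi * (\<Sum>k\<in>modes N. real_of_int k * (norm (b k))^2) > 0"
  "a - pi * (\<Sum>k\<in>modes N. real_of_int k * (norm (b k))^2) <= e * (\<Sum>k\<in>{1..int N}. (norm (b k))^2)"
proof -
 define M where "M = (2 * a * K)^2"
 \<comment> \<open>Chosen so that M / (4 \<mu>) <= a / (4 pi), half of the lower bound for V; the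
   other half falls to \<mu> Q.\<close>
 define \<mu> where "\<mu> = M * pi / a + 1"
 have \<mu>: "\<mu> > 0" using a by (auto simp: \<mu>_def M_def intro!: add_nonneg_pos)
 \<comment> \<open>The first entry keeps the action at least a / 2, the second makes the loss at
   most e Q.\<close>
 define \<eta> where "\<eta> = min (a / 2) (e * (a / (4 * pi * \<mu>)))"
 have \<eta>: "\<eta> > 0" using a e \<mu> by (simp add: \<eta>_def)
 obtain N b where b: "!!k. k \<notin> modes N ==> b k = 0"
  "!!t u. trig N (\<lambda>k. (2 * pi * real_of_int k) *\<^sub>R b k) t \<bullet> u <= 2 * a * g u"
  "pi * (\<Sum>k\<in>modes N. real_of_int k * (norm (b k))^2) >= a - \<eta>"
  "(\<Sum>k\<in>modes N. (2 * pi * real_of_int k)^2 * (norm (b k))^2) <= M"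
  by (rule mollified_loop[where z = z and C = C, OF per mir a g K \<eta> up low, folded M_def], assumption+) (rule that; assumption)
 define V where "V = (\<Sum>k\<in>{1..int N}. real_of_int k * (norm (b k))^2)"
 define Q where "Q = (\<Sum>k\<in>{1..int N}. (norm (b k))^2)"
 have ms: "modes N = {- int N..0} \<union> {1..int N}" by (auto simp: modes_def)
 have "(\<Sum>k\<in>modes N. real_of_int k * (norm (b k))^2) = (\<Sum>k\<in>{-int N..0}. real_of_int k * (norm (b k))^2) + V"
  unfolding ms V_def by (rule sum.union_disjoint) auto
 moreover have "(\<Sum>k\<in>{-int N..0}. real_of_int k * (norm (b k))^2) <= 0" by (rule sum_nonpos) (auto intro: mult_nonpos_nonneg)
 ultimately have "(\<Sum>k\<in>modes N. real_of_int k * (norm (b k))^2) <= V" by simp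
 hence "pi * (\<Sum>k\<in>modes N. real_of_int k * (norm (b k))^2) <= pi * V" by (intro mult_left_mono) auto
 moreover have "\<eta> <= a / 2" by (simp add: \<eta>_def)
 ultimately have piV: "a / 2 <= pi * V" using b(3) by linarith
 have "V <= (\<Sum>k\<in>{1..int N}. \<mu> * (norm (b k))^2 + (2 * pi * real_of_int k)^2 * (norm (b k))^2 / (4 * \<mu>))"
  unfolding V_def
 proof (rule sum_mono)
  fix k assume "k \<in> {1..int N}"
  have "real_of_int k <= \<mu> + (real_of_int k)^2 / (4 * \<mu>)"
  proof -
   have "0 <= (real_of_int k - 2 * \<mu>)^2" by simp
   hence "real_of_int k * (4 * \<mu>) <= 4 * \<mu> * \<mu> + (real_of_int k)^2" by (simp add: power2_eq_square algebra_simps)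
   thus ?thesis using \<mu> by (simp add: field_simps)
  qed
  also have "... <= \<mu> + (2 * pi * real_of_int k)^2 / (4 * \<mu>)"
  proof -
   have "1 <= 2 * pi" using pi_ge_two by linarith
   hence "1 <= (2 * pi)^2" by (rule one_le_power)
   hence "1 * (real_of_int k)^2 <= (2 * pi)^2 * (real_of_int k)^2" by (rule mult_right_mono) simp
   thus ?thesis using \<mu> by (intro add_left_mono divide_right_mono) (auto simp: power_mult_distrib)
  qed
  finally have "real_of_int k * (norm (b k))^2 <= (\<mu> + (2 * pi * real_of_int k)^2 / (4 * \<mu>)) * (norm (b k))^2" by (rule mult_right_mono) simp
  thus "real_of_int k * (norm (b k))^2 <= \<mu> * (norm (b k))^2 + (2 * pi * real_of_int k)^2 * (norm (b k))^2 / (4 * \<mu>)"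
   by (simp add: distrib_right)
 qed
 also have "... = \<mu> * Q + (\<Sum>k\<in>{1..int N}. (2 * pi * real_of_int k)^2 * (norm (b k))^2) / (4 * \<mu>)"
  by (simp add: Q_def sum.distrib sum_distrib_left sum_divide_distrib)
 also have "... <= \<mu> * Q + M / (4 * \<mu>)"
 proof (intro add_left_mono divide_right_mono)
  have "(\<Sum>k\<in>{1..int N}. (2 * pi * real_of_int k)^2 * (norm (b k))^2) <= (\<Sum>k\<in>modes N. (2 * pi * real_of_int k)^2 * (norm (b k))^2)"
   by (rule sum_mono2) (auto simp: modes_def)
  thus "(\<Sum>k\<in>{1..int N}. (2 * pi * real_of_int k)^2 * (norm (b k))^2) <= M" using b(4) by linarith
 qed (use \<mu> in simp)
 also have "M / (4 * \<mu>) <= a / (4 * pi)"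
 proof -
  have "M * pi <= \<mu> * a" using a by (simp add: \<mu>_def field_simps)
  thus ?thesis using \<mu> by (simp add: field_simps)
 qed
 finally have "V <= \<mu> * Q + a / (4 * pi)" by simp
 moreover have "a / (2 * pi) <= V" using piV by (simp add: field_simps)
 moreover have "a / (2 * pi) = 2 * (a / (4 * pi))" by simp
 ultimately have "a / (4 * pi) <= \<mu> * Q" by linarith
 hence "a / (4 * pi * \<mu>) <= Q" using \<mu> by (simp add: field_simps)
 hence "e * (a / (4 * pi * \<mu>)) <= e * Q" using e by (intro mult_left_mono) auto
 moreover have "\<eta> <= e * (a / (4 * pi * \<mu>))" by (simp add: \<eta>_def)
 ultimately have "a - pi * (\<Sum>k\<in>modes N. real_of_int k * (norm (b k))^2) <= e * Q" using b(3) by linarith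
 moreover have "pi * (\<Sum>k\<in>modes N. real_of_int k * (norm (b k))^2) > 0" using b(3) \<open>\<eta> <= a / 2\<close> a by linarith
 ultimately show ?thesis using that[OF b(1,2)] unfolding Q_def by blast
qed

section \<open>Parametrisation of a characteristic by its action\<close>

lemma absolutely_continuous_on_subset:
 assumes ac: "absolutely_continuous_on S f" and sub: "S' \<subseteq> S"
 shows "absolutely_continuous_on S' f"
 unfolding absolutely_continuous_on_def
proof (intro allI impI)
 fix e :: real assume "e > 0"
 from ac[unfolded absolutely_continuous_on_def, THEN spec, THEN mp, OF this]
 obtain c where "c > 0" and D: "\<forall>(n::nat) (a::nat => real) b.
    (\<forall>i<n. a i <= b i \<and> {a i..b i} \<subseteq> S) \<and>
    (\<forall>i<n. \<forall>j<n. i ~= j --> b i <= a j \<or> b j <= a i) \<and>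
    (\<Sum>i<n. b i - a i) < c --> (\<Sum>i<n. norm (f (b i) - f (a i))) < e"
  by (elim exE conjE)
 show "\<exists>c>0. \<forall>(n::nat) (a::nat => real) b.
    (\<forall>i<n. a i <= b i \<and> {a i..b i} \<subseteq> S') \<and>
    (\<forall>i<n. \<forall>j<n. i ~= j --> b i <= a j \<or> b j <= a i) \<and>
    (\<Sum>i<n. b i - a i) < c --> (\<Sum>i<n. norm (f (b i) - f (a i))) < e"
 proof (intro exI[of _ c] conjI \<open>c > 0\<close> allI impI, elim conjE)
  fix n :: nat and a b :: "nat => real"
  assume 1: "\<forall>i<n. a i <= b i \<and> {a i..b i} \<subseteq> S'" and 2: "\<forall>i<n. \<forall>j<n. i ~= j --> b i <= a j \<or> b j <= a i"
   and 3: "(\<Sum>i<n. b i - a i) < c"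
  have "\<forall>i<n. a i <= b i \<and> {a i..b i} \<subseteq> S" using 1 sub by (meson subset_trans)
  with 2 3 show "(\<Sum>i<n. norm (f (b i) - f (a i))) < e"
   by (intro D[THEN spec, THEN spec, THEN spec, THEN mp] conjI)
 qed
qed

lemma AE_lebesgue_negligible:
 assumes "AE t in lebesgue. P t"
 obtains N where "negligible N" "!!t. t \<notin> N ==> P t"
 using assms unfolding eventually_ae_filter negligible_iff_null_sets by auto

text \<open>A characteristic seen from a symmetric point as origin, in constant-speed action
  parametrisation. The first inequality integrates: - J z' lies in 2 a times the polar body. The
  second integrates: its pairing with z is 2 a, up to second order. Increments are used instead of
  derivatives so that no almost everywhere statement has to be averaged or passed to a
  limit.\<close>

definition char_loop :: "('n::finite pt => 'n pt) => ('n pt => real) => real => real => (real => 'n pt) => bool" where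
 "char_loop \<tau> g a C z \<longleftrightarrow> (\<forall>t. z (t + 1) = z t) \<and> (\<forall>t. z (- t) = \<tau> (z t)) \<and>
  (\<forall>s h u. 0 <= h --> h <= 1 --> - omega0 (z (s + h) - z s) u <= 2 * a * h * g u) \<and>
  (\<forall>s h. 0 <= h --> h <= 1 --> - omega0 (z (s + h) - z s) (z s) >= 2 * a * h - C * h^2)"

text \<open>An increment across an integer is split there. The two quadratic errors are each at most
  C h^2 and the cross term is at most M^2 h^2, whence the constant.\<close>

lemma char_loop_extension:
 fixes z0 :: "real => 'n::finite pt"
 assumes U: "!!s s' u. [|0 <= s; s <= s'; s' <= 1|] ==> - omega0 (z0 s' - z0 s) u <= 2 * a * (s' - s) * g u"
  and Lp: "!!s s'. [|0 <= s; s <= s'; s' <= 1|] ==> norm (z0 s' - z0 s) <= M * (s' - s)"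
  and Lw: "!!s s'. [|0 <= s; s <= s'; s' <= 1|] ==> - omega0 (z0 s' - z0 s) (z0 s) >= 2 * a * (s' - s) - C * (s' - s)^2"
  and e: "z0 0 = z0 1" and sym: "!!s. 0 <= s ==> s <= 1 ==> z0 (1 - s) = \<tau> (z0 s)" and C: "C >= 0"
 shows "char_loop \<tau> g a (2 * C + M^2) (\<lambda>t. z0 (frac t))"
 unfolding char_loop_def
proof (intro conjI allI impI)
 have L0: "M >= 0" using order_trans[OF norm_ge_zero Lp[of 0 1]] by simp
 fix t :: real
 show "z0 (frac (t + 1)) = z0 (frac t)" by (simp add: frac_1_eq)
 show "z0 (frac (- t)) = \<tau> (z0 (frac t))"
 proof (cases "t \<in> \<int>")
  case True
  hence fr: "frac (- t) = 0" "frac t = 0" by (auto simp: frac_eq_0_iff)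
  have "z0 0 = \<tau> (z0 0)" using sym[of 0] e by simp
  thus ?thesis by (simp only: fr)
 next
  case False
  thus ?thesis using sym[of "frac t"] frac_lt_1[of t] by (simp add: frac_neg less_imp_le)
 qed
 fix s h :: real assume h: "0 <= h" "h <= 1"
 define f where "f = frac s"
 have f: "0 <= f" "f < 1" by (auto simp: f_def frac_lt_1)
 have case1: "z0 (frac (s + h)) = z0 (f + h)" if "f + h <= 1"
 proof (cases "f + h = 1")
  case True
  have "s + h = of_int (\<lfloor>s\<rfloor> + 1)" using True by (simp add: f_def frac_def)
  hence fr: "frac (s + h) = 0" by (metis frac_of_int)
  show ?thesis by (simp only: fr True e)
 next
  case False
  have "frac (s + h) = f + h"
  proof (rule frac_unique_iff[THEN iffD2], intro conjI)
   have "s + h - (f + h) = of_int \<lfloor>s\<rfloor>" by (simp add: f_def frac_def)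
   thus "s + h - (f + h) \<in> \<int>" by (simp only: Ints_of_int)
  qed (use that False f h in auto)
  thus ?thesis by (simp only:)
 qed
 define e' where "e' = f + h - 1"
 have case2: "z0 (frac (s + h)) = z0 e'" "0 <= e'" "e' <= 1" "h = (1 - f) + e'" if "\<not> f + h <= 1"
 proof -
  have "frac (s + h) = e'"
  proof (rule frac_unique_iff[THEN iffD2], intro conjI)
   have "s + h - e' = of_int (\<lfloor>s\<rfloor> + 1)" by (simp add: e'_def f_def frac_def)
   thus "s + h - e' \<in> \<int>" by (simp only: Ints_of_int)
  qed (use that f h in \<open>auto simp: e'_def\<close>)
  thus "z0 (frac (s + h)) = z0 e'" by (simp only:)
 qed (use that f h in \<open>auto simp: e'_def\<close>)
 show "- omega0 (z0 (frac (s + h)) - z0 (frac s)) u <= 2 * a * h * g u" for u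
 proof (cases "f + h <= 1")
  case True
  show ?thesis unfolding case1[OF True] f_def[symmetric] using U[of f "f + h" u] f h True by simp
 next
  case False
  note c = case2[OF False]
  have "- omega0 (z0 e' - z0 f) u = - omega0 (z0 e' - z0 0) u + - omega0 (z0 1 - z0 f) u"
   by (simp add: e omega0_diff_left)
  also have "... <= 2 * a * (e' - 0) * g u + 2 * a * (1 - f) * g u" using U[of 0 e' u] U[of f 1 u] c f by (intro add_mono) auto
  also have "... = 2 * a * h * g u" by (simp add: c(4) algebra_simps)
  finally show ?thesis unfolding c(1) f_def[symmetric] .
 qed
 show "2 * a * h - (2 * C + M^2) * h^2 <= - omega0 (z0 (frac (s + h)) - z0 (frac s)) (z0 (frac s))"
 proof (cases "f + h <= 1")
  case True
  have "C * h^2 <= (2 * C + M^2) * h^2" using C by (intro mult_right_mono) auto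
  thus ?thesis unfolding case1[OF True] f_def[symmetric] using Lw[of f "f + h"] f h True by simp
 next
  case False
  note c = case2[OF False]
  have 1: "- omega0 (z0 1 - z0 f) (z0 f) >= 2 * a * (1 - f) - C * (1 - f)^2" using Lw[of f 1] f by simp
  have 2: "- omega0 (z0 e' - z0 0) (z0 0) >= 2 * a * e' - C * e'^2" using Lw[of 0 e'] c by simp
  have "\<bar>omega0 (z0 e' - z0 0) (z0 1 - z0 f)\<bar> <= norm (z0 e' - z0 0) * norm (z0 1 - z0 f)" by (rule abs_omega0_le)
  also have "... <= (M * e') * (M * (1 - f))" using Lp[of 0 e'] Lp[of f 1] c f L0 by (intro mult_mono) auto
  also have "... <= (M * h) * (M * h)" using c f L0 by (intro mult_mono) auto
  finally have 3: "\<bar>omega0 (z0 e' - z0 0) (z0 1 - z0 f)\<bar> <= M^2 * h^2" by (simp add: power2_eq_square mult_ac)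
  have "- omega0 (z0 e' - z0 f) (z0 f) = - omega0 (z0 1 - z0 f) (z0 f) + - omega0 (z0 e' - z0 0) (z0 0) + omega0 (z0 e' - z0 0) (z0 1 - z0 f)"
   by (simp add: e omega0_diff_left omega0_diff_right)
  moreover have "C * (1 - f)^2 <= C * h^2" "C * e'^2 <= C * h^2" using c f C by (auto intro!: mult_left_mono power_mono)
  moreover have "2 * a * h = 2 * a * (1 - f) + 2 * a * e'" by (simp add: c(4) algebra_simps)
  ultimately show ?thesis unfolding c(1) f_def[symmetric] using 1 2 3 by (simp add: distrib_right)
 qed
qed

text \<open>The density w = <n, x - p0> of the action, with n = - J x' a normal, is nonnegative and
  dominates |x'|. Hence x does not move where the integral S of w is constant, and x is a Lipschitz
  function of S although S need not be strictly increasing. This function, rescaled to [0, 1], is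
  the loop.\<close>

lemma gen_brake_char_reparametrization:
 fixes \<tau> :: "'n::finite pt => 'n pt"
 assumes \<tau>: "lin_antisymp_involution \<tau>" and gbc: "gen_brake_char \<tau> D x T" and p0: "\<tau> p0 = p0" "p0 \<in> D"
  and pos: "action x T > 0"
  and n1: "!!y n u. [|y \<in> frontier D; n \<in> normal_cone D y|] ==> n \<bullet> u <= (n \<bullet> (y - p0)) * g u"
  and n2: "!!y n. [|y \<in> frontier D; n \<in> normal_cone D y|] ==> norm n <= K * (n \<bullet> (y - p0))" and K: "K >= 0"
 obtains z C where "char_loop \<tau> g (action x T) C z"
proof -
 define a where "a = action x T"
 have a: "a > 0" using pos by (simp add: a_def)
 have lin: "linear \<tau>" and anti: "!!u v. omega0 (\<tau> u) (\<tau> v) = - omega0 u v" 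
  using \<tau> by (auto simp: lin_antisymp_involution_def)
 have T: "T > 0" and per: "!!t. x (t + T) = x t" and fr: "!!t. x t \<in> frontier D"
  and ac: "absolutely_continuous_on {0..T} x" and sym: "!!t. x (T - t) = \<tau> (x t)"
  and ae: "AE t in lebesgue. x differentiable (at t) \<and> vector_derivative x (at t) \<in> J0 ` normal_cone D (x t)"
  using gbc by (auto simp: gen_brake_char_def)
 obtain N where N: "negligible N" "!!t. t \<notin> N ==> x differentiable (at t) \<and> vector_derivative x (at t) \<in> J0 ` normal_cone D (x t)"
  using AE_lebesgue_negligible[OF ae] by blast
 \<comment> \<open>On the null set the velocity is set to 0, a vector of every normal cone, so that
   later estimates hold for all t.\<close>
 define v where "v t = (if t \<in> N then 0 else vector_derivative x (at t))" for t
 define n where "n t = - J0 (v t)" for t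
 define w where "w t = n t \<bullet> (x t - p0)" for t
 have v: "(x has_vector_derivative v t) (at t)" if "t \<notin> N" for t
  using N(2)[OF that] that by (simp add: v_def vector_derivative_works)
 have nc: "n t \<in> normal_cone D (x t)" for t
 proof (cases "t \<in> N")
  case False
  then obtain m where "m \<in> normal_cone D (x t)" "vector_derivative x (at t) = J0 m" using N(2) by blast
  moreover from this have "n t = m" using False by (simp add: n_def v_def)
  ultimately show ?thesis by simp
 qed (simp add: n_def v_def normal_cone_def)
 have nu: "n t \<bullet> u <= w t * g u" for t u unfolding w_def by (rule n1[OF fr nc])
 have nK: "norm (v t) <= K * w t" "norm (n t) <= K * w t" for t using n2[OF fr nc, of t] by (auto simp: n_def w_def)
 have w0: "w t >= 0" for t
 proof -
  have "(p0 - x t) \<bullet> n t <= 0" using nc[of t] p0(2) by (auto simp: normal_cone_def)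
  thus ?thesis by (simp add: w_def inner_diff_left inner_diff_right inner_commute)
 qed
 have vint: "(v has_integral (x t - x s)) {s..t}" if "0 <= s" "s <= t" "t <= T" for s t
 proof (rule AC_has_integral[OF absolutely_continuous_on_subset[OF ac] _ N(1)])
  show "(x has_vector_derivative v r) (at r within {s..t})" if "r \<in> {s..t} - N" for r
   by (rule has_vector_derivative_at_within[OF v]) (use that in simp)
 qed (use that in auto)
 have nint: "((\<lambda>r. n r \<bullet> u) has_integral - omega0 (x t - x s) u) {s..t}" if "0 <= s" "s <= t" "t <= T" for s t u
  using has_integral_neg[OF has_integral_linear[OF vint[OF that] bounded_linear_omega0_left[of u]]] 
  by (simp add: n_def omega0_eq o_def)
 \<comment> \<open>The integral of a nonintegrable function is 0 by convention, so positive action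
   forces integrability.\<close>
 have qi: "(\<lambda>t. (- J0 (vector_derivative x (at t))) \<bullet> x t) integrable_on {0..T}"
 proof (rule ccontr)
  assume "\<not> ?thesis"
  from not_integrable_integral[OF this] have "action x T = 0" by (simp only: action_def mult_zero_right)
  thus False using pos by simp
 qed
 have q: "((\<lambda>t. n t \<bullet> x t) has_integral 2 * a) {0..T}"
  by (rule has_integral_spike[OF N(1), of _ _ "\<lambda>t. (- J0 (vector_derivative x (at t))) \<bullet> x t"])
    (use integrable_integral[OF qi] in \<open>auto simp: n_def v_def a_def action_def\<close>)
 have xT: "x T = x 0" using per[of 0] by simp
 \<comment> \<open>Recentring at p0 does not change the integral, because the curve is
   closed.\<close>
 have wT: "(w has_integral 2 * a) {0..T}"
  using has_integral_diff[OF q nint[of 0 T p0]] T unfolding w_def by (simp add: inner_diff_right xT omega0_def)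
 have wi: "w integrable_on {s..t}" if "0 <= s" "t <= T" for s t
  using integrable_subinterval_real[OF has_integral_integrable[OF wT], of s t] that by auto
 define S where "S t = integral {0..t} w" for t
 have Sdiff: "(w has_integral (S t - S s)) {s..t}" if "0 <= s" "s <= t" "t <= T" for s t
 proof -
  have "integral {0..s} w + integral {s..t} w = integral {0..t} w"
   by (rule Henstock_Kurzweil_Integration.integral_combine) (use that wi in auto)
  hence "S t - S s = integral {s..t} w" by (simp add: S_def)
  thus ?thesis using integrable_integral[OF wi[of s t]] that by simp
 qed
 have Smono: "S s <= S t" if "0 <= s" "s <= t" "t <= T" for s t
  using has_integral_nonneg[OF Sdiff[OF that]] w0 by simp
 have S0: "S 0 = 0" and ST: "S T = 2 * a" using wT by (auto simp: S_def integral_unique)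
 have Scont: "continuous_on {0..T} S" unfolding S_def by (rule indefinite_integral_continuous_1) (use wT in auto)
 have up: "- omega0 (x t - x s) u <= (S t - S s) * g u" if "0 <= s" "s <= t" "t <= T" for s t u
  by (rule has_integral_le[OF nint[OF that] has_integral_mult_left[OF Sdiff[OF that]]]) (rule nu)
 have lip: "norm (x t - x s) <= K * (S t - S s)" if "0 <= s" "s <= t" "t <= T" for s t
 proof -
  have "norm (integral {s..t} v) <= integral {s..t} (\<lambda>r. K * w r)"
   by (rule integral_norm_bound_integral[OF has_integral_integrable[OF vint[OF that]] has_integral_integrable[OF has_integral_mult_right[OF Sdiff[OF that], of K]]])
     (rule nK)
  thus ?thesis using integral_unique[OF vint[OF that]] integral_unique[OF Sdiff[OF that]] by simp
 qed
 \<comment> \<open>Freezing the second argument at s replaces w r by w r - <n r, x r - x s>, and the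
   correction is at most K w r times K (S t - S s).\<close>
 have low: "- omega0 (x t - x s) (x s - p0) >= (S t - S s) - K^2 * (S t - S s)^2" if "0 <= s" "s <= t" "t <= T" for s t
 proof -
  let ?d = "S t - S s"
  have i1: "((\<lambda>r. w r * (1 - K * (K * ?d))) has_integral ?d * (1 - K * (K * ?d))) {s..t}"
   by (rule has_integral_mult_left[OF Sdiff[OF that]])
  have "?d * (1 - K * (K * ?d)) <= - omega0 (x t - x s) (x s - p0)"
  proof (rule has_integral_le[OF i1 nint[OF that]])
   fix r assume r: "r \<in> {s..t}"
   have "n r \<bullet> (x r - x s) <= norm (n r) * norm (x r - x s)" by (rule norm_cauchy_schwarz)
   also have "... <= (K * w r) * (K * ?d)"
   proof (rule mult_mono)
    have "norm (x r - x s) <= K * (S r - S s)" using lip[of s r] r that by auto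
    also have "... <= K * ?d" using Smono[of r t] r that K by (intro mult_left_mono) auto
    finally show "norm (x r - x s) <= K * ?d" .
   qed (use nK w0 K in auto)
   finally have "n r \<bullet> (x r - x s) <= (K * w r) * (K * ?d)" .
   moreover have "w r = n r \<bullet> (x s - p0) + n r \<bullet> (x r - x s)" by (simp add: w_def inner_diff_right)
   moreover have "w r * (1 - K * (K * ?d)) = w r - (K * w r) * (K * ?d)" by (simp add: algebra_simps)
   ultimately show "w r * (1 - K * (K * ?d)) <= n r \<bullet> (x s - p0)" by linarith
  qed
  thus ?thesis by (simp add: power2_eq_square algebra_simps)
 qed
 \<comment> \<open>Reflection in time reverses the velocity and \<open>\<tau>\<close> reverses the
   form, so w is invariant under t -> T - t.\<close>
 have Ssym: "S (T - t) = 2 * a - S t" if "0 <= t" "t <= T" for t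
 proof -
  define N' where "N' = N \<union> (\<lambda>r. T - r) ` N"
  have "negligible ((\<lambda>r. T - r) ` N)"
   by (rule negligible_differentiable_image_negligible[OF _ N(1)]) (auto intro!: derivative_intros)
  hence N': "negligible N'" unfolding N'_def by (rule negligible_Un[OF N(1)])
  have ww: "w (T - r) = w r" if "r \<notin> N'" for r
  proof -
   have r: "r \<notin> N" "T - r \<notin> N"
   proof -
    show "r \<notin> N" using that by (simp add: N'_def)
    show "T - r \<notin> N"
    proof
     assume "T - r \<in> N"
     hence "T - (T - r) \<in> (\<lambda>r. T - r) ` N" by (rule imageI)
     thus False using that by (simp add: N'_def)
    qed
   qed
   have d1: "((x \<circ> (\<lambda>r. T - r)) has_vector_derivative (-1) *\<^sub>R v (T - r)) (at r)"
    by (rule vector_diff_chain_at) (auto intro!: derivative_eq_intros v r)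
   have d2: "x \<circ> (\<lambda>r. T - r) = (\<lambda>r. \<tau> (x r))" using sym by (auto simp: o_def)
   have d3: "((\<lambda>r. \<tau> (x r)) has_vector_derivative \<tau> (v r)) (at r)"
    by (rule bounded_linear.has_vector_derivative[OF _ v[OF r(1)]]) (use lin linear_conv_bounded_linear in auto)
   from vector_derivative_unique_at[OF d1[unfolded d2] d3] have "v (T - r) = - \<tau> (v r)"
    by (metis minus_minus scaleR_minus1_left)
   hence "omega0 (v (T - r)) (x (T - r) - p0) = - omega0 (\<tau> (v r)) (\<tau> (x r - p0))"
    by (simp add: sym linear_diff[OF lin] p0 omega0_def)
   thus ?thesis using anti[of "v r" "x r - p0"] by (simp add: w_def n_def omega0_eq)
  qed
  have "((\<lambda>r. w ((-1) *\<^sub>R r + T)) has_integral (1 / \<bar>-1\<bar> ^ DIM(real)) *\<^sub>R (S T - S (T - t))) ((\<lambda>r. (1 / (-1)) *\<^sub>R r + - ((1 / (-1)) *\<^sub>R T)) ` cbox (T - t) T)"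
   by (rule has_integral_affinity) (use Sdiff[of "T - t" T] that in auto)
  moreover have "(\<lambda>r. (1 / (-1)) *\<^sub>R r + - ((1 / (-1)) *\<^sub>R T)) ` cbox (T - t) T = {0..t}"
  proof -
   have "(\<lambda>r. (1 / (-1)) *\<^sub>R r + - ((1 / (-1)) *\<^sub>R T)) = (\<lambda>r. T - r)" by auto
   moreover have "(\<lambda>r. T - r) ` {T - t..T} = {0..t}" using that by (simp add: image_diff_atLeastAtMost)
   ultimately show ?thesis by simp
  qed
  ultimately have "((\<lambda>r. w (T - r)) has_integral (S T - S (T - t))) {0..t}" by simp
  hence "(w has_integral (S T - S (T - t))) {0..t}" by (rule has_integral_spike[OF N', rotated]) (use ww in auto)
  hence "S t = S T - S (T - t)" by (simp add: S_def integral_unique)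
  thus ?thesis using ST by simp
 qed
 have "\<exists>t\<ge>0. t <= T \<and> S t = 2 * a * s" if s: "0 <= s" "s <= 1" for s
 proof (rule IVT'[of S 0 "2 * a * s" T])
  show "S 0 <= 2 * a * s" using S0 s a by simp
  show "2 * a * s <= S T" using ST s a by simp
 qed (use T Scont in auto)
 \<comment> \<open>Any preimage of 2 a s under S; x takes the same value at all of them.\<close>
 then obtain b where b: "!!s. 0 <= s ==> s <= 1 ==> 0 <= b s \<and> b s <= T \<and> S (b s) = 2 * a * s" by metis
 define z0 where "z0 s = x (b s) - p0" for s
 have xeq: "x t = x t'" if "0 <= t" "t <= T" "0 <= t'" "t' <= T" "S t = S t'" for t t'
 proof (cases "t <= t'")
  case True
  have "norm (x t' - x t) <= K * (S t' - S t)" by (rule lip[OF that(1) True that(4)])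
  also have "... = 0" using that(5) by simp
  finally show ?thesis by simp
 next
  case False
  have "norm (x t - x t') <= K * (S t - S t')" by (rule lip[OF that(3) _ that(2)]) (use False in simp)
  also have "... = 0" using that(5) by simp
  finally show ?thesis by simp
 qed
 have z0eq: "x t - p0 = z0 s" if "0 <= t" "t <= T" "S t = 2 * a * s" "0 <= s" "s <= 1" for t s
 proof -
  have "x t = x (b s)" by (rule xeq) (use b[OF that(4,5)] that in auto)
  thus ?thesis by (simp add: z0_def)
 qed
 have ord: "b s <= b s' \<or> s = s'" if "0 <= s" "s <= s'" "s' <= 1" for s s'
 proof (rule ccontr)
  assume "\<not> ?thesis"
  hence "S (b s') <= S (b s)" "s ~= s'" using Smono[of "b s'" "b s"] b[of s] b[of s'] that by auto
  hence "2 * a * s' <= 2 * a * s" using b[of s] b[of s'] that by simp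
  thus False using a that \<open>s ~= s'\<close> by simp
 qed
 have "char_loop \<tau> g a (2 * (K^2 * (2 * a)^2) + (K * (2 * a))^2) (\<lambda>t. z0 (frac t))"
 proof (rule char_loop_extension)
  fix s s' :: real assume s: "0 <= s" "s <= s'" "s' <= 1"
  have th: "0 <= b s" "b s' <= T" "S (b s') - S (b s) = 2 * a * (s' - s)" using b[of s] b[of s'] s by (auto simp: algebra_simps)
  show "- omega0 (z0 s' - z0 s) u <= 2 * a * (s' - s) * g u" for u
   using ord[OF s] up[of "b s" "b s'" u] th by (auto simp: z0_def omega0_def)
  show "norm (z0 s' - z0 s) <= K * (2 * a) * (s' - s)"
   using ord[OF s] lip[of "b s" "b s'"] th by (auto simp: z0_def mult_ac)
  show "2 * a * (s' - s) - K^2 * (2 * a)^2 * (s' - s)^2 <= - omega0 (z0 s' - z0 s) (z0 s)"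
  proof (cases "s = s'")
   case False
   hence o: "b s <= b s'" using ord[OF s] by simp
   have e: "omega0 (z0 s' - z0 s) (z0 s) = omega0 (x (b s') - x (b s)) (x (b s) - p0)" by (simp add: z0_def)
   have "K^2 * (2 * a)^2 * (s' - s)^2 = K^2 * (2 * a * (s' - s))^2" by (simp only: power_mult_distrib mult.assoc)
   thus ?thesis using low[OF th(1) o th(2)] unfolding th(3) by (simp only: e)
  qed (simp add: omega0_def)
 next
  show "z0 0 = z0 1" using z0eq[of 0 0] z0eq[of T 1] S0 ST T xT by simp
  fix s :: real assume s: "0 <= s" "s <= 1"
  have "S (T - b s) = 2 * a * (1 - s)" using Ssym[of "b s"] b[OF s] by (simp add: algebra_simps)
  hence "x (T - b s) - p0 = z0 (1 - s)" using z0eq[of "T - b s" "1 - s"] b[OF s] s by auto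
  thus "z0 (1 - s) = \<tau> (z0 s)" by (simp add: sym z0_def linear_diff[OF lin] p0)
 qed simp
 thus ?thesis using that unfolding a_def by blast
qed

section \<open>Gauges and their smooth approximations\<close>

definition dual :: "'a::euclidean_space set => 'a set" where
 "dual D = {v. \<forall>u\<in>D. v \<bullet> u <= 1}"

text \<open>The support function of the polar, which for an open convex D around 0 is the Minkowski
  functional. As a supremum of linear functionals it is ready for approximation by finitely many of
  them.\<close>

definition gau :: "'a::euclidean_space set => 'a => real" where
 "gau D u = Sup ((\<lambda>v. v \<bullet> u) ` dual D)"

locale convex_body =
 fixes D :: "'a::euclidean_space set"
 assumes op: "open D" and cv: "convex D" and bd: "bounded D" and zero: "0 \<in> D"
begin

lemma dual_bound: obtains K where "K > 0" "!!v. v \<in> dual D ==> norm v <= K"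
proof -
 obtain r where r: "r > 0" "cball 0 r \<subseteq> D" using op zero open_contains_cball by blast
 have "norm v <= 1 / r" if v: "v \<in> dual D" for v
 proof (cases "v = 0")
  case False
  have "(r / norm v) *\<^sub>R v \<in> D" using r False by (intro subsetD[OF r(2)]) auto
  hence "v \<bullet> ((r / norm v) *\<^sub>R v) <= 1" using v by (auto simp: dual_def)
  hence "r * norm v <= 1" using False by (simp flip: power2_norm_eq_inner add: power2_eq_square)
  thus ?thesis using r by (simp add: field_simps)
 qed (use r in simp)
 thus ?thesis using that[of "1 / r"] r by simp
qed

lemma zero_dual: "0 \<in> dual D" by (simp add: dual_def)

lemma bdd_dual: "bdd_above ((\<lambda>v. v \<bullet> u) ` dual D)"
proof -
 obtain K where K: "!!v. v \<in> dual D ==> norm v <= K" using dual_bound by blast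
 have "v \<bullet> u <= K * norm u" if "v \<in> dual D" for v
  using order_trans[OF norm_cauchy_schwarz mult_right_mono[OF K[OF that]]] by simp
 thus ?thesis by (auto intro!: bdd_aboveI)
qed

lemma gau_ge: "v \<in> dual D ==> v \<bullet> u <= gau D u"
 unfolding gau_def by (rule cSup_upper[OF _ bdd_dual]) auto

lemma gau_le: "(!!v. v \<in> dual D ==> v \<bullet> u <= c) ==> gau D u <= c"
 unfolding gau_def by (rule cSup_least) (use zero_dual in auto)

lemma gau_nonneg: "gau D u >= 0" using gau_ge[OF zero_dual, of u] by simp

lemma gau_upper: obtains K where "K > 0" "!!u. gau D u <= K * norm u" "!!v. v \<in> dual D ==> norm v <= K"
proof -
 obtain K where K: "K > 0" "!!v. v \<in> dual D ==> norm v <= K" using dual_bound by blast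
 have "gau D u <= K * norm u" for u
  by (rule gau_le) (use K order_trans[OF norm_cauchy_schwarz mult_right_mono[OF K(2)]] in auto)
 thus ?thesis using that K by blast
qed

lemma norm_le_gau:
 assumes R: "R > 0" "D \<subseteq> ball 0 R" shows "norm u <= R * gau D u"
proof (cases "u = 0")
 case False
 have "(1 / (R * norm u)) *\<^sub>R u \<in> dual D" unfolding dual_def
 proof safe
  fix d assume "d \<in> D"
  hence "norm d <= R" using R by auto
  have "u \<bullet> d <= norm u * R" by (rule order_trans[OF norm_cauchy_schwarz]) (use \<open>norm d <= R\<close> in \<open>simp add: mult_left_mono\<close>)
  thus "(1 / (R * norm u)) *\<^sub>R u \<bullet> d <= 1" using False R by (simp add: field_simps)
 qed
 from gau_ge[OF this, of u] have "norm u / R <= gau D u" using False R by (simp flip: power2_norm_eq_inner add: power2_eq_square)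
 thus ?thesis using R by (simp add: field_simps)
qed (use gau_nonneg[of 0] R in simp)

lemma gau_lower: obtains R where "R > 0" "!!u. norm u <= R * gau D u" "D \<subseteq> ball 0 R"
 using bounded_subset_ballD[OF bd, of 0] norm_le_gau by metis

lemma gau_scale: assumes "c > 0" shows "gau D (c *\<^sub>R u) = c * gau D u"
proof -
 have le: "gau D (c *\<^sub>R u) <= c * gau D u" if "c > 0" for c u
  by (rule gau_le) (use that in \<open>auto intro: mult_left_mono gau_ge\<close>)
 show ?thesis using le[OF assms, of u] le[of "1 / c" "c *\<^sub>R u"] assms by (simp add: field_simps)
qed

lemma gau_triangle: "gau D (u + w) <= gau D u + gau D w"
 by (rule gau_le) (auto simp: inner_add_right intro: add_mono gau_ge)

lemma continuous_gau: "continuous_on S (gau D)"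
proof -
 obtain K where K: "K > 0" "!!u. gau D u <= K * norm u" using gau_upper by metis
 have "\<bar>gau D u - gau D w\<bar> <= K * norm (u - w)" for u w
  using gau_triangle[of w "u - w"] gau_triangle[of u "w - u"] K(2)[of "u - w"] K(2)[of "w - u"]
  by (simp add: norm_minus_commute)
 hence "K-lipschitz_on S (gau D)" using K by (auto intro!: lipschitz_onI simp: dist_norm)
 thus ?thesis by (rule lipschitz_on_continuous_on)
qed

lemma gau_le_1: assumes "u \<in> closure D" shows "gau D u <= 1"
proof -
 have "D \<subseteq> {u. gau D u <= 1}" by (auto intro!: gau_le simp: dual_def)
 moreover have "closed {u. gau D u <= 1}"
  using continuous_closed_preimage[OF continuous_gau[of UNIV] closed_UNIV closed_atMost[of 1]] by (simp add: vimage_def)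
 ultimately show ?thesis using closure_minimal assms by blast
qed

lemma mem_of_gau_less_1: assumes u: "gau D u < 1" shows "u \<in> D"
proof (rule ccontr)
 assume "u \<notin> D"
 obtain v where v: "v ~= 0" "!!d. d \<in> D ==> v \<bullet> d <= v \<bullet> u"
 proof -
  have "{u} \<inter> D = {}" "{u} ~= {}" "D ~= {}" using \<open>u \<notin> D\<close> zero by auto
  then obtain a b where ab: "a ~= 0" "\<forall>x\<in>{u}. a \<bullet> x <= b" "\<forall>x\<in>D. a \<bullet> x >= b"
   using separating_hyperplane_sets[of "{u}" D] cv by (auto simp: convex_singleton)
  show ?thesis
  proof (rule that[of "- a"])
   fix d assume "d \<in> D"
   hence "a \<bullet> u <= a \<bullet> d" using ab(2,3) by (meson insertI1 order_trans)
   thus "- a \<bullet> d <= - a \<bullet> u" by simp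
  qed (use ab in simp)
 qed
 obtain r where r: "r > 0" "cball 0 r \<subseteq> D" using op zero open_contains_cball by blast
 have "(r / norm v) *\<^sub>R v \<in> D" using r v by (intro subsetD[OF r(2)]) auto
 from v(2)[OF this] have "r * norm v <= v \<bullet> u" using v by (simp flip: power2_norm_eq_inner add: power2_eq_square)
 moreover have "r * norm v > 0" using r v by simp
 ultimately have c: "v \<bullet> u > 0" by linarith
 have "(1 / (v \<bullet> u)) *\<^sub>R v \<in> dual D" using v(2) c by (auto simp: dual_def field_simps)
 from gau_ge[OF this, of u] u c show False by simp
qed

lemma gau_less_1: assumes "u \<in> D" shows "gau D u < 1"
proof -
 obtain e where e: "e > 0" "ball u e \<subseteq> D" using op assms open_contains_ball by blast
 define s where "s = (e / 2) / (norm u + 1)"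
 have n: "norm u + 1 > 0" by (rule add_nonneg_pos) auto
 have s: "s > 0" using e n by (simp add: s_def)
 have "norm (s *\<^sub>R u) < e"
 proof -
  have "norm (s *\<^sub>R u) <= s * (norm u + 1)" using s by (simp add: mult_left_mono)
  also have "... = e / 2"
  proof -
   have "e / 2 / y * y = e / 2" if "y > 0" for y using that by simp
   thus ?thesis unfolding s_def using n by blast
  qed
  also have "... < e" using e by simp
  finally show ?thesis .
 qed
 hence "(1 + s) *\<^sub>R u \<in> D" using s by (intro subsetD[OF e(2)]) (simp add: dist_norm algebra_simps)
 hence "gau D ((1 + s) *\<^sub>R u) <= 1" using closure_subset by (intro gau_le_1) blast
 thus ?thesis using gau_scale[of "1 + s" u] s gau_nonneg[of u] by (smt (verit) mult_less_cancel_right1 mult_le_cancel_right1)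
qed

lemma frontier_of_gau: assumes "gau D u = 1" shows "u \<in> frontier D"
proof -
 have "u \<notin> D" using gau_less_1 assms by force
 moreover have "u \<in> closure D"
 proof (rule Lim_in_closed_set[of "closure D" "\<lambda>n. (1 - 1 / (real n + 2)) *\<^sub>R u" sequentially])
  have "(1 - 1 / (real n + 2)) *\<^sub>R u \<in> D" for n
   by (rule mem_of_gau_less_1) (subst gau_scale, auto simp: assms field_simps)
  thus "\<forall>\<^sub>F n in sequentially. (1 - 1 / (real n + 2)) *\<^sub>R u \<in> closure D" using closure_subset by (auto intro!: always_eventually)
  have "(\<lambda>n. 1 - 1 / (real n + 2)) \<longlonglongrightarrow> 1" by real_asymp
  from tendsto_scaleR[OF this tendsto_const[of u]] show "(\<lambda>n. (1 - 1 / (real n + 2)) *\<^sub>R u) \<longlonglongrightarrow> u" by simp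
 qed auto
 ultimately show ?thesis using op by (simp add: frontier_def interior_open)
qed

lemma normal_vector:
 assumes n: "!!d. d \<in> D ==> n \<bullet> d <= n \<bullet> y"
 shows "n \<bullet> u <= (n \<bullet> y) * gau D u" "n ~= 0 ==> n \<bullet> y > 0" "n ~= 0 ==> (1 / (n \<bullet> y)) *\<^sub>R n \<in> dual D"
proof -
 obtain r where r: "r > 0" "cball 0 r \<subseteq> D" using op zero open_contains_cball by blast
 show p: "n \<bullet> y > 0" if "n ~= 0"
 proof -
  have "(r / norm n) *\<^sub>R n \<in> D" using r that by (intro subsetD[OF r(2)]) auto
  from n[OF this] have "r * norm n <= n \<bullet> y" using that by (simp flip: power2_norm_eq_inner add: power2_eq_square)
  moreover have "r * norm n > 0" using r that by simp
  ultimately show ?thesis by linarith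
 qed
 show d: "(1 / (n \<bullet> y)) *\<^sub>R n \<in> dual D" if "n ~= 0"
  using n p[OF that] by (auto simp: dual_def field_simps)
 show "n \<bullet> u <= (n \<bullet> y) * gau D u"
 proof (cases "n = 0")
  case False
  from gau_ge[OF d[OF False], of u] show ?thesis using p[OF False] by (simp add: field_simps)
 qed simp
qed

text \<open>The polar is compact, so finitely many functionals are uniformly close to all. The
  additive loss is a multiple of |u| and becomes a factor because |u| <= R
  \<open>gau D u\<close>.\<close>

lemma finite_net:
 assumes n: "n > 0"
 obtains W where "finite W" "W ~= {}" "W \<subseteq> dual D" "!!u. \<exists>w\<in>W. gau D u <= (1 + n) * (w \<bullet> u)"
proof -
 obtain R where R: "R > 0" "!!u. norm u <= R * gau D u" using gau_lower by metis
 obtain K where K: "!!v. v \<in> dual D ==> norm v <= K" using dual_bound by blast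
 have "closed (dual D)"
 proof -
  have "dual D = (\<Inter>u\<in>D. {v. v \<bullet> u <= 1})" by (auto simp: dual_def)
  thus ?thesis by (auto intro!: closed_INT closed_Collect_le continuous_intros)
 qed
 moreover have "bounded (dual D)" using K bounded_iff by blast
 ultimately have cp: "compact (dual D)" by (simp add: compact_eq_bounded_closed)
 \<comment> \<open>The loss e |u| occurs twice, for a near maximiser and for its neighbour in the
   net, and 2 e R = n / (1 + n) leaves exactly the factor 1 / (1 + n).\<close>
 define e where "e = n / ((1 + n) * (2 * R))"
 have e: "e > 0" using n R by (simp add: e_def)
 have "dual D \<subseteq> (\<Union>x\<in>dual D. ball x e)" using e by auto
 then obtain W where W: "W \<subseteq> dual D" "finite W" "dual D \<subseteq> (\<Union>x\<in>W. ball x e)"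
  using compactE_image[OF cp, of "dual D" "\<lambda>x. ball x e"] by auto
 show ?thesis
 proof (rule that[OF W(2) _ W(1)])
  show "W ~= {}" using W(3) zero_dual by auto
  fix u
  show "\<exists>w\<in>W. gau D u <= (1 + n) * (w \<bullet> u)"
  proof (cases "u = 0")
   case True
   have "gau D u <= 0" using True by (intro gau_le) simp
   thus ?thesis using True \<open>W ~= {}\<close> by auto
  next
   case False
   have "gau D u - e * norm u < gau D u" using e False by simp
   then obtain v where v: "v \<in> dual D" "gau D u - e * norm u < v \<bullet> u"
    using less_cSup_iff[OF _ bdd_dual, of u "gau D u - e * norm u"] zero_dual unfolding gau_def by fastforce
   obtain w where w: "w \<in> W" "norm (w - v) < e" using W(3) v(1) by (auto simp: dist_norm)
   have "(v - w) \<bullet> u <= norm (v - w) * norm u" by (rule norm_cauchy_schwarz)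
   also have "... <= e * norm u" using w by (intro mult_right_mono) (auto simp: norm_minus_commute)
   finally have "gau D u - 2 * e * norm u <= w \<bullet> u" using v(2) by (simp add: inner_diff_left)
   moreover have "2 * e * norm u <= 2 * e * (R * gau D u)" using e R(2) by (intro mult_left_mono) auto
   moreover have "2 * e * (R * gau D u) = n / (1 + n) * gau D u" 
   proof -
    have "2 * e * R = n / (1 + n)" using R n by (simp add: e_def)
    thus ?thesis by (metis mult.assoc)
   qed
   moreover have "gau D u - n / (1 + n) * gau D u = gau D u / (1 + n)" using n by (simp add: field_simps)
   ultimately have "gau D u / (1 + n) <= w \<bullet> u" by linarith
   hence "gau D u <= (1 + n) * (w \<bullet> u)" using n by (simp add: pos_divide_le_eq mult.commute)
   thus ?thesis using w by blast
  qed
 qed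
qed

text \<open>The adjoint preserves the polar, so its images may be added; a net permuted by the
  adjoint makes the log-sum-exp function invariant under \<open>\<tau>\<close>.\<close>

lemma finite_net_invariant:
 assumes n: "n > 0" and \<tau>: "linear \<tau>" "!!p. \<tau> (\<tau> p) = p" "!!u. u \<in> D ==> \<tau> u \<in> D"
 obtains W where "finite W" "W ~= {}" "W \<subseteq> dual D" "!!u. \<exists>w\<in>W. gau D u <= (1 + n) * (w \<bullet> u)" "bij_betw (adjoint \<tau>) W W"
proof -
 obtain W where W: "finite W" "W ~= {}" "W \<subseteq> dual D" "!!u. \<exists>w\<in>W. gau D u <= (1 + n) * (w \<bullet> u)" using finite_net[OF n] by blast
 have ad: "adjoint \<tau> v \<bullet> u = v \<bullet> \<tau> u" for u v using adjoint_works[OF \<tau>(1)] by (simp add: inner_commute)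
 have adad: "adjoint \<tau> (adjoint \<tau> v) = v" for v
 proof -
  have "\<forall>u. adjoint \<tau> (adjoint \<tau> v) \<bullet> u = v \<bullet> u" by (simp add: ad \<tau>(2))
  thus ?thesis by (simp add: vector_eq_rdot)
 qed
 have W: "finite W" "W ~= {}" "W \<subseteq> dual D" "!!u. \<exists>w\<in>W. gau D u <= (1 + n) * (w \<bullet> u)" using W by auto
 let ?W = "W \<union> adjoint \<tau> ` W"
 show ?thesis
 proof (rule that[of ?W])
  show "?W \<subseteq> dual D" using W(3) \<tau>(3) by (auto simp: dual_def ad)
  show "bij_betw (adjoint \<tau>) ?W ?W"
   by (rule bij_betw_byWitness[where f' = "adjoint \<tau>"]) (auto simp: adad)
 qed (use W in auto)
qed

end

section \<open>Log-sum-exp approximation of a gauge\<close>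

text \<open>A smooth convex substitute for the maximum of the functionals in W, above it by at most
  ln (card W) / \<beta>. Its gradient \<open>glse\<close> is a convex combination of points of W and
  so stays in the polar.\<close>

definition lse :: "real => 'a::euclidean_space set => 'a => real" where
 "lse \<beta> W u = ln (\<Sum>w\<in>W. exp (\<beta> * (w \<bullet> u))) / \<beta>"

definition glse :: "real => 'a::euclidean_space set => 'a => 'a" where
 "glse \<beta> W u = (1 / (\<Sum>w\<in>W. exp (\<beta> * (w \<bullet> u)))) *\<^sub>R (\<Sum>w\<in>W. exp (\<beta> * (w \<bullet> u)) *\<^sub>R w)"

locale log_sum_exp =
 fixes \<beta> :: real and W :: "'a::euclidean_space set"
 assumes W: "finite W" "W ~= {}" and \<beta>: "\<beta> > 0"
begin

lemma sum_exp_pos: "(\<Sum>w\<in>W. exp (\<beta> * (w \<bullet> u))) > 0" using W by (intro sum_pos) auto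

lemma lse_ge: "w \<in> W ==> w \<bullet> u <= lse \<beta> W u"
proof -
 assume w: "w \<in> W"
 have "exp (\<beta> * (w \<bullet> u)) <= (\<Sum>w\<in>W. exp (\<beta> * (w \<bullet> u)))" by (rule member_le_sum[OF w]) (use W in auto)
 hence "\<beta> * (w \<bullet> u) <= ln (\<Sum>w\<in>W. exp (\<beta> * (w \<bullet> u)))" using sum_exp_pos by (simp add: ln_ge_iff)
 thus ?thesis using \<beta> by (simp add: lse_def field_simps)
qed

lemma lse_le: assumes "!!w. w \<in> W ==> w \<bullet> u <= c" shows "lse \<beta> W u <= c + ln (real (card W)) / \<beta>"
proof -
 have c0: "real (card W) > 0" using W by (simp add: card_gt_0_iff)
 have "(\<Sum>w\<in>W. exp (\<beta> * (w \<bullet> u))) <= (\<Sum>w\<in>W. exp (\<beta> * c))" using assms \<beta> by (intro sum_mono) auto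
 also have "... = exp (\<beta> * c + ln (real (card W)))" using c0 by (simp add: exp_add)
 finally have "ln (\<Sum>w\<in>W. exp (\<beta> * (w \<bullet> u))) <= \<beta> * c + ln (real (card W))" using sum_exp_pos by (metis exp_gt_zero ln_exp ln_le_cancel_iff)
 hence "lse \<beta> W u <= (\<beta> * c + ln (real (card W))) / \<beta>" unfolding lse_def using \<beta> by (intro divide_right_mono) auto
 thus ?thesis using \<beta> by (simp add: add_divide_distrib)
qed

lemma lse_0: "lse \<beta> W 0 = ln (real (card W)) / \<beta>" by (simp add: lse_def)

lemma lse_has_derivative: "(lse \<beta> W has_derivative (\<lambda>h. glse \<beta> W u \<bullet> h)) (at u)"
proof -
 have "((\<lambda>u. \<Sum>w\<in>W. exp (\<beta> * (w \<bullet> u))) has_derivative (\<lambda>h. \<Sum>w\<in>W. exp (\<beta> * (w \<bullet> u)) * (\<beta> * (w \<bullet> h)))) (at u)"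
  by (rule has_derivative_sum) (auto intro!: derivative_eq_intros simp: mult_ac)
 from has_derivative_ln[OF sum_exp_pos this]
 have "((\<lambda>u. ln (\<Sum>w\<in>W. exp (\<beta> * (w \<bullet> u))) * inverse \<beta>) has_derivative
   (\<lambda>h. (\<Sum>w\<in>W. exp (\<beta> * (w \<bullet> u)) * (\<beta> * (w \<bullet> h))) * inverse (\<Sum>w\<in>W. exp (\<beta> * (w \<bullet> u))) * inverse \<beta>)) (at u)"
  by (rule has_derivative_mult_left)
 hence "((\<lambda>u. ln (\<Sum>w\<in>W. exp (\<beta> * (w \<bullet> u))) / \<beta>) has_derivative
   (\<lambda>h. (\<Sum>w\<in>W. exp (\<beta> * (w \<bullet> u)) * (\<beta> * (w \<bullet> h))) * inverse (\<Sum>w\<in>W. exp (\<beta> * (w \<bullet> u))) / \<beta>)) (at u)"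
  by (simp only: divide_inverse)
 moreover have "(\<Sum>w\<in>W. exp (\<beta> * (w \<bullet> u)) * (\<beta> * (w \<bullet> h))) * inverse (\<Sum>w\<in>W. exp (\<beta> * (w \<bullet> u))) / \<beta> = glse \<beta> W u \<bullet> h" for h
 proof -
  have "(\<Sum>w\<in>W. exp (\<beta> * (w \<bullet> u)) * (\<beta> * (w \<bullet> h))) = \<beta> * (\<Sum>w\<in>W. exp (\<beta> * (w \<bullet> u)) * (w \<bullet> h))"
   by (simp add: sum_distrib_left mult_ac)
  thus ?thesis using \<beta> by (simp add: glse_def inner_sum_left divide_inverse)
 qed
 ultimately show ?thesis by (simp add: lse_def[abs_def])
qed

lemma continuous_lse: "continuous_on S (lse \<beta> W)"
 using lse_has_derivative has_derivative_continuous continuous_at_imp_continuous_on by blast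

lemma continuous_glse: "continuous_on S (glse \<beta> W)"
 unfolding glse_def[abs_def] using less_imp_neq[OF sum_exp_pos] by (intro continuous_intros) (metis)

lemma glse_inner: "glse \<beta> W u \<bullet> h = (\<Sum>w\<in>W. exp (\<beta> * (w \<bullet> u)) * (w \<bullet> h)) / (\<Sum>w\<in>W. exp (\<beta> * (w \<bullet> u)))"
 by (simp add: glse_def inner_sum_left)

lemma glse_inner_le: assumes "!!w. w \<in> W ==> w \<bullet> h <= c" shows "glse \<beta> W u \<bullet> h <= c"
proof -
 have "(\<Sum>w\<in>W. exp (\<beta> * (w \<bullet> u)) * (w \<bullet> h)) <= (\<Sum>w\<in>W. exp (\<beta> * (w \<bullet> u)) * c)"
  using assms by (intro sum_mono mult_left_mono) auto
 also have "... = (\<Sum>w\<in>W. exp (\<beta> * (w \<bullet> u))) * c" by (simp add: sum_distrib_right)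
 finally show ?thesis using sum_exp_pos[of u] by (simp add: glse_inner field_simps)
qed

lemma glse_dual: "W \<subseteq> dual D ==> glse \<beta> W u \<in> dual D"
 unfolding dual_def by (auto intro!: glse_inner_le)

lemma glse_self_le: "glse \<beta> W u \<bullet> u <= lse \<beta> W u" by (rule glse_inner_le) (rule lse_ge)

text \<open>The tangent inequality 1 + t <= exp t, averaged with the weights of the
  gradient.\<close>

lemma lse_convex: "lse \<beta> W (u + h) >= lse \<beta> W u + glse \<beta> W u \<bullet> h"
proof -
 let ?E = "\<Sum>w\<in>W. exp (\<beta> * (w \<bullet> u))"
 define c where "c = glse \<beta> W u \<bullet> h"
 have "?E * exp (\<beta> * c) <= (\<Sum>w\<in>W. exp (\<beta> * (w \<bullet> (u + h))))"
 proof -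
  have "?E * exp (\<beta> * c) = (\<Sum>w\<in>W. exp (\<beta> * (w \<bullet> u)) * exp (\<beta> * c) * (1 + (\<beta> * (w \<bullet> h) - \<beta> * c)))"
  proof -
   have "(\<Sum>w\<in>W. exp (\<beta> * (w \<bullet> u)) * exp (\<beta> * c) * (1 + (\<beta> * (w \<bullet> h) - \<beta> * c)))
    = exp (\<beta> * c) * ((1 - \<beta> * c) * ?E + \<beta> * (\<Sum>w\<in>W. exp (\<beta> * (w \<bullet> u)) * (w \<bullet> h)))"
    by (simp add: sum_distrib_left sum.distrib sum_subtractf algebra_simps)
   also have "(\<Sum>w\<in>W. exp (\<beta> * (w \<bullet> u)) * (w \<bullet> h)) = c * ?E" using sum_exp_pos[of u] by (simp add: c_def glse_inner)
   finally show ?thesis by (simp add: algebra_simps)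
  qed
  also have "... <= (\<Sum>w\<in>W. exp (\<beta> * (w \<bullet> u)) * exp (\<beta> * c) * exp (\<beta> * (w \<bullet> h) - \<beta> * c))"
   by (intro sum_mono mult_left_mono exp_ge_add_one_self) auto
  also have "... = (\<Sum>w\<in>W. exp (\<beta> * (w \<bullet> (u + h))))"
   by (intro sum.cong) (auto simp: inner_add_right distrib_left simp flip: exp_add)
  finally show ?thesis .
 qed
 hence "ln (?E * exp (\<beta> * c)) <= ln (\<Sum>w\<in>W. exp (\<beta> * (w \<bullet> (u + h))))"
  using sum_exp_pos by (subst ln_le_cancel_iff) auto
 hence "ln ?E + \<beta> * c <= ln (\<Sum>w\<in>W. exp (\<beta> * (w \<bullet> (u + h))))" using sum_exp_pos[of u] by (simp add: ln_mult)
 hence "(ln ?E + \<beta> * c) / \<beta> <= lse \<beta> W (u + h)" unfolding lse_def using \<beta> by (intro divide_right_mono) auto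
 thus ?thesis using \<beta> by (simp add: lse_def c_def add_divide_distrib)
qed

text \<open>The tangent at u, evaluated at the origin. With \<open>glse_self_le\<close> this
  replaces Euler's identity, which fails because \<open>lse\<close> is not homogeneous.\<close>

lemma glse_self_ge: "glse \<beta> W u \<bullet> u >= lse \<beta> W u - ln (real (card W)) / \<beta>"
 using lse_convex[of u "- u"] by (simp add: lse_0)

lemma lse_invariant:
 assumes "linear \<tau>" "bij_betw (adjoint \<tau>) W W"
 shows "lse \<beta> W (\<tau> u) = lse \<beta> W u"
proof -
 have ad: "w \<bullet> \<tau> u = adjoint \<tau> w \<bullet> u" for w using adjoint_works[OF assms(1)] by (simp add: inner_commute)
 show ?thesis unfolding lse_def ad using sum.reindex_bij_betw[OF assms(2), of "\<lambda>w. exp (\<beta> * (w \<bullet> u))"] by simp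
qed

end

section \<open>The upper bound for the capacity\<close>

text \<open>Outside K the function is constant, so after subtracting m it extends by 0 to the whole
  space. All second derivatives live on the compact K and are bounded, which makes the extended
  gradient globally Lipschitz.\<close>

lemma smooth_on_lipschitz_gradient:
 fixes H :: "'a::euclidean_space => real"
 assumes sm: "smooth_on D H" and D: "open D" and K: "compact K" "K \<subseteq> D" and m: "!!p. p \<in> D - K ==> H p = m"
 defines "f \<equiv> \<lambda>x. if x \<in> D then H x - m else 0"
 obtains df L where "L >= 0" "!!x. (f has_derivative (\<lambda>v. df x \<bullet> v)) (at x)" "!!x y. norm (df x - df y) <= L * norm (x - y)"
  "!!x. x \<notin> K ==> df x = 0" "!!x. norm (df x) <= L" "!!x v. x \<in> D ==> frechet_derivative H (at x) v = df x \<bullet> v"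
  "!!x. \<bar>f x\<bar> <= L"
proof -
 define F where "F x = frechet_derivative H (at x)" for x
 define G where "G x = (if x \<in> D then F x else (\<lambda>v. 0))" for x
 have Hd: "H differentiable (at x)" if "x \<in> D" for x
  using sm[unfolded smooth_on_def, rule_format, of "[]"] that by simp
 have f0: "f x = 0" if "x \<notin> K" for x using m that by (auto simp: f_def)
 have oK: "open (- K)" using K(1) compact_imp_closed by blast
 have fG: "(f has_derivative G x) (at x)" for x
 proof (cases "x \<in> D")
  case True
  have "(H has_derivative F x) (at x)" unfolding F_def using Hd[OF True] frechet_derivative_works by blast
  hence "((\<lambda>x. H x - m) has_derivative F x) (at x)" by (auto intro!: derivative_eq_intros)
  hence "(f has_derivative F x) (at x)"
   by (rule has_derivative_transform_within_open[OF _ D True]) (simp add: f_def)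
  thus ?thesis using True by (simp add: G_def)
 next
  case False
  have "((\<lambda>x. 0) has_derivative (\<lambda>v. 0::real)) (at x)" by simp
  hence "(f has_derivative (\<lambda>v. 0)) (at x)"
   by (rule has_derivative_transform_within_open[OF _ oK]) (use False K f0 in auto)
  thus ?thesis using False by (simp add: G_def)
 qed
 have G0: "G x = (\<lambda>v. 0)" if "x \<notin> K" for x
 proof -
  have "((\<lambda>x. 0) has_derivative (\<lambda>v. 0::real)) (at x)" by simp
  hence "(f has_derivative (\<lambda>v. 0)) (at x)"
   by (rule has_derivative_transform_within_open[OF _ oK]) (use that f0 in auto)
  thus ?thesis using fG has_derivative_unique by blast
 qed
 have linG: "linear (G x)" for x using fG has_derivative_linear by blast
 define df where "df x = (\<Sum>b\<in>Basis. G x b *\<^sub>R b)" for x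
 have dfG: "df x \<bullet> v = G x v" for x v
 proof -
  have "G x v = G x (\<Sum>b\<in>Basis. (v \<bullet> b) *\<^sub>R b)" by (simp add: euclidean_representation)
  also have "... = (\<Sum>b\<in>Basis. (v \<bullet> b) * G x b)" by (simp add: linear_sum[OF linG] linear_cmul[OF linG])
  finally show ?thesis unfolding df_def inner_sum_left by (simp add: inner_commute mult.commute)
 qed
 have Gd: "\<exists>C\<ge>0. \<forall>x y. \<bar>G x b - G y b\<bar> <= C * norm (x - y)" for b
 proof -
  define u where "u x = G x b" for x
  have uD: "u x = iter_dderiv [b] H x" if "x \<in> D" for x using that by (simp add: u_def G_def F_def)
  have u0: "u x = 0" if "x \<notin> K" for x using G0[OF that] by (simp add: u_def)
  have ud: "u differentiable (at x)" for x
  proof (cases "x \<in> D")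
   case True
   have "iter_dderiv [b] H differentiable (at x)" using sm True unfolding smooth_on_def by blast
   then obtain g where "(iter_dderiv [b] H has_derivative g) (at x)" by (auto simp: differentiable_def)
   hence "(u has_derivative g) (at x)"
    by (rule has_derivative_transform_within_open[OF _ D True]) (simp add: uD)
   thus ?thesis by (auto simp: differentiable_def)
  next
   case False
   have "((\<lambda>x. 0) has_derivative (\<lambda>v. 0::real)) (at x)" by simp
   hence "(u has_derivative (\<lambda>v. 0)) (at x)"
    by (rule has_derivative_transform_within_open[OF _ oK]) (use False K u0 in auto)
   thus ?thesis by (auto simp: differentiable_def)
  qed
  define U where "U x = frechet_derivative u (at x)" for x
  have uU: "(u has_derivative U x) (at x)" for x unfolding U_def using ud frechet_derivative_works by blast
  have linU: "linear (U x)" for x using uU has_derivative_linear by blast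
  have "\<exists>B\<ge>0. \<forall>x. \<bar>U x b'\<bar> <= B" for b'
  proof -
   have c: "continuous_on K (iter_dderiv [b', b] H)" using sm K(2) continuous_on_subset unfolding smooth_on_def by blast
   have "bounded (iter_dderiv [b', b] H ` K)" by (rule compact_imp_bounded[OF compact_continuous_image[OF c K(1)]])
   then obtain B where B: "!!x. x \<in> K ==> \<bar>iter_dderiv [b', b] H x\<bar> <= B" by (auto simp: bounded_iff)
   have "\<bar>U x b'\<bar> <= max 0 B" for x
   proof (cases "x \<in> K")
    case True
    hence xD: "x \<in> D" using K by auto
    have "(iter_dderiv [b] H has_derivative U x) (at x)"
     by (rule has_derivative_transform_within_open[OF uU D xD]) (simp add: uD)
    hence "frechet_derivative (iter_dderiv [b] H) (at x) = U x" by (rule frechet_derivative_at[symmetric])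
    hence "iter_dderiv [b', b] H x = U x b'" by simp
    thus ?thesis using B[OF True] by simp
   next
    case False
    have "((\<lambda>x. 0) has_derivative (\<lambda>v. 0::real)) (at x)" by simp
    hence "(u has_derivative (\<lambda>v. 0)) (at x)"
     by (rule has_derivative_transform_within_open[OF _ oK]) (use False u0 in auto)
    hence "U x = (\<lambda>v. 0)" using uU has_derivative_unique by blast
    thus ?thesis by simp
   qed
   thus ?thesis by (intro exI[of _ "max 0 B"]) auto
  qed
  then obtain B where B: "!!b'. B b' >= 0" "!!b' x. \<bar>U x b'\<bar> <= B b'" by metis
  define C where "C = (\<Sum>b'\<in>Basis. B b')"
  have on: "onorm (U x) <= C" for x
  proof (rule onorm_le)
   fix v
   have "U x v = U x (\<Sum>b\<in>Basis. (v \<bullet> b) *\<^sub>R b)" by (simp add: euclidean_representation)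
   also have "... = (\<Sum>b\<in>Basis. (v \<bullet> b) * U x b)" by (simp add: linear_sum[OF linU] linear_cmul[OF linU])
   finally have "norm (U x v) <= (\<Sum>b\<in>Basis. \<bar>v \<bullet> b\<bar> * \<bar>U x b\<bar>)" by (simp add: sum_abs[THEN order_trans] abs_mult flip: abs_mult)
   also have "... <= (\<Sum>b\<in>Basis. norm v * B b)" by (intro sum_mono mult_mono) (auto simp: Basis_le_norm B)
   finally show "norm (U x v) <= C * norm v" by (simp add: C_def sum_distrib_left sum_distrib_right mult.commute)
  qed
  have "norm (u x - u y) <= C * norm (x - y)" for x y
   by (rule differentiable_bound[where S = UNIV and f' = U]) (use uU on has_derivative_at_withinI in auto)
  moreover have "C >= 0" using B(1) by (simp add: C_def sum_nonneg)
  ultimately show ?thesis by (intro exI[of _ C]) (auto simp: u_def)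
 qed
 then obtain C where C: "!!b. C b >= 0" "!!b x y. \<bar>G x b - G y b\<bar> <= C b * norm (x - y)" by metis
 define L1 where "L1 = (\<Sum>b\<in>Basis. C b)"
 have L1: "L1 >= 0" using C(1) by (simp add: L1_def sum_nonneg)
 have lip: "norm (df x - df y) <= L1 * norm (x - y)" for x y
 proof -
  have "df x - df y = (\<Sum>b\<in>Basis. (G x b - G y b) *\<^sub>R b)" by (simp add: df_def sum_subtractf algebra_simps)
  also have "norm ... <= (\<Sum>b\<in>Basis. C b * norm (x - y))"
   by (rule order_trans[OF norm_sum sum_mono]) (use C in auto)
  finally show ?thesis by (simp add: L1_def sum_distrib_right)
 qed
 have df0: "df x = 0" if "x \<notin> K" for x using G0[OF that] by (simp add: df_def)
 have "L1-lipschitz_on UNIV df" using lip L1 by (auto intro!: lipschitz_onI simp: dist_norm)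
 hence "continuous_on K df" using lipschitz_on_continuous_on continuous_on_subset by blast
 hence "bounded (df ` K)" using compact_imp_bounded compact_continuous_image K(1) by blast
 then obtain L2 where L2: "!!x. x \<in> K ==> norm (df x) <= L2" by (auto simp: bounded_iff)
 have "continuous_on K f" by (intro continuous_at_imp_continuous_on ballI has_derivative_continuous[OF fG])
 hence "bounded (f ` K)" using compact_imp_bounded compact_continuous_image K(1) by blast
 then obtain L3 where L3: "!!x. x \<in> K ==> \<bar>f x\<bar> <= L3" by (auto simp: bounded_iff)
 define L where "L = L1 + max 0 L2 + max 0 L3"
 have LL: "L1 <= L" "max 0 L2 <= L" "max 0 L3 <= L" using L1 by (auto simp: L_def)
 show ?thesis
 proof (rule that[of L df])
  show "(f has_derivative (\<lambda>v. df x \<bullet> v)) (at x)" for x using fG[of x] by (simp add: dfG[abs_def])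
  show "norm (df x - df y) <= L * norm (x - y)" for x y
   by (rule order_trans[OF lip mult_right_mono]) (use LL in auto)
  show "norm (df x) <= L" for x using L2[of x] df0[of x] LL by (cases "x \<in> K") auto
  show "\<bar>f x\<bar> <= L" for x using L3[of x] f0[of x] LL by (cases "x \<in> K") auto
  show "frechet_derivative H (at x) v = df x \<bullet> v" if "x \<in> D" for x v using that by (simp add: dfG G_def F_def)
 qed (use LL L1 df0 in auto)
qed

lemma lipschitz_gradient_semiconvex:
 fixes f :: "'a::euclidean_space => real"
 assumes f: "!!x. (f has_derivative (\<lambda>v. df x \<bullet> v)) (at x)" and lip: "!!x y. norm (df x - df y) <= L * norm (x - y)" and L: "L >= 0"
 shows "f (p + q) >= f p + df p \<bullet> q - L * (norm q)^2"
proof -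
 have d: "((\<lambda>t. f (p + t *\<^sub>R q)) has_real_derivative df (p + t *\<^sub>R q) \<bullet> q) (at t)" for t
 proof -
  have "((f \<circ> (\<lambda>t. p + t *\<^sub>R q)) has_derivative (\<lambda>v. df (p + t *\<^sub>R q) \<bullet> v) \<circ> (\<lambda>t. t *\<^sub>R q)) (at t)"
   by (rule diff_chain_at) (auto intro!: derivative_eq_intros f)
  thus ?thesis by (simp add: o_def has_field_derivative_def mult.commute[of _ "df (p + t *\<^sub>R q) \<bullet> q"])
 qed
 obtain w where w: "0 < w" "w < 1" "f (p + 1 *\<^sub>R q) - f (p + 0 *\<^sub>R q) = (1 - 0) * (df (p + w *\<^sub>R q) \<bullet> q)"
  using MVT2[of 0 1 "\<lambda>t. f (p + t *\<^sub>R q)" "\<lambda>t. df (p + t *\<^sub>R q) \<bullet> q"] d by auto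
 have "\<bar>(df (p + w *\<^sub>R q) - df p) \<bullet> q\<bar> <= norm (df (p + w *\<^sub>R q) - df p) * norm q" by (rule Cauchy_Schwarz_ineq2)
 also have "... <= (L * norm (w *\<^sub>R q)) * norm q" using lip[of "p + w *\<^sub>R q" p] by (intro mult_right_mono) auto
 also have "... <= (L * norm q) * norm q" using w L by (intro mult_right_mono mult_left_mono) (auto simp: mult_left_le_one_le)
 finally have "\<bar>(df (p + w *\<^sub>R q) - df p) \<bullet> q\<bar> <= L * (norm q)^2" by (simp add: power2_eq_square)
 thus ?thesis using w(3) by (simp add: inner_diff_left abs_le_iff)
qed

section \<open>Extension of the Hamiltonian beyond the domain\<close>

lemma positive_part_derivative:
 fixes g :: "real => real"
 assumes g: "!!y. y >= 0 ==> (g has_real_derivative g' y) (at y)" and g0: "g 0 = 0" "g' 0 = 0"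
 shows "((\<lambda>r. g (max 0 (r - R))) has_real_derivative g' (max 0 (r - R))) (at r)"
proof (cases r R rule: linorder_cases)
 case less
 have "((\<lambda>r. 0) has_real_derivative 0) (at r)" by simp
 hence "((\<lambda>r. g (max 0 (r - R))) has_real_derivative 0) (at r)"
  by (rule has_field_derivative_transform_within_open[where S = "{..<R}"]) (use less g0 in auto)
 thus ?thesis using less g0 by simp
next
 case greater
 have "((\<lambda>r. g (r - R)) has_real_derivative g' (r - R)) (at r)"
  using g[of "r - R"] greater DERIV_shift[of g "g' (r - R)" r "- R"] by simp
 hence "((\<lambda>r. g (max 0 (r - R))) has_real_derivative g' (r - R)) (at r)"
  by (rule has_field_derivative_transform_within_open[where S = "{R<..}"]) (use greater in auto)
 thus ?thesis using greater by simp
next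
 case equal
 have lim: "((\<lambda>h. (g (0 + h) - g 0) / h) \<longlongrightarrow> 0) (at 0)" using g[of 0] g0 by (simp add: DERIV_def)
 have "((\<lambda>h. g (max 0 h) / h) \<longlongrightarrow> 0) (at 0)"
 proof (rule filterlim_split_at_real)
  have "\<forall>\<^sub>F h in at_left (0::real). g (max 0 h) / h = 0"
   using eventually_at_left_real[of "-1" 0] by (auto elim!: eventually_mono simp: g0 max_def)
  thus "((\<lambda>h. g (max 0 h) / h) \<longlongrightarrow> 0) (at_left 0)" by (simp add: tendsto_eventually)
  have "((\<lambda>h. (g (0 + h) - g 0) / h) \<longlongrightarrow> 0) (at_right 0)" using lim by (rule filterlim_mono) (auto simp: at_le)
  moreover have "\<forall>\<^sub>F h in at_right (0::real). (g (0 + h) - g 0) / h = g (max 0 h) / h"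
   using eventually_at_right_real[of 0 1] by (auto elim!: eventually_mono simp: g0 max_def)
  ultimately show "((\<lambda>h. g (max 0 h) / h) \<longlongrightarrow> 0) (at_right 0)" by (rule Lim_transform_eventually)
 qed
 thus ?thesis using equal g0 by (simp add: DERIV_def)
qed

text \<open>The radial profile is constant up to \<open>\<rho>\<close> and grows like \<open>c r\<^sup>2\<close>, while \<open>\<phi>(r) / r\<^sup>2\<close> decreases: this makes
  the action functional nonpositive on the orbits outside the domain. The linear term with coefficient
  \<open>d\<close> only serves to bound almost critical points.\<close>

lemma radial_profile:
 fixes m c :: real
 assumes c: "0 < c" "c < m"
 obtains \<rho> d C \<phi> \<phi>' where "\<rho> > 1" "d > 0" "C >= 0"
  "!!r. (\<phi> has_real_derivative \<phi>' r) (at r)" "continuous_on UNIV \<phi>'" "!!r. r <= \<rho> ==> \<phi> r = m \<and> \<phi>' r = 0"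
  "!!r. \<phi> r >= m" "!!r. \<phi>' r >= 0" "!!r s. \<phi> s >= \<phi> r + \<phi>' r * (s - r)"
  "!!r. r >= 0 ==> \<phi> r >= c * r^2 - C" "!!r. r >= 0 ==> \<phi> r - (1/2) * (r * \<phi>' r) >= 0"
  "!!r. r >= 0 ==> \<phi> r - (1/2) * (r * \<phi>' r) >= d * r - C"
  "!!r. r >= 0 ==> \<phi>' r <= C * (1 + r)" "!!r. r >= 0 ==> \<phi> r <= C * (1 + r^2)"
proof -
 \<comment> \<open>c \<rho>^2 is the midpoint of c and m, which leaves a budget m - c \<rho>^2 = (m
   - c) / 2.\<close>
 define \<rho> where "\<rho> = sqrt ((c + m) / (2 * c))"
 have r2: "\<rho>^2 = (c + m) / (2 * c)" using c by (simp add: \<rho>_def)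
 have \<rho>: "\<rho> > 1" using c by (simp add: \<rho>_def)
 have cr: "c * \<rho>^2 = (c + m) / 2" using c by (simp add: r2)
 \<comment> \<open>The budget is spent in equal parts: 2 d \<rho> and A \<kappa> are (m - c) / 4
   each, so that \<phi> - r \<phi>' / 2 >= d r comes out exactly beyond \<rho>.\<close>
 define d where "d = (m - c) / (8 * \<rho>)"
 have d: "d > 0" "2 * d * \<rho> = (m - c) / 4" using c \<rho> by (auto simp: d_def)
 \<comment> \<open>With y = r - \<rho> the part 2 c \<rho> y completes c y^2 to c r^2 - c \<rho>^2;
   the part 2 d y is the linear gain.\<close>
 define A where "A = 2 * c * \<rho> + 2 * d"
 have A: "A > 0" using c \<rho> d by (simp add: A_def add_pos_pos)
 define \<kappa> where "\<kappa> = (m - c) / (4 * A)"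
 have \<kappa>: "\<kappa> > 0" "A * \<kappa> = (m - c) / 4" using c A by (auto simp: \<kappa>_def)
 \<comment> \<open>A convex function between y - \<kappa> and y whose derivative vanishes at 0 and
   is at most 1: the linear function y made C^1 at the junction.\<close>
 define t t' where "t y = y^2 / (y + \<kappa>)" and "t' y = (y^2 + 2 * \<kappa> * y) / (y + \<kappa>)^2" for y
 define g g' where "g y = c * y^2 + A * t y" and "g' y = 2 * c * y + A * t' y" for y
 have td: "(t has_real_derivative t' y) (at y)" if "y >= 0" for y
 proof -
  have "(t has_real_derivative ((2 * y) * (y + \<kappa>) - y^2 * 1) / ((y + \<kappa>) * (y + \<kappa>))) (at y)"
   unfolding t_def[abs_def] by (rule DERIV_divide) (use that \<kappa> in \<open>auto intro!: derivative_eq_intros\<close>)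
  moreover have "((2 * y) * (y + \<kappa>) - y^2 * 1) / ((y + \<kappa>) * (y + \<kappa>)) = t' y"
   by (simp add: t'_def power2_eq_square algebra_simps)
  ultimately show ?thesis by simp
 qed
 have tb: "0 <= t' y" "t' y <= 1" "y - \<kappa> <= t y" "t y <= y" "0 <= t y" if "y >= 0" for y
 proof -
  have p: "y + \<kappa> > 0" using that \<kappa> by simp
  show "0 <= t' y" "0 <= t y" using that \<kappa> by (auto simp: t'_def t_def)
  have "y^2 + 2 * \<kappa> * y <= (y + \<kappa>)^2" by (simp add: power2_eq_square algebra_simps)
  moreover have "(y + \<kappa>)^2 > 0" using p by simp
  ultimately show "t' y <= 1" by (simp add: t'_def)
  show "y - \<kappa> <= t y" using p unfolding t_def by (subst pos_le_divide_eq) (auto simp: power2_eq_square algebra_simps)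
  show "t y <= y" using p that \<kappa> unfolding t_def by (subst pos_divide_le_eq) (auto simp: power2_eq_square algebra_simps)
 qed
 have tc: "t b >= t a + t' a * (b - a)" if "a >= 0" "b >= 0" for a b
 proof -
  have p: "a + \<kappa> > 0" "b + \<kappa> > 0" using that \<kappa> by auto
  have "t b - (t a + t' a * (b - a)) = \<kappa>^2 * (b - a)^2 / ((b + \<kappa>) * (a + \<kappa>)^2)"
  proof -
   have ne: "a + \<kappa> ~= 0" "b + \<kappa> ~= 0" using p by auto
   have "(t b - (t a + t' a * (b - a))) * ((b + \<kappa>) * (a + \<kappa>)^2) = b^2 * (a + \<kappa>)^2 - (a^2 * (a + \<kappa>) + (a^2 + 2 * \<kappa> * a) * (b - a)) * (b + \<kappa>)"
   proof -
    have "t b * ((b + \<kappa>) * (a + \<kappa>)^2) = b^2 * (a + \<kappa>)^2" using ne by (simp add: t_def)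
    moreover have "t a * ((b + \<kappa>) * (a + \<kappa>)^2) = a^2 * (a + \<kappa>) * (b + \<kappa>)" using ne by (simp add: t_def power2_eq_square)
    moreover have "t' a * (b - a) * ((b + \<kappa>) * (a + \<kappa>)^2) = (a^2 + 2 * \<kappa> * a) * (b - a) * (b + \<kappa>)" using ne by (simp add: t'_def)
    ultimately show ?thesis by (simp only: left_diff_distrib distrib_right)
   qed
   also have "... = \<kappa>^2 * (b - a)^2" by (simp add: power2_eq_square algebra_simps)
   finally show ?thesis using ne by (simp add: eq_divide_eq)
  qed
  also have "... >= 0" using p by simp
  finally show ?thesis by simp
 qed
 have gd: "(g has_real_derivative g' y) (at y)" if "y >= 0" for y
  unfolding g_def[abs_def] g'_def by (rule derivative_eq_intros td[OF that] refl | simp)+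
 have g0: "g 0 = 0" "g' 0 = 0" by (simp_all add: g_def g'_def t_def t'_def)
 have g'0: "g' y >= 0" if "y >= 0" for y using tb(1)[OF that] that A c by (simp add: g'_def)
 have gc: "g b >= g a + g' a * (b - a)" if "a >= 0" "b >= 0" for a b
 proof -
  have "A * (t a + t' a * (b - a)) <= A * t b" using tc[OF that] A by (intro mult_left_mono) auto
  moreover have "c * (b^2 - a^2 - 2 * a * (b - a)) = c * (b - a)^2" by (simp add: power2_eq_square algebra_simps)
  moreover have "c * (b - a)^2 >= 0" using c by simp
  ultimately show ?thesis by (simp add: g_def g'_def algebra_simps)
 qed
 define Y where "Y r = max 0 (r - \<rho>)" for r
 have Y0: "Y r >= 0" for r by (simp add: Y_def)
 define \<phi> \<phi>' where "\<phi> r = m + g (Y r)" and "\<phi>' r = g' (Y r)" for r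
 define C where "C = c * \<rho>^2 + A * \<kappa> + d * \<rho> + 2 * c + A + m + 2 * d * \<rho> + 2 * c"
 have Cb: "c * \<rho>^2 + A * \<kappa> <= C" "d * \<rho> <= C" "2 * c + A <= C" "m + A + c <= C" "C >= 0" "c * \<rho>^2 <= C"
  using c A d \<kappa> \<rho> by (auto simp: C_def)
 have radial: "\<phi> r - (1/2) * (r * \<phi>' r) >= d * r" if "r > \<rho>" for r
 proof -
  define y where "y = r - \<rho>"
  have y: "y > 0" "Y r = y" "r = y + \<rho>" using that by (auto simp: y_def Y_def)
  have "r * \<phi>' r <= r * (2 * c * y + A)"
   using tb(2)[of y] y A \<rho> by (intro mult_left_mono) (auto simp: \<phi>'_def g'_def)
  hence 1: "(1/2) * (r * \<phi>' r) <= c * r * y + r * A / 2" by (simp add: algebra_simps)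
  have 2: "\<phi> r >= m + c * y^2 + A * (y - \<kappa>)"
   using tb(3)[of y] y A by (auto simp: \<phi>_def g_def intro!: mult_left_mono)
  have "m + c * y^2 + A * (y - \<kappa>) - (c * r * y + r * A / 2) = m - c * \<rho>^2 - 2 * d * \<rho> - A * \<kappa> + d * r"
   unfolding A_def y(3) by (simp add: power2_eq_square algebra_simps)
  moreover have "m - c * \<rho>^2 - 2 * d * \<rho> - A * \<kappa> = 0"
   unfolding cr d(2) \<kappa>(2) by (simp add: field_simps)
  ultimately show ?thesis using 1 2 by linarith
 qed
 have small: "\<phi> r = m \<and> \<phi>' r = 0" if "r <= \<rho>" for r using that g0 by (simp add: \<phi>_def \<phi>'_def Y_def)
 show ?thesis
 proof (rule that[of \<rho> d C \<phi> \<phi>'])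
  show "(\<phi> has_real_derivative \<phi>' r) (at r)" for r
   unfolding \<phi>_def[abs_def] \<phi>'_def Y_def[abs_def]
   using DERIV_add[OF DERIV_const positive_part_derivative[OF gd g0], of m \<rho> r] by simp
  have "continuous_on UNIV (\<lambda>r. 2 * c * Y r + A * (((Y r)^2 + 2 * \<kappa> * Y r) / (Y r + \<kappa>)^2))"
   unfolding Y_def by (intro continuous_intros) (use \<kappa> in \<open>auto simp: max_def\<close>)
  thus "continuous_on UNIV \<phi>'" by (simp add: \<phi>'_def[abs_def] g'_def t'_def)
  show "\<phi> r >= m" for r using tb(5)[OF Y0[of r]] A c by (simp add: \<phi>_def g_def)
  show "\<phi>' r >= 0" for r using g'0[OF Y0] by (simp add: \<phi>'_def)
  show "\<phi> s >= \<phi> r + \<phi>' r * (s - r)" for r s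
  proof -
   have "g' (Y r) * (s - r) <= g' (Y r) * (Y s - Y r)"
   proof (cases "r >= \<rho>")
    case True
    thus ?thesis by (intro mult_left_mono[OF _ g'0[OF Y0]]) (simp add: Y_def)
   qed (simp add: Y_def g0)
   thus ?thesis using gc[OF Y0 Y0, of r s] by (simp add: \<phi>_def \<phi>'_def)
  qed
  fix r :: real assume r: "r >= 0"
  show "\<phi> r >= c * r^2 - C"
  proof (cases "r <= \<rho>")
   case True
   hence "c * r^2 <= c * \<rho>^2" using r c by (intro mult_left_mono power_mono) auto
   thus ?thesis using small[OF True] Cb(6) c by linarith
  next
   case False
   define y where "y = r - \<rho>"
   have y: "y > 0" "Y r = y" "r = y + \<rho>" using False by (auto simp: y_def Y_def)
   have 2: "\<phi> r >= m + c * y^2 + A * (y - \<kappa>)"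
    using tb(3)[of y] y A by (auto simp: \<phi>_def g_def intro!: mult_left_mono)
   have "m + c * y^2 + A * (y - \<kappa>) = m + c * r^2 - c * \<rho>^2 - A * \<kappa> + 2 * d * y"
    unfolding A_def y(3) by (simp add: power2_eq_square algebra_simps)
   moreover have "2 * d * y >= 0" using d y by simp
   ultimately show ?thesis using 2 Cb(1) c by linarith
  qed
  show "\<phi> r - (1/2) * (r * \<phi>' r) >= d * r - C"
  proof (cases "r <= \<rho>")
   case True
   have "d * r <= d * \<rho>" using True d by (intro mult_left_mono) auto
   thus ?thesis using small[OF True] c Cb(2) by simp
  qed (use radial[of r] Cb(5) in simp)
  show "\<phi> r - (1/2) * (r * \<phi>' r) >= 0"
  proof (cases "r <= \<rho>")
   case False
   have "d * r >= 0" using d r by simp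
   thus ?thesis using radial[of r] False by linarith
  qed (use small c in simp)
  have Yr: "Y r <= r" using \<rho> r by (simp add: Y_def)
  have "\<phi>' r <= 2 * c * r + A * 1"
   unfolding \<phi>'_def g'_def using Yr c A tb(2)[OF Y0[of r]] by (intro add_mono mult_left_mono) auto
  also have "... <= (2 * c + A) * (1 + r)" using c A r by (simp add: algebra_simps)
  also have "... <= C * (1 + r)" using Cb(3) r by (intro mult_right_mono) auto
  finally show "\<phi>' r <= C * (1 + r)" .
  have "\<phi> r <= m + (c * r^2 + A * r)"
   unfolding \<phi>_def g_def using Yr Y0[of r] tb(4)[OF Y0[of r]] c A r by (intro add_mono mult_left_mono power_mono) auto
  also have "A * r <= A * (1 + r^2)" using A sum_squares_bound[of 1 r] r
   by (intro mult_left_mono) (auto simp: power2_eq_square)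
  finally have "\<phi> r <= m + c * r^2 + A * (1 + r^2)" by simp
  also have "... <= (m + A + c) * (1 + r^2)" using c by (simp add: algebra_simps)
  also have "... <= C * (1 + r^2)" using Cb(4) by (intro mult_right_mono) auto
  finally show "\<phi> r <= C * (1 + r^2)" .
 qed (use \<rho> d Cb small in auto)
qed

text \<open>The set of times at which the curve is at the given point is closed, and open because
  the curve cannot move inside E.\<close>

lemma constant_or_avoids:
 fixes x :: "real => 'a::euclidean_space"
 assumes d: "!!t. (x has_vector_derivative v t) (at t)" and E: "open E" and v0: "!!t. x t \<in> E ==> v t = 0"
  and t0: "x t0 \<in> E"
 shows "x t = x t0"
proof -
 let ?S = "{t. x t = x t0}"
 have c: "continuous_on UNIV x"
  using d by (intro continuous_at_imp_continuous_on) (auto intro: has_vector_derivative_continuous)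
 have "closed ?S" using continuous_closed_preimage_constant[OF c closed_UNIV] by simp
 moreover have "open ?S"
 proof (subst open_contains_ball, intro ballI)
  fix t assume t: "t \<in> ?S"
  have "open (x -` E)" using continuous_open_preimage[OF c open_UNIV E] by simp
  then obtain e where e: "e > 0" "ball t e \<subseteq> x -` E" using t t0 by (metis (mono_tags) mem_Collect_eq open_contains_ball vimageI)
  have "\<exists>k. \<forall>s\<in>ball t e. x s = k"
  proof (rule has_derivative_zero_constant)
   fix s assume s: "s \<in> ball t e"
   hence "v s = 0" using v0 e by blast
   thus "(x has_derivative (\<lambda>h. 0)) (at s within ball t e)"
    using d[of s] by (auto simp: has_vector_derivative_def intro: has_derivative_at_withinI)
  qed simp
  then obtain k where k: "!!s. s \<in> ball t e ==> x s = k" by blast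
  have "ball t e \<subseteq> ?S"
  proof
   fix s assume "s \<in> ball t e"
   hence "x s = x t" using k[of s] k[of t] e by simp
   thus "s \<in> ?S" using t by simp
  qed
  thus "\<exists>e>0. ball t e \<subseteq> ?S" using e by blast
 qed
 ultimately have "?S = UNIV \<or> ?S = {}" by (metis clopen)
 moreover have "t0 \<in> ?S" by simp
 ultimately have "t \<in> ?S" by (metis UNIV_I empty_iff)
 thus ?thesis by simp
qed

lemma connected_curve_in_one:
 fixes x :: "real => 'a::topological_space"
 assumes c: "continuous_on UNIV x" and "closed A" "closed B" "A \<inter> B = {}" and ab: "!!t. x t \<in> A \<or> x t \<in> B"
 shows "(\<forall>t. x t \<in> A) \<or> (\<forall>t. x t \<in> B)"
proof -
 have "closed (x -` A)" "closed (x -` B)" using continuous_closed_preimage[OF c closed_UNIV] assms by auto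
 moreover have "x -` B = - (x -` A)" using ab assms(4) by auto
 ultimately have "x -` A = UNIV \<or> x -` A = {}" using clopen by (metis closed_def double_compl)
 thus ?thesis using ab by blast
qed

lemma (in convex_body) lse_net_bounds:
 assumes Wn: "finite W" "W ~= {}" "W \<subseteq> dual D" "!!u. \<exists>w\<in>W. gau D u <= (1 + n) * (w \<bullet> u)" and \<beta>: "\<beta> > 0" and n: "n > 0"
 shows "gau D u / (1 + n) <= lse \<beta> W u" "lse \<beta> W u <= gau D u + ln (real (card W)) / \<beta>" "lse \<beta> W u >= 0"
  "ln (real (card W)) / \<beta> >= 0"
proof -
 interpret log_sum_exp \<beta> W by unfold_locales (use Wn \<beta> in auto)
 obtain w where w: "w \<in> W" "gau D u <= (1 + n) * (w \<bullet> u)" using Wn(4) by blast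
 have "gau D u / (1 + n) <= w \<bullet> u" using w(2) n by (simp add: pos_divide_le_eq mult.commute)
 also have "... <= lse \<beta> W u" by (rule lse_ge[OF w(1)])
 finally show 1: "gau D u / (1 + n) <= lse \<beta> W u" .
 have "gau D u / (1 + n) >= 0" using gau_nonneg n by simp
 with 1 show "lse \<beta> W u >= 0" by linarith
 show "lse \<beta> W u <= gau D u + ln (real (card W)) / \<beta>" by (rule lse_le) (use Wn(3) gau_ge in auto)
 have "card W >= 1" using Wn(1,2) by (simp add: Suc_le_eq card_gt_0_iff)
 thus "ln (real (card W)) / \<beta> >= 0" using \<beta> by simp
qed

lemma convex_body_translate:
 assumes "open D" "convex D" "bounded D" "p0 \<in> D"
 shows "convex_body ((\<lambda>u. u - p0) ` D)"
proof
 show "open ((\<lambda>u. u - p0) ` D)" using open_translation_subtract[of D p0] assms by simp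
 show "convex ((\<lambda>u. u - p0) ` D)" using assms by (simp add: convex_translation_subtract_eq)
 show "bounded ((\<lambda>u. u - p0) ` D)" using bounded_translation_minus assms by blast
qed (use assms in auto)

text \<open>The centre p0 comes from the open set where H vanishes, which is why loops are assumed
  for every symmetric point. Inside D the extended Hamiltonian is H itself; a critical orbit of
  positive action can be neither constant nor outside D, so it is an orbit of H of period 1.\<close>

lemma capacity_upper:
 fixes \<tau> :: "'n::finite pt => 'n pt"
 assumes \<tau>: "lin_antisymp_involution \<tau>" and D: "open D" "convex D" "bounded D" and inv: "\<tau> ` D = D"
  and H: "hz_class \<tau> D H" and a: "0 < a" "a < mH D H"
  and loops: "!!p0. [|p0 \<in> D; \<tau> p0 = p0|] ==> \<exists>C z. char_loop \<tau> (gau ((\<lambda>u. u - p0) ` D)) a C z"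
 shows "\<exists>x. ham_brake_orbit \<tau> D H x 1 \<and> \<not> (\<exists>c. \<forall>t. x t = c)"
proof -
 define m where "m = mH D H"
 have lin: "linear \<tau>" and tt: "!!p. \<tau> (\<tau> p) = p" using \<tau> by (auto simp: lin_antisymp_involution_def)
 obtain U p0 where U: "open U" "U \<subseteq> D" "!!p. p \<in> U ==> H p = 0" and p0U: "p0 \<in> U" and p0: "\<tau> p0 = p0"
  using H unfolding hz_class_def by blast
 obtain K where K: "compact K" "K \<subseteq> D" "!!p. p \<in> D - K ==> H p = m" using H unfolding hz_class_def m_def by blast
 have sm: "smooth_on D H" and H0: "!!p. p \<in> D ==> 0 <= H p" and Hinv: "!!p. p \<in> D ==> H (\<tau> p) = H p"
  using H unfolding hz_class_def by auto
 have \<tau>D: "\<tau> p \<in> D \<longleftrightarrow> p \<in> D" for p using inv tt by (metis imageI)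
 define D' where "D' = (\<lambda>u. u - p0) ` D"
 have D'iff: "u \<in> D' \<longleftrightarrow> u + p0 \<in> D" for u by (force simp: D'_def image_iff)
 interpret convex_body D' unfolding D'_def by (rule convex_body_translate) (use D p0U U in auto)
 obtain Kg where Kg: "Kg > 0" "!!u. gau D' u <= Kg * norm u" "!!v. v \<in> dual D' ==> norm v <= Kg" using gau_upper by blast
 obtain R where R: "R > 0" "!!u. norm u <= R * gau D' u" "D' \<subseteq> ball 0 R" using gau_lower by blast
 \<comment> \<open>H minus its maximum, extended by 0; adding a profile equal to m on D recovers H
   there.\<close>
 define f where "f x = (if x \<in> D then H x - m else 0)" for x
 obtain df L where L: "L >= 0" and df: "!!x. (f has_derivative (\<lambda>v. df x \<bullet> v)) (at x)"
  and dfL: "!!x y. norm (df x - df y) <= L * norm (x - y)" and dfK: "!!x. x \<notin> K ==> df x = 0" and dfb: "!!x. norm (df x) <= L"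
  and dfH: "!!x v. x \<in> D ==> frechet_derivative H (at x) v = df x \<bullet> v" and fb: "!!x. \<bar>f x\<bar> <= L"
  by (rule smooth_on_lipschitz_gradient[of D H K m, folded f_def, folded f_def[abs_def], OF sm D(1) K], assumption) (rule that; assumption)
 define c where "c = (a + m) / 2"
 have c: "0 < c" "c < m" "a < c" using a by (auto simp: c_def m_def)
 obtain \<rho> d C F F' where \<rho>: "\<rho> > 1" and d: "d > 0" and C: "C >= 0"
  and Fd: "!!r. (F has_real_derivative F' r) (at r)" and Fc: "continuous_on UNIV F'"
  and F\<rho>: "!!r. r <= \<rho> ==> F r = m \<and> F' r = 0" and Fm: "!!r. F r >= m" and F0: "!!r. F' r >= 0"
  and Fcv: "!!r s. F s >= F r + F' r * (s - r)" and Fq: "!!r. r >= 0 ==> F r >= c * r^2 - C"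
  and FE: "!!r. r >= 0 ==> F r - (1/2) * (r * F' r) >= 0"
  and Fg: "!!r. r >= 0 ==> F r - (1/2) * (r * F' r) >= d * r - C"
  and F'l: "!!r. r >= 0 ==> F' r <= C * (1 + r)" and Fl: "!!r. r >= 0 ==> F r <= C * (1 + r^2)"
  by (rule radial_profile[OF c(1,2)]) (rule that; assumption)
 \<comment> \<open>The slack c - a is shared: 2 \<epsilon> remains for the linking estimate, and
   \<eta> is the precision of the net for which c / (1 + \<eta>)^2 = a + 2 \<epsilon>.\<close>
 define \<epsilon> where "\<epsilon> = (c - a) / 4"
 define \<eta> where "\<eta> = sqrt (c / ((a + c) / 2)) - 1"
 have \<epsilon>: "\<epsilon> > 0" using c by (simp add: \<epsilon>_def)
 have ac: "a + 2 * \<epsilon> = (a + c) / 2" by (simp add: \<epsilon>_def field_simps)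
 have \<eta>: "\<eta> > 0" using c a by (simp add: \<eta>_def)
 have ace: "c / (1 + \<eta>)^2 = a + 2 * \<epsilon>" unfolding ac using c a by (simp add: \<eta>_def)
 have \<tau>D': "\<tau> u \<in> D'" if "u \<in> D'" for u
 proof -
  have "\<tau> u + p0 = \<tau> (u + p0)" by (simp add: linear_add[OF lin] p0)
  thus ?thesis using that by (simp add: D'iff \<tau>D)
 qed
 obtain W where Wn: "finite W" "W ~= {}" "W \<subseteq> dual D'" "!!u. \<exists>w\<in>W. gau D' u <= (1 + \<eta>) * (w \<bullet> u)" "bij_betw (adjoint \<tau>) W W"
  using finite_net_invariant[OF \<eta> lin tt \<tau>D'] by metis
 \<comment> \<open>The error ln (card W) / \<beta> is below \<rho> - 1, so the approximate gauge
   stays below \<rho> on the body and the profile is constant there.\<close>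
 define \<beta> where "\<beta> = 2 * (ln (real (card W)) + 1) / (\<rho> - 1)"
 have W1: "ln (real (card W)) >= 0" using Wn(1,2) by (simp add: Suc_le_eq card_gt_0_iff)
 have \<beta>: "\<beta> > 0" using \<rho> W1 by (simp add: \<beta>_def)
 have \<beta>\<rho>: "1 + ln (real (card W)) / \<beta> < \<rho>"
 proof -
  have "ln (real (card W)) / \<beta> = (ln (real (card W)) / (2 * (ln (real (card W)) + 1))) * (\<rho> - 1)" by (simp add: \<beta>_def)
  also have "... < 1 * (\<rho> - 1)" using W1 \<rho> by (intro mult_strict_right_mono) (auto simp: field_simps)
  finally show ?thesis by simp
 qed
 interpret log_sum_exp \<beta> W by unfold_locales (use Wn \<beta> in auto)
 let ?l = "lse \<beta> W" and ?g = "glse \<beta> W"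
 note lb = lse_net_bounds[OF Wn(1-4) \<beta> \<eta>]
 have l\<rho>: "?l u < \<rho>" if "u \<in> D'" for u
 proof -
  have "gau D' u <= 1" using that closure_subset by (intro gau_le_1) blast
  thus ?thesis using lb(2)[of u] \<beta>\<rho> by linarith
 qed
 have gK: "norm (?g u) <= Kg" for u using Kg(3) glse_dual[OF Wn(3)] by blast
 have lK: "?l u <= Kg * norm u + \<rho>" for u using lb(2)[of u] Kg(2)[of u] \<beta>\<rho> by linarith
 define h where "h x = f (x + p0) + F (?l x)" for x
 define dh where "dh x = df (x + p0) + F' (?l x) *\<^sub>R ?g x" for x
 have dh: "(h has_derivative (\<lambda>v. dh x \<bullet> v)) (at x)" for x
 proof -
  have 1: "((\<lambda>x. f (x + p0)) has_derivative (\<lambda>v. df (x + p0) \<bullet> v)) (at x)"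
   by (rule has_derivative_compose[of "\<lambda>x. x + p0" "\<lambda>v. v" x UNIV f, OF _ df, simplified]) (auto intro!: derivative_eq_intros)
  have 2: "((\<lambda>x. F (?l x)) has_derivative (\<lambda>v. F' (?l x) * (?g x \<bullet> v))) (at x)"
   by (rule has_derivative_compose[OF lse_has_derivative, of F "(*) (F' (?l x))" x]) (use Fd has_field_derivative_def in blast)
  show ?thesis unfolding h_def[abs_def] dh_def using has_derivative_add[OF 1 2] by (simp add: inner_add_left)
 qed
 have h\<tau>: "h (\<tau> x) = h x" for x
 proof -
  have "\<tau> x + p0 = \<tau> (x + p0)" by (simp add: linear_add[OF lin] p0)
  thus ?thesis unfolding h_def f_def using \<tau>D Hinv lse_invariant[OF lin Wn(5)] by simp
 qed
 have dh\<tau>: "dh (\<tau> x) \<bullet> \<tau> v = dh x \<bullet> v" for x v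
 proof -
  have "(h \<circ> \<tau> has_derivative (\<lambda>v. dh (\<tau> x) \<bullet> v) \<circ> \<tau>) (at x)"
   by (rule diff_chain_at[OF linear_imp_has_derivative[OF lin] dh])
  moreover have "h \<circ> \<tau> = h" using h\<tau> by auto
  ultimately have "(\<lambda>v. dh (\<tau> x) \<bullet> v) \<circ> \<tau> = (\<lambda>v. dh x \<bullet> v)" using has_derivative_unique dh by metis
  thus ?thesis by (metis comp_apply)
 qed
 have h_nonneg: "h x >= 0" for x
  using H0[of "x + p0"] Fm[of "?l x"] c unfolding h_def f_def by (auto split: if_splits)
 obtain r0 where r0: "r0 > 0" "ball p0 r0 \<subseteq> U" using U p0U open_contains_ball by blast
 have h_zero: "h x = 0" if "norm x < r0" for x
 proof -
  have "x + p0 \<in> U" using that r0 by (intro subsetD[OF r0(2)]) (simp add: dist_norm)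
  hence "x + p0 \<in> D" "H (x + p0) = 0" using U by auto
  thus ?thesis using F\<rho>[of "?l x"] l\<rho>[of x] by (simp add: h_def f_def D'iff)
 qed
 have l_lower: "norm x <= R * (1 + \<eta>) * ?l x" for x
 proof -
  have "gau D' x <= (1 + \<eta>) * ?l x" using lb(1)[of x] \<eta> by (simp add: pos_divide_le_eq mult.commute)
  hence "R * gau D' x <= R * ((1 + \<eta>) * ?l x)" using R by (intro mult_left_mono) auto
  thus ?thesis using R(2)[of x] by (simp add: mult.assoc)
 qed
 have dfx: "\<bar>df (x + p0) \<bullet> x\<bar> <= L * R" for x
 proof (cases "x + p0 \<in> K")
  case True
  hence "x \<in> D'" using K(2) by (auto simp: D'iff)
  hence "norm x <= R" using R(3) by auto
  have "\<bar>df (x + p0) \<bullet> x\<bar> <= norm (df (x + p0)) * norm x" by (rule Cauchy_Schwarz_ineq2)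
  also have "... <= L * R" using dfb \<open>norm x <= R\<close> L by (intro mult_mono) auto
  finally show ?thesis .
 qed (use dfK L R in simp)
 have rad: "F (?l x) - (1/2) * (F' (?l x) * (?g x \<bullet> x)) >= F (?l x) - (1/2) * (?l x * F' (?l x))" for x
  using mult_left_mono[OF glse_self_le[of x] F0[of "?l x"]] by (simp add: mult.commute)
 have growth: "h x - (1/2) * (dh x \<bullet> x) >= d / (R * (1 + \<eta>)) * norm x - (C + L + L * R)" for x
 proof -
  have "d / (R * (1 + \<eta>)) * norm x <= d / (R * (1 + \<eta>)) * (R * (1 + \<eta>) * ?l x)"
   using l_lower[of x] d R \<eta> by (intro mult_left_mono) auto
  also have "... = d * ?l x" using R \<eta> by simp
  finally have 1: "d / (R * (1 + \<eta>)) * norm x <= d * ?l x" .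
  have "h x - (1/2) * (dh x \<bullet> x) = f (x + p0) - (1/2) * (df (x + p0) \<bullet> x) + (F (?l x) - (1/2) * (F' (?l x) * (?g x \<bullet> x)))"
   by (simp add: h_def dh_def inner_add_left distrib_left)
  thus ?thesis using 1 rad[of x] Fg[OF lb(3)[of x]] fb[of "x + p0"] dfx[of x] by (simp only: abs_le_iff) linarith
 qed
 have sc: "h (x + q) >= h x + dh x \<bullet> q - L * (norm q)^2" for x q
 proof -
  have 1: "f (x + p0 + q) >= f (x + p0) + df (x + p0) \<bullet> q - L * (norm q)^2"
   by (rule lipschitz_gradient_semiconvex[OF df dfL L])
  have "F' (?l x) * (?g x \<bullet> q) <= F' (?l x) * (?l (x + q) - ?l x)" using lse_convex[of x q] by (intro mult_left_mono F0) auto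
  hence 2: "F (?l (x + q)) >= F (?l x) + F' (?l x) * (?g x \<bullet> q)" using Fcv[of "?l x" "?l (x + q)"] by linarith
  have e: "h (x + q) = f (x + p0 + q) + F (?l (x + q))" unfolding h_def by (simp add: add.commute add.left_commute)
  show ?thesis using 1 2 unfolding e by (simp add: h_def dh_def inner_add_left)
 qed
 have dh_lin: "norm (dh x) <= (L + C * (1 + \<rho> + Kg) * Kg) * (1 + norm x)" for x
 proof -
  have "norm (dh x) <= norm (df (x + p0)) + F' (?l x) * norm (?g x)" unfolding dh_def using norm_triangle_ineq[of "df (x + p0)"] F0[of "?l x"] by (metis abs_of_nonneg norm_scaleR)
  also have "... <= L + (C * (1 + ?l x)) * Kg" using dfb F'l[OF lb(3)[of x]] gK[of x] F0[of "?l x"] C lb(3)[of x] by (intro add_mono mult_mono) auto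
  also have "... <= L * (1 + norm x) + (C * ((1 + \<rho> + Kg) * (1 + norm x))) * Kg"
  proof (intro add_mono mult_right_mono mult_left_mono)
   show "L <= L * (1 + norm x)" using L by (simp add: mult_left_le distrib_left)
   have "Kg * norm x + \<rho> <= Kg * (1 + norm x) + \<rho> * (1 + norm x)" using Kg(1) \<rho> by (simp add: distrib_left)
   thus "1 + ?l x <= (1 + \<rho> + Kg) * (1 + norm x)" using lK[of x] norm_ge_zero[of x] by (simp add: distrib_right del: norm_ge_zero)
  qed (use C Kg in auto)
  also have "... = (L + C * (1 + \<rho> + Kg) * Kg) * (1 + norm x)" by (simp add: algebra_simps)
  finally show ?thesis .
 qed
 \<comment> \<open>The Hamiltonian vanishes for |x| < r0, so constants may be bounded by multiples
   of |x|^2 / r0^2.\<close>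
 define C2 where "C2 = (L + C) / r0^2 + C * (Kg + \<rho> / r0)^2"
 have C20: "C2 >= 0" using L C by (simp add: C2_def)
 have h_quad: "h x <= C2 * (norm x)^2" for x
 proof (cases "norm x < r0")
  case True
  thus ?thesis using h_zero[OF True] C20 by simp
 next
  case False
  have n: "norm x / r0 >= 1" using False r0(1) by simp
  hence n2: "1 <= (norm x)^2 / r0^2" using power_mono[OF n, of 2] by (simp add: power_divide)
  have "?l x <= Kg * norm x + \<rho> * (norm x / r0)" using lK[of x] mult_left_mono[OF n, of \<rho>] \<rho> by simp
  also have "... = (Kg + \<rho> / r0) * norm x" by (simp add: distrib_right)
  finally have "(?l x)^2 <= ((Kg + \<rho> / r0) * norm x)^2" using lb(3)[of x] by (intro power_mono)
  hence 1: "C * (?l x)^2 <= C * (Kg + \<rho> / r0)^2 * (norm x)^2" using C by (simp add: mult_left_mono power_mult_distrib mult.assoc)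
  have 2: "(L + C) * 1 <= (L + C) * ((norm x)^2 / r0^2)" using L C n2 by (intro mult_left_mono) auto
  have "h x <= L + C * (1 + (?l x)^2)" unfolding h_def using fb[of "x + p0"] Fl[OF lb(3)[of x]] by (intro add_mono) auto
  also have "... <= (L + C) * ((norm x)^2 / r0^2) + C * (Kg + \<rho> / r0)^2 * (norm x)^2" using 1 2 by (simp add: distrib_left)
  also have "... = C2 * (norm x)^2" by (simp add: C2_def distrib_right)
  finally show ?thesis .
 qed
 have hlow: "h x >= (a + 2 * \<epsilon>) * (gau D' x)^2 - (L + C)" for x
 proof -
  have "(gau D' x / (1 + \<eta>))^2 <= (?l x)^2" using lb(1)[of x] gau_nonneg \<eta> by (intro power_mono) auto
  hence "c * (gau D' x / (1 + \<eta>))^2 <= c * (?l x)^2" using c by (intro mult_left_mono) auto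
  moreover have "c * (gau D' x / (1 + \<eta>))^2 = (a + 2 * \<epsilon>) * (gau D' x)^2" unfolding ace[symmetric] by (simp add: power_divide)
  ultimately show ?thesis unfolding h_def using Fq[OF lb(3)[of x]] fb[of "x + p0"] by (simp add: abs_le_iff)
 qed
 obtain P P' :: "'n pt => 'n pt" where P: "linear P" "linear P'" "!!u. P (P' u) = u" "!!u. P' (P u) = u"
  "!!u v. omega0 (P u) (P v) = omega0 u v" "!!u. P (mirror u) = \<tau> (P u)"
  using symplectic_normal_form[OF \<tau>] by blast
 obtain B where B: "B > 0" "!!u. norm (P u) <= B * norm u" using linear_bounded_pos[OF P(1)] by blast
 obtain B' where B': "B' > 0" "!!u. norm (P' u) <= B' * norm u" using linear_bounded_pos[OF P(2)] by blast
 obtain B2 where B2: "B2 > 0" "!!u. norm (adjoint P u) <= B2 * norm u" using linear_bounded_pos[OF adjoint_linear[OF P(1)]] by blast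
 have nB: "norm u <= B' * norm (P u)" for u using B'(2)[of "P u"] P(4) by simp
 have ad: "adjoint P v \<bullet> u = v \<bullet> P u" for u v using adjoint_works[OF P(1)] by (simp add: inner_commute)
 define k where "k u = h (P u)" for u
 define dk where "dk u = adjoint P (dh (P u))" for u
 have cont: "continuous_on UNIV P" "continuous_on UNIV (adjoint P)" using P(1) adjoint_linear linear_continuous_on linear_conv_bounded_linear by blast+
 have ch: "continuous_on UNIV h" using dh has_derivative_continuous continuous_at_imp_continuous_on by blast
 have cdf: "continuous_on UNIV df" using dfL L by (intro lipschitz_on_continuous_on[of L] lipschitz_onI) (auto simp: dist_norm)
 have cdh: "continuous_on UNIV dh" unfolding dh_def[abs_def]
  by (intro continuous_intros continuous_on_compose2[OF cdf] continuous_on_compose2[OF Fc] continuous_lse continuous_glse) auto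
 define C1 where "C1 = L + C * (1 + \<rho> + Kg) * Kg"
 have C10: "C1 >= 0" using L C Kg(1) \<rho> by (simp add: C1_def)
 interpret hg: hamiltonian_growth k dk "L * B^2" "r0 / B" "B2 * C1 * (1 + B)" "C2 * B^2" "C + L + L * R" "d / (R * (1 + \<eta>)) / B'"
 proof
  show "continuous_on UNIV k" unfolding k_def[abs_def] by (rule continuous_on_compose2[OF ch cont(1)]) auto
  show "continuous_on UNIV dk" unfolding dk_def[abs_def]
   by (intro continuous_on_compose2[OF cont(2)] continuous_on_compose2[OF cdh cont(1)]) auto
  have sq: "(norm (P p))^2 <= B^2 * (norm p)^2" for p using power_mono[OF B(2)[of p] norm_ge_zero, of 2] by (simp add: power_mult_distrib)
  show "0 <= L * B^2" using L by simp
  show "0 < r0 / B" using r0 B by simp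
  show "0 < d / (R * (1 + \<eta>)) / B'" using d R \<eta> B' by simp
  fix p q
  show "k (p + q) >= k p + dk p \<bullet> q - L * B^2 * (norm q)^2"
   using sc[of "P p" "P q"] mult_left_mono[OF sq[of q] L] by (simp add: k_def dk_def ad linear_add[OF P(1)] mult.assoc)
  show "k p >= 0" by (simp add: k_def h_nonneg)
  show "k p = 0" if "norm p < r0 / B"
  proof -
   have "B * norm p < r0" using that B(1) by (simp add: pos_less_divide_eq mult.commute)
   thus ?thesis unfolding k_def using B(2)[of p] by (intro h_zero) linarith
  qed
  show "k p <= C2 * B^2 * (norm p)^2" using h_quad[of "P p"] mult_left_mono[OF sq[of p] C20] by (simp add: k_def mult.assoc)
  show "norm (dk p) <= B2 * C1 * (1 + B) * (1 + norm p)"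
  proof -
   have "norm (dk p) <= B2 * norm (dh (P p))" unfolding dk_def by (rule B2(2))
   also have "... <= B2 * (C1 * (1 + norm (P p)))" using dh_lin[of "P p"] B2(1) by (intro mult_left_mono) (auto simp: C1_def)
   also have "... <= B2 * (C1 * ((1 + B) * (1 + norm p)))"
   proof (intro mult_left_mono)
    have "1 + norm (P p) <= 1 + B * norm p" using B(2)[of p] by simp
    also have "... <= (1 + B) * (1 + norm p)" using B(1) by (simp add: distrib_left distrib_right)
    finally show "1 + norm (P p) <= (1 + B) * (1 + norm p)" .
   qed (use C10 B2 in auto)
   finally show ?thesis by (simp add: mult.assoc)
  qed
  show "d / (R * (1 + \<eta>)) / B' * norm p - (C + L + L * R) <= k p - (1/2) * (dk p \<bullet> p)"
  proof -
   have "norm p / B' <= norm (P p)" using nB[of p] B'(1) by (simp add: pos_divide_le_eq mult.commute)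
   hence "d / (R * (1 + \<eta>)) * (norm p / B') <= d / (R * (1 + \<eta>)) * norm (P p)" using d R \<eta> by (intro mult_left_mono) auto
   thus ?thesis using growth[of "P p"] by (simp add: k_def dk_def ad)
  qed
  show "dk (mirror p) = mirror (dk p)"
  proof -
   have "dk (mirror p) \<bullet> v = mirror (dk p) \<bullet> v" for v
   proof -
    have "dk (mirror p) \<bullet> v = dh (\<tau> (P p)) \<bullet> \<tau> (\<tau> (P v))" by (simp add: dk_def ad P(6) tt)
    also have "... = dk p \<bullet> mirror v" by (simp only: dh\<tau>) (simp add: dk_def ad P(6))
    also have "... = mirror (dk p) \<bullet> v" by (simp add: mirror_def inner_prod_def)
    finally show ?thesis .
   qed
   thus ?thesis by (metis vector_eq_rdot)
  qed
 qed
 obtain Cz z where z: "char_loop \<tau> (gau D') a Cz z" using loops[of p0] p0 p0U U unfolding D'_def by blast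
 have zu: "- omega0 (z (s + h) - z s) u <= 2 * a * h * gau D' u" if "0 <= h" "h <= 1" for s h u
  using z that unfolding char_loop_def by blast
 define z' where "z' t = P' (z t)" for t
 have Pz: "P (z' t) = z t" for t by (simp add: z'_def P(3))
 have om: "omega0 (z' s - z' t) u = omega0 (z s - z t) (P u)" for s t u
  by (subst P(5)[symmetric]) (simp add: linear_diff[OF P(1)] Pz)
 define G where "G u = gau D' (P u)" for u
 have R': "B' * R > 0" using B' R by simp
 obtain N b where b: "!!k. k \<notin> modes N ==> b k = 0"
  "!!t u. trig N (\<lambda>k. (2 * pi * real_of_int k) *\<^sub>R b k) t \<bullet> u <= 2 * a * G u"
  "pi * (\<Sum>k\<in>modes N. real_of_int k * (norm (b k))^2) > 0"
  "a - pi * (\<Sum>k\<in>modes N. real_of_int k * (norm (b k))^2) <= \<epsilon> / (B' * R)^2 * (\<Sum>k\<in>{1..int N}. (norm (b k))^2)"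
 proof (rule mollified_loop_defect[of z' a G "Kg * B" "\<epsilon> / (B' * R)^2" Cz])
  show "z' (t + 1) = z' t" for t using z by (simp add: z'_def char_loop_def)
  show "z' (- t) = mirror (z' t)" for t
  proof -
   have "P (z' (- t)) = P (mirror (z' t))" using z by (simp add: Pz P(6) char_loop_def)
   thus ?thesis by (metis P(4))
  qed
  show "G u <= Kg * B * norm u" for u
   using order_trans[OF Kg(2)[of "P u"] mult_left_mono[OF B(2)[of u], of Kg]] Kg(1) by (simp add: G_def mult.assoc)
  show "- omega0 (z' (s + h) - z' s) u <= 2 * a * h * G u" if "0 <= h" "h <= 1" for s h u
   unfolding om G_def by (rule zu[OF that])
  show "- omega0 (z' (s + h) - z' s) (z' s) >= 2 * a * h - Cz * h^2" if "0 <= h" "h <= 1" for s h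
   using z that by (simp add: om Pz char_loop_def)
  show "0 < \<epsilon> / (B' * R)^2" using \<epsilon> R' by (intro divide_pos_pos zero_less_power)
  show "0 <= Kg * B" using Kg(1) B(1) by (intro mult_nonneg_nonneg less_imp_le)
 qed (rule a(1) | (rule that; assumption))+
 obtain y where y: "!!t. (y has_vector_derivative J0 (dk (y t))) (at t)" "!!t. y (t + 1) = y t" "!!t. y (- t) = mirror (y t)"
  "integral {0..1} (\<lambda>t. (1/2) * (dk (y t) \<bullet> y t) - k (y t)) > 0"
 proof (rule hg.brake_orbit_exists_of_loop[of N b a "B' * R" \<epsilon> G "L + C"])
  show "continuous_on UNIV G" unfolding G_def[abs_def] by (rule continuous_on_compose2[OF continuous_gau cont(1)]) auto
  show "norm u <= B' * R * G u" for u
   using order_trans[OF nB[of u] mult_left_mono[OF R(2)[of "P u"], of B']] B'(1) by (simp add: G_def mult.assoc)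
  show "hg.Act N b > 0" using b(3) by (simp add: hg.Act_def)
  show "a - hg.Act N b <= \<epsilon> * (\<Sum>k\<in>{1..int N}. (norm (b k))^2) / (B' * R)^2" using b(4) by (simp add: hg.Act_def)
  show "k p >= (a + 2 * \<epsilon>) * (G p)^2 - (L + C)" for p using hlow by (simp add: k_def G_def)
  show "0 <= a" using a by simp
 qed (rule b R' \<epsilon> | assumption | (rule that; assumption))+
 define X where "X t = P (y t)" for t
 define v where "v t = P (J0 (dk (y t)))" for t
 have Xd: "(X has_vector_derivative v t) (at t)" for t unfolding X_def v_def
  by (rule bounded_linear.has_vector_derivative[OF _ y(1)]) (use P(1) linear_conv_bounded_linear in auto)
 have vw: "omega0 (v t) w = - (dh (X t) \<bullet> w)" for t w
 proof -
  have "omega0 (v t) w = omega0 (J0 (dk (y t))) (P' w)" unfolding v_def by (subst P(5)[symmetric]) (simp add: P(3))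
  thus ?thesis by (simp add: omega0_eq dk_def ad P(3) X_def)
 qed
 have v0: "v t = 0 \<longleftrightarrow> dh (X t) = 0" for t
 proof
  assume "v t = 0"
  hence "dh (X t) \<bullet> w = 0" for w using vw[of t w] by (simp add: omega0_def)
  thus "dh (X t) = 0" by (metis inner_eq_zero_iff)
 next
  assume "dh (X t) = 0"
  hence "J0 (v t) \<bullet> w = 0" for w using vw[of t w] by (simp add: omega0_eq)
  hence "J0 (v t) = 0" by (metis inner_eq_zero_iff)
  thus "v t = 0" by (metis norm_J0 norm_eq_zero)
 qed
 have int: "integral {0..1} (\<lambda>t. (1/2) * (dh (X t) \<bullet> X t) - h (X t)) > 0"
  using y(4) by (simp add: dk_def ad k_def X_def)
 \<comment> \<open>The critical value is the integral of this expression. It must therefore be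
   positive at some time, which a rest point and a point outside the body both violate.\<close>
 have neg: False if "!!t. (1/2) * (dh (X t) \<bullet> X t) - h (X t) <= 0"
 proof -
  have "(\<lambda>t. (1/2) * (dh (X t) \<bullet> X t) - h (X t)) integrable_on {0..1}"
   using int not_integrable_integral by fastforce
  hence "integral {0..1} (\<lambda>t. (1/2) * (dh (X t) \<bullet> X t) - h (X t)) <= integral {0..1::real} (\<lambda>t. 0)"
   by (rule integral_le) (use that in auto)
  thus False using int by (simp only: integral_0)
 qed
 have cxi: "continuous_on UNIV X" using Xd by (intro continuous_at_imp_continuous_on) (auto intro: has_vector_derivative_continuous)
 have nonconst: "\<not> (\<forall>t. X t = X t0)" for t0
 proof
  assume c: "\<forall>t. X t = X t0"
  have "v t = 0" for t
  proof -
   have "X = (\<lambda>_. X t0)" using c by auto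
   hence "(X has_vector_derivative 0) (at t)" by (metis has_vector_derivative_const)
   thus ?thesis using vector_derivative_unique_at[OF Xd] by simp
  qed
  hence "dh (X t) = 0" for t using v0 by simp
  thus False using neg h_nonneg by simp
 qed
 define K' where "K' = (\<lambda>u. u - p0) ` K"
 have K'iff: "u \<in> K' \<longleftrightarrow> u + p0 \<in> K" for u by (force simp: K'_def image_iff)
 have K': "closed K'" "K' \<subseteq> D'" unfolding K'_def D'_def by (rule compact_imp_closed[OF compact_translation_subtract[OF K(1)]], rule image_mono[OF K(2)])
 have f0: "f (u + p0) = 0" "df (u + p0) = 0" if "u \<notin> K'" for u
  using that K(3) dfK by (auto simp: f_def K'iff)
 \<comment> \<open>Between K' and the level \<rho> the extended Hamiltonian is constant; an orbit
   entering this open region would rest there.\<close>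
 define E where "E = {u. ?l u < \<rho>} - K'"
 have "open {u. ?l u < \<rho>}" using continuous_lse by (intro open_Collect_less) (auto intro: continuous_intros)
 hence "open E" unfolding E_def using K' by (intro open_Diff)
 have E0: "v t = 0" if "X t \<in> E" for t
  unfolding v0 using that F\<rho>[of "?l (X t)"] f0 by (auto simp: E_def dh_def)
 have noE: "X t \<notin> E" for t
 proof
  assume "X t \<in> E"
  from constant_or_avoids[OF Xd \<open>open E\<close> E0 this] nonconst show False by blast
 qed
 have "closed {u. \<rho> <= ?l u}" using continuous_lse by (intro closed_Collect_le) (auto intro: continuous_intros)
 moreover have "K' \<inter> {u. \<rho> <= ?l u} = {}" using K' l\<rho> by fastforce
 moreover have "X t \<in> K' \<or> X t \<in> {u. \<rho> <= ?l u}" for t using noE[of t] by (auto simp: E_def not_less)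
 ultimately have "(\<forall>t. X t \<in> K') \<or> (\<forall>t. X t \<in> {u. \<rho> <= ?l u})"
  by (intro connected_curve_in_one[OF cxi K'(1)])
 \<comment> \<open>Outside, the Hamiltonian is the radial profile alone, whose estimate \<phi> - r
   \<phi>' / 2 >= 0 makes the integrand nonpositive.\<close>
 moreover have False if "\<forall>t. X t \<in> {u. \<rho> <= ?l u}"
 proof (rule neg)
  fix t
  have "X t \<notin> K'" using that \<open>K' \<inter> _ = {}\<close> by blast
  hence "h (X t) = F (?l (X t))" "dh (X t) \<bullet> X t = F' (?l (X t)) * (?g (X t) \<bullet> X t)" using f0 by (auto simp: h_def dh_def)
  thus "(1/2) * (dh (X t) \<bullet> X t) - h (X t) <= 0" using rad[of "X t"] FE[OF lb(3)[of "X t"]] by simp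
 qed
 ultimately have XK: "X t \<in> K'" for t by blast
 define x where "x t = X t + p0" for t
 have xD: "x t \<in> D" for t using XK[of t] K(2) by (auto simp: x_def K'iff)
 have "ham_brake_orbit \<tau> D H x 1" unfolding ham_brake_orbit_def
 proof (intro conjI allI)
  fix t
  show "x t \<in> D" by (rule xD)
  show "x (t + 1) = x t" by (simp add: x_def X_def y)
  show s: "x (- t) = \<tau> (x t)" by (simp add: x_def X_def y(3) P(6) linear_add[OF lin] p0)
  show "x (1 - t) = x (- t)" using y(2)[of "- t"] by (simp add: x_def X_def)
  have "(x has_vector_derivative v t) (at t)" unfolding x_def[abs_def] using has_vector_derivative_add_const Xd by blast
  moreover have "omega0 (v t) w = - frechet_derivative H (at (x t)) w" for w
  proof -
   have "?l (X t) <= \<rho>" using l\<rho>[of "X t"] XK[of t] K'(2) by force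
   thus ?thesis using F\<rho>[of "?l (X t)"] dfH[OF xD[of t]] by (simp add: vw dh_def x_def)
  qed
  ultimately show "\<exists>v. (x has_vector_derivative v) (at t) \<and> (\<forall>w. omega0 v w = - frechet_derivative H (at (x t)) w)" by blast
 qed
 moreover have "\<not> (\<exists>c. \<forall>t. x t = c)"
 proof
  assume "\<exists>c. \<forall>t. x t = c"
  then obtain c where "!!t. X t + p0 = c" by (auto simp: x_def)
  hence "X t = X 0" for t by (metis add_right_cancel)
  thus False using nonconst by blast
 qed
 ultimately show ?thesis by blast
qed

section \<open>Finiteness of the capacity\<close>

lemma sin_ge_quadratic: "x >= 0 ==> sin x >= x - x^2 / (2::real)"
proof -
 assume x: "x >= 0"
 have "sin 0 - 0 + 0^2 / 2 <= sin x - x + x^2 / 2"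
 proof (rule DERIV_nonneg_imp_nondecreasing[OF x])
  fix y :: real assume y: "0 <= y" "y <= x"
  have "\<bar>sin (y / 2)\<bar> * \<bar>sin (y / 2)\<bar> <= 1 * (y / 2)"
   using abs_sin_x_le_abs_x[of "y / 2"] y abs_sin_le_one[of "y / 2"] by (intro mult_mono) auto
  hence "2 * (sin (y / 2))^2 <= y" by (simp add: power2_eq_square)
  moreover have "cos y = 1 - 2 * (sin (y / 2))^2" using cos_double_sin[of "y / 2"] by simp
  ultimately have "0 <= cos y - 1 + y" by simp
  moreover have "((\<lambda>x. sin x - x + x^2 / 2) has_real_derivative cos y - 1 + y) (at y)" by (auto intro!: derivative_eq_intros)
  ultimately show "\<exists>z. ((\<lambda>x. sin x - x + x^2 / 2) has_real_derivative z) (at y) \<and> 0 <= z" by blast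
 qed
 thus ?thesis by simp
qed

text \<open>A circle of radius \<rho> in normal coordinates, with action pi \<rho>^2. The normal
  form stretches norms by at most B, and \<rho> = B R is the radius for which the chord bound is
  exactly 2 a h g u. The action is fixed before g, so that one value serves the gauges of all
  centres.\<close>

lemma circle_char_loop:
 fixes \<tau> :: "'n::finite pt => 'n pt"
 assumes \<tau>: "lin_antisymp_involution \<tau>" and R: "R > 0"
 obtains a where "a > 0" "\<forall>g. (\<forall>u. norm u <= R * g u) --> (\<exists>C z. char_loop \<tau> g a C z)"
proof -
 obtain p p' :: "'n pt => 'n pt" where p: "linear p" 
  "!!u v. omega0 (p u) (p v) = omega0 u v" "!!u. p (mirror u) = \<tau> (p u)"
  by (rule symplectic_normal_form[OF \<tau>]) (rule that; assumption)
 obtain B where B: "B > 0" "!!u. norm (p u) <= B * norm u" using linear_bounded_pos[OF p(1)] by blast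
 define \<rho> where "\<rho> = B * R"
 have \<rho>: "\<rho> > 0" using B R by (simp add: \<rho>_def)
 obtain c :: "real^'n" where c: "norm c = \<rho>" using vector_choose_size[of \<rho>] \<rho> by (auto intro: less_imp_le)
 have cc: "c \<bullet> c = \<rho>^2" using c by (simp add: power2_norm_eq_inner[symmetric])
 define y :: "real => 'n pt" where "y t = (cos (2 * pi * t) *\<^sub>R c, sin (2 * pi * t) *\<^sub>R c)" for t
 define a where "a = pi * \<rho>^2"
 have chord: "norm (y (s + h) - y s) <= \<rho> * (2 * pi * h)" if "h >= 0" for s h
 proof -
  let ?A = "2 * pi * (s + h)" and ?B = "2 * pi * s"
  have "(norm (y (s + h) - y s))^2 = \<rho>^2 * ((cos ?A - cos ?B)^2 + (sin ?A - sin ?B)^2)"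
   by (simp add: y_def norm_prod_def c power_mult_distrib distrib_left flip: scaleR_diff_left)
  also have "(cos ?A - cos ?B)^2 + (sin ?A - sin ?B)^2 = ((sin ?A)^2 + (cos ?A)^2) + ((sin ?B)^2 + (cos ?B)^2) - 2 * (cos ?A * cos ?B + sin ?A * sin ?B)"
   by (simp add: power2_diff algebra_simps del: sin_cos_squared_add)
  also have "... = 2 - 2 * cos (?A - ?B)" by (simp only: sin_cos_squared_add cos_diff)
  also have "?A - ?B = 2 * (pi * h)" by (simp add: algebra_simps)
  also have "2 - 2 * cos (2 * (pi * h)) = 4 * (sin (pi * h))^2" by (simp only: cos_double_sin) simp
  also have "\<rho>^2 * (4 * (sin (pi * h))^2) <= \<rho>^2 * (4 * (pi * h)^2)"
   using power_mono[OF abs_sin_x_le_abs_x[of "pi * h"], of 2] by (intro mult_left_mono) auto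
  also have "... = (\<rho> * (2 * pi * h))^2" by (simp add: power_mult_distrib)
  finally show ?thesis using \<rho> that by (auto intro: power2_le_imp_le)
 qed
 have area: "- omega0 (y (s + h) - y s) (y s) = \<rho>^2 * sin (2 * pi * h)" for s h
 proof -
  let ?A = "2 * pi * (s + h)" and ?B = "2 * pi * s"
  have "- omega0 (y (s + h) - y s) (y s) = \<rho>^2 * (sin ?A * cos ?B - cos ?A * sin ?B)"
   by (simp add: omega0_def y_def cc inner_diff_left) (simp add: algebra_simps)
  also have "... = \<rho>^2 * sin (?A - ?B)" by (simp only: sin_diff)
  also have "?A - ?B = 2 * pi * h" by (simp add: algebra_simps)
  finally show ?thesis .
 qed
 show ?thesis
 proof (rule that)
  show "a > 0" using \<rho> by (simp add: a_def)
  show "\<forall>g. (\<forall>u. norm u <= R * g u) --> (\<exists>C z. char_loop \<tau> g a C z)"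
  proof (intro allI impI)
  fix g :: "'n pt => real" assume g: "\<forall>u. norm u <= R * g u"
  have "char_loop \<tau> g a (\<rho>^2 * ((2 * pi)^2 / 2)) (\<lambda>t. p (y t))"
   unfolding char_loop_def
  proof (intro conjI allI impI)
   fix t :: real
   have "y (t + 1) = y t" by (simp add: y_def distrib_left)
   thus "p (y (t + 1)) = p (y t)" by (simp only:)
   have "y (- t) = mirror (y t)" by (simp add: y_def mirror_def)
   thus "p (y (- t)) = \<tau> (p (y t))" by (simp only: p(3))
  next
   fix s h :: real and u :: "'n pt" assume h: "0 <= h" "h <= 1"
   have "- omega0 (p (y (s + h)) - p (y s)) u <= norm (p (y (s + h) - y s)) * norm u"
    using abs_omega0_le[of "p (y (s + h)) - p (y s)" u] by (simp add: linear_diff[OF p(1)])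
   also have "... <= (B * (\<rho> * (2 * pi * h))) * (R * g u)"
   proof (rule mult_mono[OF order_trans[OF B(2) mult_left_mono[OF chord]] g[rule_format]])
    show "0 <= B * (\<rho> * (2 * pi * h))" using B \<rho> h by simp
   qed (use B h in auto)
   also have "... = 2 * a * h * g u" by (simp add: a_def \<rho>_def power2_eq_square mult_ac)
   finally show "- omega0 (p (y (s + h)) - p (y s)) u <= 2 * a * h * g u" .
  next
   fix s h :: real assume h: "0 <= h" "h <= 1"
   have "\<rho>^2 * (2 * pi * h - (2 * pi * h)^2 / 2) <= \<rho>^2 * sin (2 * pi * h)"
    using sin_ge_quadratic[of "2 * pi * h"] h by (intro mult_left_mono) auto
   also have "... = - omega0 (p (y (s + h)) - p (y s)) (p (y s))" by (simp only: linear_diff[OF p(1), symmetric] p(2) area)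
   finally show "- omega0 (p (y (s + h)) - p (y s)) (p (y s)) >= 2 * a * h - \<rho>^2 * ((2 * pi)^2 / 2) * h^2"
    by (simp add: a_def right_diff_distrib power_mult_distrib mult_ac)
  qed
  thus "\<exists>C z. char_loop \<tau> g a C z" by blast
  qed
 qed
qed

text \<open>Keeps the supremum that defines the capacity from being taken over the empty set, so the
  capacity is nonnegative.\<close>

lemma zero_hamiltonian_admissible:
 fixes \<tau> :: "'n::finite pt => 'n pt"
 assumes D: "open D" "p0 \<in> D" "\<tau> p0 = p0"
 shows "hz_admissible \<tau> D (\<lambda>_. 0)" "mH D (\<lambda>_. 0) = 0"
proof -
 show m: "mH D (\<lambda>_. 0) = 0" using D by (auto simp: mH_def image_constant)
 have it: "\<exists>c. iter_dderiv vs (\<lambda>_::'n pt. 0::real) = (\<lambda>_. c)" for vs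
  by (induction vs) (auto simp: frechet_derivative_const)
 have "smooth_on D (\<lambda>_. 0)" unfolding smooth_on_def
 proof
  fix vs
  obtain c where "iter_dderiv vs (\<lambda>_::'n pt. 0::real) = (\<lambda>_. c)" using it by blast
  thus "continuous_on D (iter_dderiv vs (\<lambda>_. 0)) \<and> (\<forall>p\<in>D. iter_dderiv vs (\<lambda>_. 0) differentiable at p)" by simp
 qed
 hence "hz_class \<tau> D (\<lambda>_. 0)" unfolding hz_class_def m using D by (intro conjI exI[of _ D] exI[of _ "{}"]) auto
 moreover have "\<exists>c. \<forall>t. x t = c" if "ham_brake_orbit \<tau> D (\<lambda>_. 0) x T" for x T
 proof -
  have "(x has_vector_derivative 0) (at t)" for t
  proof -
   have "\<exists>v. (x has_vector_derivative v) (at t) \<and> (\<forall>w. omega0 v w = - frechet_derivative (\<lambda>_::'n pt. 0) (at (x t)) w)"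
    using that unfolding ham_brake_orbit_def by blast
   then obtain v where v: "(x has_vector_derivative v) (at t)" "!!w. omega0 v w = - frechet_derivative (\<lambda>_::'n pt. 0) (at (x t)) w" by blast
   have "J0 v \<bullet> J0 v = 0" using v(2)[of "J0 v"] by (simp add: omega0_eq frechet_derivative_const)
   hence "v = 0" by (simp add: inner_J0_J0)
   thus ?thesis using v by simp
  qed
  hence "x t = x 0" for t using constant_or_avoids[of x "\<lambda>_. 0" UNIV 0 t] by simp
  thus ?thesis by blast
 qed
 ultimately show "hz_admissible \<tau> D (\<lambda>_. 0)" unfolding hz_admissible_def by blast
qed

locale symmetric_domain =
 fixes \<tau> :: "'n::finite pt => 'n pt" and D :: "'n pt set"
 assumes \<tau>: "lin_antisymp_involution \<tau>" and D: "open D" "convex D" "bounded D" "D ~= {}" and inv: "\<tau> ` D = D"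
begin

lemma fixed_point_exists: obtains p0 where "p0 \<in> D" "\<tau> p0 = p0"
proof -
 have lin: "linear \<tau>" and tt: "!!p. \<tau> (\<tau> p) = p" using \<tau> by (auto simp: lin_antisymp_involution_def)
 obtain p where p: "p \<in> D" using D by blast
 hence "\<tau> p \<in> D" using inv by blast
 hence "(1/2) *\<^sub>R p + (1/2) *\<^sub>R \<tau> p \<in> D" using p D(2) by (auto simp: convex_def)
 moreover have "\<tau> ((1/2) *\<^sub>R p + (1/2) *\<^sub>R \<tau> p) = (1/2) *\<^sub>R p + (1/2) *\<^sub>R \<tau> p"
  by (simp add: linear_add[OF lin] linear_scale[OF lin] tt add.commute)
 ultimately show ?thesis using that by blast
qed

lemma capacity_le_of_char_loop:
 assumes a: "a > 0" and loops: "!!p0. [|p0 \<in> D; \<tau> p0 = p0|] ==> \<exists>C z. char_loop \<tau> (gau ((\<lambda>u. u - p0) ` D)) a C z"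
 shows "c_HZ_tau \<tau> D <= ereal a"
 unfolding c_HZ_tau_def
proof (rule Sup_least)
 fix e assume "e \<in> {ereal (mH D H) |H. hz_admissible \<tau> D H}"
 then obtain H where e: "e = ereal (mH D H)" and H: "hz_admissible \<tau> D H" by blast
 have "mH D H <= a"
 proof (rule ccontr)
  assume "\<not> ?thesis"
  hence "a < mH D H" by simp
  with capacity_upper[OF \<tau> D(1-3) inv _ a _ loops] H have "\<exists>x. ham_brake_orbit \<tau> D H x 1 \<and> \<not> (\<exists>c. \<forall>t. x t = c)"
   unfolding hz_admissible_def by blast
  thus False using H unfolding hz_admissible_def by (metis zero_less_one order_refl)
 qed
 thus "e <= ereal a" by (simp add: e)
qed

lemma capacity_finite: obtains c where "c >= 0" "c_HZ_tau \<tau> D = ereal c"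
proof -
 obtain p where p: "p \<in> D" "\<tau> p = p" by (rule fixed_point_exists)
 obtain R where R: "R > 0" "D \<subseteq> ball 0 R" using D(3) bounded_subset_ballD by blast
 \<comment> \<open>D lies in the ball of radius R about 0, so every translate by a point of D lies
   in the ball of radius 2 R.\<close>
 obtain a where a: "a > 0" "\<forall>g. (\<forall>u. norm u <= (2 * R) * g u) --> (\<exists>C z. char_loop \<tau> g a C z)"
  by (rule circle_char_loop[OF \<tau>, of "2 * R"], use R in simp) (rule that; assumption)
 have "c_HZ_tau \<tau> D <= ereal a"
 proof (rule capacity_le_of_char_loop[OF a(1)])
  fix p0 assume p0: "p0 \<in> D" "\<tau> p0 = p0"
  interpret convex_body "(\<lambda>u. u - p0) ` D" using convex_body_translate D p0 by blast
  have sub: "(\<lambda>u. u - p0) ` D \<subseteq> ball 0 (2 * R)"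
  proof (rule image_subsetI)
   fix u assume "u \<in> D"
   hence "norm u < R" "norm p0 < R" using R p0 by auto
   thus "u - p0 \<in> ball 0 (2 * R)" using norm_triangle_ineq4[of u p0] by simp
  qed
  show "\<exists>C z. char_loop \<tau> (gau ((\<lambda>u. u - p0) ` D)) a C z"
   by (rule a(2)[rule_format]) (rule norm_le_gau[OF _ sub], use R in simp)
 qed
 moreover have "0 <= c_HZ_tau \<tau> D" unfolding c_HZ_tau_def
 proof (rule Sup_upper)
  show "0 \<in> {ereal (mH D H) |H. hz_admissible \<tau> D H}"
   using zero_hamiltonian_admissible[of D p \<tau>] p D(1) by (auto simp: zero_ereal_def intro!: exI[of _ "\<lambda>_. 0"])
 qed
 ultimately obtain c where "c_HZ_tau \<tau> D = ereal c" "c >= 0" by (cases "c_HZ_tau \<tau> D") (auto simp: zero_ereal_def)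
 thus ?thesis using that by blast
qed

lemma nonadmissible_orbit:
 assumes "c_HZ_tau \<tau> D < ereal (mH D H)" "hz_class \<tau> D H"
 obtains x T where "0 < T" "T <= 1" "ham_brake_orbit \<tau> D H x T" "\<not> (\<exists>c. \<forall>t. x t = c)"
proof -
 have "\<not> hz_admissible \<tau> D H"
 proof
  assume "hz_admissible \<tau> D H"
  hence "ereal (mH D H) <= c_HZ_tau \<tau> D" unfolding c_HZ_tau_def by (intro Sup_upper) blast
  thus False using assms(1) by simp
 qed
 thus ?thesis using that assms(2) unfolding hz_admissible_def by blast
qed

end

section \<open>Smooth step functions of the approximate gauge\<close>

text \<open>A witness sequence of successive derivatives, so that later differentiation can refer to
  each of them by its index.\<close>

definition smooth1 :: "(real => real) => bool" where
 "smooth1 f \<longleftrightarrow> (\<exists>g. g 0 = f \<and> (\<forall>(k::nat) x. (g k has_real_derivative g (Suc k) x) (at x)))"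

text \<open>A coinductive principle: a set of functions closed under some choice of derivative
  consists of smooth functions.\<close>

lemma smooth1_of_closed:
 assumes A: "!!f. f \<in> A ==> \<exists>f'\<in>A. \<forall>x. (f has_real_derivative f' x) (at x)" and f: "f \<in> A"
 shows "smooth1 f"
proof -
 obtain d where d: "!!f. f \<in> A ==> d f \<in> A \<and> (\<forall>x. (f has_real_derivative d f x) (at x))" using A by metis
 have m: "(d ^^ k) f \<in> A" for k by (induction k) (use f d in auto)
 show ?thesis unfolding smooth1_def
  by (intro exI[of _ "\<lambda>k. (d ^^ k) f"] conjI allI) (use d[OF m] in auto)
qed

lemma smooth1_derivative: assumes "smooth1 f" obtains f' where "smooth1 f'" "!!x. (f has_real_derivative f' x) (at x)"
proof -
 obtain g where g: "g 0 = f" "!!(k::nat) x. (g k has_real_derivative g (Suc k) x) (at x)" using assms unfolding smooth1_def by blast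
 have "smooth1 (g 1)" unfolding smooth1_def by (intro exI[of _ "\<lambda>k. g (Suc k)"]) (use g in auto)
 moreover have "(f has_real_derivative g 1 x) (at x)" for x using g(2)[of 0 x] g(1) by simp
 ultimately show ?thesis using that by blast
qed

lemma smooth1_antiderivative:
 assumes "smooth1 f" "!!x. (F has_real_derivative f x) (at x)" shows "smooth1 F"
proof (rule smooth1_of_closed[of "insert F {f. smooth1 f}"])
 fix h assume "h \<in> insert F {f. smooth1 f}"
 thus "\<exists>h'\<in>insert F {f. smooth1 f}. \<forall>x. (h has_real_derivative h' x) (at x)"
  using assms smooth1_derivative[of h] by (metis insertCI insertE mem_Collect_eq)
qed simp

lemma smooth1_affine: assumes "smooth1 f" shows "smooth1 (\<lambda>x. c * f (a * x + b))"
proof (rule smooth1_of_closed[of "{\<lambda>x. c * f (a * x + b) | c f. smooth1 f}"])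
 fix h assume "h \<in> {\<lambda>x. c * f (a * x + b) | c f. smooth1 f}"
 then obtain c f where h: "h = (\<lambda>x. c * f (a * x + b))" and f: "smooth1 f" by blast
 obtain f' where f': "smooth1 f'" "!!x. (f has_real_derivative f' x) (at x)" using smooth1_derivative[OF f] by blast
 have "(h has_real_derivative c * a * f' (a * x + b)) (at x)" for x unfolding h
  by (rule derivative_eq_intros DERIV_chain2[OF f'(2)] refl)+ simp
 hence "\<forall>x. (h has_real_derivative c * a * f' (a * x + b)) (at x)" by simp
 moreover have "(\<lambda>x. c * a * f' (a * x + b)) \<in> {\<lambda>x. c * f (a * x + b) | c f. smooth1 f}" using f'(1) by blast
 ultimately show "\<exists>h'\<in>{\<lambda>x. c * f (a * x + b) | c f. smooth1 f}. \<forall>x. (h has_real_derivative h' x) (at x)" by (rule rev_bexI[rotated])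
qed (use assms in blast)

lemma smooth1_diff: assumes "smooth1 f" "smooth1 h" shows "smooth1 (\<lambda>x. f x - h x)"
proof (rule smooth1_of_closed[of "{\<lambda>x. f x - h x | f h. smooth1 f \<and> smooth1 h}"])
 fix k assume "k \<in> {\<lambda>x. f x - h x | f h. smooth1 f \<and> smooth1 h}"
 then obtain f h where k: "k = (\<lambda>x. f x - h x)" and fh: "smooth1 f" "smooth1 h" by blast
 obtain f' where f': "smooth1 f'" "!!x. (f has_real_derivative f' x) (at x)" using smooth1_derivative[OF fh(1)] by blast
 obtain h' where h': "smooth1 h'" "!!x. (h has_real_derivative h' x) (at x)" using smooth1_derivative[OF fh(2)] by blast
 have "\<forall>x. (k has_real_derivative f' x - h' x) (at x)" unfolding k using DERIV_diff f'(2) h'(2) by blast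
 moreover have "(\<lambda>x. f' x - h' x) \<in> {\<lambda>x. f x - h x | f h. smooth1 f \<and> smooth1 h}" using f'(1) h'(1) by blast
 ultimately show "\<exists>k'\<in>{\<lambda>x. f x - h x | f h. smooth1 f \<and> smooth1 h}. \<forall>x. (k has_real_derivative k' x) (at x)" by (rule rev_bexI[rotated])
qed (use assms in blast)

inductive_set prodsums :: "(real => real) set" where
 prod: "smooth1 f ==> smooth1 h ==> (\<lambda>x. f x * h x) \<in> prodsums"
| sum: "f \<in> prodsums ==> h \<in> prodsums ==> (\<lambda>x. f x + h x) \<in> prodsums"

lemma smooth1_mult: assumes "smooth1 f" "smooth1 h" shows "smooth1 (\<lambda>x. f x * h x)"
proof (rule smooth1_of_closed[of prodsums])
 fix k assume "k \<in> prodsums"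
 thus "\<exists>k'\<in>prodsums. \<forall>x. (k has_real_derivative k' x) (at x)"
 proof induction
  case (prod f h)
  obtain f' where f': "smooth1 f'" "!!x. (f has_real_derivative f' x) (at x)" using smooth1_derivative[OF prod(1)] by blast
  obtain h' where h': "smooth1 h'" "!!x. (h has_real_derivative h' x) (at x)" using smooth1_derivative[OF prod(2)] by blast
  have "\<forall>x. ((\<lambda>x. f x * h x) has_real_derivative f' x * h x + h' x * f x) (at x)" using DERIV_mult[OF f'(2) h'(2)] by blast
  moreover have "(\<lambda>x. f' x * h x + h' x * f x) \<in> prodsums" using prod f' h' by (intro prodsums.intros)
  ultimately show ?case by (rule rev_bexI[rotated])
 next
  case (sum f h)
  then obtain f' h' where fh: "f' \<in> prodsums" "h' \<in> prodsums" "\<forall>x. (f has_real_derivative f' x) (at x)" "\<forall>x. (h has_real_derivative h' x) (at x)" by blast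
  have "\<forall>x. ((\<lambda>x. f x + h x) has_real_derivative f' x + h' x) (at x)" using fh(3,4) DERIV_add by blast
  moreover have "(\<lambda>x. f' x + h' x) \<in> prodsums" using fh(1,2) by (rule prodsums.intros)
  ultimately show ?case by (rule rev_bexI[rotated])
 qed
qed (use assms prodsums.prod in blast)

text \<open>The polynomial in 1/x makes the family of flat functions closed under differentiation:
  d/dx brings out a factor 1/x^2, which is \<open>[:0, 0, 1:]\<close>.\<close>

definition flat :: "real poly => real => real" where
 "flat P x = (if x <= 0 then 0 else poly P (1 / x) * exp (- (1 / x)))"

lemma poly_times_exp_tendsto_0: "((\<lambda>y::real. y ^ k * poly P y * exp (- y)) \<longlongrightarrow> 0) at_top"
proof (induction P arbitrary: k)
 case (pCons a p)
 have "((\<lambda>y::real. a * (y ^ k / exp y) + y ^ Suc k * poly p y * exp (- y)) \<longlongrightarrow> a * 0 + 0) at_top"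
  by (intro tendsto_add tendsto_mult tendsto_const tendsto_power_div_exp_0 pCons.IH)
 moreover have "(\<lambda>y::real. a * (y ^ k / exp y) + y ^ Suc k * poly p y * exp (- y)) = (\<lambda>y. y ^ k * poly (pCons a p) y * exp (- y))"
  by (rule ext) (simp add: exp_minus divide_inverse algebra_simps)
 ultimately show ?case by simp
qed simp

lemma flat_derivative: "(flat P has_real_derivative flat ([:0, 0, 1:] * (P - pderiv P)) x) (at x)"
proof -
 consider "x < 0" | "x > 0" | "x = 0" by linarith
 thus ?thesis
 proof cases
  case 1
  have "((\<lambda>_. 0) has_real_derivative flat ([:0, 0, 1:] * (P - pderiv P)) x) (at x)" using 1 by (simp add: flat_def)
  thus ?thesis by (rule has_field_derivative_transform_within_open[of _ _ _ "{..<0}"]) (use 1 in \<open>auto simp: flat_def\<close>)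
 next
  case 2
  have "((\<lambda>x. poly P (1 / x) * exp (- (1 / x))) has_real_derivative
    poly (pderiv P) (1 / x) * (- (1 / x^2)) * exp (- (1 / x)) + exp (- (1 / x)) * (1 / x^2) * poly P (1 / x)) (at x)"
  proof (rule DERIV_mult)
   have i: "((\<lambda>x. 1 / x) has_real_derivative - (1 / x^2)) (at x)" using 2 by (auto intro!: derivative_eq_intros simp: power2_eq_square)
   show "((\<lambda>x. poly P (1 / x)) has_real_derivative poly (pderiv P) (1 / x) * (- (1 / x^2))) (at x)" by (rule DERIV_chain2[OF poly_DERIV i])
   show "((\<lambda>x. exp (- (1 / x))) has_real_derivative exp (- (1 / x)) * (1 / x^2)) (at x)"
    using DERIV_chain2[OF DERIV_exp DERIV_minus[OF i]] by simp
  qed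
  moreover have "poly (pderiv P) (1 / x) * (- (1 / x^2)) * exp (- (1 / x)) + exp (- (1 / x)) * (1 / x^2) * poly P (1 / x)
   = flat ([:0, 0, 1:] * (P - pderiv P)) x" using 2 by (simp add: flat_def power2_eq_square algebra_simps)
  ultimately have "((\<lambda>x. poly P (1 / x) * exp (- (1 / x))) has_real_derivative flat ([:0, 0, 1:] * (P - pderiv P)) x) (at x)" by simp
  thus ?thesis by (rule has_field_derivative_transform_within_open[of _ _ _ "{0<..}"]) (use 2 in \<open>auto simp: flat_def\<close>)
 next
  case 3
  have "((\<lambda>h. flat P h / h) \<longlongrightarrow> 0) (at 0)"
  proof (rule filterlim_split_at)
   show "((\<lambda>h. flat P h / h) \<longlongrightarrow> 0) (at_left 0)"
    by (rule tendsto_eventually) (auto simp: eventually_at_filter flat_def)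
   have "((\<lambda>h. inverse h ^ 1 * poly P (inverse h) * exp (- inverse h)) \<longlongrightarrow> 0) (at_right (0::real))"
    by (rule filterlim_compose[OF poly_times_exp_tendsto_0 filterlim_inverse_at_top_right])
   moreover have "\<forall>\<^sub>F h in at_right 0. inverse h ^ 1 * poly P (inverse h) * exp (- inverse h) = flat P h / h"
    by (auto simp: eventually_at_filter flat_def divide_inverse)
   ultimately show "((\<lambda>h. flat P h / h) \<longlongrightarrow> 0) (at_right 0)" by (rule Lim_transform_eventually)
  qed
  thus ?thesis using 3 by (simp add: has_field_derivative_iff flat_def)
 qed
qed

lemma smooth1_flat: "smooth1 (flat P)"
 by (rule smooth1_of_closed[of "range flat"]) (use flat_derivative in blast)+

lemma constant_derivative_increment:
 assumes "u <= v" "!!x. u <= x ==> x <= v ==> (f has_real_derivative c) (at x)"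
 shows "f v = f u + c * (v - u :: real)"
proof (cases "u = v")
 case False
 then obtain z where "f v - f u = (v - u) * c" using MVT2[of u v f "\<lambda>_. c"] assms by auto
 thus ?thesis by (simp add: algebra_simps)
qed simp

text \<open>The normalised primitive of a bump function supported in [0, 1].\<close>

lemma smooth_step:
 obtains S where "smooth1 S" "!!x. x <= 0 ==> S x = 0" "!!x. x >= 1 ==> S x = 1" "!!x. 0 <= S x" "!!x. S x <= 1"
proof -
 define b where "b x = flat 1 x * flat 1 (1 - x)" for x
 have sb: "smooth1 b" unfolding b_def[abs_def] using smooth1_mult[OF smooth1_flat smooth1_affine[OF smooth1_flat, of 1 1 "-1" 1]] by simp
 have b0: "b x >= 0" for x by (simp add: b_def flat_def)
 have bz: "b x = 0" if "x <= 0 \<or> x >= 1" for x using that by (auto simp: b_def flat_def)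
 have bp: "b x > 0" if "0 < x" "x < 1" for x using that by (simp add: b_def flat_def)
 have "continuous_on UNIV b" using smooth1_derivative[OF sb] by (metis DERIV_continuous continuous_at_imp_continuous_on)
 then obtain F where "!!x. (F has_vector_derivative b x) (at x)" using continuous_antiderivative_UNIV by metis
 hence F: "!!x. (F has_real_derivative b x) (at x)" by (simp add: has_real_derivative_iff_has_vector_derivative)
 have mono: "F x <= F y" if "x <= y" for x y by (rule DERIV_nonneg_imp_nondecreasing[OF that]) (use F b0 in blast)
 have F0: "F x = F 0" if "x <= 0" for x
  using constant_derivative_increment[of x 0 F 0] F bz that by (metis add.right_neutral mult_zero_left)
 have F1: "F x = F 1" if "x >= 1" for x
  using constant_derivative_increment[of 1 x F 0] F bz that by (metis add.right_neutral mult_zero_left)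
 have I: "F 0 < F 1"
  by (rule DERIV_pos_imp_increasing_open) (use F bp in \<open>auto intro!: continuous_at_imp_continuous_on DERIV_isCont\<close>)
 define S where "S x = (F x - F 0) / (F 1 - F 0)" for x
 show ?thesis
 proof (rule that[of S])
  have "smooth1 (\<lambda>x. 1 / (F 1 - F 0) * b (1 * x + 0))" by (rule smooth1_affine[OF sb])
  moreover have "(S has_real_derivative 1 / (F 1 - F 0) * b (1 * x + 0)) (at x)" for x unfolding S_def
   using I by (auto intro!: derivative_eq_intros F)
  ultimately show "smooth1 S" by (rule smooth1_antiderivative)
  fix x
  have "F 0 <= F x" using mono[of 0 x] F0[of x] by (cases "x >= 0") auto
  moreover have "F x <= F 1" using mono[of x 1] F1[of x] by (cases "x <= 1") auto
  ultimately show "0 <= S x" "S x <= 1" using I by (auto simp: S_def)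
  show "S x = 0" if "x <= 0" using F0[OF that] by (simp add: S_def)
  show "S x = 1" if "x >= 1" using F1[OF that] I by (simp add: S_def)
 qed
qed

text \<open>The step \<Theta> of the Hamiltonians: flat near 0 and near 1, with slope close to 1 in
  between. It is the difference of two shifted primitives of a smooth step, so its slope is a
  difference of two steps.\<close>

lemma smooth_ramp:
 fixes \<delta> :: real
 assumes \<delta>: "0 < \<delta>" "\<delta> < 1/4"
 obtains g :: "nat => real => real" where "!!k x. (g k has_real_derivative g (Suc k) x) (at x)"
  "!!q. q <= \<delta> ==> g 0 q = 0 \<and> g 1 q = 0" "!!q. q >= 1 - \<delta> ==> g 0 q = 1 \<and> g 1 q = 0"
  "!!q. 0 <= g 1 q" "!!q. g 1 q <= 1 / (1 - 3 * \<delta>)" "!!q. 0 <= g 0 q" "!!q. g 0 q <= 1"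
proof -
 obtain S where S: "smooth1 S" "!!x. x <= 0 ==> S x = 0" "!!x. x >= 1 ==> S x = 1" "!!x. 0 <= S x" "!!x. S x <= 1"
  by (rule smooth_step) (rule that; assumption)
 define S' where "S' x = S (x / \<delta>)" for x
 have S': "smooth1 S'" unfolding S'_def[abs_def] using smooth1_affine[OF S(1), of 1 "1 / \<delta>" 0] by simp
 have S'0: "S' x = 0" if "x <= 0" for x using that \<delta> S(2) by (simp add: S'_def divide_nonpos_pos)
 have S'1: "S' x = 1" if "x >= \<delta>" for x using that \<delta> S(3) by (simp add: S'_def)
 have "continuous_on UNIV S'" using smooth1_derivative[OF S'] by (metis DERIV_continuous continuous_at_imp_continuous_on)
 then obtain s where "!!x. (s has_vector_derivative S' x) (at x)" using continuous_antiderivative_UNIV by metis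
 hence s: "!!x. (s has_real_derivative S' x) (at x)" by (simp add: has_real_derivative_iff_has_vector_derivative)
 have ss: "smooth1 s" using smooth1_antiderivative[OF S' s] .
 \<comment> \<open>The steps start at \<delta> and \<delta> + l and have width \<delta>; hence the
   slope is supported in [\<delta>, 1 - \<delta>] and is at most 1 / l.\<close>
 define l where "l = 1 - 3 * \<delta>"
 have l: "l > 0" using \<delta> by (simp add: l_def)
 define T where "T q = 1 / l * s (1 * q + - \<delta>) - 1 / l * s (1 * q + - (\<delta> + l))" for q
 have "smooth1 T" unfolding T_def[abs_def] by (intro smooth1_diff smooth1_affine ss)
 then obtain g where g: "g 0 = T" "!!(k::nat) x. (g k has_real_derivative g (Suc k) x) (at x)" unfolding smooth1_def by blast
 have d: "(T has_real_derivative (S' (q - \<delta>) - S' (q - (\<delta> + l))) / l) (at q)" for q unfolding T_def[abs_def]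
  by (rule derivative_eq_intros DERIV_chain2[OF s] refl)+ (simp add: diff_divide_distrib algebra_simps)
 have g1: "g 1 q = (S' (q - \<delta>) - S' (q - (\<delta> + l))) / l" for q using DERIV_unique[OF g(2)[of 0 q, unfolded g(1)] d] by simp
 have smono: "S' x <= S' y" if "x <= y" "y <= 0 \<or> y >= \<delta>" for x y using that S'0 S'1 S(4,5) by (cases "y >= \<delta>") (auto simp: S'_def)
 have Te: "T q = (s (q - \<delta>) - s (q - (\<delta> + l))) / l" for q by (simp add: T_def diff_divide_distrib algebra_simps)
 have z0: "g 0 q = 0 \<and> g 1 q = 0" if "q <= \<delta>" for q
 proof -
  have e: "s x = s 0" if "x <= 0" for x
   using constant_derivative_increment[of x 0 s 0] s S'0 that by (metis add.right_neutral mult_zero_left)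
  have q: "q - \<delta> <= 0" "q - (\<delta> + l) <= 0" using that l by auto
  show ?thesis unfolding g1 g(1) Te e[OF q(1)] e[OF q(2)] S'0[OF q(1)] S'0[OF q(2)] by simp
 qed
 have z1: "g 0 q = 1 \<and> g 1 q = 0" if "q >= 1 - \<delta>" for q
 proof -
  have e: "s x = s \<delta> + 1 * (x - \<delta>)" if "x >= \<delta>" for x
   by (rule constant_derivative_increment[OF that]) (use s S'1 in metis)
  have q: "q - \<delta> >= \<delta>" "q - (\<delta> + l) >= \<delta>" using that \<delta> by (auto simp: l_def)
  have "s (q - \<delta>) - s (q - (\<delta> + l)) = l" using e[OF q(1)] e[OF q(2)] by simp
  thus ?thesis using l unfolding g1 g(1) Te S'1[OF q(1)] S'1[OF q(2)] by simp
 qed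
 have n: "0 <= g 1 q" for q
 proof (cases "q - \<delta> >= \<delta>")
  case True
  thus ?thesis using l S(5) unfolding g1 S'1[OF True] by (simp add: S'_def)
 next
  case False
  hence "q - (\<delta> + l) <= 0" using \<delta> by (simp add: l_def)
  thus ?thesis using l S(4) unfolding g1 S'0[OF \<open>q - (\<delta> + l) <= 0\<close>] by (simp add: S'_def)
 qed
 have up: "g 1 q <= 1 / l" for q unfolding g1 using S(4)[of "(q - (\<delta> + l)) / \<delta>"] S(5)[of "(q - \<delta>) / \<delta>"] l
  by (intro divide_right_mono) (auto simp: S'_def)
 have mono: "g 0 p <= g 0 q" if "p <= q" for p q
  by (rule DERIV_nonneg_imp_nondecreasing[OF that]) (use g(2)[of 0] n in auto)
 show ?thesis
 proof (rule that[of g])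
  fix q
  show "0 <= g 0 q" using mono[of "min q \<delta>" q] z0[of "min q \<delta>"] by simp
  show "g 0 q <= 1" using mono[of q "max q (1 - \<delta>)"] z1[of "max q (1 - \<delta>)"] by simp
  show "g 1 q <= 1 / (1 - 3 * \<delta>)" using up[of q] by (simp add: l_def)
 qed (rule g(2) z0 z1 n; assumption?)+
qed

section \<open>Smooth functions of the log-sum-exp gauge\<close>

inductive_set function_algebra :: "('a => real) set => ('a => real) set" for B where
 base: "f \<in> B ==> f \<in> function_algebra B"
| const: "(\<lambda>_. c) \<in> function_algebra B"
| add: "f \<in> function_algebra B ==> h \<in> function_algebra B ==> (\<lambda>x. f x + h x) \<in> function_algebra B"
| mult: "f \<in> function_algebra B ==> h \<in> function_algebra B ==> (\<lambda>x. f x * h x) \<in> function_algebra B"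

lemma function_algebra_sum:
 assumes "finite W" "!!w. w \<in> W ==> f w \<in> function_algebra B"
 shows "(\<lambda>x. \<Sum>w\<in>W. f w x) \<in> function_algebra B"
 using assms by (induction W) (auto intro: function_algebra.intros)

text \<open>The product rule keeps all directional derivatives inside the algebra as soon as those
  of the generators are there; iteration gives smoothness.\<close>

lemma smooth_on_function_algebra:
 fixes f :: "'a::euclidean_space => real"
 assumes B: "!!f. f \<in> B ==> \<exists>f'. (\<forall>x. (f has_derivative f' x) (at x)) \<and> (\<forall>v. (\<lambda>x. f' x v) \<in> function_algebra B)"
  and f: "f \<in> function_algebra B"
 shows "smooth_on S f"
proof -
 have d: "\<exists>f'. (\<forall>x. (f has_derivative f' x) (at x)) \<and> (\<forall>v. (\<lambda>x. f' x v) \<in> function_algebra B)" if "f \<in> function_algebra B" for f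
  using that
 proof induction
  case (base f) thus ?case by (rule B)
 next
  case (const c)
  show ?case by (intro exI[of _ "\<lambda>_ _. 0"]) (auto intro: function_algebra.intros)
 next
  case (add f h)
  then obtain f' h' where "\<forall>x. (f has_derivative f' x) (at x)" "\<forall>v. (\<lambda>x. f' x v) \<in> function_algebra B"
   "\<forall>x. (h has_derivative h' x) (at x)" "\<forall>v. (\<lambda>x. h' x v) \<in> function_algebra B" by blast
  thus ?case by (intro exI[of _ "\<lambda>x v. f' x v + h' x v"]) (auto intro: function_algebra.intros has_derivative_add)
 next
  case (mult f h)
  then obtain f' h' where "\<forall>x. (f has_derivative f' x) (at x)" "\<forall>v. (\<lambda>x. f' x v) \<in> function_algebra B"
   "\<forall>x. (h has_derivative h' x) (at x)" "\<forall>v. (\<lambda>x. h' x v) \<in> function_algebra B" by blast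
  with mult(1,2) show ?case by (intro exI[of _ "\<lambda>x v. f x * h' x v + f' x v * h x"]) (auto intro!: function_algebra.add function_algebra.mult has_derivative_mult)
 qed
 have it: "iter_dderiv vs f \<in> function_algebra B" for vs
 proof (induction vs)
  case (Cons v vs)
  obtain f' where f': "\<forall>x. (iter_dderiv vs f has_derivative f' x) (at x)" "\<forall>v. (\<lambda>x. f' x v) \<in> function_algebra B" using d[OF Cons] by blast
  have "frechet_derivative (iter_dderiv vs f) (at x) = f' x" for x by (rule frechet_derivative_at[OF f'(1)[rule_format], symmetric])
  hence "iter_dderiv (v # vs) f = (\<lambda>x. f' x v)" by simp
  thus ?case using f'(2) by simp
 qed (use f in simp)
 have "iter_dderiv vs f differentiable (at x)" for vs x using d[OF it] unfolding differentiable_def by blast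
 thus ?thesis unfolding smooth_on_def
  by (auto intro!: continuous_at_imp_continuous_on differentiable_imp_continuous_within)
qed

lemma has_derivative_translate:
 assumes "(f has_derivative F) (at (x - p))" shows "((\<lambda>x. f (x - p)) has_derivative F) (at x)"
 by (rule has_derivative_compose[of "\<lambda>x. x - p" "\<lambda>v. v" x UNIV f F, simplified]) (use assms in \<open>auto intro!: derivative_eq_intros\<close>)

lemma (in log_sum_exp) smooth_on_step_lse:
 fixes g :: "nat => real => real"
 assumes g: "!!k x. (g k has_real_derivative g (Suc k) x) (at x)"
 shows "smooth_on D (\<lambda>x. m * g 0 ((lse \<beta> W (x - p))^2))"
proof -
 let ?S = "\<lambda>x. \<Sum>w\<in>W. exp (\<beta> * (w \<bullet> (x - p)))" and ?l = "\<lambda>x. lse \<beta> W (x - p)"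
 \<comment> \<open>The derivative of \<open>lse\<close> is a quotient, so the reciprocal of the
   exponential sum must be a generator, as must all derivatives of the step.\<close>
 define B where "B = insert ?l (insert (\<lambda>x. 1 / ?S x) (range (\<lambda>k x. g k ((?l x)^2)) \<union> range (\<lambda>w x. exp (\<beta> * (w \<bullet> (x - p))))))"
 let ?A = "function_algebra B"
 have e: "(\<lambda>x. exp (\<beta> * (w \<bullet> (x - p)))) \<in> ?A" for w by (rule function_algebra.base) (simp add: B_def)
 have l: "?l \<in> ?A" by (rule function_algebra.base) (simp add: B_def)
 have iS: "(\<lambda>x. 1 / ?S x) \<in> ?A" by (rule function_algebra.base) (simp add: B_def)
 have gk: "(\<lambda>x. g k ((?l x)^2)) \<in> ?A" for k by (rule function_algebra.base) (simp add: B_def)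
 have dl: "(\<lambda>x. glse \<beta> W (x - p) \<bullet> v) \<in> ?A" for v
 proof -
  have "(\<lambda>x. (\<Sum>w\<in>W. exp (\<beta> * (w \<bullet> (x - p))) * (w \<bullet> v)) * (1 / ?S x)) \<in> ?A"
   by (intro function_algebra.mult function_algebra_sum iS W e function_algebra.const)
  thus ?thesis by (simp add: glse_inner)
 qed
 have dl': "(?l has_derivative (\<lambda>v. glse \<beta> W (x - p) \<bullet> v)) (at x)" for x by (rule has_derivative_translate[OF lse_has_derivative])
 have de: "((\<lambda>x. exp (\<beta> * (w \<bullet> (x - p)))) has_derivative (\<lambda>v. exp (\<beta> * (w \<bullet> (x - p))) * (\<beta> * (w \<bullet> v)))) (at x)" for w x
  by (auto intro!: derivative_eq_intros)
 have "smooth_on D f" if "f \<in> ?A" for f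
 proof (rule smooth_on_function_algebra[OF _ that])
  fix f assume "f \<in> B"
  then consider "f = ?l" | "f = (\<lambda>x. 1 / ?S x)" | k where "f = (\<lambda>x. g k ((?l x)^2))" | w where "f = (\<lambda>x. exp (\<beta> * (w \<bullet> (x - p))))"
   unfolding B_def by blast
  thus "\<exists>f'. (\<forall>x. (f has_derivative f' x) (at x)) \<and> (\<forall>v. (\<lambda>x. f' x v) \<in> ?A)"
  proof cases
   case 1
   show ?thesis unfolding 1 by (intro exI[of _ "\<lambda>x v. glse \<beta> W (x - p) \<bullet> v"] conjI allI dl dl')
  next
   case 2
   have "((\<lambda>x. 1 / ?S x) has_derivative (\<lambda>v. (\<Sum>w\<in>W. exp (\<beta> * (w \<bullet> (x - p))) * (\<beta> * (w \<bullet> v))) * ((-1) * ((1 / ?S x) * (1 / ?S x))))) (at x)" for x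
   proof -
    have "(?S has_derivative (\<lambda>v. \<Sum>w\<in>W. exp (\<beta> * (w \<bullet> (x - p))) * (\<beta> * (w \<bullet> v)))) (at x)" by (rule has_derivative_sum[OF de])
    from has_derivative_divide[OF has_derivative_const[of 1] this] sum_exp_pos[of "x - p"]
    show ?thesis by (simp add: mult_ac divide_inverse)
   qed
   moreover have "(\<lambda>x. (\<Sum>w\<in>W. exp (\<beta> * (w \<bullet> (x - p))) * (\<beta> * (w \<bullet> v))) * ((-1) * ((1 / ?S x) * (1 / ?S x)))) \<in> ?A" for v
    by (intro function_algebra.mult function_algebra_sum iS W e function_algebra.const)
   ultimately show ?thesis unfolding 2 by (intro exI conjI allI)
  next
   case (3 k)
   have "((\<lambda>x. g k ((?l x)^2)) has_derivative (\<lambda>v. g (Suc k) ((?l x)^2) * (2 * ?l x * (glse \<beta> W (x - p) \<bullet> v)))) (at x)" for x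
   proof -
    have "((\<lambda>x. (?l x)^2) has_derivative (\<lambda>v. 2 * ?l x * (glse \<beta> W (x - p) \<bullet> v))) (at x)"
     by (rule derivative_eq_intros dl' refl)+ (simp add: mult_ac)
    from has_derivative_compose[OF this g[unfolded has_field_derivative_def, of k]] show ?thesis .
   qed
   moreover have "(\<lambda>x. g (Suc k) ((?l x)^2) * (2 * ?l x * (glse \<beta> W (x - p) \<bullet> v))) \<in> ?A" for v
    by (intro function_algebra.mult gk l dl function_algebra.const)
   ultimately show ?thesis unfolding 3 by (intro exI conjI allI)
  next
   case (4 w)
   have "(\<lambda>x. exp (\<beta> * (w \<bullet> (x - p))) * (\<beta> * (w \<bullet> v))) \<in> ?A" for v by (intro function_algebra.mult e function_algebra.const)
   with de show ?thesis unfolding 4 by (intro exI conjI allI)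
  qed
 qed
 moreover have "(\<lambda>x. m * g 0 ((?l x)^2)) \<in> ?A" by (intro function_algebra.mult gk function_algebra.const)
 ultimately show ?thesis by blast
qed

section \<open>Existence of a minimal characteristic\<close>

locale pointed_domain = symmetric_domain \<tau> D
 for \<tau> :: "'n::finite pt => 'n pt" and D + 
 fixes p0 :: "'n pt"
 assumes p0D: "p0 \<in> D" and p0fix: "\<tau> p0 = p0"
begin

abbreviation body :: "'n pt set" where "body \<equiv> (\<lambda>u. u - p0) ` D"

sublocale convex_body body using convex_body_translate D p0D by blast

lemma lin: "linear \<tau>" and involutive: "\<tau> (\<tau> p) = p"
 using \<tau> unfolding lin_antisymp_involution_def by blast+

lemma body_iff: "u \<in> body \<longleftrightarrow> u + p0 \<in> D" by (force simp: image_iff)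

lemma \<tau>_D: "\<tau> p \<in> D \<longleftrightarrow> p \<in> D" using inv involutive by (metis imageI)

lemma \<tau>_translate: "\<tau> (p - p0) = \<tau> p - p0" "\<tau> (p + p0) = \<tau> p + p0" by (simp_all add: linear_diff[OF lin] linear_add[OF lin] p0fix)

text \<open>For H = m \<Theta>(l^2) the orbit stays on a level r of l and its velocity is a constant
  multiple of J applied to the gradient of l. Scaling space by 1/r and time by T makes it a loop of
  period 1 near the boundary. Its speed factor T 2 m \<Theta>'(r^2) is at most 2 m times the maximal
  slope.\<close>

lemma approximate_characteristic:
 assumes m: "c_HZ_tau \<tau> D < ereal m" "m > 0" and \<delta>: "0 < \<delta>" "\<delta> < 1/4"
 obtains z n \<mu> where "!!t. (z has_vector_derivative \<mu> *\<^sub>R J0 (n t)) (at t)" "!!t. n t \<in> dual body" "!!t. n t \<bullet> z t >= 1 - \<delta>"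
  "0 < \<mu>" "\<mu> <= 2 * m / (1 - 3 * \<delta>)" "!!t. z (t + 1) = z t" "!!t. z (- t) = \<tau> (z t)"
  "!!t. 1 - \<delta> <= gau body (z t)" "!!t. gau body (z t) <= 1 + \<delta>"
proof -
 \<comment> \<open>Fine enough that (1 + \<eta>) sqrt (1 - \<delta>) < 1: the level where H becomes
   constant still lies inside D.\<close>
 define \<eta> where "\<eta> = \<delta> / 4"
 have \<eta>: "\<eta> > 0" using \<delta> by (simp add: \<eta>_def)
 define r1 where "r1 = sqrt (1 - \<delta>)"
 have r1: "r1 > 0" "r1^2 = 1 - \<delta>" using \<delta> by (auto simp: r1_def)
 have r\<eta>: "(1 + \<eta>) * r1 < 1"
 proof -
  have "((1 + \<eta>) * r1)^2 = (1 + \<delta> / 2 + \<delta>^2 / 16) * (1 - \<delta>)" by (simp add: power_mult_distrib r1 \<eta>_def power2_sum power_divide)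
  also have "... = 1 - \<delta> / 2 - \<delta>^2 * (7 / 16) - \<delta> * \<delta>^2 / 16" by (simp add: field_simps power2_eq_square)
  also have "... < 1^2"
  proof -
   have "\<delta>^2 * (7 / 16) >= 0" "\<delta> * \<delta>^2 / 16 >= 0" using \<delta> by simp_all
   thus ?thesis using \<delta> unfolding one_power2 by linarith
  qed
  finally show ?thesis by (rule power2_less_imp_less) simp
 qed
 have \<tau>b: "\<tau> u \<in> body" if "u \<in> body" for u using that by (simp add: body_iff \<tau>_translate(2)[symmetric] \<tau>_D)
 obtain W where Wn: "finite W" "W ~= {}" "W \<subseteq> dual body" "!!u. \<exists>w\<in>W. gau body u <= (1 + \<eta>) * (w \<bullet> u)" "bij_betw (adjoint \<tau>) W W"
  using finite_net_invariant[OF \<eta> lin involutive \<tau>b] by metis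
 define r0 where "r0 = sqrt \<delta>"
 have r0: "r0 > 0" "r0^2 = \<delta>" using \<delta> by (auto simp: r0_def)
 \<comment> \<open>The additive error of l is at most \<delta> r0. Nonconstant orbits have level r
   >= r0 = sqrt \<delta>, since \<Theta>' vanishes below \<delta>, so relative to r the error is at
   most \<delta>.\<close>
 define \<beta> where "\<beta> = (ln (real (card W)) + 1) / (\<delta> * r0)"
 have W1: "ln (real (card W)) >= 0" using Wn(1,2) by (simp add: Suc_le_eq card_gt_0_iff)
 have \<beta>: "\<beta> > 0" using r0 \<delta> W1 by (simp add: \<beta>_def)
 define \<kappa> where "\<kappa> = ln (real (card W)) / \<beta>"
 have \<kappa>: "\<kappa> <= \<delta> * r0"
 proof -
  have "\<kappa> = (ln (real (card W)) / (ln (real (card W)) + 1)) * (\<delta> * r0)" by (simp add: \<kappa>_def \<beta>_def)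
  also have "... <= 1 * (\<delta> * r0)" using W1 r0 \<delta> by (intro mult_right_mono) auto
  finally show ?thesis by simp
 qed
 interpret log_sum_exp \<beta> W by unfold_locales (use Wn \<beta> in auto)
 let ?l = "lse \<beta> W" and ?g = "glse \<beta> W"
 note lb = lse_net_bounds[OF Wn(1-4) \<beta> \<eta>, folded \<kappa>_def]
 have gl: "gau body u <= (1 + \<eta>) * ?l u" for u using lb(1)[of u] \<eta> by (simp add: pos_divide_le_eq mult.commute)
 obtain g :: "nat => real => real" where g: "!!k x. (g k has_real_derivative g (Suc k) x) (at x)"
  and g0: "!!q. q <= \<delta> ==> g 0 q = 0 \<and> g 1 q = 0" and g1: "!!q. q >= 1 - \<delta> ==> g 0 q = 1 \<and> g 1 q = 0"
  and gp: "!!q. 0 <= g 1 q" "!!q. g 1 q <= 1 / (1 - 3 * \<delta>)" "!!q. 0 <= g 0 q" "!!q. g 0 q <= 1"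
  by (rule smooth_ramp[OF \<delta>]) (rule that; assumption)
 define H where "H x = m * g 0 ((?l (x - p0))^2)" for x
 have Hb: "0 <= H x" "H x <= m" for x using gp(3,4) m by (auto simp: H_def mult_left_le)
 \<comment> \<open>The maximum is attained at a point of gauge (1 + \<eta>) r1 < 1, where l is at
   least r1 and the step has reached 1.\<close>
 have mx: "mH D H = m"
 proof -
  obtain e :: "'n pt" where e: "e ~= 0" using vector_choose_size[of 1] by (metis norm_zero zero_le_one zero_neq_one)
  obtain R where R: "R > 0" "!!u. norm u <= R * gau body u" using gau_lower by metis
  have ge: "gau body e > 0" using R(2)[of e] R(1) e by (smt (verit) zero_less_mult_iff zero_less_norm_iff)
  define u where "u = ((1 + \<eta>) * r1 / gau body e) *\<^sub>R e"
  have gu: "gau body u = (1 + \<eta>) * r1" unfolding u_def using ge r1 \<eta> by (subst gau_scale) auto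
  have ub: "u \<in> body" using gu r\<eta> by (intro mem_of_gau_less_1) simp
  have "r1 <= ?l u" using gl[of u] \<eta> unfolding gu by simp
  hence "r1^2 <= (?l u)^2" using r1 by (intro power_mono) auto
  hence "H (u + p0) = m" using g1 r1 by (simp add: H_def)
  moreover have "u + p0 \<in> D" using ub by (simp only: body_iff)
  ultimately show ?thesis unfolding mH_def by (intro cSup_eq_maximum) (use Hb in \<open>auto intro: rev_image_eqI\<close>)
 qed
 have cl: "continuous_on UNIV (\<lambda>x. ?l (x - p0))" by (intro continuous_on_compose2[OF continuous_lse[of UNIV]] continuous_intros) auto
 have cls: "hz_class \<tau> D H"
  unfolding hz_class_def mx
 proof (intro conjI ballI)
  show "smooth_on D H" unfolding H_def[abs_def] by (rule smooth_on_step_lse) (rule g)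
  show "H (\<tau> p) = H p" for p by (simp add: H_def \<tau>_translate(1)[symmetric] lse_invariant[OF lin Wn(5)])
  show "0 <= H p" "H p <= m" for p by (rule Hb)+
  let ?U = "{x. ?l (x - p0) < r0} \<inter> D"
  have "open {x. ?l (x - p0) < r0}" using cl by (intro open_Collect_less) (auto intro: continuous_intros)
  hence "open ?U" using D(1) by auto
  moreover have "p0 \<in> ?U" 
  proof -
   have "\<delta> * r0 < 1 * r0" using \<delta> r0 by (intro mult_strict_right_mono) auto
   hence "\<kappa> < r0" using \<kappa> by linarith
   thus ?thesis using p0D by (simp add: lse_0 \<kappa>_def)
  qed
  moreover have "H p = 0" if "p \<in> ?U" for p
  proof -
   have "(?l (p - p0))^2 <= r0^2" using that lb(3) by (intro power_mono) auto
   thus ?thesis using g0 r0 by (simp add: H_def)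
  qed
  ultimately show "\<exists>U. open U \<and> U ~= {} \<and> U \<subseteq> D \<and> U \<inter> {p. \<tau> p = p} ~= {} \<and> (\<forall>p\<in>U. H p = 0)"
   using p0fix by (intro exI[of _ ?U]) blast
  let ?K = "{x. ?l (x - p0) <= r1}"
  have KD: "?K \<subseteq> D"
  proof
   fix x assume x: "x \<in> ?K"
   have "gau body (x - p0) <= (1 + \<eta>) * r1" 
    by (rule order_trans[OF gl mult_left_mono]) (use x \<eta> in auto)
   hence "x - p0 \<in> body" using r\<eta> by (intro mem_of_gau_less_1) simp
   thus "x \<in> D" by (simp only: body_iff diff_add_cancel)
  qed
  have "closed ?K" using cl by (intro closed_Collect_le) (auto intro: continuous_intros)
  moreover have "bounded ?K" using D(3) KD bounded_subset by blast
  ultimately have "compact ?K" by (simp add: compact_eq_bounded_closed)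
  moreover have "H p = m" if "p \<in> D - ?K" for p
  proof -
   have "r1^2 <= (?l (p - p0))^2" using that r1 by (intro power_mono) auto
   thus ?thesis using g1 r1 by (simp add: H_def)
  qed
  ultimately show "\<exists>K. compact K \<and> K \<subseteq> D \<and> (\<forall>p\<in>D - K. H p = m)" using KD by blast
 qed
 have dH: "frechet_derivative H (at x) = (\<lambda>w. m * (g 1 ((?l (x - p0))^2) * (2 * ?l (x - p0) * (?g (x - p0) \<bullet> w))))" for x
 proof (rule frechet_derivative_at[symmetric])
  have dl: "((\<lambda>x. ?l (x - p0)) has_derivative (\<lambda>v. ?g (x - p0) \<bullet> v)) (at x)" by (rule has_derivative_translate[OF lse_has_derivative])
  have "((\<lambda>x. (?l (x - p0))^2) has_derivative (\<lambda>v. 2 * ?l (x - p0) * (?g (x - p0) \<bullet> v))) (at x)"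
   by (rule derivative_eq_intros dl refl)+ (simp add: mult_ac)
  from has_derivative_mult_right[OF has_derivative_compose[OF this g[unfolded has_field_derivative_def, of 0]], of m]
  show "(H has_derivative (\<lambda>w. m * (g 1 ((?l (x - p0))^2) * (2 * ?l (x - p0) * (?g (x - p0) \<bullet> w))))) (at x)"
   by (simp add: H_def[abs_def])
 qed
 obtain x T where T: "0 < T" "T <= 1" and orb: "ham_brake_orbit \<tau> D H x T" and nc: "\<not> (\<exists>c. \<forall>t. x t = c)"
  by (rule nonadmissible_orbit[of H]) (use m mx cls in auto)
 define X where "X t = x t - p0" for t
 define M where "M t = m * (g 1 ((?l (X t))^2) * (2 * ?l (X t)))" for t
 have Xd: "(X has_vector_derivative M t *\<^sub>R J0 (?g (X t))) (at t)" for t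
 proof -
  obtain v where v: "(x has_vector_derivative v) (at t)" "!!w. omega0 v w = - frechet_derivative H (at (x t)) w"
   using orb unfolding ham_brake_orbit_def by blast
  have "J0 v \<bullet> w = (- M t *\<^sub>R ?g (X t)) \<bullet> w" for w using v(2)[of w] by (simp add: dH omega0_eq M_def X_def mult_ac)
  hence "J0 v = - M t *\<^sub>R ?g (X t)" by (metis vector_eq_rdot)
  hence "J0 (J0 v) = - M t *\<^sub>R J0 (?g (X t))" by (simp add: J0_scaleR J0_minus)
  hence "v = M t *\<^sub>R J0 (?g (X t))" by (simp add: J0_J0)
  moreover have "(X has_vector_derivative v) (at t)" unfolding X_def[abs_def] using v(1) by (auto intro: derivative_eq_intros)
  ultimately show ?thesis by simp
 qed
 define r where "r = ?l (X 0)"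
 \<comment> \<open>The gradient of l is orthogonal to J of itself.\<close>
 have lr: "?l (X t) = r" for t
 proof -
  have "((\<lambda>t. ?l (X t)) has_vector_derivative 0) (at t)" for t
  proof -
   have "((\<lambda>t. ?l (X t)) has_derivative (\<lambda>h. ?g (X t) \<bullet> (h *\<^sub>R (M t *\<^sub>R J0 (?g (X t)))))) (at t)"
    by (rule has_derivative_compose[OF Xd[unfolded has_vector_derivative_def] lse_has_derivative])
   thus ?thesis by (simp add: has_vector_derivative_def inner_J0_self inner_commute)
  qed
  from constant_or_avoids[OF this open_UNIV, of 0 t] show ?thesis by (simp add: r_def)
 qed
 define M0 where "M0 = m * (g 1 (r^2) * (2 * r))"
 have M0: "M t = M0" for t by (simp add: M_def M0_def lr)
 have "M0 ~= 0"
 proof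
  assume "M0 = 0"
  hence "(X has_vector_derivative 0) (at t)" for t using Xd[of t] by (simp add: M0)
  from constant_or_avoids[OF this open_UNIV, of 0] have "x t = x 0" for t by (simp add: X_def)
  thus False using nc by blast
 qed
 hence gr: "g 1 (r^2) ~= 0" "r ~= 0" by (auto simp: M0_def)
 have rp: "r > 0" using lb(3)[of "X 0"] gr by (simp add: r_def)
 have "\<not> r\<^sup>2 <= \<delta>" using g0 gr by blast
 hence rr0: "r >= r0" using power_mono[of r r0 2] rp r0 by fastforce
 have Mp: "M0 > 0" using m(2) gp(1)[of "r^2"] gr(1) rp unfolding M0_def by (intro mult_pos_pos) auto
 have \<kappa>r: "\<kappa> / r <= \<delta>"
 proof -
  have "\<kappa> <= \<delta> * r" using \<kappa> mult_left_mono[OF rr0, of \<delta>] \<delta> by linarith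
  thus ?thesis using rp by (simp add: pos_divide_le_eq)
 qed
 define z where "z t = (1 / r) *\<^sub>R X (T * t)" for t
 define n where "n t = ?g (X (T * t))" for t
 define \<mu> where "\<mu> = T * M0 / r"
 show ?thesis
 proof (rule that[of z \<mu> n])
  show "0 < \<mu>" using T Mp rp by (simp add: \<mu>_def)
  have "\<mu> = T * (2 * m * g 1 (r^2))" using rp by (simp add: \<mu>_def M0_def)
  also have "... <= 1 * (2 * m * g 1 (r^2))" using T m gp(1) by (intro mult_right_mono) auto
  also have "... <= 1 * (2 * m * (1 / (1 - 3 * \<delta>)))" using m gp(2) by (intro mult_left_mono) auto
  finally show "\<mu> <= 2 * m / (1 - 3 * \<delta>)" by simp
  fix t
  have Td: "((\<lambda>t. T * t) has_vector_derivative T) (at t)"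
   unfolding has_real_derivative_iff_has_vector_derivative[symmetric] by (auto intro!: derivative_eq_intros)
  have "((\<lambda>t. X (T * t)) has_vector_derivative T *\<^sub>R (M0 *\<^sub>R J0 (n t))) (at t)"
   using vector_diff_chain_at[of "\<lambda>t. T * t" T t X "M0 *\<^sub>R J0 (n t)"] Xd[of "T * t"] Td by (simp add: o_def M0 n_def)
  from has_vector_derivative_scaleR[OF DERIV_const[of "1 / r"] this]
  show "(z has_vector_derivative \<mu> *\<^sub>R J0 (n t)) (at t)" by (simp add: z_def[abs_def] \<mu>_def)
  show "n t \<in> dual body" unfolding n_def by (rule glse_dual[OF Wn(3)])
  have "(r - \<kappa>) / r <= (?g (X (T * t)) \<bullet> X (T * t)) / r" using glse_self_ge[of "X (T * t)", folded \<kappa>_def] rp by (intro divide_right_mono) (auto simp: lr)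
  thus "1 - \<delta> <= n t \<bullet> z t" using \<kappa>r rp by (simp add: n_def z_def diff_divide_distrib)
  have gz: "gau body (z t) = gau body (X (T * t)) / r" unfolding z_def using rp by (subst gau_scale) auto
  have "gau body (X (T * t)) / r <= ((1 + \<eta>) * r) / r" using gl[of "X (T * t)"] rp by (intro divide_right_mono) (auto simp: lr)
  thus "gau body (z t) <= 1 + \<delta>" using rp \<delta> by (simp add: gz \<eta>_def)
  have "(r - \<kappa>) / r <= gau body (X (T * t)) / r" using lb(2)[of "X (T * t)"] rp by (intro divide_right_mono) (auto simp: lr)
  thus "1 - \<delta> <= gau body (z t)" using \<kappa>r rp by (simp add: gz diff_divide_distrib)
  have "x (T * t + T) = x (T * t)" "x (- (T * t)) = \<tau> (x (T * t))" using orb unfolding ham_brake_orbit_def by blast+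
  thus "z (t + 1) = z t" "z (- t) = \<tau> (z t)"
   by (simp_all add: z_def X_def distrib_left linear_scale[OF lin] \<tau>_translate(1))
 qed
qed

text \<open>The three estimates survive passage to the limit, where the equation \<open>z' = \<mu> J n\<close> is lost.\<close>

lemma approximate_characteristic_estimates:
 assumes z: "!!t. (z has_vector_derivative \<mu> *\<^sub>R J0 (n t)) (at t)" and n: "!!t. n t \<in> dual body" and nz: "!!t. n t \<bullet> z t >= 1 - b"
  and \<mu>: "0 < \<mu>" and K: "\<forall>v\<in>dual body. norm v <= K" and h: "h >= 0"
 shows "- omega0 (z (s + h) - z s) u <= \<mu> * h * gau body u" "norm (z (s + h) - z s) <= \<mu> * K * h"
  "- omega0 (z (s + h) - z s) (z s) >= \<mu> * h * (1 - b) - (\<mu> * K)^2 * h^2"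
proof -
 have K0: "K >= 0" using order_trans[OF norm_ge_zero bspec[OF K n]] .
 have d: "((\<lambda>r. omega0 (z r) u) has_real_derivative - (\<mu> * (n r \<bullet> u))) (at r)" for r u
  using bounded_linear.has_vector_derivative[OF bounded_linear_omega0_left z[of r], of u]
  by (simp add: has_real_derivative_iff_has_vector_derivative omega0_eq J0_scaleR J0_J0)
 have up: "- omega0 (z (s + h) - z s) u <= \<mu> * h * gau body u" if h: "h >= 0" for h u
 proof -
  have "omega0 (z s) u + \<mu> * gau body u * s <= omega0 (z (s + h)) u + \<mu> * gau body u * (s + h)"
  proof (rule DERIV_nonneg_imp_nondecreasing[of s "s + h" "\<lambda>r. omega0 (z r) u + \<mu> * gau body u * r"])
   fix r
   have "((\<lambda>r. omega0 (z r) u + \<mu> * gau body u * r) has_real_derivative - (\<mu> * (n r \<bullet> u)) + \<mu> * gau body u) (at r)"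
    by (rule derivative_eq_intros d refl)+ simp
   moreover have "\<mu> * (n r \<bullet> u) <= \<mu> * gau body u" using gau_ge[OF n] \<mu> by (intro mult_left_mono) auto
   ultimately show "\<exists>y. ((\<lambda>r. omega0 (z r) u + \<mu> * gau body u * r) has_real_derivative y) (at r) \<and> 0 <= y" by (intro exI conjI) auto
  qed (use h in simp)
  thus ?thesis by (simp add: omega0_diff_left algebra_simps)
 qed
 show "- omega0 (z (s + h) - z s) u <= \<mu> * h * gau body u" by (rule up[OF h])
 have lip: "norm (z r - z s) <= \<mu> * K * (r - s)" if "s <= r" for r
 proof -
  have 1: "- omega0 (z r - z s) u <= (\<mu> * (r - s)) * gau body u" for u using up[of "r - s" u] that by simp
  have 2: "gau body u <= K * norm u" for u by (rule gau_le) (use order_trans[OF norm_cauchy_schwarz mult_right_mono[OF bspec[OF K]]] in auto)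
  have "norm (z r - z s) <= (\<mu> * (r - s)) * K" by (rule norm_le_of_omega_bound[OF 1 2]) (use \<mu> K0 that in auto)
  thus ?thesis by (simp add: mult_ac)
 qed
 show "norm (z (s + h) - z s) <= \<mu> * K * h" using lip[of "s + h"] h by simp
 define B where "B = \<mu> * (1 - b) - \<mu> * K * (\<mu> * K * h)"
 have "- omega0 (z s) (z s) - B * s <= - omega0 (z (s + h)) (z s) - B * (s + h)"
 proof (rule DERIV_nonneg_imp_nondecreasing[of s "s + h" "\<lambda>r. - omega0 (z r) (z s) - B * r"])
  fix r assume r: "s <= r" "r <= s + h"
  have "((\<lambda>r. - omega0 (z r) (z s) - B * r) has_real_derivative \<mu> * (n r \<bullet> z s) - B) (at r)"
   by (rule derivative_eq_intros d refl)+ simp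
  moreover have "B <= \<mu> * (n r \<bullet> z s)"
  proof -
   have "n r \<bullet> (z r - z s) <= norm (n r) * norm (z r - z s)" by (rule norm_cauchy_schwarz)
   also have "... <= K * (\<mu> * K * h)"
   proof (rule mult_mono[OF bspec[OF K n]])
    have "\<mu> * K * (r - s) <= \<mu> * K * h" using r \<mu> K0 by (intro mult_left_mono) auto
    thus "norm (z r - z s) <= \<mu> * K * h" using lip[OF r(1)] by linarith
   qed (use K0 in auto)
   finally have "(1 - b) - K * (\<mu> * K * h) <= n r \<bullet> z s" using nz[of r] by (simp add: inner_diff_right)
   hence "\<mu> * ((1 - b) - K * (\<mu> * K * h)) <= \<mu> * (n r \<bullet> z s)" using \<mu> by (intro mult_left_mono) auto
   thus ?thesis by (simp add: B_def right_diff_distrib mult.assoc)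
  qed
  ultimately show "\<exists>y. ((\<lambda>r. - omega0 (z r) (z s) - B * r) has_real_derivative y) (at r) \<and> 0 <= y" by (intro exI conjI) auto
 qed (use h in simp)
 hence "B * h <= - omega0 (z (s + h) - z s) (z s)" by (simp add: omega0_diff_left distrib_left)
 thus "- omega0 (z (s + h) - z s) (z s) >= \<mu> * h * (1 - b) - (\<mu> * K)^2 * h^2"
  by (simp add: B_def power2_eq_square algebra_simps)
qed

end

context pointed_domain
begin

text \<open>The approximate loops are uniformly Lipschitz, so a subsequence converges and the
  increment inequalities converge with it. The limit has gauge 1 throughout because the gauges tend
  to 1.\<close>

lemma limit_characteristic:
 assumes c: "c_HZ_tau \<tau> D = ereal c" "c >= 0"
 obtains z a C M where "0 < a" "a <= 2 * c" "char_loop \<tau> (gau body) (a / 2) C z" "!!t. gau body (z t) = 1"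
  "!!s t. norm (z s - z t) <= M * \<bar>s - t\<bar>"
proof -
 obtain K where K: "K > 0" "\<forall>v\<in>dual body. norm v <= K" using dual_bound by metis
 obtain R where R: "R > 0" "!!u. norm u <= R * gau body u" using gau_lower by metis
 \<comment> \<open>The shift by 5 keeps b k below 1/4, as the ramp requires, and 1 - 3 b k bounded
   away from 0.\<close>
 define b where "b k = 1 / (real k + 5)" for k :: nat
 define m where "m k = c + 1 / (real k + 1)" for k :: nat
 have b: "0 < b k" "b k < 1/4" "b k <= 1/5" for k by (auto simp: b_def field_simps)
 have m: "m k > 0" "m k <= c + 1" "c_HZ_tau \<tau> D < ereal (m k)" for k using c by (auto simp: m_def add_nonneg_pos)
 define P where "P k z n a \<longleftrightarrow> (\<forall>t. (z has_vector_derivative a *\<^sub>R J0 (n t)) (at t)) \<and> (\<forall>t. n t \<in> dual body) \<and> (\<forall>t. n t \<bullet> z t >= 1 - b k)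
  \<and> 0 < a \<and> a <= 2 * m k / (1 - 3 * b k) \<and> (\<forall>t. z (t + 1) = z t) \<and> (\<forall>t. z (- t) = \<tau> (z t))
  \<and> (\<forall>t. 1 - b k <= gau body (z t)) \<and> (\<forall>t. gau body (z t) <= 1 + b k)" for k z n a
 have "\<exists>z n a. P k z n a" for k
  by (rule approximate_characteristic[OF m(3,1) b(1,2), of k k], unfold P_def) (intro exI conjI allI; assumption)
 then obtain Z n A where "!!k. P k (Z k) (n k) (A k)" by metis
 note P = this[unfolded P_def]
 have zd: "(Z k has_vector_derivative A k *\<^sub>R J0 (n k t)) (at t)" and nd: "n k t \<in> dual body" and nz: "n k t \<bullet> Z k t >= 1 - b k"
  and A: "0 < A k" "A k <= 2 * m k / (1 - 3 * b k)" and per: "Z k (t + 1) = Z k t" and sym: "Z k (- t) = \<tau> (Z k t)"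
  and gz: "1 - b k <= gau body (Z k t)" "gau body (Z k t) <= 1 + b k" for k t using P[of k] by blast+
 note est = approximate_characteristic_estimates[OF zd nd nz A(1) K(2)]
 define M where "M = 5 * (c + 1)"
 have M: "M >= 0" "A k <= M" for k
 proof -
  have "2 * m k / (1 - 3 * b k) <= 2 * (c + 1) / (1 - 3 * (1/5))"
   using m[of k] b(3)[of k] c by (intro frac_le) auto
  thus "A k <= M" using A(2)[of k] by (simp add: M_def)
 qed (use c in \<open>simp add: M_def\<close>)
 have lip: "norm (Z k s - Z k t) <= M * K * \<bar>s - t\<bar>" for k s t
 proof -
  have 1: "norm (Z k (u + h) - Z k u) <= M * K * h" if "h >= 0" for u h
  proof -
   have "A k * K * h <= M * K * h" using M K that by (intro mult_right_mono) auto
   thus ?thesis using est(2)[OF that, of k u] by linarith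
  qed
  show ?thesis using 1[of "s - t" t] 1[of "t - s" s] by (cases "s >= t") (auto simp: norm_minus_commute)
 qed
 obtain l r1 where l: "strict_mono (r1 :: nat => nat)" "(A \<circ> r1) \<longlonglongrightarrow> l"
  using compact_imp_seq_compact[OF compact_Icc[of 0 M]] A(1) M(2) unfolding seq_compact_def by (metis atLeastAtMost_iff less_imp_le)
 obtain r2 z where z: "strict_mono (r2 :: nat => nat)" "uniform_limit UNIV (\<lambda>k. Z (r1 (r2 k))) z sequentially"
 proof (rule periodic_Arzela_Ascoli[of "\<lambda>k. Z (r1 k)" "R * 2" "M * K"])
  show "Z (r1 k) (t + 1) = Z (r1 k) t" for k t by (rule per)
  show "norm (Z (r1 k) t) <= R * 2" for k t
  proof -
   have "R * gau body (Z (r1 k) t) <= R * 2" using gz(2)[of "r1 k" t] b(2)[of "r1 k"] R(1) by (intro mult_left_mono) auto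
   thus ?thesis using R(2)[of "Z (r1 k) t"] by linarith
  qed
  fix k and t s :: real assume ts: "\<bar>t - s\<bar> <= 1"
  have "\<bar>t - s\<bar> * \<bar>t - s\<bar> <= 1 * \<bar>t - s\<bar>" using ts by (intro mult_right_mono) auto
  hence "\<bar>t - s\<bar>\<^sup>2 <= \<bar>t - s\<bar>" by (simp only: power2_eq_square mult_1)
  hence "\<bar>t - s\<bar> <= sqrt \<bar>t - s\<bar>" by (rule real_le_rsqrt)
  hence "M * K * \<bar>t - s\<bar> <= M * K * sqrt \<bar>t - s\<bar>" using M K by (intro mult_left_mono) auto
  thus "norm (Z (r1 k) t - Z (r1 k) s) <= M * K * sqrt \<bar>t - s\<bar>" using lip[of "r1 k" t s] by linarith
 qed (rule that; assumption)
 define r where "r k = r1 (r2 k)" for k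
 have r: "filterlim r at_top sequentially" unfolding r_def
  using strict_mono_compose[OF l(1) z(1)] filterlim_subseq by (auto simp: o_def)
 have zl: "(\<lambda>k. Z (r k) t) \<longlonglongrightarrow> z t" for t using tendsto_uniform_limitI[OF z(2), of t] by (simp add: r_def)
 have ll: "(\<lambda>k. A (r k)) \<longlonglongrightarrow> l" using LIMSEQ_subseq_LIMSEQ[OF l(2) z(1)] by (simp add: r_def o_def)
 have "b \<longlonglongrightarrow> 0" "m \<longlonglongrightarrow> c + 0" unfolding b_def[abs_def] m_def[abs_def] by real_asymp+
 hence dl: "(\<lambda>k. b (r k)) \<longlonglongrightarrow> 0" and ml: "(\<lambda>k. m (r k)) \<longlonglongrightarrow> c" using filterlim_compose[OF _ r] by auto
 have up: "- omega0 (z (s + h) - z s) u <= 2 * (l / 2) * h * gau body u" if "0 <= h" for s h u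
 proof (rule LIMSEQ_le)
  show "(\<lambda>k. - omega0 (Z (r k) (s + h) - Z (r k) s) u) \<longlonglongrightarrow> - omega0 (z (s + h) - z s) u"
   unfolding omega0_def by (intro tendsto_intros zl)
  have "(\<lambda>k. A (r k) * h * gau body u) \<longlonglongrightarrow> l * h * gau body u" by (intro tendsto_intros ll)
  thus "(\<lambda>k. A (r k) * h * gau body u) \<longlonglongrightarrow> 2 * (l / 2) * h * gau body u" by simp
 qed (use est(1)[OF that] in blast)
 have low: "- omega0 (z (s + h) - z s) (z s) >= l * h * (1 - 0) - (l * K)^2 * h^2" if "0 <= h" for s h
 proof (rule LIMSEQ_le)
  show "(\<lambda>k. - omega0 (Z (r k) (s + h) - Z (r k) s) (Z (r k) s)) \<longlonglongrightarrow> - omega0 (z (s + h) - z s) (z s)"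
   unfolding omega0_def by (intro tendsto_intros zl)
  show "(\<lambda>k. A (r k) * h * (1 - b (r k)) - (A (r k) * K)^2 * h^2) \<longlonglongrightarrow> l * h * (1 - 0) - (l * K)^2 * h^2"
   by (intro tendsto_intros ll dl)
 qed (use est(3)[OF that] in blast)
 have "l >= 0" by (rule LIMSEQ_le_const[OF ll]) (use A(1) less_imp_le in blast)
 \<comment> \<open>A full period has zero increment, so the lower inequality at h = 1 reads 1 - b k
   <= A k K^2 and prevents collapse.\<close>
 moreover have "l ~= 0"
 proof
  assume l0: "l = 0"
  have "1 - b k <= A k * K^2" for k
  proof -
   have "A k * (1 - b k) <= A k * (A k * K^2)" using est(3)[of 1 k 0] per[of k 0] by (simp add: omega0_def power2_eq_square mult_ac)
   thus ?thesis using A(1) by (simp add: mult_le_cancel_left_pos)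
  qed
  hence "1 - 0 <= l * K^2" by (intro LIMSEQ_le[OF tendsto_diff[OF tendsto_const dl] tendsto_mult_right[OF ll]]) blast
  thus False using l0 by simp
 qed
 ultimately have lp: "l > 0" by simp
 show ?thesis
 proof (rule that[of l "(l * K)^2" z "M * K"])
  show "0 < l" by (rule lp)
  have "(\<lambda>k. 2 * m (r k) / (1 - 3 * b (r k))) \<longlonglongrightarrow> 2 * c / (1 - 3 * 0)" by (intro tendsto_intros ml dl) simp
  from LIMSEQ_le[OF ll this] A(2) show "l <= 2 * c" by auto
  show "char_loop \<tau> (gau body) (l / 2) ((l * K)^2) z"
   unfolding char_loop_def
  proof (intro conjI allI impI)
   fix t
   show "z (t + 1) = z t" using LIMSEQ_unique[OF zl[of "t + 1"]] zl[of t] by (simp add: per)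
   have "(\<lambda>k. \<tau> (Z (r k) t)) \<longlonglongrightarrow> \<tau> (z t)" 
    by (rule bounded_linear.tendsto[OF _ zl]) (use lin linear_conv_bounded_linear in blast)
   thus "z (- t) = \<tau> (z t)" using LIMSEQ_unique[OF zl[of "- t"]] by (simp add: sym)
  next
   fix s h u assume "0 <= (h::real)"
   thus "- omega0 (z (s + h) - z s) u <= 2 * (l / 2) * h * gau body u" by (rule up)
  next
   fix s h assume "0 <= (h::real)"
   from low[OF this, of s] show "- omega0 (z (s + h) - z s) (z s) >= 2 * (l / 2) * h - (l * K)^2 * h^2" by simp
  qed
  show "norm (z s - z t) <= M * K * \<bar>s - t\<bar>" for s t
   by (rule LIMSEQ_le_const2[OF tendsto_norm[OF tendsto_diff[OF zl zl]]]) (use lip in blast)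
  fix t
  have gl: "(\<lambda>k. gau body (Z (r k) t)) \<longlonglongrightarrow> gau body (z t)"
   by (rule continuous_on_tendsto_compose[OF continuous_gau[of UNIV] zl]) auto
  have "1 - 0 <= gau body (z t)" by (rule LIMSEQ_le[OF tendsto_diff[OF tendsto_const dl] gl]) (use gz in blast)
  moreover have "gau body (z t) <= 1 + 0" by (rule LIMSEQ_le[OF gl tendsto_add[OF tendsto_const dl]]) (use gz in blast)
  ultimately show "gau body (z t) = 1" by simp
 qed
qed

section \<open>From loops back to generalized characteristics\<close>

lemma lipschitz_absolutely_continuous:
 fixes x :: "real => 'b::real_normed_vector"
 assumes lip: "!!s t. s \<in> S ==> t \<in> S ==> norm (x s - x t) <= M * \<bar>s - t\<bar>"
 shows "absolutely_continuous_on S x"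
 unfolding absolutely_continuous_on_def
proof (intro allI impI)
 fix e :: real assume e: "e > 0"
 have M1: "\<bar>M\<bar> + 1 > 0" by simp
 show "\<exists>c>0. \<forall>(n::nat) (a::nat => real) b. (\<forall>i<n. a i <= b i \<and> {a i..b i} \<subseteq> S) \<and> (\<forall>i<n. \<forall>j<n. i ~= j --> b i <= a j \<or> b j <= a i)
   \<and> (\<Sum>i<n. b i - a i) < c --> (\<Sum>i<n. norm (x (b i) - x (a i))) < e"
 proof (intro exI[of _ "e / (\<bar>M\<bar> + 1)"] conjI allI impI; (elim conjE)?)
  show "e / (\<bar>M\<bar> + 1) > 0" using e M1 by simp
  fix n :: nat and a b :: "nat => real"
  assume ab: "\<forall>i<n. a i <= b i \<and> {a i..b i} \<subseteq> S" and s: "(\<Sum>i<n. b i - a i) < e / (\<bar>M\<bar> + 1)"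
  have "(\<Sum>i<n. norm (x (b i) - x (a i))) <= (\<Sum>i<n. (\<bar>M\<bar> + 1) * (b i - a i))"
  proof (rule sum_mono)
   fix i assume "i \<in> {..<n}"
   hence i0: "a i <= b i" "{a i..b i} \<subseteq> S" using ab by auto
   have i: "a i \<in> S" "b i \<in> S" using i0(1) by (auto intro!: subsetD[OF i0(2)])
   have "M * \<bar>b i - a i\<bar> <= (\<bar>M\<bar> + 1) * (b i - a i)" using i0(1) by (simp add: mult_right_mono)
   thus "norm (x (b i) - x (a i)) <= (\<bar>M\<bar> + 1) * (b i - a i)" using lip[OF i(2,1)] by linarith
  qed
  also have "... = (\<bar>M\<bar> + 1) * (\<Sum>i<n. b i - a i)" by (rule sum_distrib_left[symmetric])
  also have "... < e" using s M1 by (simp add: pos_less_divide_eq mult.commute)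
  finally show "(\<Sum>i<n. norm (x (b i) - x (a i))) < e" .
 qed
qed

text \<open>Differentiating the two inequalities gives <- J v, u> <= m g(u) for all u, with equality
  at u = z t where g = 1. Hence - J v attains its maximum over the body at z t.\<close>

lemma loop_velocity:
 assumes z: "char_loop \<tau> (gau body) (m / 2) C z" and gz: "gau body (z t) = 1" and m: "m > 0"
  and v: "(z has_vector_derivative v) (at t)"
 shows "- J0 v \<in> normal_cone D (z t + p0)" "(- J0 v) \<bullet> z t = m"
proof -
 have d: "((\<lambda>r. - omega0 (z r) u) has_real_derivative (- J0 v) \<bullet> u) (at t)" for u
  using has_vector_derivative_minus[OF bounded_linear.has_vector_derivative[OF bounded_linear_omega0_left v, of u]]
  by (simp add: has_real_derivative_iff_has_vector_derivative omega0_eq)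
 have zu: "- omega0 (z (s + h) - z s) u <= m * h * gau body u" if "0 <= h" "h <= 1" for s h u
 proof -
  have "- omega0 (z (s + h) - z s) u <= 2 * (m / 2) * h * gau body u" using z that unfolding char_loop_def by blast
  thus ?thesis by simp
 qed
 have zl: "- omega0 (z (s + h) - z s) (z s) >= m * h - C * h^2" if "0 <= h" "h <= 1" for s h
  using z that unfolding char_loop_def by auto
 have up: "(- J0 v) \<bullet> u <= m * gau body u" for u
 proof (rule derivative_le_of_increment[OF d, of _ _ 0])
  fix h :: real assume "0 < h" "h < 1"
  thus "- omega0 (z (t + h)) u - (- omega0 (z t) u) <= m * gau body u * h + 0 * h^2"
   using zu[of h t u] by (simp add: omega0_diff_left mult_ac)
 qed
 have "- ((- J0 v) \<bullet> z t) <= - m"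
 proof (rule derivative_le_of_increment[OF DERIV_minus[OF d], of _ _ C])
  fix h :: real assume "0 < h" "h < 1"
  thus "- (- omega0 (z (t + h)) (z t)) - (- (- omega0 (z t) (z t))) <= - m * h + C * h^2"
   using zl[of h t] by (simp add: omega0_diff_left mult_ac)
 qed
 thus e: "(- J0 v) \<bullet> z t = m" using up[of "z t"] gz by simp
 show "- J0 v \<in> normal_cone D (z t + p0)" unfolding normal_cone_def
 proof (rule CollectI, rule ballI)
  fix u assume "u \<in> D"
  hence "u - p0 \<in> body" by blast
  from gau_le_1[OF subsetD[OF closure_subset this]] have "gau body (u - p0) <= 1" .
  hence "m * gau body (u - p0) <= m" using m by simp
  hence "(- J0 v) \<bullet> (u - p0) <= (- J0 v) \<bullet> z t" using up[of "u - p0"] e by linarith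
  thus "(u - (z t + p0)) \<bullet> - J0 v <= 0" by (simp add: inner_diff_left inner_diff_right inner_add_left inner_add_right inner_commute)
 qed
qed

lemma frontier_of_loop: "gau body u = 1 ==> u + p0 \<in> frontier D"
proof -
 assume "gau body u = 1"
 hence "u \<in> frontier body" by (rule frontier_of_gau)
 moreover have "body = (+) (- p0) ` D" by (intro image_cong) auto
 ultimately have "u \<in> (+) (- p0) ` frontier D" by (simp only: frontier_translation)
 thus ?thesis by auto
qed

lemma loop_velocity_ae:
 assumes z: "char_loop \<tau> (gau body) (m / 2) C z" and gz: "!!t. gau body (z t) = 1" and m: "m > 0"
  and lip: "!!s t. norm (z s - z t) <= M * \<bar>s - t\<bar>"
 obtains N v where "negligible N" "!!t. t \<notin> N ==> (z has_vector_derivative v t) (at t)"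
  "!!t. t \<notin> N ==> - J0 (v t) \<in> normal_cone D (z t + p0)" "!!t. t \<notin> N ==> (- J0 (v t)) \<bullet> z t = m"
  "!!s t. s <= t ==> (v has_integral (z t - z s)) {s..t}"
proof -
 let ?N = "{t. \<not> z differentiable (at t)}" and ?v = "\<lambda>t. vector_derivative z (at t)"
 have N: "negligible ?N" by (rule lipschitz_differentiable_ae[OF lip])
 have v: "(z has_vector_derivative ?v t) (at t)" if "t \<notin> ?N" for t using that vector_derivative_works by blast
 show ?thesis
 proof (rule that[OF N v])
  show "- J0 (?v t) \<in> normal_cone D (z t + p0)" "(- J0 (?v t)) \<bullet> z t = m" if "t \<notin> ?N" for t
   using loop_velocity[OF z gz m v[OF that]] by auto
  fix s t :: real assume "s <= t"
  thus "(?v has_integral (z t - z s)) {s..t}"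
   by (rule AC_has_integral[OF lipschitz_absolutely_continuous[OF lip] _ N]) (auto intro!: has_vector_derivative_at_within v)
 qed
qed

text \<open>Any period T of z is allowed, not only 1: a period below 1 yields a characteristic of
  smaller action, which will rule out self-intersections.\<close>

lemma generalized_characteristic_of_loop:
 assumes z: "char_loop \<tau> (gau body) (m / 2) C z" and gz: "!!t. gau body (z t) = 1" and m: "m > 0"
  and lip: "!!s t. norm (z s - z t) <= M * \<bar>s - t\<bar>" and T: "T > 0" "!!t. z (t + T) = z t"
 shows "gen_brake_char \<tau> D (\<lambda>t. z t + p0) T" "action (\<lambda>t. z t + p0) T = T * m / 2"
proof -
 let ?x = "\<lambda>t. z t + p0"
 obtain N v where N: "negligible N" and v: "!!t. t \<notin> N ==> (z has_vector_derivative v t) (at t)"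
  and nc: "!!t. t \<notin> N ==> - J0 (v t) \<in> normal_cone D (z t + p0)" and nz: "!!t. t \<notin> N ==> (- J0 (v t)) \<bullet> z t = m"
  and vi: "!!s t. s <= t ==> (v has_integral (z t - z s)) {s..t}"
  by (rule loop_velocity_ae[OF z gz m lip]) (rule that; assumption)
 have xv: "(?x has_vector_derivative v t) (at t)" if "t \<notin> N" for t using v[OF that] by (auto intro: derivative_eq_intros)
 have z0: "z T = z 0" using T(2)[of 0] by simp
 have i0: "((\<lambda>t. (- J0 (v t)) \<bullet> p0) has_integral 0) {0..T}"
  using has_integral_neg[OF has_integral_linear[OF vi[of 0 T] bounded_linear_omega0_left[of p0]]] T z0 
  by (simp add: omega0_eq o_def omega0_def[of 0])
 have i1: "((\<lambda>t. m + (- J0 (v t)) \<bullet> p0) has_integral (T * m + 0)) {0..T}"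
  using has_integral_add[OF has_integral_const_real[of m 0 T] i0] T by simp
 have "((\<lambda>t. (- J0 (vector_derivative ?x (at t))) \<bullet> ?x t) has_integral (T * m + 0)) {0..T}"
 proof (rule has_integral_spike[OF N _ i1])
  fix t assume "t \<in> {0..T} - N"
  thus "(- J0 (vector_derivative ?x (at t))) \<bullet> ?x t = m + (- J0 (v t)) \<bullet> p0"
   using nz[of t] vector_derivative_at[OF xv, of t] by (simp add: inner_add_right)
 qed
 hence e: "integral {0..T} (\<lambda>t. (- J0 (vector_derivative ?x (at t))) \<bullet> ?x t) = T * m + 0" by (rule integral_unique)
 show act: "action ?x T = T * m / 2" unfolding action_def e by simp
 have sym: "z (- t) = \<tau> (z t)" for t using z by (simp add: char_loop_def)
 show "gen_brake_char \<tau> D ?x T" unfolding gen_brake_char_def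
 proof (intro conjI allI notI)
  show "T > 0" by (rule T)
  show "z (t + T) + p0 = z t + p0" for t by (simp add: T)
  show "z t + p0 \<in> frontier D" for t by (rule frontier_of_loop[OF gz])
  show "absolutely_continuous_on {0..T} ?x" by (rule lipschitz_absolutely_continuous[where M = M]) (use lip in simp)
  show "z (T - t) + p0 = \<tau> (z t + p0)" for t using T(2)[of "- t"] by (simp add: sym \<tau>_translate)
  have "(- N) \<subseteq> {t. ?x differentiable (at t) \<and> vector_derivative ?x (at t) \<in> J0 ` normal_cone D (?x t)}"
  proof (intro subsetI CollectI conjI)
   fix t assume "t \<in> - N"
   hence t: "t \<notin> N" by simp
   show "?x differentiable (at t)" using xv[OF t] differentiableI_vector by blast
   have "vector_derivative ?x (at t) = J0 (- J0 (v t))" using vector_derivative_at[OF xv[OF t]] by (simp add: J0_minus J0_J0)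
   thus "vector_derivative ?x (at t) \<in> J0 ` normal_cone D (?x t)" using nc[OF t] by blast
  qed
  thus "AE t in lebesgue. ?x differentiable (at t) \<and> vector_derivative ?x (at t) \<in> J0 ` normal_cone D (?x t)"
   using N unfolding eventually_ae_filter negligible_iff_null_sets by (auto intro!: bexI[of _ N])
  assume "\<exists>c. \<forall>t. ?x t = c"
  then obtain c where "?x = (\<lambda>_. c)" by blast
  hence "vector_derivative ?x (at t) = 0" for t by simp
  moreover have "J0 (0::'n pt) = 0" by (simp add: J0_def zero_prod_def)
  ultimately have "action ?x T = 0" by (simp add: action_def)
  thus False using act T m by simp
 qed
qed

lemma normal_cone_bounds:
 assumes y: "n \<in> normal_cone D y"
 shows "n \<bullet> u <= (n \<bullet> (y - p0)) * gau body u" "n ~= 0 ==> n \<bullet> (y - p0) > 0"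
  "n ~= 0 ==> (1 / (n \<bullet> (y - p0))) *\<^sub>R n \<in> dual body"
proof -
 have "n \<bullet> d <= n \<bullet> (y - p0)" if "d \<in> body" for d
 proof -
  have "d + p0 \<in> D" using that by (simp only: body_iff)
  hence "(d + p0 - y) \<bullet> n <= 0" using y unfolding normal_cone_def by blast
  thus ?thesis by (simp add: inner_diff_left inner_diff_right inner_add_left inner_add_right inner_commute[of _ n])
 qed
 from normal_vector[OF this] show "n \<bullet> u <= (n \<bullet> (y - p0)) * gau body u" "n ~= 0 ==> n \<bullet> (y - p0) > 0"
  "n ~= 0 ==> (1 / (n \<bullet> (y - p0))) *\<^sub>R n \<in> dual body" by blast+
qed

lemma char_loop_of_characteristic:
 assumes "gen_brake_char \<tau> D y S" "action y S > 0"
 shows "\<exists>C z. char_loop \<tau> (gau body) (action y S) C z"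
proof -
 obtain K where K: "K > 0" "!!v. v \<in> dual body ==> norm v <= K" using dual_bound by blast
 have nK: "norm n <= K * (n \<bullet> (y - p0))" if n: "n \<in> normal_cone D y" for n y
 proof (cases "n = 0")
  case False
  note b = normal_cone_bounds[OF n]
  have "norm ((1 / (n \<bullet> (y - p0))) *\<^sub>R n) <= K" by (rule K(2)[OF b(3)[OF False]])
  hence "norm n / (n \<bullet> (y - p0)) <= K" using b(2)[OF False] by simp
  thus ?thesis using b(2)[OF False] by (simp add: pos_divide_le_eq)
 qed simp
 obtain z C where "char_loop \<tau> (gau body) (action y S) C z"
  by (rule gen_brake_char_reparametrization[OF \<tau> assms(1) p0fix p0D assms(2), of "gau body" K])
   (use normal_cone_bounds(1) nK K(1) in \<open>auto intro: less_imp_le\<close>)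
 thus ?thesis by blast
qed

end

text \<open>One characteristic produces a char loop relative to each symmetric point, with the same
  action, as the upper bound demands.\<close>

lemma (in symmetric_domain) capacity_le_action:
 assumes "gen_brake_char \<tau> D y S" "action y S > 0"
 shows "c_HZ_tau \<tau> D <= ereal (action y S)"
proof (rule capacity_le_of_char_loop[OF assms(2)])
 fix p0 assume "p0 \<in> D" "\<tau> p0 = p0"
 then interpret pointed_domain \<tau> D p0 by unfold_locales
 show "\<exists>C z. char_loop \<tau> (gau ((\<lambda>u. u - p0) ` D)) (action y S) C z" by (rule char_loop_of_characteristic[OF assms])
qed

lemma (in pointed_domain) minimal_loop:
 obtains z m C M where "0 < m" "c_HZ_tau \<tau> D = ereal (m / 2)" "char_loop \<tau> (gau body) (m / 2) C z" "!!t. gau body (z t) = 1"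
  "!!s t. norm (z s - z t) <= M * \<bar>s - t\<bar>" "gen_brake_char \<tau> D (\<lambda>t. z t + p0) 1" "action (\<lambda>t. z t + p0) 1 = m / 2"
proof -
 obtain c where c: "c >= 0" "c_HZ_tau \<tau> D = ereal c" by (rule capacity_finite)
 obtain z m C M where z: "0 < m" "m <= 2 * c" "char_loop \<tau> (gau body) (m / 2) C z" "!!t. gau body (z t) = 1"
  "!!s t. norm (z s - z t) <= M * \<bar>s - t\<bar>"
  by (rule limit_characteristic[OF c(2,1)]) (rule that; assumption)
 have per: "z (t + 1) = z t" for t using z(3) by (simp add: char_loop_def)
 note g = generalized_characteristic_of_loop[OF z(3,4,1,5) zero_less_one per]
 have "c_HZ_tau \<tau> D <= ereal (m / 2)" using capacity_le_action[OF g(1)] g(2) z(1) by simp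
 hence "c_HZ_tau \<tau> D = ereal (m / 2)" using c z(2) by simp
 thus ?thesis using that[of m C z M] z g by simp
qed

section \<open>Boundaries of class C11\<close>

text \<open>The times of agreement form a clopen set. Only Lipschitz continuity on S is available,
  which suffices because both curves run in S: on a short interval the maximal distance is at most
  half of itself.\<close>

lemma ode_unique:
 fixes x y :: "real => 'a::real_normed_vector"
 assumes x: "!!t. (x has_vector_derivative F (x t)) (at t)" "!!t. x t \<in> S"
  and y: "!!t. (y has_vector_derivative F (y t)) (at t)" "!!t. y t \<in> S"
  and F: "!!p. p \<in> S ==> \<exists>r>0. \<exists>M. \<forall>q\<in>S \<inter> ball p r. \<forall>q'\<in>S \<inter> ball p r. norm (F q - F q') <= M * norm (q - q')"
  and eq: "x t0 = y t0"
 shows "x t = y t"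
proof -
 let ?S = "{t. x t = y t}"
 have c: "continuous_on UNIV x" "continuous_on UNIV y"
  using x(1) y(1) by (auto intro!: continuous_at_imp_continuous_on has_vector_derivative_continuous)
 have "closed ?S" using closed_Collect_eq[OF c] .
 moreover have "open ?S"
 proof (subst open_contains_ball, intro ballI)
  fix s assume "s \<in> ?S"
  hence s: "x s = y s" by simp
  obtain r M where r: "r > 0" and M: "!!q q'. [|q \<in> S; q \<in> ball (x s) r; q' \<in> S; q' \<in> ball (x s) r|] ==> norm (F q - F q') <= M * norm (q - q')"
   using F[OF x(2)[of s]] by blast
  have "open (x -` ball (x s) r \<inter> y -` ball (x s) r)" using c by (intro open_Int open_vimage) (auto simp: continuous_on_eq_continuous_at)
  moreover have "s \<in> x -` ball (x s) r \<inter> y -` ball (x s) r" using r s by simp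
  ultimately obtain e where e: "e > 0" "cball s e \<subseteq> x -` ball (x s) r \<inter> y -` ball (x s) r" using open_contains_cball by blast
  \<comment> \<open>Short enough that |M| d <= 1/2.\<close>
  define d where "d = min e (1 / (2 * (\<bar>M\<bar> + 1)))"
  have d: "d > 0" "d <= e" "\<bar>M\<bar> * d <= 1/2"
  proof -
   show "d > 0" using e by (simp add: d_def)
   show "d <= e" by (simp add: d_def)
   have "\<bar>M\<bar> * d <= (\<bar>M\<bar> + 1) * (1 / (2 * (\<bar>M\<bar> + 1)))" using e by (intro mult_mono) (auto simp: d_def)
   also have "... = 1/2" by (simp add: field_simps)
   finally show "\<bar>M\<bar> * d <= 1/2" .
  qed
  let ?I = "cball s d" and ?u = "\<lambda>t. x t - y t"
  have cu: "continuous_on ?I (\<lambda>t. norm (?u t))" by (intro continuous_intros continuous_on_subset[OF c(1)] continuous_on_subset[OF c(2)]) auto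
  obtain t1 where t1: "t1 \<in> ?I" "!!t. t \<in> ?I ==> norm (?u t) <= norm (?u t1)"
   using continuous_attains_sup[OF compact_cball _ cu] d(1) by auto
  define m where "m = norm (?u t1)"
  have "norm (?u t1 - ?u s) <= (\<bar>M\<bar> * m) * norm (t1 - s)"
  proof (rule differentiable_bound[of ?I])
   fix t assume t: "t \<in> ?I"
   show "(?u has_derivative (\<lambda>h. h *\<^sub>R (F (x t) - F (y t)))) (at t within ?I)"
    using has_derivative_at_withinI[OF has_vector_derivative_diff[OF x(1)[of t] y(1)[of t], unfolded has_vector_derivative_def]] .
   have te: "t \<in> cball s e" using t d(2) by simp
   have "norm (F (x t) - F (y t)) <= M * norm (?u t)" using e(2) te x(2) y(2) by (intro M) auto
   also have "... <= \<bar>M\<bar> * m" using t1(2)[OF t] by (intro mult_mono) (auto simp: m_def)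
   finally have "norm (F (x t) - F (y t)) <= \<bar>M\<bar> * m" .
   thus "onorm (\<lambda>h. h *\<^sub>R (F (x t) - F (y t))) <= \<bar>M\<bar> * m" 
    by (intro onorm_le) (simp add: mult.commute mult_left_mono)
  qed (use t1 d in auto)
  also have "... <= (\<bar>M\<bar> * m) * d" using t1(1) by (intro mult_left_mono) (auto simp: m_def dist_norm norm_minus_commute)
  also have "... = (\<bar>M\<bar> * d) * m" by simp
  also have "... <= (1/2) * m" using d(3) by (intro mult_right_mono) (auto simp: m_def)
  finally have "m <= (1/2) * m" using s by (simp add: m_def)
  hence "m <= 0" by simp
  have "ball s d \<subseteq> ?S"
  proof
   fix t assume "t \<in> ball s d"
   hence "norm (?u t) <= 0" using t1(2)[of t] \<open>m <= 0\<close> by (simp add: m_def)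
   thus "t \<in> ?S" by simp
  qed
  thus "\<exists>e>0. ball s e \<subseteq> ?S" using d(1) by blast
 qed
 ultimately have "?S = UNIV \<or> ?S = {}" by (metis clopen)
 moreover have "t0 \<in> ?S" using eq by simp
 ultimately have "t \<in> ?S" by (metis UNIV_I empty_iff)
 thus ?thesis by simp
qed

lemma C11_chart:
 fixes S :: "'n::finite pt set"
 assumes "C11_hypersurface S" "p \<in> S"
 obtains V g G L where "open V" "p \<in> V" "L >= 0" "!!q. q \<in> V ==> (g has_derivative (\<lambda>v. G q \<bullet> v)) (at q)" "!!q. q \<in> V ==> G q ~= 0"
  "!!q r. q \<in> V ==> r \<in> V ==> norm (G q - G r) <= L * norm (q - r)" "!!q. q \<in> V ==> q \<in> S \<longleftrightarrow> g q = (0::real)"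
proof -
 obtain V g L where V: "open V" "p \<in> V" and g: "\<forall>q\<in>V. g differentiable (at q) \<and> frechet_derivative g (at q) ~= (\<lambda>_. 0)"
  and L: "\<forall>q\<in>V. \<forall>r\<in>V. \<forall>v. \<bar>frechet_derivative g (at q) v - frechet_derivative g (at r) v\<bar> <= L * norm (q - r) * norm v"
  and S: "S \<inter> V = {q\<in>V. g q = (0::real)}" 
  using bspec[OF assms(1)[unfolded C11_hypersurface_def] assms(2)] by (elim exE conjE) (rule that; assumption)
 define G where "G q = (\<Sum>b\<in>Basis. frechet_derivative g (at q) b *\<^sub>R b)" for q
 have dg: "frechet_derivative g (at q) = (\<lambda>v. G q \<bullet> v)" if "q \<in> V" for q
 proof
  fix v
  have l: "linear (frechet_derivative g (at q))" using g that linear_frechet_derivative by blast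
  have "frechet_derivative g (at q) v = frechet_derivative g (at q) (\<Sum>b\<in>Basis. (v \<bullet> b) *\<^sub>R b)" by (simp add: euclidean_representation)
  also have "... = (\<Sum>b\<in>Basis. (v \<bullet> b) * frechet_derivative g (at q) b)" by (simp add: linear_sum[OF l] linear_scale[OF l] o_def)
  also have "... = G q \<bullet> v" by (simp add: G_def inner_sum_left inner_commute[of v] mult.commute)
  finally show "frechet_derivative g (at q) v = G q \<bullet> v" .
 qed
 show ?thesis
 proof (rule that[of V "\<bar>L\<bar>" g G])
  fix q assume q: "q \<in> V"
  show "(g has_derivative (\<lambda>v. G q \<bullet> v)) (at q)" using g q frechet_derivative_works dg[OF q] by metis
  show "G q ~= 0" using g q dg[OF q] by auto
  show "q \<in> S \<longleftrightarrow> g q = 0" using S q by blast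
  fix r assume r: "r \<in> V"
  define w where "w = G q - G r"
  have "w \<bullet> w <= L * norm (q - r) * norm w"
   using L[rule_format, OF q r, of w] dg[OF q] dg[OF r] by (simp add: w_def inner_diff_left)
  also have "... <= \<bar>L\<bar> * norm (q - r) * norm w" by (intro mult_right_mono) auto
  finally have "norm w * norm w <= (\<bar>L\<bar> * norm (q - r)) * norm w" by (simp add: power2_norm_eq_inner[symmetric] power2_eq_square)
  thus "norm (G q - G r) <= \<bar>L\<bar> * norm (q - r)" unfolding w_def[symmetric] by (cases "w = 0") auto
 qed (use V in auto)
qed

text \<open>Every vector in the kernel of the gradient is the velocity of a curve \<open>q + t v + s(t) e\<close> in the zero set, where \<open>G \<bullet> e = 1\<close>
  and the correction \<open>s(t) = O(t\<^sup>2)\<close> comes from the intermediate value theorem.\<close>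

lemma level_set_curve:
 fixes g :: "'a::euclidean_space => real"
 assumes V: "open V" "q \<in> V" and L: "L >= 0" and g: "!!q. q \<in> V ==> (g has_derivative (\<lambda>v. G q \<bullet> v)) (at q)" and G: "G q ~= 0"
  and lip: "!!q r. q \<in> V ==> r \<in> V ==> norm (G q - G r) <= L * norm (q - r)" and gq: "g q = 0" and v: "G q \<bullet> v = 0"
 obtains b where "b 0 = q" "\<forall>\<^sub>F t in nhds 0. b t \<in> V \<and> g (b t) = 0" "(b has_vector_derivative v) (at (0::real))"
proof -
 obtain a where a: "a > 0" "ball q a \<subseteq> V" using V open_contains_ball by blast
 have inV: "q + w \<in> V" if "norm w < a" for w by (rule subsetD[OF a(2)]) (use that in \<open>simp add: dist_norm\<close>)
 have rem: "\<bar>g (q + w) - G q \<bullet> w\<bar> <= L * (norm w)^2" if w: "norm w < a" for w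
 proof -
  have seg: "closed_segment q (q + w) \<subseteq> ball q a" using w a by (intro closed_segment_subset) (auto simp: dist_norm)
  have nq: "norm (x - q) <= norm w" if "x \<in> closed_segment q (q + w)" for x
   using segment_bound(1)[OF that] by simp
  have "norm (g (q + w) - g q - G q \<bullet> (q + w - q)) <= norm (q + w - q) * (L * norm w)"
  proof (rule differentiable_bound_linearization[where S = "closed_segment q (q + w)" and f' = "\<lambda>x v. G x \<bullet> v"])
   show "q + t *\<^sub>R (q + w - q) \<in> closed_segment q (q + w)" if "t \<in> {0..1}" for t
    using that by (auto simp: closed_segment_def intro!: exI[of _ t] simp: algebra_simps)
   fix x assume x: "x \<in> closed_segment q (q + w)"
   hence xV: "x \<in> V" using seg a by blast
   show "(g has_derivative (\<lambda>v. G x \<bullet> v)) (at x within closed_segment q (q + w))" by (rule has_derivative_at_withinI[OF g[OF xV]])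
   have "norm (G x - G q) <= L * norm w" using lip[OF xV V(2)] mult_left_mono[OF nq[OF x] L] by linarith
   hence "norm ((G x - G q) \<bullet> v) <= (L * norm w) * norm v" for v
    using order_trans[OF Cauchy_Schwarz_ineq2 mult_right_mono] by auto
   thus "onorm ((\<lambda>v. G x \<bullet> v) - (\<lambda>v. G q \<bullet> v)) <= L * norm w" by (intro onorm_le) (simp add: inner_diff_left)
  qed auto
  thus ?thesis by (simp add: gq power2_eq_square mult_ac)
 qed
 \<comment> \<open>A direction transversal to the level set, scaled so that g changes at unit rate
   along it.\<close>
 define e where "e = (1 / (G q \<bullet> G q)) *\<^sub>R G q"
 have Ge: "G q \<bullet> e = 1" using G by (simp add: e_def)
 define M where "M = L * (norm v + 1)^2"
 have M: "M >= 0" using L by (simp add: M_def)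
 \<comment> \<open>The second entry gives |s| |e| <= |t| for |s| <= M t^2, whence |t v + s e| <= |t|
   (|v| + 1); the first then keeps the point in the ball of radius a.\<close>
 define t0 where "t0 = min (a / (2 * (norm v + 1))) (1 / (M * norm e + 1))"
 have v1: "norm v + 1 > 0" and M1: "M * norm e + 1 > 0" using M by (auto intro: add_nonneg_pos)
 have t0: "t0 > 0" using a v1 M1 by (auto simp: t0_def)
 have wb: "norm (t *\<^sub>R v + s *\<^sub>R e) <= \<bar>t\<bar> * (norm v + 1)" "norm (t *\<^sub>R v + s *\<^sub>R e) < a"
  if t: "\<bar>t\<bar> < t0" and s: "\<bar>s\<bar> <= M * t^2" for t s
 proof -
  have "\<bar>t\<bar> < 1 / (M * norm e + 1)" using t by (simp add: t0_def)
  hence "\<bar>t\<bar> * (M * norm e + 1) < 1" by (simp only: pos_less_divide_eq[OF M1])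
  hence Me: "\<bar>t\<bar> * (M * norm e) <= 1" by (simp add: distrib_left)
  have "\<bar>s\<bar> * norm e <= (M * t^2) * norm e" using s by (intro mult_right_mono) auto
  also have "... = \<bar>t\<bar> * (\<bar>t\<bar> * (M * norm e))" 
  proof -
   have t2: "t^2 = \<bar>t\<bar> * \<bar>t\<bar>" by (simp add: power2_eq_square)
   show ?thesis unfolding t2 by (simp only: mult_ac)
  qed
  also have "... <= \<bar>t\<bar> * 1" using Me by (intro mult_left_mono) auto
  finally have "\<bar>s\<bar> * norm e <= \<bar>t\<bar>" by simp
  thus 1: "norm (t *\<^sub>R v + s *\<^sub>R e) <= \<bar>t\<bar> * (norm v + 1)"
   using norm_triangle_ineq[of "t *\<^sub>R v" "s *\<^sub>R e"] by (simp add: distrib_left)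
  have "\<bar>t\<bar> * (norm v + 1) < a / (2 * (norm v + 1)) * (norm v + 1)" using t v1 by (intro mult_strict_right_mono) (auto simp: t0_def)
  also have "... <= a"
  proof -
   have "a / (2 * y) * y <= a" if "y > 0" for y using that a(1) by simp
   thus ?thesis using v1 by blast
  qed
  finally show "norm (t *\<^sub>R v + s *\<^sub>R e) < a" using 1 by linarith
 qed
 have val: "\<bar>g (q + (t *\<^sub>R v + s *\<^sub>R e)) - s\<bar> <= M * t^2" if t: "\<bar>t\<bar> < t0" and s: "\<bar>s\<bar> <= M * t^2" for t s
 proof -
  have "\<bar>g (q + (t *\<^sub>R v + s *\<^sub>R e)) - G q \<bullet> (t *\<^sub>R v + s *\<^sub>R e)\<bar> <= L * (norm (t *\<^sub>R v + s *\<^sub>R e))^2"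
   by (rule rem[OF wb(2)[OF that]])
  also have "... <= L * (\<bar>t\<bar> * (norm v + 1))^2" using wb(1)[OF that] L by (intro mult_left_mono power_mono) auto
  also have "... = M * t^2" by (simp add: M_def power_mult_distrib)
  finally show ?thesis by (simp add: inner_add_right v Ge)
 qed
 have "\<exists>s. \<bar>s\<bar> <= M * t^2 \<and> g (q + (t *\<^sub>R v + s *\<^sub>R e)) = 0" if t: "\<bar>t\<bar> < t0" for t
 proof -
  let ?f = "\<lambda>s. g (q + (t *\<^sub>R v + s *\<^sub>R e))"
  have Mt: "M * t^2 >= 0" using M by simp
  have "\<exists>s\<ge>- (M * t^2). s <= M * t^2 \<and> ?f s = 0"
  proof (rule IVT')
   show "?f (- (M * t^2)) <= 0" using val[OF t, of "- (M * t^2)"] Mt by (simp add: abs_le_iff)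
   show "0 <= ?f (M * t^2)" using val[OF t, of "M * t^2"] Mt by (simp add: abs_le_iff)
   have cg: "continuous_on V g" using g has_derivative_continuous by (intro continuous_at_imp_continuous_on) blast
   show "continuous_on {- (M * t^2)..M * t^2} ?f"
   proof (rule continuous_on_compose2[OF cg])
    show "(\<lambda>s. q + (t *\<^sub>R v + s *\<^sub>R e)) ` {- (M * t^2)..M * t^2} \<subseteq> V"
    proof (rule image_subsetI)
     fix s assume "s \<in> {- (M * t^2)..M * t^2}"
     hence "norm (t *\<^sub>R v + s *\<^sub>R e) < a" by (intro wb(2)[OF t]) auto
     thus "q + (t *\<^sub>R v + s *\<^sub>R e) \<in> V" by (rule inV)
    qed
   qed (intro continuous_intros)
  qed (use Mt in simp)
  then obtain s where "- (M * t^2) <= s" "s <= M * t^2" "?f s = 0" by blast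
  thus ?thesis by (intro exI[of _ s]) auto
 qed
 then obtain s where s: "!!t. \<bar>t\<bar> < t0 ==> \<bar>s t\<bar> <= M * t^2 \<and> g (q + (t *\<^sub>R v + s t *\<^sub>R e)) = 0" by metis
 define b where "b t = q + (t *\<^sub>R v + s t *\<^sub>R e)" for t
 have s0: "s 0 = 0" using s[of 0] t0 by simp
 show ?thesis
 proof (rule that[of b])
  show "b 0 = q" by (simp add: b_def s0)
  have "b t \<in> V \<and> g (b t) = 0" if "dist t 0 < t0" for t
  proof
   have t: "\<bar>t\<bar> < t0" using that by simp
   show "g (b t) = 0" using s[OF t] by (simp add: b_def)
   have "norm (t *\<^sub>R v + s t *\<^sub>R e) < a" using s[OF t] by (intro wb(2)[OF t]) auto
   thus "b t \<in> V" unfolding b_def by (rule inV)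
  qed
  thus "\<forall>\<^sub>F t in nhds 0. b t \<in> V \<and> g (b t) = 0" unfolding eventually_nhds_metric using t0 by blast
  have "((\<lambda>t. s t / t) \<longlongrightarrow> 0) (at 0)"
  proof (rule Lim_null_comparison)
   have "norm (s t / t) <= M * \<bar>t\<bar>" if "\<bar>t\<bar> < t0" "t ~= 0" for t
   proof -
    have "\<bar>s t\<bar> <= M * (\<bar>t\<bar> * \<bar>t\<bar>)" using s[OF that(1)] by (simp add: power2_eq_square)
    thus ?thesis using that(2) by (simp add: pos_divide_le_eq mult.assoc)
   qed
   thus "\<forall>\<^sub>F t in at 0. norm (s t / t) <= M * \<bar>t\<bar>" using t0 unfolding eventually_at by (intro exI[of _ t0]) (auto simp: dist_norm)
   show "((\<lambda>t. M * \<bar>t\<bar>) \<longlongrightarrow> 0) (at 0)" by (auto intro!: tendsto_eq_intros)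
  qed
  hence "(s has_real_derivative 0) (at 0)" by (simp add: has_field_derivative_iff s0)
  hence ds: "(s has_vector_derivative 0) (at 0)" by (simp add: has_real_derivative_iff_has_vector_derivative)
  have "((\<lambda>t. s t *\<^sub>R e) has_vector_derivative 0) (at 0)"
   using bounded_linear.has_vector_derivative[OF bounded_linear_scaleR_left ds, of e] by simp
  moreover have "((\<lambda>t. t *\<^sub>R v) has_vector_derivative v) (at 0)" by (auto intro!: derivative_eq_intros)
  ultimately have "((\<lambda>t. t *\<^sub>R v + s t *\<^sub>R e) has_vector_derivative (v + 0)) (at 0)" by (intro has_vector_derivative_add)
  thus "(b has_vector_derivative v) (at 0)" unfolding b_def[abs_def] by (auto intro: derivative_eq_intros)
 qed
qed

section \<open>Normals and characteristic lines of the boundary\<close>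

context pointed_domain
begin

lemma normal_exists: assumes p: "p \<in> frontier D" obtains n where "n \<in> normal_cone D p" "n \<bullet> (p - p0) = 1"
proof -
 have "p \<notin> D" using p D(1) by (simp add: frontier_def interior_open)
 hence "{p} \<inter> D = {}" "{p} ~= {}" "convex {p}" by auto
 then obtain a b where ab: "a ~= 0" "\<forall>x\<in>{p}. a \<bullet> x <= b" "\<forall>x\<in>D. a \<bullet> x >= b"
  using separating_hyperplane_sets[of "{p}" D] D by metis
 have nc: "- a \<in> normal_cone D p" unfolding normal_cone_def
 proof (rule CollectI, rule ballI)
  fix u assume "u \<in> D"
  hence "a \<bullet> p <= a \<bullet> u" using ab(2,3) by (meson insertI1 order_trans)
  thus "(u - p) \<bullet> - a <= 0" by (simp add: inner_diff_left inner_diff_right inner_commute[of _ a])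
 qed
 have pos: "- a \<bullet> (p - p0) > 0" using normal_cone_bounds(2)[OF nc] ab(1) by simp
 show ?thesis
 proof (rule that[of "(1 / (- a \<bullet> (p - p0))) *\<^sub>R (- a)"])
  have "c *\<^sub>R n \<in> normal_cone D p" if "c >= 0" "n \<in> normal_cone D p" for c n
   using that by (auto simp: normal_cone_def mult_nonneg_nonpos)
  thus "(1 / (- a \<bullet> (p - p0))) *\<^sub>R (- a) \<in> normal_cone D p" using pos nc by (metis less_imp_le zero_le_divide_1_iff)
 qed (use pos in auto)
qed

text \<open>The normalisation by pairing with p - p0 matches the action parametrisation: the minimal
  loop satisfies x' = m J (nrm x). Under the C11 assumption \<open>normal_cone_ray\<close> makes the
  choice unique.\<close>

definition nrm :: "'n pt => 'n pt" where
 "nrm p = (SOME n. n \<in> normal_cone D p \<and> n \<bullet> (p - p0) = 1)"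

lemma nrm: assumes "p \<in> frontier D" shows "nrm p \<in> normal_cone D p" "nrm p \<bullet> (p - p0) = 1"
proof -
 have "\<exists>n. n \<in> normal_cone D p \<and> n \<bullet> (p - p0) = 1" using normal_exists[OF assms] by blast
 from someI_ex[OF this] show "nrm p \<in> normal_cone D p" "nrm p \<bullet> (p - p0) = 1" by (simp_all add: nrm_def)
qed

lemma nrm_nonzero: "p \<in> frontier D ==> nrm p ~= 0" using nrm(2)[of p] by auto

text \<open>A normal, as a linear function, is maximal over the closure at p, so its derivative
  along any curve in the boundary through p vanishes.\<close>

lemma normal_cone_tangent_space:
 assumes p: "p \<in> frontier D" and n: "n \<in> normal_cone D p" and v: "v \<in> tangent_space (frontier D) p"
 shows "n \<bullet> v = 0"
proof -
 obtain g where g: "g 0 = p" "\<forall>\<^sub>F t in nhds 0. g t \<in> frontier D" "(g has_vector_derivative v) (at (0::real))"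
  using v unfolding tangent_space_def by blast
 have le: "n \<bullet> u <= n \<bullet> p" if "u \<in> closure D" for u
 proof -
  have "D \<subseteq> {u. n \<bullet> u <= n \<bullet> p}" using n by (auto simp: normal_cone_def inner_diff_left inner_commute[of _ n])
  hence "closure D \<subseteq> {u. n \<bullet> u <= n \<bullet> p}" by (rule closure_minimal) (rule closed_halfspace_le)
  thus ?thesis using that by blast
 qed
 have d: "((\<lambda>t. n \<bullet> g t) has_real_derivative n \<bullet> v) (at 0)"
  using bounded_linear.has_vector_derivative[OF bounded_linear_inner_right g(3), of n] by (simp add: has_real_derivative_iff_has_vector_derivative)
 obtain e where e: "e > 0" "!!t. dist t 0 < e ==> g t \<in> frontier D" using g(2) unfolding eventually_nhds_metric by blast
 show ?thesis
 proof (rule DERIV_local_max[OF d e(1)], intro allI impI)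
  fix t :: real assume "\<bar>0 - t\<bar> < e"
  hence "g t \<in> closure D" using e(2)[of t] by (simp add: frontier_def)
  thus "n \<bullet> g t <= n \<bullet> g 0" unfolding g(1) by (rule le)
 qed
qed

context
 assumes C11: "C11_hypersurface (frontier D)"
begin

text \<open>By \<open>level_set_curve\<close> every vector orthogonal to the gradient G is tangent.
  A normal annihilates tangent vectors, so its component orthogonal to G is zero.\<close>

lemma chart_normal:
 assumes p: "p \<in> frontier D"
 obtains V G L where "open V" "p \<in> V" "L >= 0" "!!q r. q \<in> V ==> r \<in> V ==> norm (G q - G r) <= L * norm (q - r)"
  "!!q n. [|q \<in> V; q \<in> frontier D; n \<in> normal_cone D q|] ==> n = ((n \<bullet> G q) / (G q \<bullet> G q)) *\<^sub>R G q"
  "!!q v. [|q \<in> V; q \<in> frontier D; G q \<bullet> v = 0|] ==> v \<in> tangent_space (frontier D) q"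
  "!!q. q \<in> V ==> G q ~= 0"
proof -
 obtain V g G L where V: "open V" "p \<in> V" and L: "L >= 0" and g: "!!q. q \<in> V ==> (g has_derivative (\<lambda>v. G q \<bullet> v)) (at q)"
  and G: "!!q. q \<in> V ==> G q ~= 0" and lip: "!!q r. q \<in> V ==> r \<in> V ==> norm (G q - G r) <= L * norm (q - r)"
  and S: "!!q. q \<in> V ==> q \<in> frontier D \<longleftrightarrow> g q = (0::real)"
  by (rule C11_chart[OF C11 p]) (rule that; assumption)
 have tan: "v \<in> tangent_space (frontier D) q" if q: "q \<in> V" "q \<in> frontier D" and v: "G q \<bullet> v = 0" for q v
 proof -
  have gq: "g q = 0" using q S by blast
  obtain y where y: "y 0 = q" "\<forall>\<^sub>F t in nhds 0. y t \<in> V \<and> g (y t) = 0" "(y has_vector_derivative v) (at (0::real))"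
   by (rule level_set_curve[OF V(1) q(1) L g G[OF q(1)] lip gq v]) (assumption | rule that; assumption)+
  have "\<forall>\<^sub>F t in nhds 0. y t \<in> frontier D" using y(2) by eventually_elim (use S in blast)
  thus ?thesis unfolding tangent_space_def using y by blast
 qed
 show ?thesis
 proof (rule that[of V L G])
  fix q n assume q: "q \<in> V" "q \<in> frontier D" and n: "n \<in> normal_cone D q"
  define \<mu> where "\<mu> = (n \<bullet> G q) / (G q \<bullet> G q)"
  define v where "v = n - \<mu> *\<^sub>R G q"
  have Gv: "G q \<bullet> v = 0" using G[OF q(1)] by (simp add: v_def \<mu>_def inner_diff_right inner_commute)
  have "n \<bullet> v = 0" by (rule normal_cone_tangent_space[OF q(2) n tan[OF q Gv]])
  hence "v \<bullet> v = 0" using Gv by (simp add: v_def inner_diff_left)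
  thus "n = ((n \<bullet> G q) / (G q \<bullet> G q)) *\<^sub>R G q" by (simp add: v_def \<mu>_def)
 qed (use V L lip tan G in auto)
qed

lemma normal_cone_ray: assumes p: "p \<in> frontier D" and n: "n \<in> normal_cone D p" shows "n = (n \<bullet> (p - p0)) *\<^sub>R nrm p"
proof -
 obtain V G L where V: "p \<in> V" and nc: "!!q n. [|q \<in> V; q \<in> frontier D; n \<in> normal_cone D q|] ==> n = ((n \<bullet> G q) / (G q \<bullet> G q)) *\<^sub>R G q"
  by (rule chart_normal[OF p]) (rule that; assumption)
 obtain a where a: "nrm p = a *\<^sub>R G p" using nc[OF V p nrm(1)[OF p]] by blast
 obtain b where b: "n = b *\<^sub>R G p" using nc[OF V p n] by blast
 have 1: "a * (G p \<bullet> (p - p0)) = 1" using nrm(2)[OF p] by (simp add: a)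
 have "(n \<bullet> (p - p0)) *\<^sub>R nrm p = (b * (a * (G p \<bullet> (p - p0)))) *\<^sub>R G p" by (simp add: a b mult_ac)
 thus ?thesis by (simp add: 1 b)
qed

lemma tangent_space_nrm: assumes p: "p \<in> frontier D" shows "tangent_space (frontier D) p = {v. nrm p \<bullet> v = 0}"
proof -
 obtain V G L where V: "p \<in> V" and nc: "!!q n. [|q \<in> V; q \<in> frontier D; n \<in> normal_cone D q|] ==> n = ((n \<bullet> G q) / (G q \<bullet> G q)) *\<^sub>R G q"
  and tan: "!!q v. [|q \<in> V; q \<in> frontier D; G q \<bullet> v = 0|] ==> v \<in> tangent_space (frontier D) q"
  by (rule chart_normal[OF p]) (rule that; assumption)
 obtain a where a: "nrm p = a *\<^sub>R G p" using nc[OF V p nrm(1)[OF p]] by blast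
 have "a ~= 0" using nrm_nonzero[OF p] a by auto
 show ?thesis
 proof (intro equalityI subsetI CollectI)
  fix v assume "v \<in> tangent_space (frontier D) p"
  thus "nrm p \<bullet> v = 0" by (rule normal_cone_tangent_space[OF p nrm(1)[OF p]])
 next
  fix v assume "v \<in> {v. nrm p \<bullet> v = 0}"
  hence "G p \<bullet> v = 0" using a \<open>a ~= 0\<close> by simp
  thus "v \<in> tangent_space (frontier D) p" by (rule tan[OF V p])
 qed
qed

text \<open>The tangent space is the hyperplane orthogonal to \<open>nrm p\<close>, and its
  complement with respect to the form is spanned by \<open>J0 (nrm p)\<close>.\<close>

lemma char_line_nrm: assumes p: "p \<in> frontier D" shows "char_line (frontier D) p = range (\<lambda>\<mu>. \<mu> *\<^sub>R J0 (nrm p))"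
proof (intro equalityI subsetI)
 fix v assume v: "v \<in> char_line (frontier D) p"
 have w0: "J0 v \<bullet> w = 0" if "nrm p \<bullet> w = 0" for w
  using v that unfolding char_line_def tangent_space_nrm[OF p] omega0_eq by blast
 have nn: "nrm p \<bullet> nrm p ~= 0" using nrm_nonzero[OF p] by simp
 define \<mu> where "\<mu> = (J0 v \<bullet> nrm p) / (nrm p \<bullet> nrm p)"
 define w where "w = J0 v - \<mu> *\<^sub>R nrm p"
 have nw: "nrm p \<bullet> w = 0" using nn by (simp add: w_def \<mu>_def inner_diff_right inner_commute)
 have "w \<bullet> w = 0" using w0[OF nw] nw by (subst w_def) (simp add: inner_diff_left)
 hence "J0 v = \<mu> *\<^sub>R nrm p" by (simp add: w_def)
 hence "J0 (J0 v) = \<mu> *\<^sub>R J0 (nrm p)" by (simp add: J0_scaleR)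
 hence "v = (- \<mu>) *\<^sub>R J0 (nrm p)" by (simp add: J0_J0) (metis minus_minus)
 thus "v \<in> range (\<lambda>\<mu>. \<mu> *\<^sub>R J0 (nrm p))" by blast
next
 fix v assume "v \<in> range (\<lambda>\<mu>. \<mu> *\<^sub>R J0 (nrm p))"
 then obtain \<mu> where v: "v = \<mu> *\<^sub>R J0 (nrm p)" by blast
 have "nrm p \<bullet> v = 0" by (simp add: v inner_J0_self inner_commute)
 moreover have "omega0 v w = 0" if "nrm p \<bullet> w = 0" for w using that by (simp add: v omega0_eq J0_scaleR J0_J0)
 ultimately show "v \<in> char_line (frontier D) p" unfolding char_line_def tangent_space_nrm[OF p] by blast
qed

text \<open>In a chart \<open>nrm q\<close> is G q / d q with d q = <G q, q - p0>. Both are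
  Lipschitz and d does not vanish on the boundary, so it is bounded away from 0 near p.\<close>

lemma nrm_locally_lipschitz:
 assumes p: "p \<in> frontier D"
 shows "\<exists>r>0. \<exists>M. \<forall>q\<in>frontier D \<inter> ball p r. \<forall>q'\<in>frontier D \<inter> ball p r. norm (nrm q - nrm q') <= M * norm (q - q')"
proof -
 obtain V G L where V: "open V" "p \<in> V" and L: "L >= 0" and lip: "!!q r. q \<in> V ==> r \<in> V ==> norm (G q - G r) <= L * norm (q - r)"
  and nc: "!!q n. [|q \<in> V; q \<in> frontier D; n \<in> normal_cone D q|] ==> n = ((n \<bullet> G q) / (G q \<bullet> G q)) *\<^sub>R G q"
  by (rule chart_normal[OF p]) (rule that; assumption)
 obtain K where K: "K > 0" "!!v. v \<in> dual body ==> norm v <= K" using dual_bound by blast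
 obtain c where c: "c > 0" "ball p c \<subseteq> V" using V open_contains_ball by blast
 define d where "d q = G q \<bullet> (q - p0)" for q
 have nd: "nrm q = (1 / d q) *\<^sub>R G q" "d q ~= 0" if q: "q \<in> V" "q \<in> frontier D" for q
 proof -
  obtain a where a: "nrm q = a *\<^sub>R G q" using nc[OF q nrm(1)[OF q(2)]] by blast
  have ad: "a * d q = 1" using nrm(2)[OF q(2)] by (simp add: a d_def)
  thus "d q ~= 0" by auto
  hence "a = 1 / d q" using ad by (simp add: field_simps)
  thus "nrm q = (1 / d q) *\<^sub>R G q" using a by simp
 qed
 have nK: "norm (nrm q) <= K" if "q \<in> frontier D" for q
  using K(2)[OF normal_cone_bounds(3)[OF nrm(1)[OF that] nrm_nonzero[OF that]]] nrm(2)[OF that] by simp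
 define B where "B = norm (G p) + L * c"
 define R where "R = norm (p - p0) + c"
 have BR: "B >= 0" "R >= 0" using L c by (auto simp: B_def R_def)
 have GB: "norm (G q) <= B" if "q \<in> ball p c" for q
 proof -
  have "norm (G q - G p) <= L * norm (q - p)" using lip that c V by blast
  also have "... <= L * c" using that L by (intro mult_left_mono) (auto simp: dist_norm norm_minus_commute)
  finally show ?thesis using norm_triangle_sub[of "G q" "G p"] by (simp add: B_def)
 qed
 have qR: "norm (q - p0) <= R" if "q \<in> ball p c" for q
  using that norm_triangle_ineq[of "q - p" "p - p0"] by (simp add: R_def dist_norm norm_minus_commute)
 have dl: "\<bar>d q - d q'\<bar> <= (L * R + B) * norm (q - q')" if q: "q \<in> ball p c" "q' \<in> ball p c" for q q'
 proof -
  have "d q - d q' = (G q - G q') \<bullet> (q - p0) + G q' \<bullet> (q - q')" by (simp add: d_def inner_diff_left inner_diff_right)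
  hence "\<bar>d q - d q'\<bar> <= norm (G q - G q') * norm (q - p0) + norm (G q') * norm (q - q')"
   using Cauchy_Schwarz_ineq2[of "G q - G q'" "q - p0"] Cauchy_Schwarz_ineq2[of "G q'" "q - q'"] by linarith
  also have "... <= (L * norm (q - q')) * R + B * norm (q - q')"
  proof (intro add_mono mult_mono)
   show "norm (G q - G q') <= L * norm (q - q')" by (rule lip) (use q c in auto)
  qed (use qR[OF q(1)] GB[OF q(2)] L BR in auto)
  finally show ?thesis by (simp add: algebra_simps)
 qed
 define d0 where "d0 = \<bar>d p\<bar> / 2"
 have d0: "d0 > 0" using nd(2)[OF V(2) p] by (simp add: d0_def)
 define r where "r = min c (d0 / (L * R + B + 1))"
 have LRB: "L * R + B + 1 > 0" using L BR by (simp add: add_nonneg_pos)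
 have r: "r > 0" using c d0 LRB by (simp add: r_def)
 have dlow: "\<bar>d q\<bar> >= d0" if "q \<in> ball p r" for q
 proof -
  have q: "q \<in> ball p c" "norm (q - p) <= d0 / (L * R + B + 1)" using that by (auto simp: r_def dist_norm norm_minus_commute)
  have "\<bar>d q - d p\<bar> <= (L * R + B) * norm (q - p)" using dl[OF q(1), of p] c by simp
  also have "... <= (L * R + B + 1) * (d0 / (L * R + B + 1))" using q(2) L BR d0 LRB by (intro mult_mono) auto
  also have "... = d0" using LRB by simp
  finally show ?thesis unfolding d0_def by linarith
 qed
 define M where "M = (L + K * (L * R + B)) / d0"
 have "norm (nrm q - nrm q') <= M * norm (q - q')" if q: "q \<in> frontier D \<inter> ball p r" "q' \<in> frontier D \<inter> ball p r" for q q'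
 proof -
  have b: "q \<in> ball p c" "q' \<in> ball p c" using q by (auto simp: r_def)
  have v: "q \<in> V" "q' \<in> V" using b c by auto
  have f: "q \<in> frontier D" "q' \<in> frontier D" using q by auto
  have G': "G q' = d q' *\<^sub>R nrm q'" using nd[OF v(2) f(2)] by simp
  have Gq: "G q = d q *\<^sub>R nrm q" using nd[OF v(1) f(1)] by simp
  \<comment> \<open>Avoids the difference of two reciprocals: only |d q| has to be bounded
    below.\<close>
  have "d q *\<^sub>R (nrm q - nrm q') = (G q - G q') + (d q' - d q) *\<^sub>R nrm q'"
   by (simp add: Gq G' scaleR_diff_left scaleR_diff_right)
  hence "norm (d q *\<^sub>R (nrm q - nrm q')) <= norm (G q - G q') + norm ((d q' - d q) *\<^sub>R nrm q')"
   by (metis norm_triangle_ineq)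
  also have "... <= L * norm (q - q') + ((L * R + B) * norm (q - q')) * K"
   using lip[OF v] dl[OF b] nK[OF f(2)] K L BR by (simp only: norm_scaleR, intro add_mono mult_mono) (auto simp: abs_minus_commute)
  finally have "\<bar>d q\<bar> * norm (nrm q - nrm q') <= L * norm (q - q') + ((L * R + B) * norm (q - q')) * K"
   by (simp only: norm_scaleR)
  hence 1: "\<bar>d q\<bar> * norm (nrm q - nrm q') <= (L + K * (L * R + B)) * norm (q - q')" by (simp add: algebra_simps)
  have "d0 * norm (nrm q - nrm q') <= \<bar>d q\<bar> * norm (nrm q - nrm q')" using dlow q by (intro mult_right_mono) auto
  with 1 have "norm (nrm q - nrm q') * d0 <= (L + K * (L * R + B)) * norm (q - q')" by (simp add: mult.commute)
  thus ?thesis using d0 by (simp add: M_def pos_le_divide_eq)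
 qed
 thus ?thesis using r by blast
qed

lemma continuous_nrm: "continuous_on (frontier D) nrm"
proof (rule continuous_onI)
 fix p and e :: real assume p: "p \<in> frontier D" and e: "e > 0"
 obtain r M where r: "r > 0" and M: "!!q q'. [|q \<in> frontier D \<inter> ball p r; q' \<in> frontier D \<inter> ball p r|] ==> norm (nrm q - nrm q') <= M * norm (q - q')"
  using nrm_locally_lipschitz[OF p] by blast
 have M1: "\<bar>M\<bar> + 1 > 0" by simp
 define d where "d = min r (e / (\<bar>M\<bar> + 1))"
 have "d > 0" using r e M1 by (simp add: d_def)
 moreover have "dist (nrm q) (nrm p) <= e" if q: "q \<in> frontier D" "dist q p < d" for q
 proof -
  have qp: "norm (q - p) <= e / (\<bar>M\<bar> + 1)" using q(2) by (simp add: d_def dist_norm)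
  have "norm (nrm q - nrm p) <= M * norm (q - p)" by (rule M) (use q p r in \<open>auto simp: d_def dist_commute\<close>)
  also have "... <= (\<bar>M\<bar> + 1) * (e / (\<bar>M\<bar> + 1))" using qp e M1 by (intro mult_mono) auto
  also have "... = e" using M1 by simp
  finally show ?thesis by (simp add: dist_norm)
 qed
 ultimately show "\<exists>d>0. \<forall>x'\<in>frontier D. dist x' p < d --> dist (nrm x') (nrm p) <= e" by blast
qed

text \<open>The velocity is almost everywhere the continuous function m J (nrm x), so the Lipschitz
  curve is C^1 and solves a uniquely solvable equation. If x s = x t with s < t, uniqueness makes d
  = t - s < 1 a period, and the action d m / 2 of the shortened characteristic would be below the
  capacity.\<close>

lemma smooth_minimal_characteristic:
 "\<exists>x. brake_char \<tau> (frontier D) x 1 \<and> action x 1 > 0 \<and> c_HZ_tau \<tau> D = ereal (action x 1)"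
proof -
 obtain z m C M where m: "0 < m" and cap: "c_HZ_tau \<tau> D = ereal (m / 2)" and z: "char_loop \<tau> (gau body) (m / 2) C z"
  and gz: "!!t. gau body (z t) = 1" and lip: "!!s t. norm (z s - z t) <= M * \<bar>s - t\<bar>"
  and act: "action (\<lambda>t. z t + p0) 1 = m / 2"
  by (rule minimal_loop) (rule that; assumption)
 define x where "x t = z t + p0" for t
 define F where "F q = m *\<^sub>R J0 (nrm q)" for q
 have xf: "x t \<in> frontier D" for t unfolding x_def by (rule frontier_of_loop[OF gz])
 obtain N v where N: "negligible N" and v: "!!t. t \<notin> N ==> (z has_vector_derivative v t) (at t)"
  and nc: "!!t. t \<notin> N ==> - J0 (v t) \<in> normal_cone D (z t + p0)" and nz: "!!t. t \<notin> N ==> (- J0 (v t)) \<bullet> z t = m"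
  and vi: "!!s t. s <= t ==> (v has_integral (z t - z s)) {s..t}"
  by (rule loop_velocity_ae[OF z gz m lip]) (rule that; assumption)
 have vF: "v t = F (x t)" if "t \<notin> N" for t
 proof -
  have "- J0 (v t) = ((- J0 (v t)) \<bullet> (x t - p0)) *\<^sub>R nrm (x t)"
   by (rule normal_cone_ray[OF xf]) (use nc[OF that] in \<open>simp add: x_def\<close>)
  moreover have "x t - p0 = z t" by (simp add: x_def)
  ultimately have "- J0 (v t) = m *\<^sub>R nrm (x t)" using nz[OF that] by (simp only:)
  hence "J0 (- J0 (v t)) = m *\<^sub>R J0 (nrm (x t))" by (simp add: J0_scaleR)
  thus ?thesis by (simp add: F_def J0_minus J0_J0)
 qed
 have "norm (z s - z t) <= \<bar>M\<bar> * \<bar>s - t\<bar>" for s t by (rule order_trans[OF lip mult_right_mono]) auto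
 hence "continuous_on UNIV z" by (intro lipschitz_on_continuous_on[of "\<bar>M\<bar>"] lipschitz_onI) (auto simp: dist_norm)
 hence cx: "continuous_on UNIV x" unfolding x_def[abs_def] by (intro continuous_intros)
 have cF: "continuous_on UNIV (\<lambda>t. F (x t))" unfolding F_def
  by (intro continuous_intros bounded_linear.continuous_on[OF bounded_linear_J0] continuous_on_compose2[OF continuous_nrm cx]) (use xf in auto)
 obtain P where P: "!!t. (P has_vector_derivative F (x t)) (at t)" using continuous_antiderivative_UNIV[OF cF] by blast
 \<comment> \<open>The almost everywhere velocity and its continuous version have the same
   integrals, so x is a C^1 primitive.\<close>
 have zP: "z t - z s = P t - P s" if "s <= t" for s t
 proof (rule has_integral_unique)
  show "((\<lambda>t. F (x t)) has_integral (z t - z s)) {s..t}" by (rule has_integral_spike[OF N _ vi[OF that]]) (use vF in auto)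
  show "((\<lambda>t. F (x t)) has_integral (P t - P s)) {s..t}"
   by (rule fundamental_theorem_of_calculus[OF that]) (rule has_vector_derivative_at_within[OF P])
 qed
 have zP0: "x t = P t + (x 0 - P 0)" for t using zP[of 0 t] zP[of t 0] by (cases "0 <= t") (auto simp: x_def algebra_simps)
 have xd: "(x has_vector_derivative F (x t)) (at t)" for t
 proof -
  have "((\<lambda>t. P t + (x 0 - P 0)) has_vector_derivative F (x t) + 0) (at t)" by (intro has_vector_derivative_add P has_vector_derivative_const)
  moreover have "(\<lambda>t. P t + (x 0 - P 0)) = x" by (rule ext) (rule zP0[symmetric])
  ultimately show ?thesis by simp
 qed
 have per: "x (t + 1) = x t" for t using z by (simp add: char_loop_def x_def)
 have sym: "x (- t) = \<tau> (x t)" for t using z by (simp add: char_loop_def x_def \<tau>_translate)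
 have Fl: "\<exists>r>0. \<exists>M. \<forall>q\<in>frontier D \<inter> ball p r. \<forall>q'\<in>frontier D \<inter> ball p r. norm (F q - F q') <= M * norm (q - q')"
  if p: "p \<in> frontier D" for p
 proof -
  obtain r M where r: "r > 0" and M: "!!q q'. [|q \<in> frontier D \<inter> ball p r; q' \<in> frontier D \<inter> ball p r|] ==> norm (nrm q - nrm q') <= M * norm (q - q')"
   using nrm_locally_lipschitz[OF p] by blast
  have "norm (F q - F q') <= (m * M) * norm (q - q')" if "q \<in> frontier D \<inter> ball p r" "q' \<in> frontier D \<inter> ball p r" for q q'
  proof -
   have "norm (F q - F q') = m * norm (nrm q - nrm q')"
    unfolding F_def scaleR_diff_right[symmetric] J0_diff[symmetric] using m by (simp add: norm_J0)
   thus ?thesis using mult_left_mono[OF M[OF that], of m] m by (simp add: mult.assoc)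
  qed
  thus ?thesis using r by blast
 qed
 have "inj_on x {0..<1}"
 proof (rule linorder_inj_onI)
  fix s t :: real assume st: "s < t" "s \<in> {0..<1}" "t \<in> {0..<1}"
  show "x s ~= x t"
  proof
   assume e: "x s = x t"
   define d where "d = t - s"
   have d: "0 < d" "d < 1" using st by (auto simp: d_def)
   have sh: "((\<lambda>r. x (r + d)) has_vector_derivative F (x (r + d))) (at r)" for r
   proof -
    have "((\<lambda>r. r + d) has_vector_derivative (1 + 0)) (at r)"
     by (intro has_vector_derivative_add has_vector_derivative_id has_vector_derivative_const)
    from vector_diff_chain_at[OF this xd] show ?thesis by (simp add: o_def)
   qed
   have "x (r + d) = x r" for r
    by (rule ode_unique[where F = F and S = "frontier D" and ?t0.0 = s, OF sh xf xd xf Fl]) (use e in \<open>auto simp: d_def\<close>)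
   hence zd: "z (r + d) = z r" for r by (simp add: x_def)
   note g = generalized_characteristic_of_loop[OF z gz m lip d(1) zd]
   have "c_HZ_tau \<tau> D <= ereal (d * m / 2)" using capacity_le_action[OF g(1)] g(2) d m by simp
   moreover have "d * m < 1 * m" using d m by (intro mult_strict_right_mono) auto
   ultimately show False by (simp add: cap)
  qed
 qed auto
 have vd: "vector_derivative x (at t) = F (x t)" for t by (rule vector_derivative_at[OF xd])
 have "brake_char \<tau> (frontier D) x 1" unfolding brake_char_def
 proof (intro conjI allI)
  show "x (t + 1) = x t" for t by (rule per)
  show "x C1_differentiable_on UNIV" unfolding C1_differentiable_on_def
   by (rule exI[of _ "\<lambda>t. F (x t)"]) (intro conjI ballI xd cF)
  show "vector_derivative x (at t) ~= 0" for t
  proof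
   assume "vector_derivative x (at t) = 0"
   hence "J0 (nrm (x t)) = 0" using m by (simp add: vd F_def)
   hence "nrm (x t) = 0" by (metis norm_J0 norm_eq_zero)
   thus False using nrm_nonzero[OF xf] by simp
  qed
  show "inj_on x {0..<1}" by fact
  show "x t \<in> frontier D" for t by (rule xf)
  show "vector_derivative x (at t) \<in> char_line (frontier D) (x t)" for t unfolding vd F_def char_line_nrm[OF xf] by blast
  show "x (1 - t) = \<tau> (x t)" for t using per[of "- t"] sym[of t] by simp
 qed simp
 moreover have "action x 1 = m / 2" using act by (simp add: x_def[abs_def])
 ultimately show ?thesis using m cap by (intro exI[of _ x]) auto
qed

text \<open>The velocity is v(t) J (nrm y) with v continuous and nowhere 0, so v has one sign. The
  action is half the integral of v, and its positivity selects the outward orientation that the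
  normal cone requires.\<close>

lemma brake_char_imp_gen_brake_char:
 assumes bc: "brake_char \<tau> (frontier D) y T" and pos: "action y T > 0"
 shows "gen_brake_char \<tau> D y T"
proof -
 have T: "T > 0" and per: "!!t. y (t + T) = y t" and C1: "y C1_differentiable_on UNIV" and nz: "!!t. vector_derivative y (at t) ~= 0"
  and yf: "!!t. y t \<in> frontier D" and cl: "!!t. vector_derivative y (at t) \<in> char_line (frontier D) (y t)"
  and sym: "!!t. y (T - t) = \<tau> (y t)" using bc unfolding brake_char_def by blast+
 obtain w where w: "!!t. (y has_vector_derivative w t) (at t)" and cw: "continuous_on UNIV w"
  using C1 unfolding C1_differentiable_on_def by blast
 have vw: "vector_derivative y (at t) = w t" for t by (rule vector_derivative_at[OF w])
 define v where "v t = (- J0 (w t)) \<bullet> (y t - p0)" for t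
 have cy: "continuous_on UNIV y" using w by (intro continuous_at_imp_continuous_on) (auto intro: has_vector_derivative_continuous)
 have cv: "continuous_on S v" for S unfolding v_def
  by (intro continuous_intros bounded_linear.continuous_on[OF bounded_linear_J0] continuous_on_subset[OF cw] continuous_on_subset[OF cy]) auto
 have wv: "w t = v t *\<^sub>R J0 (nrm (y t))" for t
 proof -
  obtain a where a: "w t = a *\<^sub>R J0 (nrm (y t))" using cl[of t] unfolding vw char_line_nrm[OF yf] by blast
  have "v t = a" using nrm(2)[OF yf[of t]] by (simp add: v_def a J0_scaleR J0_J0)
  thus ?thesis using a by simp
 qed
 have v0: "v t ~= 0" for t using nz[of t] wv[of t] by (auto simp: vw)
 have y0: "y T = y 0" using per[of 0] by simp
 have i0: "((\<lambda>t. (- J0 (w t)) \<bullet> p0) has_integral 0) {0..T}"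
 proof -
  have "(w has_integral (y T - y 0)) {0..T}" using T by (intro fundamental_theorem_of_calculus has_vector_derivative_at_within[OF w]) auto
  from has_integral_neg[OF has_integral_linear[OF this bounded_linear_omega0_left[of p0]]] show ?thesis
   by (simp add: y0 omega0_eq o_def omega0_def[of 0])
 qed
 have i1: "(v has_integral integral {0..T} v) {0..T}" by (rule integrable_integral[OF integrable_continuous_interval[OF cv]])
 have act: "action y T = (1/2) * integral {0..T} v"
 proof -
  have "((\<lambda>t. (- J0 (vector_derivative y (at t))) \<bullet> y t) has_integral (integral {0..T} v + 0)) {0..T}"
   using has_integral_add[OF i1 i0] by (rule has_integral_eq[rotated]) (simp add: v_def vw inner_diff_right)
  from integral_unique[OF this] show ?thesis unfolding action_def by (simp only: add_0_right)
 qed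
 have "\<exists>t. v t > 0"
 proof (rule ccontr)
  assume "\<not> ?thesis"
  hence n: "v t <= 0" for t by (simp add: not_less)
  have "integral {0..T} v <= integral {0..T} (\<lambda>_. 0)"
   by (rule integral_le[OF integrable_continuous_interval[OF cv]]) (use n in auto)
  thus False using pos by (simp add: act)
 qed
 then obtain t1 where t1: "v t1 > 0" by blast
 have vp: "v t > 0" for t
 proof (rule ccontr)
  assume "\<not> v t > 0"
  hence "v t <= 0" by simp
  moreover have "connected (range v)" by (rule connected_continuous_image[OF cv connected_UNIV])
  ultimately have "0 \<in> range v" using t1 by (meson connectedD_interval less_imp_le rangeI)
  thus False using v0 by (metis rangeE)
 qed
 have J: "w t \<in> J0 ` normal_cone D (y t)" for t
 proof -
  have "v t *\<^sub>R nrm (y t) \<in> normal_cone D (y t)"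
   using nrm(1)[OF yf[of t]] less_imp_le[OF vp[of t]] unfolding normal_cone_def by (simp add: mult_nonneg_nonpos)
  moreover have "w t = J0 (v t *\<^sub>R nrm (y t))" by (simp add: wv J0_scaleR)
  ultimately show ?thesis by blast
 qed
 show ?thesis unfolding gen_brake_char_def
 proof (intro conjI allI)
  show "T > 0" "!!t. y (t + T) = y t" "!!t. y t \<in> frontier D" "!!t. y (T - t) = \<tau> (y t)" by (fact T per yf sym)+
  show "\<not> (\<exists>c. \<forall>t. y t = c)"
  proof
   assume "\<exists>c. \<forall>t. y t = c"
   then obtain c where "y = (\<lambda>_. c)" by blast
   hence "vector_derivative y (at 0) = 0" by simp
   thus False using nz by blast
  qed
  have "bounded (w ` {0..T})" by (intro compact_imp_bounded compact_continuous_image continuous_on_subset[OF cw]) auto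
  then obtain B where "\<forall>x\<in>w ` {0..T}. norm x <= B" unfolding bounded_iff by blast
  hence B: "norm (w t) <= B" if "t \<in> {0..T}" for t using that by blast
  show "absolutely_continuous_on {0..T} y"
  proof (rule lipschitz_absolutely_continuous[where M = B])
   fix s t assume st: "s \<in> {0..T}" "t \<in> {0..T}"
   have "norm (y s - y t) <= B * norm (s - t)"
   proof (rule differentiable_bound[OF convex_closed_interval[of 0 T]])
    show "(y has_derivative (\<lambda>h. h *\<^sub>R w r)) (at r within {0..T})" for r
     using w[of r] unfolding has_vector_derivative_def by (rule has_derivative_at_withinI)
    show "onorm (\<lambda>h. h *\<^sub>R w r) <= B" if "r \<in> {0..T}" for r
     using B[OF that] by (intro onorm_le) (simp add: mult.commute[of B] mult_left_mono)
   qed (use st in auto)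
   thus "norm (y s - y t) <= B * \<bar>s - t\<bar>" by simp
  qed
  show "AE t in lebesgue. y differentiable at t \<and> vector_derivative y (at t) \<in> J0 ` normal_cone D (y t)"
   using J w unfolding vw by (intro AE_I2) (auto intro: differentiableI_vector)
 qed
qed

end

end

theorem theorem1p3:
  fixes \<tau> :: "'n::finite pt \<Rightarrow> 'n pt" and D :: "'n pt set"
  assumes "lin_antisymp_involution \<tau>"
    and "open D" and "D \<noteq> {}" and "convex D" and "bounded D" and "\<tau> ` D = D"
  shows "(\<exists>x T. gen_brake_char \<tau> D x T \<and> action x T > 0 \<and>
            (\<forall>y S. gen_brake_char \<tau> D y S \<and> action y S > 0 \<longrightarrow> action x T \<le> action y S) \<and>
            ereal (action x T) = c_HZ_tau \<tau> D)
       \<and> (C11_hypersurface (frontier D) \<longrightarrow>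
          (\<exists>x T. brake_char \<tau> (frontier D) x T \<and> action x T > 0 \<and>
            (\<forall>y S. brake_char \<tau> (frontier D) y S \<and> action y S > 0 \<longrightarrow> action x T \<le> action y S) \<and>
            ereal (action x T) = c_HZ_tau \<tau> D))"
proof -
  interpret symmetric_domain \<tau> D by unfold_locales (use assms in auto)
  obtain p0 where "p0 \<in> D" "\<tau> p0 = p0" by (rule fixed_point_exists)
  then interpret pointed_domain \<tau> D p0 by unfold_locales
  \<comment> \<open>Minimality in both statements is the inequality between capacity and action; in
    the smooth case characteristics of positive action are first recognised as generalized
    ones.\<close>
  have le: "a \<le> action y S" if "gen_brake_char \<tau> D y S" "action y S > 0" "c_HZ_tau \<tau> D = ereal a" for y S a
    using capacity_le_action[OF that(1,2)] that(3) by simp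
  obtain z \<mu> C M where z: "0 < \<mu>" "c_HZ_tau \<tau> D = ereal (\<mu> / 2)" "gen_brake_char \<tau> D (\<lambda>t. z t + p0) 1" "action (\<lambda>t. z t + p0) 1 = \<mu> / 2"
    by (rule minimal_loop) (rule that; assumption)
  show ?thesis
  proof (intro conjI impI)
    show "\<exists>x T. gen_brake_char \<tau> D x T \<and> action x T > 0 \<and>
            (\<forall>y S. gen_brake_char \<tau> D y S \<and> action y S > 0 \<longrightarrow> action x T \<le> action y S) \<and> ereal (action x T) = c_HZ_tau \<tau> D"
      by (rule exI[of _ "\<lambda>t. z t + p0"], rule exI[of _ 1]) (use z le in auto)
    assume C11: "C11_hypersurface (frontier D)"
    obtain x where x: "brake_char \<tau> (frontier D) x 1" "action x 1 > 0" "c_HZ_tau \<tau> D = ereal (action x 1)"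
      using smooth_minimal_characteristic[OF C11] by blast
    show "\<exists>x T. brake_char \<tau> (frontier D) x T \<and> action x T > 0 \<and>
            (\<forall>y S. brake_char \<tau> (frontier D) y S \<and> action y S > 0 \<longrightarrow> action x T \<le> action y S) \<and> ereal (action x T) = c_HZ_tau \<tau> D"
      by (rule exI[of _ x], rule exI[of _ 1]) (use x le brake_char_imp_gen_brake_char[OF C11] in auto)
  qed
qed

end
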